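(* Let $\lambda\in T$. There is an $\mathcal H[W]$-module isomorphism $$\mathcal H[W]\otimes_{\mathcal H}\mathsf{M}_\lambda\;\cong\;\bigoplus_{\chi\in\widehat W^\lambda}Z_\chi^{\oplus d_\chi},\qquad d_\chi:=\dim\chi .$$ Furthermore, the $Z_\chi$, $\chi\in\widehat W^\lambda$, are simple pairwise non-isomorphic $\mathcal H[W]$-modules.
   Context: Let $\Delta\subset\mathfrak h$ be a finite reduced root system with Weyl group $W$, and let $\mathbf X\subset\mathfrak h^\vee$, $\mathbf Y\subset\mathfrak h$ be $W$-invariant lattices associated with $\Delta$ (such as the (co)root and weight lattices), with the natural $W$-invariant non-degenerate pairing $\langle\,,\rangle:\mathbf X\times\mathbf Y\to\frac1n\mathbb Z$, $n$ a positive integer. Fix $q\in\mathbb C^*$, not a root of unity, together with an $n$-th root $q^{1/n}$, and put $q^{a/n}:=(q^{1/n})^a$ for $a\in\mathbb Z$. The quantum torus $\mathcal H$ is the $\mathbb C$-algebra with basis $\{e^xe^y : x\in\mathbf X,y\in\mathbf Y\}$, containing the group algebras $\mathbb C\mathbf X$ and $\mathbb C\mathbf Y$ as subalgebras, with $e^xe^y=q^{\langle x,y\rangle}e^ye^x$. $W$ acts on $\mathcal H$ by algebra automorphisms $h\mapsto{}^wh$, with ${}^w(e^x)=e^{w(x)}$, ${}^w(e^y)=e^{w(y)}$. For a subgroup $W'\subset W$, the twisted group algebra $\mathcal H[W']$ is $\mathcal H\otimes_{\mathbb C}\mathbb C[W']$ with product $(f\otimes w)(g\otimes u)=(f\cdot{}^wg)\otimes(wu)$.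 $T:=\mathrm{Hom}(\mathbf X,\mathbb C^* )$; for $y\in\mathbf Y$ let $q^y\in T$ be given by $x(q^y)=q^{\langle x,y\rangle}$; $\Lambda:=T/q^{\mathbf Y}$. $W$ acts on $T$ and on $\Lambda$. For $\lambda\in T$, $W^\lambda\subset W$ is the isotropy group of the image of $\lambda$ in $\Lambda$, and $\widehat W^\lambda$ is the set of isomorphism classes of simple complex $W^\lambda$-modules. $\mathsf{M}_\lambda$ is the $\mathcal H$-module with basis $\{v_\mu : \mu\in\lambda\cdot q^{\mathbf Y}\}$ and $e^y(v_\mu)=v_{\mu q^y}$, $e^x(v_\mu)=x(\mu)v_\mu$; it is an $\mathcal H[W^\lambda]$-module via $w:v_\mu\mapsto v_{w(\mu)}$. For $\chi\in\widehat W^\lambda$, $V_\chi:=\mathsf{M}_\lambda\otimes_{\mathbb C}\chi$ as an $\mathcal H[W^\lambda]$-module ($\mathcal H$ acting on the first factor, $W^\lambda$ diagonally), and $Z_\chi:=\mathcal H[W]\otimes_{\mathcal H[W^\lambda]}V_\chi$. *)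

theory Defs
  imports
    Complex_Main
    "HOL-Library.Function_Algebras"
    "HOL-Library.Poly_Mapping"
    "HOL-Algebra.Bij"
    "HOL-Algebra.Generated_Groups"
    "HOL-Algebra.Free_Abelian_Groups"
    "HOL-Algebra.Group_Action"
    "HOL-Algebra.Module"
begin

text \<open>
  The library locale for modules requires a commutative ring of scalars; only its record type
  is reused here.  That record also has multiplication and unit fields, which play no role for
  modules; the constructions below leave them \<open>undefined\<close>.
\<close>

locale left_module = R?: ring R + M?: abelian_group M
  for R :: "('a, 'r) ring_scheme" (structure) and M :: "('a, 'b, 'm) module_scheme" (structure) +
  assumes smult_closed:
      "\<lbrakk>a \<in> carrier R; x \<in> carrier M\<rbrakk> \<Longrightarrow> a \<odot>\<^bsub>M\<^esub> x \<in> carrier M"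
    and smult_l_distr:
      "\<lbrakk>a \<in> carrier R; b \<in> carrier R; x \<in> carrier M\<rbrakk> \<Longrightarrow>
        (a \<oplus>\<^bsub>R\<^esub> b) \<odot>\<^bsub>M\<^esub> x = a \<odot>\<^bsub>M\<^esub> x \<oplus>\<^bsub>M\<^esub> b \<odot>\<^bsub>M\<^esub> x"
    and smult_r_distr:
      "\<lbrakk>a \<in> carrier R; x \<in> carrier M; y \<in> carrier M\<rbrakk> \<Longrightarrow>
        a \<odot>\<^bsub>M\<^esub> (x \<oplus>\<^bsub>M\<^esub> y) = a \<odot>\<^bsub>M\<^esub> x \<oplus>\<^bsub>M\<^esub> a \<odot>\<^bsub>M\<^esub> y"
    and smult_assoc:
      "\<lbrakk>a \<in> carrier R; b \<in> carrier R; x \<in> carrier M\<rbrakk> \<Longrightarrow>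
        (a \<otimes>\<^bsub>R\<^esub> b) \<odot>\<^bsub>M\<^esub> x = a \<odot>\<^bsub>M\<^esub> (b \<odot>\<^bsub>M\<^esub> x)"
    and smult_one: "x \<in> carrier M \<Longrightarrow> \<one>\<^bsub>R\<^esub> \<odot>\<^bsub>M\<^esub> x = x"

definition simple_module :: "('a, 'r) ring_scheme \<Rightarrow> ('a, 'b, 'm) module_scheme \<Rightarrow> bool" where
  "simple_module R M \<longleftrightarrow> left_module R M \<and> carrier M \<noteq> {\<zero>\<^bsub>M\<^esub>} \<and>
     (\<forall>N. submodule N R M \<longrightarrow> N = {\<zero>\<^bsub>M\<^esub>} \<or> N = carrier M)"

definition module_isomorphic ::
  "('a, 'r) ring_scheme \<Rightarrow> ('a, 'b, 'm) module_scheme \<Rightarrow> ('a, 'c, 'n) module_scheme \<Rightarrow> bool" where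
  "module_isomorphic R M N \<longleftrightarrow> left_module R M \<and> left_module R N \<and>
     (\<exists>f. bij_betw f (carrier M) (carrier N) \<and>
          (\<forall>x\<in>carrier M. \<forall>y\<in>carrier M. f (x \<oplus>\<^bsub>M\<^esub> y) = f x \<oplus>\<^bsub>N\<^esub> f y) \<and>
          (\<forall>a\<in>carrier R. \<forall>x\<in>carrier M. f (a \<odot>\<^bsub>M\<^esub> x) = a \<odot>\<^bsub>N\<^esub> f x))"

definition restrict_scalars ::
  "('s \<Rightarrow> 'a) \<Rightarrow> ('a, 'b) module \<Rightarrow> ('s, 'b) module" where
  "restrict_scalars \<phi> M = \<lparr>carrier = carrier M, monoid.mult = mult M, one = one M,
     zero = zero M, add = add M, smult = (\<lambda>s m. \<phi> s \<odot>\<^bsub>M\<^esub> m)\<rparr>"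

definition direct_sum :: "'i set \<Rightarrow> ('i \<Rightarrow> ('a, 'b) module) \<Rightarrow> ('a, 'i \<Rightarrow> 'b) module" where
  "direct_sum I M = \<lparr>
     carrier = {f \<in> (\<Pi>\<^sub>E i\<in>I. carrier (M i)). finite {i \<in> I. f i \<noteq> \<zero>\<^bsub>M i\<^esub>}},
     monoid.mult = undefined, one = undefined,
     zero = (\<lambda>i\<in>I. \<zero>\<^bsub>M i\<^esub>),
     add = (\<lambda>f g. \<lambda>i\<in>I. f i \<oplus>\<^bsub>M i\<^esub> g i),
     smult = (\<lambda>a f. \<lambda>i\<in>I. a \<odot>\<^bsub>M i\<^esub> f i)\<rparr>"

text \<open>
  For a right \<open>S\<close>-module \<open>A\<close> (with right action \<open>ra :: 'a \<Rightarrow> 's \<Rightarrow> 'a\<close>) and a left \<open>S\<close>-module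
  \<open>B\<close>, the tensor product over \<open>S\<close> is the free abelian group on \<open>A \<times> B\<close> modulo the
  subgroup generated by the usual relations.
\<close>

definition tensor_relations ::
  "('s, 'k) ring_scheme \<Rightarrow> ('a, 'r) ring_scheme \<Rightarrow> ('a \<Rightarrow> 's \<Rightarrow> 'a) \<Rightarrow> ('s, 'b) module
    \<Rightarrow> ('a \<times> 'b \<Rightarrow>\<^sub>0 int) set" where
  "tensor_relations S A ra B =
     {frag_of (a \<oplus>\<^bsub>A\<^esub> a', b) - frag_of (a, b) - frag_of (a', b) | a a' b.
        a \<in> carrier A \<and> a' \<in> carrier A \<and> b \<in> carrier B} \<union>
     {frag_of (a, b \<oplus>\<^bsub>B\<^esub> b') - frag_of (a, b) - frag_of (a, b') | a b b'.
        a \<in> carrier A \<and> b \<in> carrier B \<and> b' \<in> carrier B} \<union>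
     {frag_of (ra a s, b) - frag_of (a, s \<odot>\<^bsub>B\<^esub> b) | a s b.
        a \<in> carrier A \<and> s \<in> carrier S \<and> b \<in> carrier B}"

definition tensor_subgroup ::
  "('s, 'k) ring_scheme \<Rightarrow> ('a, 'r) ring_scheme \<Rightarrow> ('a \<Rightarrow> 's \<Rightarrow> 'a) \<Rightarrow> ('s, 'b) module
    \<Rightarrow> ('a \<times> 'b \<Rightarrow>\<^sub>0 int) set" where
  "tensor_subgroup S A ra B =
     generate (free_Abelian_group (carrier A \<times> carrier B)) (tensor_relations S A ra B)"

definition tensor_group ::
  "('s, 'k) ring_scheme \<Rightarrow> ('a, 'r) ring_scheme \<Rightarrow> ('a \<Rightarrow> 's \<Rightarrow> 'a) \<Rightarrow> ('s, 'b) module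
    \<Rightarrow> ('a \<times> 'b \<Rightarrow>\<^sub>0 int) set monoid" where
  "tensor_group S A ra B =
     free_Abelian_group (carrier A \<times> carrier B) Mod tensor_subgroup S A ra B"

text \<open>
  The tensor product as a module: \<open>act r (a, b)\<close> is a representative of \<open>r \<cdot> (a \<otimes> b)\<close>, extended
  additively and passed to cosets (for a well-defined action all sets in the union are the same
  coset).
\<close>

definition tensor_module ::
  "('s, 'k) ring_scheme \<Rightarrow> ('a, 'r) ring_scheme \<Rightarrow> ('a \<Rightarrow> 's \<Rightarrow> 'a) \<Rightarrow> ('s, 'b) module
    \<Rightarrow> ('t \<Rightarrow> 'a \<times> 'b \<Rightarrow> 'a \<times> 'b \<Rightarrow>\<^sub>0 int) \<Rightarrow> ('t, ('a \<times> 'b \<Rightarrow>\<^sub>0 int) set) module" where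
  "tensor_module S A ra B act = \<lparr>
     carrier = carrier (tensor_group S A ra B),
     monoid.mult = undefined, one = undefined,
     zero = \<one>\<^bsub>tensor_group S A ra B\<^esub>,
     add = mult (tensor_group S A ra B),
     smult = (\<lambda>r C. \<Union>c\<in>C. tensor_subgroup S A ra B
        #>\<^bsub>free_Abelian_group (carrier A \<times> carrier B)\<^esub> frag_extend (act r) c)\<rparr>"

text \<open>\<open>R \<otimes>\<^sub>S M\<close>, where \<open>S\<close> acts on \<open>R\<close> from the right through a ring homomorphism \<open>\<phi> : S \<rightarrow> R\<close>.\<close>

definition induced_module ::
  "('a, 'r) ring_scheme \<Rightarrow> ('s, 'k) ring_scheme \<Rightarrow> ('s \<Rightarrow> 'a) \<Rightarrow> ('s, 'b) module
    \<Rightarrow> ('a, ('a \<times> 'b \<Rightarrow>\<^sub>0 int) set) module" where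
  "induced_module R S \<phi> M =
     tensor_module S R (\<lambda>a s. a \<otimes>\<^bsub>R\<^esub> \<phi> s) M (\<lambda>r (a, m). frag_of (r \<otimes>\<^bsub>R\<^esub> a, m))"

text \<open>
  For a finite group \<open>G\<close> acting on a ring \<open>A\<close>, an element \<open>\<Sum>w. f w \<otimes> w\<close> of \<open>A[G]\<close> is encoded by its
  coefficient function \<open>f\<close>, which is zero outside \<open>G\<close>; thus \<open>A[G']\<close> is literally a subset of
  \<open>A[G]\<close> for a subgroup \<open>G'\<close>.  The product is the bilinear extension of
  \<open>(a \<otimes> u) (b \<otimes> v) = a (act u b) \<otimes> u v\<close>.
\<close>

definition twisted_group_algebra ::
  "('a, 'r) ring_scheme \<Rightarrow> ('g, 'k) monoid_scheme \<Rightarrow> ('g \<Rightarrow> 'a \<Rightarrow> 'a) \<Rightarrow> ('g \<Rightarrow> 'a) ring" where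
  "twisted_group_algebra A G act = \<lparr>
     carrier = {f. (\<forall>w\<in>carrier G. f w \<in> carrier A) \<and> (\<forall>w. w \<notin> carrier G \<longrightarrow> f w = \<zero>\<^bsub>A\<^esub>)},
     monoid.mult = (\<lambda>f g w. if w \<in> carrier G
        then \<Oplus>\<^bsub>A\<^esub>u\<in>carrier G. f u \<otimes>\<^bsub>A\<^esub> act u (g (inv\<^bsub>G\<^esub> u \<otimes>\<^bsub>G\<^esub> w)) else \<zero>\<^bsub>A\<^esub>),
     one = (\<lambda>w. if w = \<one>\<^bsub>G\<^esub> then \<one>\<^bsub>A\<^esub> else \<zero>\<^bsub>A\<^esub>),
     zero = (\<lambda>w. \<zero>\<^bsub>A\<^esub>),
     add = (\<lambda>f g w. f w \<oplus>\<^bsub>A\<^esub> g w)\<rparr>"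

definition pure_elt :: "('a, 'r) ring_scheme \<Rightarrow> 'a \<Rightarrow> 'g \<Rightarrow> 'g \<Rightarrow> 'a" where
  "pure_elt A a w = (\<lambda>u. if u = w then a else \<zero>\<^bsub>A\<^esub>)"

definition complex_ring :: "complex ring" where
  "complex_ring = \<lparr>carrier = UNIV, monoid.mult = (*), one = 1, zero = 0, add = (+)\<rparr>"

definition group_algebra :: "('g, 'k) monoid_scheme \<Rightarrow> ('g \<Rightarrow> complex) ring" where
  "group_algebra G = twisted_group_algebra complex_ring G (\<lambda>w c. c)"

text \<open>
  Isomorphism classes of simple complex \<open>G\<close>-modules, i.e. of simple modules over the group algebra,
  for finite \<open>G\<close>.  Such modules are finite dimensional, so every isomorphism class has members
  whose carrier is a set of elements of type \<open>nat \<Rightarrow> complex\<close> (e.g. a coordinate space).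
\<close>

type_synonym 'g cmodule = "('g \<Rightarrow> complex, nat \<Rightarrow> complex) module"

definition irr_classes :: "('g, 'k) monoid_scheme \<Rightarrow> 'g cmodule set set" where
  "irr_classes G = {U. simple_module (group_algebra G) U} //
     {(U, U'). simple_module (group_algebra G) U \<and> simple_module (group_algebra G) U' \<and>
        module_isomorphic (group_algebra G) U U'}"

definition class_rep :: "'g cmodule set \<Rightarrow> 'g cmodule" where
  "class_rep \<chi> = (SOME U. U \<in> \<chi>)"

definition underlying_space ::
  "('g, 'k) monoid_scheme \<Rightarrow> ('g \<Rightarrow> complex, 'b) module \<Rightarrow> (complex, 'b) module" where
  "underlying_space G U = restrict_scalars (\<lambda>c. pure_elt complex_ring c \<one>\<^bsub>G\<^esub>) U"

definition is_basis :: "('a, 'r) ring_scheme \<Rightarrow> ('a, 'b, 'm) module_scheme \<Rightarrow> 'b set \<Rightarrow> bool" where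
  "is_basis K M B \<longleftrightarrow> finite B \<and> B \<subseteq> carrier M \<and>
     (\<forall>m\<in>carrier M. \<exists>!c. c \<in> B \<rightarrow>\<^sub>E carrier K \<and> m = (\<Oplus>\<^bsub>M\<^esub>b\<in>B. c b \<odot>\<^bsub>M\<^esub> b))"

definition class_dim :: "('g, 'k) monoid_scheme \<Rightarrow> 'g cmodule set \<Rightarrow> nat" where
  "class_dim G \<chi> =
     (THE d. \<exists>B. is_basis complex_ring (underlying_space G (class_rep \<chi>)) B \<and> card B = d)"

definition is_coroot :: "'h::real_vector set \<Rightarrow> 'h \<Rightarrow> ('h \<Rightarrow> real) \<Rightarrow> bool" where
  "is_coroot \<Delta> \<alpha> f \<longleftrightarrow> linear f \<and> f \<alpha> = 2 \<and> (\<lambda>v. v - f v *\<^sub>R \<alpha>) ` \<Delta> \<subseteq> \<Delta> \<and> f ` \<Delta> \<subseteq> \<int>"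

text \<open>The ambient space \<open>\<hh>\<close> is the whole type; it is finite dimensional because the roots span it.\<close>

definition reduced_root_system :: "'h::real_vector set \<Rightarrow> bool" where
  "reduced_root_system \<Delta> \<longleftrightarrow> finite \<Delta> \<and> span \<Delta> = UNIV \<and> 0 \<notin> \<Delta> \<and>
     (\<forall>\<alpha>\<in>\<Delta>. \<exists>f. is_coroot \<Delta> \<alpha> f) \<and>
     (\<forall>\<alpha>\<in>\<Delta>. \<forall>c. c *\<^sub>R \<alpha> \<in> \<Delta> \<longrightarrow> c = 1 \<or> c = - 1)"

text \<open>Composition is the product of \<open>BijGroup UNIV\<close>.\<close>

definition weyl_group :: "'h::real_vector set \<Rightarrow> ('h \<Rightarrow> 'h) monoid" where
  "weyl_group \<Delta> = subgroup_generated (BijGroup UNIV)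
     {(\<lambda>v. v - f v *\<^sub>R \<alpha>) | \<alpha> f. \<alpha> \<in> \<Delta> \<and> is_coroot \<Delta> \<alpha> f}"

definition is_lattice ::
  "(real \<Rightarrow> 'v \<Rightarrow> 'v) \<Rightarrow> 'v::ab_group_add set \<Rightarrow> 'v set \<Rightarrow> bool" where
  "is_lattice scale V L \<longleftrightarrow> (\<exists>B. finite B \<and> \<not> module.dependent scale B \<and>
     module.span scale B = V \<and> L = range (\<lambda>c :: 'v \<Rightarrow> int. \<Sum>b\<in>B. scale (of_int (c b)) b))"

text \<open>
  The dual space \<open>\<hh>\<^sup>\<or>\<close> consists of the linear functionals, with pointwise operations, and the pairing
  is evaluation.
\<close>

definition dual_space :: "('h::real_vector \<Rightarrow> real) set" where
  "dual_space = {f. linear f}"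

definition dual_scale :: "real \<Rightarrow> ('h \<Rightarrow> real) \<Rightarrow> 'h \<Rightarrow> real" where
  "dual_scale c f = (\<lambda>v. c * f v)"

definition dual_act :: "('h \<Rightarrow> 'h) \<Rightarrow> ('h \<Rightarrow> real) \<Rightarrow> 'h \<Rightarrow> real" where
  "dual_act w x = (\<lambda>v. x (inv_into UNIV w v))"

text \<open>
  \<open>s\<close> is the chosen \<open>n\<close>-th root of \<open>q\<close>.  Non-degeneracy of the pairing \<open>X \<times> Y \<rightarrow> (1/n)\<int>\<close> is
  automatic, since \<open>X\<close> and \<open>Y\<close> are full lattices in \<open>\<hh>\<^sup>\<or>\<close> and \<open>\<hh>\<close>.
\<close>

locale quantum_torus_setup =
  fixes \<Delta> :: "'h::real_vector set" and X :: "('h \<Rightarrow> real) set" and Y :: "'h set"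
    and n :: nat and q s :: complex
  assumes root_system: "reduced_root_system \<Delta>"
    and X_lattice: "is_lattice dual_scale dual_space X"
    and Y_lattice: "is_lattice (*\<^sub>R) UNIV Y"
    and X_invariant: "w \<in> carrier (weyl_group \<Delta>) \<Longrightarrow> dual_act w ` X = X"
    and Y_invariant: "w \<in> carrier (weyl_group \<Delta>) \<Longrightarrow> w ` Y = Y"
    and n_pos: "n > 0"
    and pairing: "\<lbrakk>x \<in> X; y \<in> Y\<rbrakk> \<Longrightarrow> real n * x y \<in> \<int>"
    and q_nonzero: "q \<noteq> 0"
    and q_not_root_of_unity: "k > 0 \<Longrightarrow> q ^ k \<noteq> 1"
    and s_root: "s ^ n = q"

text \<open>\<open>q\<^bsup>\<langle>x,y\<rangle>\<^esup>\<close>; the floor only converts the integer \<open>n\<langle>x,y\<rangle>\<close> to type \<open>int\<close>.\<close>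

definition qpair :: "nat \<Rightarrow> complex \<Rightarrow> ('h \<Rightarrow> real) \<Rightarrow> 'h \<Rightarrow> complex" where
  "qpair n s x y = s powi \<lfloor>real n * x y\<rfloor>"

definition push :: "('a \<Rightarrow> 'b) \<Rightarrow> ('a \<Rightarrow>\<^sub>0 complex) \<Rightarrow> 'b \<Rightarrow>\<^sub>0 complex" where
  "push g p = (\<Sum>k\<in>Poly_Mapping.keys p. Poly_Mapping.single (g k) (Poly_Mapping.lookup p k))"

type_synonym 'h qtorus = "('h \<Rightarrow> real) \<times> 'h \<Rightarrow>\<^sub>0 complex"

text \<open>
  The basis vector indexed by \<open>(x, y)\<close> is \<open>e\<^sup>x e\<^sup>y\<close>.  From \<open>e\<^sup>x e\<^sup>y = q\<^bsup>\<langle>x,y\<rangle>\<^esup> e\<^sup>y e\<^sup>x\<close> one gets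
  \<open>(e\<^sup>x e\<^sup>y) (e\<^bsup>x'\<^esup> e\<^bsup>y'\<^esup>) = q\<^bsup>-\<langle>x',y\<rangle>\<^esup> e\<^bsup>x+x'\<^esup> e\<^bsup>y+y'\<^esup>\<close>.
\<close>

definition quantum_torus ::
  "('h \<Rightarrow> real) set \<Rightarrow> 'h set \<Rightarrow> nat \<Rightarrow> complex \<Rightarrow> 'h::real_vector qtorus ring" where
  "quantum_torus X Y n s = \<lparr>
     carrier = {f. Poly_Mapping.keys f \<subseteq> X \<times> Y},
     monoid.mult = (\<lambda>f g. \<Sum>(x, y)\<in>Poly_Mapping.keys f. \<Sum>(x', y')\<in>Poly_Mapping.keys g.
        Poly_Mapping.single (x + x', y + y')
          (Poly_Mapping.lookup f (x, y) * Poly_Mapping.lookup g (x', y') * inverse (qpair n s x' y))),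
     one = Poly_Mapping.single (0, 0) 1,
     zero = 0,
     add = (+)\<rparr>"

definition qtorus_act :: "('h \<Rightarrow> 'h) \<Rightarrow> 'h qtorus \<Rightarrow> 'h qtorus" where
  "qtorus_act w = push (\<lambda>(x, y). (dual_act w x, w y))"

definition twisted_qtorus ::
  "('h \<Rightarrow> real) set \<Rightarrow> 'h set \<Rightarrow> nat \<Rightarrow> complex \<Rightarrow> ('h \<Rightarrow> 'h) monoid
    \<Rightarrow> (('h \<Rightarrow> 'h) \<Rightarrow> 'h::real_vector qtorus) ring" where
  "twisted_qtorus X Y n s G = twisted_group_algebra (quantum_torus X Y n s) G qtorus_act"

text \<open>Homomorphisms from \<open>X\<close> to the nonzero complex numbers, made unique by extensionality.\<close>

type_synonym 'h character = "('h \<Rightarrow> real) \<Rightarrow> complex"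

definition torus :: "('h \<Rightarrow> real) set \<Rightarrow> 'h character monoid" where
  "torus X = \<lparr>
     carrier = {\<mu> \<in> extensional X. (\<forall>x\<in>X. \<mu> x \<noteq> 0) \<and> (\<forall>x\<in>X. \<forall>x'\<in>X. \<mu> (x + x') = \<mu> x * \<mu> x')},
     monoid.mult = (\<lambda>\<mu> \<nu>. \<lambda>x\<in>X. \<mu> x * \<nu> x),
     one = (\<lambda>x\<in>X. 1)\<rparr>"

definition torus_act :: "('h \<Rightarrow> real) set \<Rightarrow> ('h \<Rightarrow> 'h) \<Rightarrow> 'h character \<Rightarrow> 'h character" where
  "torus_act X w \<mu> = (\<lambda>x\<in>X. \<mu> (dual_act (inv_into UNIV w) x))"

definition q_elt :: "('h \<Rightarrow> real) set \<Rightarrow> nat \<Rightarrow> complex \<Rightarrow> 'h \<Rightarrow> 'h character" where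
  "q_elt X n s y = (\<lambda>x\<in>X. qpair n s x y)"

text \<open>The image of \<open>\<lambda>\<close> in \<open>\<Lambda> = T / q\<^sup>Y\<close>, i.e. the coset of \<open>\<lambda>\<close>.\<close>

definition q_coset ::
  "('h \<Rightarrow> real) set \<Rightarrow> 'h set \<Rightarrow> nat \<Rightarrow> complex \<Rightarrow> 'h character \<Rightarrow> 'h character set" where
  "q_coset X Y n s \<mu> = q_elt X n s ` Y #>\<^bsub>torus X\<^esub> \<mu>"

definition isotropy_group ::
  "'h::real_vector set \<Rightarrow> ('h \<Rightarrow> real) set \<Rightarrow> 'h set \<Rightarrow> nat \<Rightarrow> complex \<Rightarrow> 'h character
    \<Rightarrow> ('h \<Rightarrow> 'h) monoid" where
  "isotropy_group \<Delta> X Y n s \<mu> = (weyl_group \<Delta>)\<lparr>carrier :=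
     stabilizer (weyl_group \<Delta>) (\<lambda>w C. torus_act X w ` C) (q_coset X Y n s \<mu>)\<rparr>"

text \<open>
  Here \<open>(e\<^sup>x e\<^sup>y) v\<^sub>\<mu> = x(\<mu> q\<^sup>y) v\<^bsub>\<mu> q\<^sup>y\<^esub>\<close>, and \<open>x(\<mu>)\<close> is written \<open>\<mu> x\<close>.  The weight \<open>\<lambda>\<close> is called
  \<open>lam\<close> in the code.
\<close>

definition M_mod ::
  "('h \<Rightarrow> real) set \<Rightarrow> 'h set \<Rightarrow> nat \<Rightarrow> complex \<Rightarrow> 'h character
    \<Rightarrow> ('h qtorus, 'h character \<Rightarrow>\<^sub>0 complex) module" where
  "M_mod X Y n s lam = \<lparr>
     carrier = {m. Poly_Mapping.keys m \<subseteq> q_coset X Y n s lam},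
     monoid.mult = undefined, one = undefined,
     zero = 0,
     add = (+),
     smult = (\<lambda>h m. \<Sum>(x, y)\<in>Poly_Mapping.keys h. \<Sum>\<mu>\<in>Poly_Mapping.keys m.
        let \<nu> = \<mu> \<otimes>\<^bsub>torus X\<^esub> q_elt X n s y in
        Poly_Mapping.single \<nu> (Poly_Mapping.lookup h (x, y) * Poly_Mapping.lookup m \<mu> * \<nu> x))\<rparr>"

definition M_tw_mod ::
  "'h::real_vector set \<Rightarrow> ('h \<Rightarrow> real) set \<Rightarrow> 'h set \<Rightarrow> nat \<Rightarrow> complex \<Rightarrow> 'h character
    \<Rightarrow> (('h \<Rightarrow> 'h) \<Rightarrow> 'h qtorus, 'h character \<Rightarrow>\<^sub>0 complex) module" where
  "M_tw_mod \<Delta> X Y n s lam = \<lparr>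
     carrier = carrier (M_mod X Y n s lam),
     monoid.mult = undefined, one = undefined,
     zero = 0,
     add = (+),
     smult = (\<lambda>f m. \<Sum>w\<in>carrier (isotropy_group \<Delta> X Y n s lam).
        f w \<odot>\<^bsub>M_mod X Y n s lam\<^esub> push (torus_act X w) m)\<rparr>"

text \<open>
  \<open>M\<^sub>\<lambda> \<otimes> \<chi>\<close> over the complex numbers, with \<open>h \<otimes> w\<close> acting by \<open>m \<otimes> u \<mapsto> h w m \<otimes> w u\<close>.
\<close>

type_synonym 'h V_elt = "(('h character \<Rightarrow>\<^sub>0 complex) \<times> (nat \<Rightarrow> complex) \<Rightarrow>\<^sub>0 int) set"

definition V_mod ::
  "'h::real_vector set \<Rightarrow> ('h \<Rightarrow> real) set \<Rightarrow> 'h set \<Rightarrow> nat \<Rightarrow> complex \<Rightarrow> 'h character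
    \<Rightarrow> ('h \<Rightarrow> 'h) cmodule set
    \<Rightarrow> (('h \<Rightarrow> 'h) \<Rightarrow> 'h qtorus, 'h V_elt) module" where
  "V_mod \<Delta> X Y n s lam \<chi> =
     (let Wl = isotropy_group \<Delta> X Y n s lam; M = M_tw_mod \<Delta> X Y n s lam; U = class_rep \<chi> in
      tensor_module complex_ring M (\<lambda>m c. Poly_Mapping.map (\<lambda>a. a * c) m) (underlying_space Wl U)
        (\<lambda>f (m, u). \<Sum>w\<in>carrier Wl.
           frag_of (pure_elt (quantum_torus X Y n s) (f w) w \<odot>\<^bsub>M\<^esub> m,
                    pure_elt complex_ring 1 w \<odot>\<^bsub>U\<^esub> u)))"

definition Z_mod :: "'h::real_vector set \<Rightarrow> ('h \<Rightarrow> real) set \<Rightarrow> 'h set \<Rightarrow> nat \<Rightarrow> complex \<Rightarrow> 'h character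
    \<Rightarrow> ('h \<Rightarrow> 'h) cmodule set
    \<Rightarrow> (('h \<Rightarrow> 'h) \<Rightarrow> 'h qtorus, ((('h \<Rightarrow> 'h) \<Rightarrow> 'h qtorus) \<times> 'h V_elt \<Rightarrow>\<^sub>0 int) set) module" where
  "Z_mod \<Delta> X Y n s lam \<chi> =
     induced_module (twisted_qtorus X Y n s (weyl_group \<Delta>))
       (twisted_qtorus X Y n s (isotropy_group \<Delta> X Y n s lam)) id (V_mod \<Delta> X Y n s lam \<chi>)"

text \<open>Induction from the quantum torus itself, along \<open>h \<mapsto> h \<otimes> 1\<close>.\<close>

definition induced_M :: "'h::real_vector set \<Rightarrow> ('h \<Rightarrow> real) set \<Rightarrow> 'h set \<Rightarrow> nat \<Rightarrow> complex \<Rightarrow> 'h character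
    \<Rightarrow> (('h \<Rightarrow> 'h) \<Rightarrow> 'h qtorus,
        ((('h \<Rightarrow> 'h) \<Rightarrow> 'h qtorus) \<times> ('h character \<Rightarrow>\<^sub>0 complex) \<Rightarrow>\<^sub>0 int) set) module" where
  "induced_M \<Delta> X Y n s lam =
     induced_module (twisted_qtorus X Y n s (weyl_group \<Delta>)) (quantum_torus X Y n s)
       (\<lambda>h. pure_elt (quantum_torus X Y n s) h \<one>\<^bsub>weyl_group \<Delta>\<^esub>) (M_mod X Y n s lam)"

end

theory Submission
  imports Defs "HOL-Computational_Algebra.Fundamental_Theorem_Algebra"
begin

text \<open>
  Write \<open>G = W\<^sup>\<lambda>\<close> and \<open>C = \<lambda> q\<^sup>Y\<close>.  For a \<open>G\<close>-module \<open>U\<close> let \<open>Z(U)\<close> be the module induced from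
  \<open>M\<^sub>\<lambda> \<otimes> U\<close>, and let \<open>L\<close> be the module induced from \<open>M\<^sub>\<lambda>\<close>.

  Coordinates.  The twisted group algebra of \<open>W\<close> is free as a right module over the quantum torus, with
  basis \<open>W\<close>, and over the twisted group algebra of \<open>G\<close>, with basis a set of representatives of \<open>W / G\<close>.
  Tensor products over a subring of which the big ring is a free right module split
  (\<open>coproduct_of_free\<close>).  So \<open>L\<close> is the direct sum of lines, one for each \<open>(w, \<mu>)\<close> in
  \<open>W \<times> C\<close>, and \<open>Z(U)\<close> is the direct sum of copies of \<open>U\<close>, one for each \<open>(c, \<mu>)\<close> with \<open>c\<close> a representative.
  On the copy \<open>(c, \<mu>)\<close> the elements \<open>e\<^sup>x\<close> act through the character \<open>c(\<mu>)\<close>.  These characters are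
  distinct: if \<open>c(\<mu>) = c'(\<mu>')\<close>, then \<open>c\<^sup>-\<^sup>1 c'\<close> maps a point of the coset \<open>C\<close> into \<open>C\<close>, hence lies in
  \<open>G\<close>, and \<open>c = c'\<close> (\<open>weights_distinct\<close>).  So the copies are the weight spaces of \<open>Z(U)\<close>.

  Simplicity and isomorphisms.  A submodule of \<open>Z(U)\<close> contains the weight components of its elements
  (\<open>weight_component\<close>), the elements \<open>e\<^sup>y w\<close> carry any weight space onto any other, and those that
  bring the weight \<open>\<lambda>\<close> back to itself realise the action of \<open>G\<close> on \<open>U\<close> (\<open>zz_move\<close>).  Therefore a
  nonzero submodule is everything when \<open>U\<close> is simple (\<open>Z_simple\<close>).  For the same reason an
  isomorphism \<open>Z(U) \<cong> Z(U')\<close> restricts on one weight space to a nonzero homomorphism \<open>U \<rightarrow> U'\<close> of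
  \<open>G\<close>-modules, and Schur's lemma gives \<open>U \<cong> U'\<close> (\<open>Z_isomorphic_imp\<close>).

  The decomposition.  A vector \<open>u\<close> of \<open>U\<close> defines a homomorphism \<open>L \<rightarrow> Z(U)\<close>,
  \<open>f \<otimes> m \<mapsto> f \<otimes> (m \<otimes> u)\<close> (\<open>theta_exists\<close>).  The lines \<open>(c g, g\<^sup>-\<^sup>1(\<nu>))\<close>, \<open>g \<in> G\<close>, of \<open>L\<close> form a copy
  of the group algebra of \<open>G\<close> which this homomorphism maps to the copy \<open>(c, \<nu>)\<close> of \<open>U\<close> by
  \<open>a \<mapsto> a u\<close> (\<open>slice_theta\<close>, \<open>theta_slice_vector\<close>).  Let \<open>u\<close> run over bases \<open>e\<^sub>\<chi>\<^sub>,\<^sub>i\<close> of all simple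
  \<open>G\<close>-modules \<open>\<chi>\<close>.  The homomorphisms together form a bijection from \<open>L\<close> onto
  \<open>\<Oplus>\<^sub>\<chi> Z\<^sub>\<chi>\<^sup>d\<close>, \<open>d = dim \<chi>\<close>, because \<open>a \<mapsto> (a e\<^sub>\<chi>\<^sub>,\<^sub>i)\<close> is a bijection from the group algebra onto
  \<open>\<Oplus>\<^sub>\<chi> \<chi>\<^sup>d\<close> (\<open>regular_representation\<close>).  It is onto by the density theorem (\<open>density\<close>).  It is
  injective because an element that annihilates all simple modules is zero (\<open>irr_faithful\<close>):
  otherwise there is a minimal left ideal \<open>S\<close> of such elements, \<open>S\<close> is itself a simple module, so
  \<open>S S = 0\<close>; but \<open>s s\<^sup>* s = 0\<close> forces \<open>s = 0\<close> for the conjugate linear involution with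
  \<open>g\<^sup>* = g\<^sup>-\<^sup>1\<close>, which is positive.
\<close>

section \<open>Additive maps and direct sums of abelian groups\<close>

definition add_hom :: "('a, 'm) ring_scheme \<Rightarrow> ('b, 'n) ring_scheme \<Rightarrow> ('a \<Rightarrow> 'b) \<Rightarrow> bool" where
  "add_hom A B f \<longleftrightarrow> (\<forall>x\<in>carrier A. f x \<in> carrier B) \<and>
     (\<forall>x\<in>carrier A. \<forall>y\<in>carrier A. f (x \<oplus>\<^bsub>A\<^esub> y) = f x \<oplus>\<^bsub>B\<^esub> f y)"

lemma add_homI:
  assumes "\<And>x. x \<in> carrier A \<Longrightarrow> f x \<in> carrier B"
    and "\<And>x y. x \<in> carrier A \<Longrightarrow> y \<in> carrier A \<Longrightarrow> f (x \<oplus>\<^bsub>A\<^esub> y) = f x \<oplus>\<^bsub>B\<^esub> f y"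
  shows "add_hom A B f"
  using assms by (simp add: add_hom_def)

lemma add_hom_closed: "add_hom A B f \<Longrightarrow> x \<in> carrier A \<Longrightarrow> f x \<in> carrier B"
  by (simp add: add_hom_def)

lemma add_hom_add:
  "add_hom A B f \<Longrightarrow> x \<in> carrier A \<Longrightarrow> y \<in> carrier A \<Longrightarrow> f (x \<oplus>\<^bsub>A\<^esub> y) = f x \<oplus>\<^bsub>B\<^esub> f y"
  by (simp add: add_hom_def)

lemma (in abelian_group) add_idem_zero:
  "x \<in> carrier G \<Longrightarrow> x \<oplus> x = x \<Longrightarrow> x = \<zero>"
  by (metis add.l_cancel_one)

lemma add_hom_zero:
  assumes "add_hom A B f" "abelian_group A" "abelian_group B"
  shows "f \<zero>\<^bsub>A\<^esub> = \<zero>\<^bsub>B\<^esub>"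
proof -
  interpret A: abelian_group A by fact
  interpret B: abelian_group B by fact
  have "f \<zero>\<^bsub>A\<^esub> \<oplus>\<^bsub>B\<^esub> f \<zero>\<^bsub>A\<^esub> = f \<zero>\<^bsub>A\<^esub>"
    using add_hom_add[OF assms(1), of "\<zero>\<^bsub>A\<^esub>" "\<zero>\<^bsub>A\<^esub>"] by simp
  then show ?thesis
    using B.add_idem_zero add_hom_closed[OF assms(1)] by simp
qed

lemma add_hom_neg:
  assumes "add_hom A B f" "abelian_group A" "abelian_group B" "x \<in> carrier A"
  shows "f (\<ominus>\<^bsub>A\<^esub> x) = \<ominus>\<^bsub>B\<^esub> f x"
proof -
  interpret A: abelian_group A by fact
  interpret B: abelian_group B by fact
  have "f (\<ominus>\<^bsub>A\<^esub> x) \<oplus>\<^bsub>B\<^esub> f x = \<zero>\<^bsub>B\<^esub>"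
    using add_hom_add[OF assms(1), of "\<ominus>\<^bsub>A\<^esub> x" x] add_hom_zero[OF assms(1-3)] assms(4)
    by (simp add: A.l_neg)
  then show ?thesis
    using B.minus_equality add_hom_closed[OF assms(1)] assms(4) by simp
qed

lemma add_hom_finsum:
  assumes "add_hom A B f" "abelian_group A" "abelian_group B" "finite I" "h \<in> I \<rightarrow> carrier A"
  shows "f (finsum A h I) = (\<Oplus>\<^bsub>B\<^esub>i\<in>I. f (h i))"
proof -
  interpret A: abelian_group A by fact
  interpret B: abelian_group B by fact
  show ?thesis using assms(4,5)
  proof (induction I rule: finite_induct)
    case empty
    then show ?case using add_hom_zero[OF assms(1-3)] by simp
  next
    case (insert i I)
    then have "h \<in> I \<rightarrow> carrier A" "h i \<in> carrier A" by auto
    with insert show ?case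
      using add_hom_closed[OF assms(1)]
      by (simp add: add_hom_add[OF assms(1)] Pi_iff)
  qed
qed

lemma add_hom_compose:
  "add_hom A B f \<Longrightarrow> add_hom B C g \<Longrightarrow> add_hom A C (\<lambda>x. g (f x))"
  by (simp add: add_hom_def)

text \<open>
  The generating sets below are closed under negation, so sums alone generate the subgroup.
\<close>

inductive_set add_span :: "('a, 'm) ring_scheme \<Rightarrow> 'a set \<Rightarrow> 'a set" for A S where
  zero: "\<zero>\<^bsub>A\<^esub> \<in> add_span A S"
| base: "x \<in> S \<Longrightarrow> x \<in> add_span A S"
| add: "x \<in> add_span A S \<Longrightarrow> y \<in> add_span A S \<Longrightarrow> x \<oplus>\<^bsub>A\<^esub> y \<in> add_span A S"

lemma add_span_subset:
  assumes "abelian_group A" "S \<subseteq> carrier A" "x \<in> add_span A S"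
  shows "x \<in> carrier A"
proof -
  interpret A: abelian_group A by fact
  show ?thesis using assms(3) by induction (use assms(2) in auto)
qed

lemma add_span_trans:
  assumes "\<And>x. x \<in> S \<Longrightarrow> x \<in> add_span A S'" "x \<in> add_span A S"
  shows "x \<in> add_span A S'"
  using assms(2) by induction (auto intro: add_span.intros assms(1))

lemma add_hom_span_image:
  assumes "add_hom A B f" "abelian_group A" "abelian_group B" "S \<subseteq> carrier A"
    "\<And>x. x \<in> S \<Longrightarrow> f x \<in> add_span B S'" "x \<in> add_span A S"
  shows "f x \<in> add_span B S'"
  using assms(6)
proof induction
  case zero
  then show ?case using add_hom_zero[OF assms(1-3)] by (simp add: add_span.zero)
next
  case (add x y)
  then show ?case
    using add_hom_add[OF assms(1)] add_span_subset[OF assms(2,4)] by (simp add: add_span.add)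
qed (rule assms(5))

lemma add_hom_eq_on_span:
  assumes "add_hom A B f" "add_hom A B g" "abelian_group A" "abelian_group B" "S \<subseteq> carrier A"
    "\<And>x. x \<in> S \<Longrightarrow> f x = g x" "x \<in> add_span A S"
  shows "f x = g x"
  using assms(7)
proof induction
  case zero
  then show ?case using add_hom_zero[OF assms(1,3,4)] add_hom_zero[OF assms(2,3,4)] by simp
next
  case (add x y)
  then show ?case
    using add_hom_add[OF assms(1)] add_hom_add[OF assms(2)] add_span_subset[OF assms(3,5)] by simp
qed (rule assms(6))

text \<open>
  A direct sum decomposition of \<open>Z\<close> into the groups \<open>U i\<close>, given by the inclusions \<open>z i\<close> and the
  coordinates \<open>p i\<close>.  Stating it through maps, instead of an isomorphism with a group of functions,
  allows nested sums to be flattened by composing the maps.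
\<close>

locale add_coproduct =
  fixes Z :: "('z, 'm) ring_scheme" and I :: "'i set" and U :: "'i \<Rightarrow> ('u, 'n) ring_scheme"
    and z :: "'i \<Rightarrow> 'u \<Rightarrow> 'z" and p :: "'i \<Rightarrow> 'z \<Rightarrow> 'u"
  assumes Z_group: "abelian_group Z"
    and U_group: "i \<in> I \<Longrightarrow> abelian_group (U i)"
    and z_hom: "i \<in> I \<Longrightarrow> add_hom (U i) Z (z i)"
    and p_hom: "i \<in> I \<Longrightarrow> add_hom Z (U i) (p i)"
    and p_z: "i \<in> I \<Longrightarrow> u \<in> carrier (U i) \<Longrightarrow> p i (z i u) = u"
    and p_z_neq: "i \<in> I \<Longrightarrow> j \<in> I \<Longrightarrow> i \<noteq> j \<Longrightarrow> u \<in> carrier (U j) \<Longrightarrow> p i (z j u) = \<zero>\<^bsub>U i\<^esub>"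
    and spanning: "carrier Z \<subseteq> add_span Z {z i u |i u. i \<in> I \<and> u \<in> carrier (U i)}"
begin

sublocale Z: abelian_group Z by (rule Z_group)

lemmas z_closed = add_hom_closed[OF z_hom]
lemmas p_closed = add_hom_closed[OF p_hom]
lemmas z_zero = add_hom_zero[OF z_hom U_group Z_group]
lemmas p_zero = add_hom_zero[OF p_hom Z_group U_group]

lemma gens_closed: "{z i u |i u. i \<in> I \<and> u \<in> carrier (U i)} \<subseteq> carrier Z"
  using z_closed by blast

lemma induct_span [consumes 1, case_names zero base add]:
  assumes "x \<in> carrier Z" "P \<zero>\<^bsub>Z\<^esub>"
    and "\<And>i u. i \<in> I \<Longrightarrow> u \<in> carrier (U i) \<Longrightarrow> P (z i u)"
    and "\<And>x y. x \<in> carrier Z \<Longrightarrow> y \<in> carrier Z \<Longrightarrow> P x \<Longrightarrow> P y \<Longrightarrow> P (x \<oplus>\<^bsub>Z\<^esub> y)"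
  shows "P x"
proof -
  have "x \<in> add_span Z {z i u |i u. i \<in> I \<and> u \<in> carrier (U i)}" using spanning assms(1) by blast
  then show ?thesis
    by induction (auto intro: assms add_span_subset[OF Z_group gens_closed])
qed

text \<open>
  The expansion holds over all sufficiently large finite index sets, so that the expansions of two
  elements can be compared over a common one.
\<close>

lemma expansion:
  assumes "x \<in> carrier Z"
  shows "\<exists>J. finite J \<and> J \<subseteq> I \<and> (\<forall>K. finite K \<longrightarrow> J \<subseteq> K \<longrightarrow> K \<subseteq> I \<longrightarrow> x = (\<Oplus>\<^bsub>Z\<^esub>i\<in>K. z i (p i x)))"
  using assms
proof (induction rule: induct_span)
  case zero
  have "\<zero>\<^bsub>Z\<^esub> = (\<Oplus>\<^bsub>Z\<^esub>i\<in>K. z i (p i \<zero>\<^bsub>Z\<^esub>))" if "finite K" "K \<subseteq> I" for K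
  proof -
    have "(\<Oplus>\<^bsub>Z\<^esub>i\<in>K. z i (p i \<zero>\<^bsub>Z\<^esub>)) = (\<Oplus>\<^bsub>Z\<^esub>i\<in>K. \<zero>\<^bsub>Z\<^esub>)"
      by (rule Z.finsum_cong') (use that p_zero z_zero in auto)
    then show ?thesis by simp
  qed
  then show ?case by (intro exI[of _ "{}"]) auto
next
  case (base j u)
  have "z j u = (\<Oplus>\<^bsub>Z\<^esub>i\<in>K. z i (p i (z j u)))" if K: "finite K" "K \<subseteq> I" "j \<in> K" for K
  proof -
    have "(\<Oplus>\<^bsub>Z\<^esub>i\<in>K. z i (p i (z j u))) = (\<Oplus>\<^bsub>Z\<^esub>i\<in>K. if j = i then z j u else \<zero>\<^bsub>Z\<^esub>)"
      by (rule Z.finsum_cong') (use K base p_z p_z_neq z_zero z_closed in auto)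
    also have "\<dots> = z j u"
      using K base z_closed by (intro Z.finsum_singleton) auto
    finally show ?thesis by simp
  qed
  then show ?case using base by (intro exI[of _ "{j}"]) auto
next
  case (add x y)
  then obtain J J' where J: "finite J" "J \<subseteq> I" "\<And>K. finite K \<Longrightarrow> J \<subseteq> K \<Longrightarrow> K \<subseteq> I \<Longrightarrow> x = (\<Oplus>\<^bsub>Z\<^esub>i\<in>K. z i (p i x))"
    and J': "finite J'" "J' \<subseteq> I" "\<And>K. finite K \<Longrightarrow> J' \<subseteq> K \<Longrightarrow> K \<subseteq> I \<Longrightarrow> y = (\<Oplus>\<^bsub>Z\<^esub>i\<in>K. z i (p i y))"
    by meson
  have "x \<oplus>\<^bsub>Z\<^esub> y = (\<Oplus>\<^bsub>Z\<^esub>i\<in>K. z i (p i (x \<oplus>\<^bsub>Z\<^esub> y)))" if K: "finite K" "J \<union> J' \<subseteq> K" "K \<subseteq> I" for K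
  proof -
    have "(\<Oplus>\<^bsub>Z\<^esub>i\<in>K. z i (p i (x \<oplus>\<^bsub>Z\<^esub> y))) = (\<Oplus>\<^bsub>Z\<^esub>i\<in>K. z i (p i x) \<oplus>\<^bsub>Z\<^esub> z i (p i y))"
      using K add p_closed z_closed
      by (intro Z.finsum_cong') (auto simp: add_hom_add[OF p_hom] add_hom_add[OF z_hom] subset_iff)
    also have "\<dots> = (\<Oplus>\<^bsub>Z\<^esub>i\<in>K. z i (p i x)) \<oplus>\<^bsub>Z\<^esub> (\<Oplus>\<^bsub>Z\<^esub>i\<in>K. z i (p i y))"
      using K add by (intro Z.finsum_addf) (auto intro!: z_closed p_closed)
    also have "\<dots> = x \<oplus>\<^bsub>Z\<^esub> y" using J(3)[of K] J'(3)[of K] K by simp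
    finally show ?thesis by simp
  qed
  then show ?case using J J' by (intro exI[of _ "J \<union> J'"]) auto
qed

lemma finite_support:
  assumes "x \<in> carrier Z" shows "finite {i \<in> I. p i x \<noteq> \<zero>\<^bsub>U i\<^esub>}"
  using assms
proof (induction rule: induct_span)
  case zero
  have "{i \<in> I. p i \<zero>\<^bsub>Z\<^esub> \<noteq> \<zero>\<^bsub>U i\<^esub>} = {}" using p_zero by auto
  then show ?case by (metis finite.emptyI)
next
  case (base j u)
  have "{i \<in> I. p i (z j u) \<noteq> \<zero>\<^bsub>U i\<^esub>} \<subseteq> {j}" using p_z_neq base by auto
  then show ?case using finite_subset by blast
next
  case (add x y)
  have "{i \<in> I. p i (x \<oplus>\<^bsub>Z\<^esub> y) \<noteq> \<zero>\<^bsub>U i\<^esub>} \<subseteq> {i \<in> I. p i x \<noteq> \<zero>\<^bsub>U i\<^esub>} \<union> {i \<in> I. p i y \<noteq> \<zero>\<^bsub>U i\<^esub>}"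
  proof
    fix i assume i: "i \<in> {i \<in> I. p i (x \<oplus>\<^bsub>Z\<^esub> y) \<noteq> \<zero>\<^bsub>U i\<^esub>}"
    then interpret Ui: abelian_group "U i" using U_group by auto
    show "i \<in> {i \<in> I. p i x \<noteq> \<zero>\<^bsub>U i\<^esub>} \<union> {i \<in> I. p i y \<noteq> \<zero>\<^bsub>U i\<^esub>}"
      using i add by (auto simp: add_hom_add[OF p_hom])
  qed
  then show ?case using add finite_subset by (meson finite_UnI)
qed

text \<open>
  Both elements have the same expansion over a common finite index set.
\<close>

lemma coordinates_inject:
  assumes "x \<in> carrier Z" "y \<in> carrier Z" "\<And>i. i \<in> I \<Longrightarrow> p i x = p i y"
  shows "x = y"
proof -
  obtain J J' where "finite J" "J \<subseteq> I" "\<And>K. finite K \<Longrightarrow> J \<subseteq> K \<Longrightarrow> K \<subseteq> I \<Longrightarrow> x = (\<Oplus>\<^bsub>Z\<^esub>i\<in>K. z i (p i x))"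
    and "finite J'" "J' \<subseteq> I" "\<And>K. finite K \<Longrightarrow> J' \<subseteq> K \<Longrightarrow> K \<subseteq> I \<Longrightarrow> y = (\<Oplus>\<^bsub>Z\<^esub>i\<in>K. z i (p i y))"
    using expansion[OF assms(1)] expansion[OF assms(2)] by metis
  then have "x = (\<Oplus>\<^bsub>Z\<^esub>i\<in>J\<union>J'. z i (p i x))" "y = (\<Oplus>\<^bsub>Z\<^esub>i\<in>J\<union>J'. z i (p i y))" "J \<union> J' \<subseteq> I" by auto
  moreover have "(\<Oplus>\<^bsub>Z\<^esub>i\<in>J\<union>J'. z i (p i x)) = (\<Oplus>\<^bsub>Z\<^esub>i\<in>J\<union>J'. z i (p i y))"
    using \<open>J \<union> J' \<subseteq> I\<close> assms by (intro Z.finsum_cong') (auto intro!: z_closed p_closed)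
  ultimately show ?thesis by simp
qed

end

lemma add_coproduct_compose:
  assumes "add_coproduct Z I (\<lambda>_. V) z p" "add_coproduct V J (\<lambda>_. U) z' p'" 
  shows "add_coproduct Z (I \<times> J) (\<lambda>_. U) (\<lambda>(i, j) u. z i (z' j u)) (\<lambda>(i, j) x. p' j (p i x))"
proof -
  interpret Z: add_coproduct Z I "\<lambda>_. V" z p by fact
  interpret V: add_coproduct V J "\<lambda>_. U" z' p' by fact
  show ?thesis
  proof (rule add_coproduct.intro, goal_cases)
    case 1 then show ?case by (rule Z.Z_group)
  next
    case (2 i) then show ?case using V.U_group by auto
  next
    case (3 i) then show ?case
      by (auto intro!: add_hom_compose[OF V.z_hom Z.z_hom])
  next
    case (4 i) then show ?case
      by (auto intro!: add_hom_compose[OF Z.p_hom V.p_hom])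
  next
    case (5 i u) then show ?case
      by (auto simp: Z.p_z V.p_z V.z_closed)
  next
    case (6 i j u)
    obtain i1 i2 j1 j2 where ij: "i = (i1, i2)" "j = (j1, j2)" by force
    show ?case
    proof (cases "i1 = j1")
      case True
      then show ?thesis using 6 ij by (auto simp: Z.p_z V.p_z_neq V.z_closed)
    next
      case False
      then show ?thesis using 6 ij by (auto simp: Z.p_z_neq V.p_zero V.z_closed)
    qed
  next
    case 7
    show ?case
    proof
      fix x assume "x \<in> carrier Z"
      then show "x \<in> add_span Z {(case i of (i, j) \<Rightarrow> \<lambda>u. z i (z' j u)) u |i u. i \<in> I \<times> J \<and> u \<in> carrier U}"
      proof (induction rule: Z.induct_span)
        case (base i u)
        have "u \<in> add_span V {z' j u |j u. j \<in> J \<and> u \<in> carrier U}"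
          using base V.spanning by auto
        then show ?case
          by (rule add_hom_span_image[OF Z.z_hom[OF base(1)] V.Z_group Z.Z_group V.gens_closed, rotated])
             (use base in \<open>force intro: add_span.base\<close>)
      qed (auto intro: add_span.intros)
    qed
  qed
qed

section \<open>Tensor products over a ring\<close>

locale tensor_product =
  fixes S :: "('s, 'k) ring_scheme" and A :: "('a, 'r) ring_scheme" and ra :: "'a \<Rightarrow> 's \<Rightarrow> 'a"
    and B :: "('s, 'b) module"
  assumes A_group: "abelian_group A" and B_group: "abelian_group B"
    and ra_closed: "a \<in> carrier A \<Longrightarrow> t \<in> carrier S \<Longrightarrow> ra a t \<in> carrier A"
    and B_smult_closed: "t \<in> carrier S \<Longrightarrow> b \<in> carrier B \<Longrightarrow> t \<odot>\<^bsub>B\<^esub> b \<in> carrier B"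
begin

sublocale A: abelian_group A by (rule A_group)
sublocale B: abelian_group B by (rule B_group)

definition F where "F = free_Abelian_group (carrier A \<times> carrier B)"
definition K where "K = tensor_subgroup S A ra B"
definition tens :: "'a \<Rightarrow> 'b \<Rightarrow> ('a \<times> 'b \<Rightarrow>\<^sub>0 int) set" where "tens a b = K #>\<^bsub>F\<^esub> frag_of (a, b)"
abbreviation T where "T \<equiv> tensor_module S A ra B"

lemma F_simps [simp]: "x \<in> carrier F \<longleftrightarrow> Poly_Mapping.keys x \<subseteq> carrier A \<times> carrier B"
  "x \<otimes>\<^bsub>F\<^esub> y = x + y" "\<one>\<^bsub>F\<^esub> = 0"
  by (auto simp: F_def)

lemma F_group: "comm_group F" by (simp add: F_def abelian_free_Abelian_group)

lemma relations_closed: "tensor_relations S A ra B \<subseteq> carrier F"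
proof
  fix x assume "x \<in> tensor_relations S A ra B"
  then show "x \<in> carrier F"
    unfolding tensor_relations_def
    by (auto simp: ra_closed B_smult_closed dest!: subsetD[OF keys_diff])
qed

lemma K_subgroup: "subgroup K F"
  using group.generate_is_subgroup[of F, OF _ relations_closed] F_group
  by (simp add: K_def tensor_subgroup_def F_def comm_group.axioms)

lemma K_normal: "K \<lhd> F"
  using F_group K_subgroup by (simp add: comm_group.normal_iff_subgroup)

lemma K_keys: "x \<in> K \<Longrightarrow> Poly_Mapping.keys x \<subseteq> carrier A \<times> carrier B"
  using subgroup.subset[OF K_subgroup] F_simps(1) by blast

lemma K_zero: "0 \<in> K" using subgroup.one_closed[OF K_subgroup] by simp
lemma K_add: "x \<in> K \<Longrightarrow> y \<in> K \<Longrightarrow> x + y \<in> K" using subgroup.m_closed[OF K_subgroup] by simp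
lemma K_neg: "x \<in> K \<Longrightarrow> - x \<in> K"
  using subgroup.m_inv_closed[OF K_subgroup, of x] K_keys[of x] by (simp add: F_def)
lemma K_diff: "x \<in> K \<Longrightarrow> y \<in> K \<Longrightarrow> x - y \<in> K" using K_add[OF _ K_neg] by fastforce

lemma coset_eq_iff:
  "K #>\<^bsub>F\<^esub> x = K #>\<^bsub>F\<^esub> y \<longleftrightarrow> x - y \<in> K"
proof
  assume "K #>\<^bsub>F\<^esub> x = K #>\<^bsub>F\<^esub> y"
  then have "x \<in> K #>\<^bsub>F\<^esub> y" using K_zero by (force simp: r_coset_def)
  then show "x - y \<in> K" by (auto simp: r_coset_def)
next
  assume xy: "x - y \<in> K"
  have "k + x \<in> K #>\<^bsub>F\<^esub> y" if "k \<in> K" for k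
    using K_add[OF that xy] by (auto simp: r_coset_def algebra_simps intro!: bexI[of _ "k + (x - y)"])
  moreover have "k + y \<in> K #>\<^bsub>F\<^esub> x" if "k \<in> K" for k
    using K_diff[OF that xy] by (auto simp: r_coset_def algebra_simps intro!: bexI[of _ "k - (x - y)"])
  ultimately show "K #>\<^bsub>F\<^esub> x = K #>\<^bsub>F\<^esub> y" by (auto simp: r_coset_def)
qed

lemma T_carrier: "carrier (T act) = (\<lambda>x. K #>\<^bsub>F\<^esub> x) ` carrier F"
  by (simp add: tensor_module_def tensor_group_def F_def K_def carrier_FactGroup)

lemma T_zero: "\<zero>\<^bsub>T act\<^esub> = K #>\<^bsub>F\<^esub> 0"
proof -
  have "K #>\<^bsub>F\<^esub> 0 = K" by (auto simp: r_coset_def)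
  then show ?thesis by (simp add: tensor_module_def tensor_group_def F_def K_def)
qed

lemma T_add: "x \<in> carrier F \<Longrightarrow> y \<in> carrier F \<Longrightarrow> (K #>\<^bsub>F\<^esub> x) \<oplus>\<^bsub>T act\<^esub> (K #>\<^bsub>F\<^esub> y) = K #>\<^bsub>F\<^esub> (x + y)"
  using normal.rcos_sum[OF K_normal, of x y]
  by (simp add: tensor_module_def tensor_group_def F_def K_def)

lemma T_smult: "r \<odot>\<^bsub>T act\<^esub> C = (\<Union>c\<in>C. K #>\<^bsub>F\<^esub> frag_extend (act r) c)"
  by (simp add: tensor_module_def tensor_group_def F_def K_def)

lemma F_add_closed: "x \<in> carrier F \<Longrightarrow> y \<in> carrier F \<Longrightarrow> x + y \<in> carrier F"
  using F_group by (metis F_simps(2) comm_group.axioms(1) comm_monoid.axioms(1) monoid.m_closed)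

lemma F_neg_closed: "x \<in> carrier F \<Longrightarrow> - x \<in> carrier F"
  by simp

lemma T_group: "abelian_group (T act)"
proof (rule abelian_groupI)
  fix x y assume "x \<in> carrier (T act)" "y \<in> carrier (T act)"
  then obtain a b where ab: "a \<in> carrier F" "b \<in> carrier F" "x = K #>\<^bsub>F\<^esub> a" "y = K #>\<^bsub>F\<^esub> b"
    unfolding T_carrier by blast
  then show "x \<oplus>\<^bsub>T act\<^esub> y \<in> carrier (T act)" unfolding T_carrier
    using F_add_closed by (auto simp: T_add simp del: F_simps(1))
  show "x \<oplus>\<^bsub>T act\<^esub> y = y \<oplus>\<^bsub>T act\<^esub> x" using ab by (simp add: T_add add.commute del: F_simps(1))
  fix z assume "z \<in> carrier (T act)"
  then obtain c where c: "c \<in> carrier F" "z = K #>\<^bsub>F\<^esub> c" unfolding T_carrier by blast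
  show "x \<oplus>\<^bsub>T act\<^esub> y \<oplus>\<^bsub>T act\<^esub> z = x \<oplus>\<^bsub>T act\<^esub> (y \<oplus>\<^bsub>T act\<^esub> z)"
    using ab c F_add_closed by (simp add: T_add add.assoc del: F_simps(1))
next
  have z: "0 \<in> carrier F" by simp
  show "\<zero>\<^bsub>T act\<^esub> \<in> carrier (T act)" using z unfolding T_carrier T_zero by blast
  fix x assume "x \<in> carrier (T act)"
  then obtain a where a: "a \<in> carrier F" "x = K #>\<^bsub>F\<^esub> a" unfolding T_carrier by blast
  then show "\<zero>\<^bsub>T act\<^esub> \<oplus>\<^bsub>T act\<^esub> x = x" using z by (simp add: T_add T_zero del: F_simps(1))
  have "(K #>\<^bsub>F\<^esub> (- a)) \<oplus>\<^bsub>T act\<^esub> x = \<zero>\<^bsub>T act\<^esub>"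
    using a T_add[OF F_neg_closed[OF a(1)] a(1)] by (simp add: T_zero)
  then show "\<exists>y\<in>carrier (T act). y \<oplus>\<^bsub>T act\<^esub> x = \<zero>\<^bsub>T act\<^esub>"
    using F_neg_closed[OF a(1)] unfolding T_carrier by blast
qed

lemma tens_closed: "a \<in> carrier A \<Longrightarrow> b \<in> carrier B \<Longrightarrow> tens a b \<in> carrier (T act)"
  unfolding T_carrier tens_def by (auto simp: image_iff intro!: exI[of _ "frag_of (a, b)"])

lemma tens_add_left:
  assumes "a \<in> carrier A" "a' \<in> carrier A" "b \<in> carrier B"
  shows "tens (a \<oplus>\<^bsub>A\<^esub> a') b = tens a b \<oplus>\<^bsub>T act\<^esub> tens a' b"
proof -
  have "frag_of (a \<oplus>\<^bsub>A\<^esub> a', b) - frag_of (a, b) - frag_of (a', b) \<in> K"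
    unfolding K_def tensor_subgroup_def tensor_relations_def
    by (rule generate.incl) (use assms in blast)
  then show ?thesis using assms by (simp add: tens_def T_add coset_eq_iff algebra_simps)
qed

lemma tens_add_right:
  assumes "a \<in> carrier A" "b \<in> carrier B" "b' \<in> carrier B"
  shows "tens a (b \<oplus>\<^bsub>B\<^esub> b') = tens a b \<oplus>\<^bsub>T act\<^esub> tens a b'"
proof -
  have "frag_of (a, b \<oplus>\<^bsub>B\<^esub> b') - frag_of (a, b) - frag_of (a, b') \<in> K"
    unfolding K_def tensor_subgroup_def tensor_relations_def
    by (rule generate.incl) (use assms in blast)
  then show ?thesis using assms by (simp add: tens_def T_add coset_eq_iff algebra_simps)
qed

lemma tens_balanced:
  assumes "a \<in> carrier A" "t \<in> carrier S" "b \<in> carrier B"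
  shows "tens (ra a t) b = tens a (t \<odot>\<^bsub>B\<^esub> b)"
proof -
  have "frag_of (ra a t, b) - frag_of (a, t \<odot>\<^bsub>B\<^esub> b) \<in> K"
    unfolding K_def tensor_subgroup_def tensor_relations_def
    by (rule generate.incl) (use assms in blast)
  then show ?thesis by (simp add: tens_def coset_eq_iff)
qed

lemma tens_hom_left: "b \<in> carrier B \<Longrightarrow> add_hom A (T act) (\<lambda>a. tens a b)"
  by (intro add_homI tens_closed tens_add_left)

lemma tens_hom_right: "a \<in> carrier A \<Longrightarrow> add_hom B (T act) (tens a)"
  by (intro add_homI tens_closed tens_add_right)

lemma T_span:
  assumes "x \<in> carrier (T act)"
  shows "x \<in> add_span (T act) {tens a b |a b. a \<in> carrier A \<and> b \<in> carrier B}" (is "_ \<in> add_span _ ?G")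
proof -
  interpret T: abelian_group "T act" by (rule T_group)
  have sub: "?G \<subseteq> carrier (T act)" using tens_closed by blast
  have neg: "\<ominus>\<^bsub>T act\<^esub> y \<in> add_span (T act) ?G" if "y \<in> add_span (T act) ?G" for y
    using that
  proof induction
    case zero
    then show ?case using add_span.zero[of "T act" ?G] by (simp only: T.add.inv_one[folded a_inv_def])
  next
    case (base y)
    then obtain a b where ab: "y = tens a b" "a \<in> carrier A" "b \<in> carrier B" by blast
    then have "\<ominus>\<^bsub>T act\<^esub> y = tens (\<ominus>\<^bsub>A\<^esub> a) b"
      using add_hom_neg[OF tens_hom_left[of b act] A_group T_group, of a] by simp
    then show ?case using ab by (auto intro!: add_span.base)
  next
    case (add x y)
    then show ?case using add_span_subset[OF T_group sub] by (simp add: T.minus_add add_span.add)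
  qed
  obtain f where f: "x = K #>\<^bsub>F\<^esub> f" "f \<in> carrier F" using assms unfolding T_carrier by blast
  have "Poly_Mapping.keys f \<subseteq> carrier A \<times> carrier B" using f by simp
  then have "K #>\<^bsub>F\<^esub> f \<in> add_span (T act) ?G"
  proof (induction f rule: free_Abelian_group_induct[consumes 1, case_names zero diff one])
    case zero
    then show ?case using add_span.zero[of "T act" ?G] by (simp add: T_zero)
  next
    case (diff x y)
    have y: "(K #>\<^bsub>F\<^esub> (- y)) \<oplus>\<^bsub>T act\<^esub> (K #>\<^bsub>F\<^esub> y) = \<zero>\<^bsub>T act\<^esub>"
      using T_add[of "- y" y] diff(2) by (simp add: T_zero)
    have "K #>\<^bsub>F\<^esub> (- y) = \<ominus>\<^bsub>T act\<^esub> (K #>\<^bsub>F\<^esub> y)"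
      by (rule T.minus_equality[symmetric, OF y]) (use diff(2) in \<open>auto simp: T_carrier\<close>)
    then have "K #>\<^bsub>F\<^esub> (x - y) = (K #>\<^bsub>F\<^esub> x) \<oplus>\<^bsub>T act\<^esub> \<ominus>\<^bsub>T act\<^esub> (K #>\<^bsub>F\<^esub> y)"
      using T_add[of x "- y" act] diff(1,2) by simp
    then show ?case using neg[OF diff(4)] diff(3) by (simp add: add_span.add)
  next
    case (one a)
    then show ?case by (auto simp: tens_def intro!: add_span.base)
  qed
  then show ?thesis using f by simp
qed

lemma T_hom_eqI:
  assumes "add_hom (T act) Q f" "add_hom (T act) Q g" "abelian_group Q"
    "\<And>a b. a \<in> carrier A \<Longrightarrow> b \<in> carrier B \<Longrightarrow> f (tens a b) = g (tens a b)" "x \<in> carrier (T act)"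
  shows "f x = g x"
  by (rule add_hom_eq_on_span[OF assms(1,2) T_group assms(3) _ _ T_span[OF assms(5)]])
     (use assms(4) tens_closed in blast)+

text \<open>
  A balanced biadditive map extends to the free abelian group by freeness and kills the three kinds
  of relations, hence their span \<open>K\<close>.
\<close>

lemma universal:
  assumes Q: "abelian_group Q"
    and "\<And>a b. a \<in> carrier A \<Longrightarrow> b \<in> carrier B \<Longrightarrow> \<beta> a b \<in> carrier Q"
    and "\<And>a a' b. a \<in> carrier A \<Longrightarrow> a' \<in> carrier A \<Longrightarrow> b \<in> carrier B \<Longrightarrow> \<beta> (a \<oplus>\<^bsub>A\<^esub> a') b = \<beta> a b \<oplus>\<^bsub>Q\<^esub> \<beta> a' b"
    and "\<And>a b b'. a \<in> carrier A \<Longrightarrow> b \<in> carrier B \<Longrightarrow> b' \<in> carrier B \<Longrightarrow> \<beta> a (b \<oplus>\<^bsub>B\<^esub> b') = \<beta> a b \<oplus>\<^bsub>Q\<^esub> \<beta> a b'"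
    and "\<And>a t b. a \<in> carrier A \<Longrightarrow> t \<in> carrier S \<Longrightarrow> b \<in> carrier B \<Longrightarrow> \<beta> (ra a t) b = \<beta> a (t \<odot>\<^bsub>B\<^esub> b)"
  obtains h where "add_hom (T act) Q h" "\<And>a b. a \<in> carrier A \<Longrightarrow> b \<in> carrier B \<Longrightarrow> h (tens a b) = \<beta> a b"
proof -
  interpret Q: abelian_group Q by (rule Q)
  obtain h0 where h0: "h0 \<in> hom F (add_monoid Q)"
    "\<And>x. x \<in> carrier A \<times> carrier B \<Longrightarrow> h0 (frag_of x) = (case x of (a, b) \<Rightarrow> \<beta> a b)"
    using comm_group.free_Abelian_group_universal[OF Q.a_comm_group,
        of "\<lambda>(a, b). \<beta> a b" "carrier A \<times> carrier B"] assms(2)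
    unfolding F_def by (auto simp: image_subset_iff)
  have h0c: "h0 x \<in> carrier Q" if "x \<in> carrier F" for x using h0(1) that by (auto simp: hom_def)
  have h0a: "h0 (x + y) = h0 x \<oplus>\<^bsub>Q\<^esub> h0 y" if "x \<in> carrier F" "y \<in> carrier F" for x y
    using h0(1) that by (auto simp: hom_def)
  have h00: "h0 0 = \<zero>\<^bsub>Q\<^esub>"
    by (rule Q.add_idem_zero) (use h0a[of 0 0] h0c[of 0] in auto)
  have h0d: "h0 (x - y) = h0 x \<ominus>\<^bsub>Q\<^esub> h0 y" if "x \<in> carrier F" "y \<in> carrier F" for x y
  proof -
    have "h0 (- y) \<oplus>\<^bsub>Q\<^esub> h0 y = \<zero>\<^bsub>Q\<^esub>" using h0a[of "- y" y] h00 that by simp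
    then have "h0 (- y) = \<ominus>\<^bsub>Q\<^esub> h0 y" using h0c that Q.minus_equality by (metis F_neg_closed)
    then show ?thesis using h0a[of x "- y"] that by (simp add: a_minus_def)
  qed
  have fr: "frag_of (a, b) \<in> carrier F" if "a \<in> carrier A" "b \<in> carrier B" for a b
    using that by simp
  have dc: "x - y \<in> carrier F" if "x \<in> carrier F" "y \<in> carrier F" for x y
    using F_add_closed[OF that(1) F_neg_closed[OF that(2)]] by simp
  have cancel: "(u \<oplus>\<^bsub>Q\<^esub> v) \<ominus>\<^bsub>Q\<^esub> u \<ominus>\<^bsub>Q\<^esub> v = \<zero>\<^bsub>Q\<^esub>" if "u \<in> carrier Q" "v \<in> carrier Q" for u v
    using that Q.r_neg[of "u \<oplus>\<^bsub>Q\<^esub> v"] by (simp add: a_minus_def Q.minus_add Q.a_assoc)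
  have rel: "h0 x = \<zero>\<^bsub>Q\<^esub>" if "x \<in> tensor_relations S A ra B" for x
    using that unfolding tensor_relations_def
  proof (elim UnE CollectE exE conjE)
    fix a a' b assume *: "x = frag_of (a \<oplus>\<^bsub>A\<^esub> a', b) - frag_of (a, b) - frag_of (a', b)"
      "a \<in> carrier A" "a' \<in> carrier A" "b \<in> carrier B"
    have "h0 x = \<beta> (a \<oplus>\<^bsub>A\<^esub> a') b \<ominus>\<^bsub>Q\<^esub> \<beta> a b \<ominus>\<^bsub>Q\<^esub> \<beta> a' b"
      using * by (simp add: h0d fr dc h0(2) del: F_simps)
    then show ?thesis using * assms(2,3) cancel by simp
  next
    fix a b b' assume *: "x = frag_of (a, b \<oplus>\<^bsub>B\<^esub> b') - frag_of (a, b) - frag_of (a, b')"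
      "a \<in> carrier A" "b \<in> carrier B" "b' \<in> carrier B"
    have "h0 x = \<beta> a (b \<oplus>\<^bsub>B\<^esub> b') \<ominus>\<^bsub>Q\<^esub> \<beta> a b \<ominus>\<^bsub>Q\<^esub> \<beta> a b'"
      using * by (simp add: h0d fr dc h0(2) del: F_simps)
    then show ?thesis using * assms(2,4) cancel by simp
  next
    fix a t b assume *: "x = frag_of (ra a t, b) - frag_of (a, t \<odot>\<^bsub>B\<^esub> b)"
      "a \<in> carrier A" "t \<in> carrier S" "b \<in> carrier B"
    then have "h0 x = \<beta> (ra a t) b \<ominus>\<^bsub>Q\<^esub> \<beta> a (t \<odot>\<^bsub>B\<^esub> b)"
      by (simp add: h0d fr ra_closed B_smult_closed h0(2) del: F_simps)
    then show ?thesis using * assms(2,5) B_smult_closed by (simp add: a_minus_def Q.r_neg)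
  qed
  have ker: "h0 x = \<zero>\<^bsub>Q\<^esub> \<and> x \<in> carrier F" if "x \<in> K" for x
    using that unfolding K_def tensor_subgroup_def F_def[symmetric]
  proof (induction x rule: generate.induct)
    case one
    then show ?case using h00 by simp
  next
    case (incl h)
    then show ?case using rel relations_closed by blast
  next
    case (inv h)
    then have *: "h \<in> carrier F" "h0 h = \<zero>\<^bsub>Q\<^esub>" using rel relations_closed by blast+
    then have "inv\<^bsub>F\<^esub> h = 0 - h" by (simp add: F_def)
    then show ?case using * h0d[of 0 h] dc[of 0 h] h00 by (simp add: a_minus_def)
  next
    case (eng h1 h2)
    then show ?case using h0a[of h1 h2] F_add_closed[of h1 h2] by (simp del: F_simps(1))
  qed
  have "h0 x = h0 y" if "x \<in> carrier F" "y \<in> carrier F" "K #>\<^bsub>F\<^esub> x = K #>\<^bsub>F\<^esub> y" for x y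
  proof -
    have "h0 (x - y) = \<zero>\<^bsub>Q\<^esub>" using that ker by (simp add: coset_eq_iff)
    then show ?thesis using h0a[of "x - y" y] that dc h0c by simp
  qed
  then obtain g where g: "g \<in> hom (F Mod K) (add_monoid Q)" "\<And>x. x \<in> carrier F \<Longrightarrow> g (K #>\<^bsub>F\<^esub> x) = h0 x"
    using FactGroup_universal[OF h0(1) K_normal] by blast
  show ?thesis
  proof (rule that)
    show "add_hom (T act) Q g"
      using g(1) by (auto simp: add_hom_def hom_def tensor_module_def tensor_group_def F_def K_def)
    show "g (tens a b) = \<beta> a b" if "a \<in> carrier A" "b \<in> carrier B" for a b
      using g(2)[of "frag_of (a, b)"] that h0(2) by (simp add: tens_def)
  qed
qed

text \<open>
  The scalar action on a tensor module is a union of cosets over all representatives.  It is a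
  single coset, and additive, as soon as \<open>act r\<close> is biadditive and balanced modulo \<open>K\<close>, because then
  its linear extension preserves \<open>K\<close>.
\<close>

lemma smult_coset:
  assumes cl: "\<And>a b. a \<in> carrier A \<Longrightarrow> b \<in> carrier B \<Longrightarrow> act r (a, b) \<in> carrier F"
    and left: "\<And>b. b \<in> carrier B \<Longrightarrow> add_hom A (T act) (\<lambda>a. K #>\<^bsub>F\<^esub> act r (a, b))"
    and right: "\<And>a. a \<in> carrier A \<Longrightarrow> add_hom B (T act) (\<lambda>b. K #>\<^bsub>F\<^esub> act r (a, b))"
    and bal: "\<And>a t b. a \<in> carrier A \<Longrightarrow> t \<in> carrier S \<Longrightarrow> b \<in> carrier B \<Longrightarrow>
       K #>\<^bsub>F\<^esub> act r (ra a t, b) = K #>\<^bsub>F\<^esub> act r (a, t \<odot>\<^bsub>B\<^esub> b)"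
  shows "add_hom (T act) (T act) (\<lambda>C. r \<odot>\<^bsub>T act\<^esub> C)"
    and "\<And>a b. a \<in> carrier A \<Longrightarrow> b \<in> carrier B \<Longrightarrow> r \<odot>\<^bsub>T act\<^esub> tens a b = K #>\<^bsub>F\<^esub> act r (a, b)"
proof -
  let ?e = "frag_extend (act r)"
  have ecl: "?e x \<in> carrier F" if "x \<in> carrier F" for x
  proof -
    have "Poly_Mapping.keys (?e x) \<subseteq> (\<Union>y\<in>Poly_Mapping.keys x. Poly_Mapping.keys (act r y))"
      by (rule keys_frag_extend)
    moreover have "Poly_Mapping.keys (act r y) \<subseteq> carrier A \<times> carrier B" if "y \<in> Poly_Mapping.keys x" for y
    proof -
      have "y \<in> carrier A \<times> carrier B" using \<open>x \<in> carrier F\<close> that F_simps(1) by blast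
      then show ?thesis using cl[of "fst y" "snd y"] by (simp add: mem_Times_iff)
    qed
    ultimately have "Poly_Mapping.keys (?e x) \<subseteq> carrier A \<times> carrier B" by blast
    then show ?thesis by (simp only: F_simps)
  qed
  have rel: "?e x \<in> K" if "x \<in> tensor_relations S A ra B" for x
    using that unfolding tensor_relations_def
  proof (elim UnE CollectE exE conjE)
    fix a a' b assume *: "x = frag_of (a \<oplus>\<^bsub>A\<^esub> a', b) - frag_of (a, b) - frag_of (a', b)"
      "a \<in> carrier A" "a' \<in> carrier A" "b \<in> carrier B"
    have "K #>\<^bsub>F\<^esub> act r (a \<oplus>\<^bsub>A\<^esub> a', b) = K #>\<^bsub>F\<^esub> (act r (a, b) + act r (a', b))"
      using add_hom_add[OF left[OF *(4)] *(2,3)] T_add[of _ _ act, OF cl cl] * by simp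
    then show ?thesis using * by (simp add: coset_eq_iff frag_extend_diff frag_extend_add diff_diff_eq)
  next
    fix a b b' assume *: "x = frag_of (a, b \<oplus>\<^bsub>B\<^esub> b') - frag_of (a, b) - frag_of (a, b')"
      "a \<in> carrier A" "b \<in> carrier B" "b' \<in> carrier B"
    have "K #>\<^bsub>F\<^esub> act r (a, b \<oplus>\<^bsub>B\<^esub> b') = K #>\<^bsub>F\<^esub> (act r (a, b) + act r (a, b'))"
      using add_hom_add[OF right[OF *(2)] *(3,4)] T_add[of _ _ act, OF cl cl] * by simp
    then show ?thesis using * by (simp add: coset_eq_iff frag_extend_diff frag_extend_add diff_diff_eq)
  next
    fix a t b assume *: "x = frag_of (ra a t, b) - frag_of (a, t \<odot>\<^bsub>B\<^esub> b)"
      "a \<in> carrier A" "t \<in> carrier S" "b \<in> carrier B"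
    then show ?thesis using bal by (simp add: coset_eq_iff frag_extend_diff)
  qed
  have ker: "?e x \<in> K" if "x \<in> K" for x
    using that unfolding K_def tensor_subgroup_def F_def[symmetric]
  proof (induction x rule: generate.induct)
    case one
    then show ?case using K_zero by (simp add: K_def tensor_subgroup_def F_def)
  next
    case (incl h)
    then show ?case using rel by (simp add: K_def tensor_subgroup_def F_def)
  next
    case (inv h)
    then have "h \<in> carrier F" using relations_closed by blast
    then have "inv\<^bsub>F\<^esub> h = - h" by (simp add: F_def)
    then show ?case using rel[OF inv] K_neg by (simp add: K_def tensor_subgroup_def F_def frag_extend_minus)
  next
    case (eng h1 h2)
    then show ?case using K_add by (simp add: frag_extend_add K_def tensor_subgroup_def F_def)
  qed
  have main: "r \<odot>\<^bsub>T act\<^esub> (K #>\<^bsub>F\<^esub> x) = K #>\<^bsub>F\<^esub> ?e x" if "x \<in> carrier F" for x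
  proof -
    have "K #>\<^bsub>F\<^esub> ?e c = K #>\<^bsub>F\<^esub> ?e x" if c: "c \<in> K #>\<^bsub>F\<^esub> x" for c
    proof -
      obtain k where "k \<in> K" "c = k + x" using c by (auto simp: r_coset_def)
      then show ?thesis using ker by (simp add: coset_eq_iff frag_extend_add)
    qed
    moreover have "x \<in> K #>\<^bsub>F\<^esub> x" using K_zero by (force simp: r_coset_def)
    ultimately show ?thesis unfolding T_smult by blast
  qed
  show "add_hom (T act) (T act) (\<lambda>C. r \<odot>\<^bsub>T act\<^esub> C)"
  proof (rule add_homI)
    fix x assume "x \<in> carrier (T act)"
    then show "r \<odot>\<^bsub>T act\<^esub> x \<in> carrier (T act)" using main ecl unfolding T_carrier by auto
  next
    fix x y assume "x \<in> carrier (T act)" "y \<in> carrier (T act)"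
    then obtain u v where uv: "x = K #>\<^bsub>F\<^esub> u" "y = K #>\<^bsub>F\<^esub> v" "u \<in> carrier F" "v \<in> carrier F"
      unfolding T_carrier by blast
    then have "x \<oplus>\<^bsub>T act\<^esub> y = K #>\<^bsub>F\<^esub> (u + v)" using T_add by simp
    then show "r \<odot>\<^bsub>T act\<^esub> (x \<oplus>\<^bsub>T act\<^esub> y) = r \<odot>\<^bsub>T act\<^esub> x \<oplus>\<^bsub>T act\<^esub> r \<odot>\<^bsub>T act\<^esub> y"
      using main[OF F_add_closed[OF uv(3,4)]] main[OF uv(3)] main[OF uv(4)] T_add[OF ecl ecl, OF uv(3,4), of act] uv(1,2)
      by (simp add: frag_extend_add)
  qed
  show "r \<odot>\<^bsub>T act\<^esub> tens a b = K #>\<^bsub>F\<^esub> act r (a, b)" if "a \<in> carrier A" "b \<in> carrier B" for a b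
    unfolding tens_def using main[of "frag_of (a, b)"] that by simp
qed

lemma coset_sum:
  assumes "finite J" "\<And>j. j \<in> J \<Longrightarrow> a j \<in> carrier A" "\<And>j. j \<in> J \<Longrightarrow> b j \<in> carrier B"
  shows "K #>\<^bsub>F\<^esub> (\<Sum>j\<in>J. frag_of (a j, b j)) = (\<Oplus>\<^bsub>T act\<^esub>j\<in>J. tens (a j) (b j))
    \<and> (\<Sum>j\<in>J. frag_of (a j, b j)) \<in> carrier F"
proof -
  interpret T: abelian_group "T act" by (rule T_group)
  show ?thesis using assms
  proof (induction J rule: finite_induct)
    case empty
    then show ?case by (simp add: T_zero)
  next
    case (insert j J)
    have "frag_of (a j, b j) \<in> carrier F" using insert by simp
    moreover have "tens (a i) (b i) \<in> carrier (T act)" if "i \<in> insert j J" for i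
      using insert.prems that by (intro tens_closed) auto
    then have "(\<lambda>j. tens (a j) (b j)) \<in> J \<rightarrow> carrier (T act)" "tens (a j) (b j) \<in> carrier (T act)" by auto
    ultimately show ?case
      using insert T_add[of "frag_of (a j, b j)" "\<Sum>j\<in>J. frag_of (a j, b j)" act] F_add_closed
      by (simp add: tens_closed tens_def[symmetric] del: F_simps(1))
  qed
qed

text \<open>
  A free right module has coordinates \<open>c i\<close> with respect to its basis \<open>r i\<close>, and
  \<open>a \<otimes> b \<mapsto> c i a \<cdot> b\<close> is balanced, so it defines the coordinates on the tensor product.  Only
  the action of the coordinates on \<open>B\<close> enters there, and the conditions on \<open>c\<close> are stated for it.
\<close>

lemma coproduct_of_free:
  assumes r_closed: "\<And>i. i \<in> I \<Longrightarrow> r i \<in> carrier A"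
    and c_closed: "\<And>i a. i \<in> I \<Longrightarrow> a \<in> carrier A \<Longrightarrow> c i a \<in> carrier S"
    and c_add: "\<And>i a a' b. i \<in> I \<Longrightarrow> a \<in> carrier A \<Longrightarrow> a' \<in> carrier A \<Longrightarrow> b \<in> carrier B \<Longrightarrow>
       c i (a \<oplus>\<^bsub>A\<^esub> a') \<odot>\<^bsub>B\<^esub> b = c i a \<odot>\<^bsub>B\<^esub> b \<oplus>\<^bsub>B\<^esub> c i a' \<odot>\<^bsub>B\<^esub> b"
    and c_ra: "\<And>i a t b. i \<in> I \<Longrightarrow> a \<in> carrier A \<Longrightarrow> t \<in> carrier S \<Longrightarrow> b \<in> carrier B \<Longrightarrow>
       c i (ra a t) \<odot>\<^bsub>B\<^esub> b = c i a \<odot>\<^bsub>B\<^esub> (t \<odot>\<^bsub>B\<^esub> b)"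
    and c_r: "\<And>i b. i \<in> I \<Longrightarrow> b \<in> carrier B \<Longrightarrow> c i (r i) \<odot>\<^bsub>B\<^esub> b = b"
    and c_r_neq: "\<And>i j b. i \<in> I \<Longrightarrow> j \<in> I \<Longrightarrow> i \<noteq> j \<Longrightarrow> b \<in> carrier B \<Longrightarrow> c i (r j) \<odot>\<^bsub>B\<^esub> b = \<zero>\<^bsub>B\<^esub>"
    and span: "\<And>a. a \<in> carrier A \<Longrightarrow> a \<in> add_span A {ra (r i) t |i t. i \<in> I \<and> t \<in> carrier S}"
    and B_add: "\<And>t b b'. t \<in> carrier S \<Longrightarrow> b \<in> carrier B \<Longrightarrow> b' \<in> carrier B \<Longrightarrow>
       t \<odot>\<^bsub>B\<^esub> (b \<oplus>\<^bsub>B\<^esub> b') = t \<odot>\<^bsub>B\<^esub> b \<oplus>\<^bsub>B\<^esub> t \<odot>\<^bsub>B\<^esub> b'"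
  obtains p where "add_coproduct (T act) I (\<lambda>_. B) (\<lambda>i. tens (r i)) p"
    and "\<And>i a b. i \<in> I \<Longrightarrow> a \<in> carrier A \<Longrightarrow> b \<in> carrier B \<Longrightarrow> p i (tens a b) = c i a \<odot>\<^bsub>B\<^esub> b"
proof -
  have "\<exists>h. add_hom (T act) B h \<and> (\<forall>a\<in>carrier A. \<forall>b\<in>carrier B. h (tens a b) = c i a \<odot>\<^bsub>B\<^esub> b)" if "i \<in> I" for i
    by (rule universal[of B "\<lambda>a b. c i a \<odot>\<^bsub>B\<^esub> b" act])
       (use that B_group c_closed c_add c_ra B_smult_closed B_add in auto)
  then obtain p where p: "\<And>i. i \<in> I \<Longrightarrow> add_hom (T act) B (p i)"
    "\<And>i a b. i \<in> I \<Longrightarrow> a \<in> carrier A \<Longrightarrow> b \<in> carrier B \<Longrightarrow> p i (tens a b) = c i a \<odot>\<^bsub>B\<^esub> b"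
    by metis
  let ?G = "{tens (r i) u |i u. i \<in> I \<and> u \<in> carrier B}"
  have "add_coproduct (T act) I (\<lambda>_. B) (\<lambda>i. tens (r i)) p"
  proof (rule add_coproduct.intro, goal_cases)
    case 7
    show ?case
    proof
      fix x assume "x \<in> carrier (T act)"
      then have "x \<in> add_span (T act) {tens a b |a b. a \<in> carrier A \<and> b \<in> carrier B}" by (rule T_span)
      then show "x \<in> add_span (T act) ?G"
      proof (rule add_span_trans[rotated])
        fix y assume "y \<in> {tens a b |a b. a \<in> carrier A \<and> b \<in> carrier B}"
        then obtain a b where ab: "y = tens a b" "a \<in> carrier A" "b \<in> carrier B" by blast
        show "y \<in> add_span (T act) ?G" unfolding ab(1)
        proof (rule add_hom_span_image[OF tens_hom_left[OF ab(3)] A_group T_group _ _ span[OF ab(2)]])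
          show "{ra (r i) t |i t. i \<in> I \<and> t \<in> carrier S} \<subseteq> carrier A" using ra_closed r_closed by blast
          fix x assume "x \<in> {ra (r i) t |i t. i \<in> I \<and> t \<in> carrier S}"
          then obtain i t where it: "x = ra (r i) t" "i \<in> I" "t \<in> carrier S" by blast
          then have "tens x b = tens (r i) (t \<odot>\<^bsub>B\<^esub> b)" using tens_balanced r_closed ab by simp
          then show "tens x b \<in> add_span (T act) ?G"
            using it ab B_smult_closed by (intro add_span.base) (auto intro!: exI[of _ i] exI[of _ "t \<odot>\<^bsub>B\<^esub> b"])
        qed
      qed
    qed
  qed (use p T_group B_group tens_hom_right[OF r_closed] r_closed c_r c_r_neq in auto)
  then show ?thesis using that p(2) by blast
qed

end

section \<open>Twisted group algebras\<close>

lemma left_module_smult_hom: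
  "left_module R M \<Longrightarrow> r \<in> carrier R \<Longrightarrow> add_hom M M (\<lambda>x. r \<odot>\<^bsub>M\<^esub> x)"
  by (auto intro!: add_homI left_module.smult_closed left_module.smult_r_distr)

lemma left_module_scalar_hom:
  "left_module R M \<Longrightarrow> x \<in> carrier M \<Longrightarrow> add_hom R M (\<lambda>r. r \<odot>\<^bsub>M\<^esub> x)"
  by (auto intro!: add_homI left_module.smult_closed left_module.smult_l_distr)

lemma left_module_groups:
  assumes "left_module R M" shows "abelian_group M" "ring R" "abelian_group R"
  using assms by (auto simp: left_module_def ring.is_abelian_group)

lemma left_module_zero_smult:
  assumes "left_module R M" "x \<in> carrier M" shows "\<zero>\<^bsub>R\<^esub> \<odot>\<^bsub>M\<^esub> x = \<zero>\<^bsub>M\<^esub>"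
  using add_hom_zero[OF left_module_scalar_hom[OF assms]] left_module_groups[OF assms(1)] by simp

lemma left_module_smult_zero:
  assumes "left_module R M" "r \<in> carrier R" shows "r \<odot>\<^bsub>M\<^esub> \<zero>\<^bsub>M\<^esub> = \<zero>\<^bsub>M\<^esub>"
  using add_hom_zero[OF left_module_smult_hom[OF assms]] left_module_groups[OF assms(1)] by simp

locale twisted_action = A: ring A + G: group G
  for A :: "('a, 'r) ring_scheme" (structure) and G :: "('g, 'k) monoid_scheme" (structure) +
  fixes act :: "'g \<Rightarrow> 'a \<Rightarrow> 'a"
  assumes finite_G: "finite (carrier G)"
    and act_closed: "w \<in> carrier G \<Longrightarrow> a \<in> carrier A \<Longrightarrow> act w a \<in> carrier A"
    and act_add: "w \<in> carrier G \<Longrightarrow> a \<in> carrier A \<Longrightarrow> b \<in> carrier A \<Longrightarrow>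
       act w (a \<oplus>\<^bsub>A\<^esub> b) = act w a \<oplus>\<^bsub>A\<^esub> act w b"
    and act_mult: "w \<in> carrier G \<Longrightarrow> a \<in> carrier A \<Longrightarrow> b \<in> carrier A \<Longrightarrow>
       act w (a \<otimes>\<^bsub>A\<^esub> b) = act w a \<otimes>\<^bsub>A\<^esub> act w b"
    and act_unit: "w \<in> carrier G \<Longrightarrow> act w \<one>\<^bsub>A\<^esub> = \<one>\<^bsub>A\<^esub>"
    and act_id: "a \<in> carrier A \<Longrightarrow> act \<one>\<^bsub>G\<^esub> a = a"
    and act_comp: "u \<in> carrier G \<Longrightarrow> v \<in> carrier G \<Longrightarrow> a \<in> carrier A \<Longrightarrow>
       act (u \<otimes>\<^bsub>G\<^esub> v) a = act u (act v a)"
begin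

abbreviation TA where "TA \<equiv> twisted_group_algebra A G act"

lemma act_hom: "w \<in> carrier G \<Longrightarrow> add_hom A A (act w)"
  by (intro add_homI act_closed act_add)

lemma act_zero: "w \<in> carrier G \<Longrightarrow> act w \<zero>\<^bsub>A\<^esub> = \<zero>\<^bsub>A\<^esub>"
  using add_hom_zero[OF act_hom A.abelian_group_axioms A.abelian_group_axioms] .

lemma TA_carrier: "f \<in> carrier TA \<longleftrightarrow> (\<forall>w\<in>carrier G. f w \<in> carrier A) \<and> (\<forall>w. w \<notin> carrier G \<longrightarrow> f w = \<zero>\<^bsub>A\<^esub>)"
  by (simp add: twisted_group_algebra_def)

lemma TA_closed: "f \<in> carrier TA \<Longrightarrow> f w \<in> carrier A"
  by (cases "w \<in> carrier G") (auto simp: TA_carrier)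

lemma TA_zero: "\<zero>\<^bsub>TA\<^esub> = (\<lambda>w. \<zero>\<^bsub>A\<^esub>)" by (simp add: twisted_group_algebra_def)
lemma TA_one: "\<one>\<^bsub>TA\<^esub> = pure_elt A \<one>\<^bsub>A\<^esub> \<one>\<^bsub>G\<^esub>"
  by (auto simp: twisted_group_algebra_def pure_elt_def)
lemma TA_add: "f \<oplus>\<^bsub>TA\<^esub> g = (\<lambda>w. f w \<oplus>\<^bsub>A\<^esub> g w)" by (simp add: twisted_group_algebra_def)
lemma TA_mult: "f \<otimes>\<^bsub>TA\<^esub> g = (\<lambda>w. if w \<in> carrier G
        then \<Oplus>\<^bsub>A\<^esub>u\<in>carrier G. f u \<otimes>\<^bsub>A\<^esub> act u (g (inv\<^bsub>G\<^esub> u \<otimes>\<^bsub>G\<^esub> w)) else \<zero>\<^bsub>A\<^esub>)"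
  by (simp add: twisted_group_algebra_def)

lemma TA_group: "abelian_group TA"
proof (rule abelian_groupI)
  fix x assume x: "x \<in> carrier TA"
  let ?y = "\<lambda>w. \<ominus>\<^bsub>A\<^esub> x w"
  have "?y \<in> carrier TA" using x by (auto simp: TA_carrier)
  moreover have "?y \<oplus>\<^bsub>TA\<^esub> x = \<zero>\<^bsub>TA\<^esub>"
    using TA_closed[OF x] by (auto simp: TA_add TA_zero A.l_neg)
  ultimately show "\<exists>y\<in>carrier TA. y \<oplus>\<^bsub>TA\<^esub> x = \<zero>\<^bsub>TA\<^esub>" by blast
next
  fix x assume x: "x \<in> carrier TA"
  then show "\<zero>\<^bsub>TA\<^esub> \<oplus>\<^bsub>TA\<^esub> x = x" using TA_closed[OF x] by (auto simp: TA_add TA_zero)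
  fix y assume y: "y \<in> carrier TA"
  show "x \<oplus>\<^bsub>TA\<^esub> y \<in> carrier TA" using x y by (auto simp: TA_carrier TA_add)
  show "x \<oplus>\<^bsub>TA\<^esub> y = y \<oplus>\<^bsub>TA\<^esub> x" using TA_closed[OF x] TA_closed[OF y] by (auto simp: TA_add A.a_comm)
  fix z assume z: "z \<in> carrier TA"
  show "x \<oplus>\<^bsub>TA\<^esub> y \<oplus>\<^bsub>TA\<^esub> z = x \<oplus>\<^bsub>TA\<^esub> (y \<oplus>\<^bsub>TA\<^esub> z)"
    using TA_closed[OF x] TA_closed[OF y] TA_closed[OF z] by (auto simp: TA_add A.a_assoc)
qed (auto simp: TA_carrier TA_zero)

sublocale TA: abelian_group TA by (rule TA_group)

lemma pure_closed: "a \<in> carrier A \<Longrightarrow> w \<in> carrier G \<Longrightarrow> pure_elt A a w \<in> carrier TA"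
  by (auto simp: TA_carrier pure_elt_def)

abbreviation pures where "pures \<equiv> {pure_elt A a w |a w. a \<in> carrier A \<and> w \<in> carrier G}"

lemma pures_closed: "pures \<subseteq> carrier TA" using pure_closed by blast

lemma TA_span:
  assumes "f \<in> carrier TA"
  shows "f \<in> add_span TA pures"
proof -
  have "(\<lambda>w. if w \<in> J then f w else \<zero>\<^bsub>A\<^esub>) \<in> add_span TA pures" if "finite J" "J \<subseteq> carrier G" for J
    using that
  proof (induction J rule: finite_induct)
    case empty
    then show ?case using add_span.zero[of TA] by (simp add: TA_zero)
  next
    case (insert v J)
    have "(\<lambda>w. if w \<in> insert v J then f w else \<zero>\<^bsub>A\<^esub>)
      = pure_elt A (f v) v \<oplus>\<^bsub>TA\<^esub> (\<lambda>w. if w \<in> J then f w else \<zero>\<^bsub>A\<^esub>)"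
      using insert TA_closed[OF assms] by (auto simp: TA_add pure_elt_def)
    moreover have "pure_elt A (f v) v \<in> add_span TA pures"
      using insert TA_closed[OF assms] by (auto intro!: add_span.base)
    ultimately show ?case using insert by (auto intro: add_span.add)
  qed
  from this[OF finite_G subset_refl] have "(\<lambda>w. if w \<in> carrier G then f w else \<zero>\<^bsub>A\<^esub>) \<in> add_span TA pures" .
  moreover have "(\<lambda>w. if w \<in> carrier G then f w else \<zero>\<^bsub>A\<^esub>) = f" using assms by (auto simp: TA_carrier)
  ultimately show ?thesis by simp
qed

text \<open>
  The product of the twisted group algebra is a convolution sum; identities between additive
  expressions are therefore checked on the elements \<open>a \<otimes> w\<close>, where the product is explicit.
\<close>

lemma TA_hom_eqI:
  assumes "add_hom TA Q f" "add_hom TA Q g" "abelian_group Q"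
    "\<And>a w. a \<in> carrier A \<Longrightarrow> w \<in> carrier G \<Longrightarrow> f (pure_elt A a w) = g (pure_elt A a w)" "x \<in> carrier TA"
  shows "f x = g x"
  by (rule add_hom_eq_on_span[OF assms(1,2) TA_group assms(3) pures_closed _ TA_span[OF assms(5)]])
     (use assms(4) in blast)

lemma term_closed:
  assumes "f \<in> carrier TA" "g \<in> carrier TA" "u \<in> carrier G"
  shows "f u \<otimes>\<^bsub>A\<^esub> act u (g v) \<in> carrier A"
  using assms TA_closed act_closed by simp

lemma TA_mult_closed:
  assumes "f \<in> carrier TA" "g \<in> carrier TA" shows "f \<otimes>\<^bsub>TA\<^esub> g \<in> carrier TA"
  using term_closed[OF assms] by (auto simp: TA_carrier TA_mult intro!: A.finsum_closed)

lemma mult_hom_left: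
  assumes g: "g \<in> carrier TA"
  shows "add_hom TA TA (\<lambda>f. f \<otimes>\<^bsub>TA\<^esub> g)"
proof (rule add_homI)
  fix x y assume xy: "x \<in> carrier TA" "y \<in> carrier TA"
  have "(\<Oplus>\<^bsub>A\<^esub>u\<in>carrier G. (x u \<oplus>\<^bsub>A\<^esub> y u) \<otimes>\<^bsub>A\<^esub> act u (g (inv\<^bsub>G\<^esub> u \<otimes>\<^bsub>G\<^esub> w))) =
    (\<Oplus>\<^bsub>A\<^esub>u\<in>carrier G. x u \<otimes>\<^bsub>A\<^esub> act u (g (inv\<^bsub>G\<^esub> u \<otimes>\<^bsub>G\<^esub> w)))
    \<oplus>\<^bsub>A\<^esub> (\<Oplus>\<^bsub>A\<^esub>u\<in>carrier G. y u \<otimes>\<^bsub>A\<^esub> act u (g (inv\<^bsub>G\<^esub> u \<otimes>\<^bsub>G\<^esub> w)))" for w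
    using term_closed[OF xy(1) g] term_closed[OF xy(2) g] TA_closed[OF xy(1)] TA_closed[OF xy(2)] TA_closed[OF g]
    by (intro trans[OF A.finsum_cong' A.finsum_addf]) (auto simp: A.l_distr act_closed)
  then show "(x \<oplus>\<^bsub>TA\<^esub> y) \<otimes>\<^bsub>TA\<^esub> g = x \<otimes>\<^bsub>TA\<^esub> g \<oplus>\<^bsub>TA\<^esub> y \<otimes>\<^bsub>TA\<^esub> g"
    by (auto simp: TA_mult TA_add)
qed (use g TA_mult_closed in auto)

lemma mult_hom_right:
  assumes g: "g \<in> carrier TA"
  shows "add_hom TA TA (\<lambda>f. g \<otimes>\<^bsub>TA\<^esub> f)"
proof (rule add_homI)
  fix x y assume xy: "x \<in> carrier TA" "y \<in> carrier TA"
  have "(\<Oplus>\<^bsub>A\<^esub>u\<in>carrier G. g u \<otimes>\<^bsub>A\<^esub> act u (x (inv\<^bsub>G\<^esub> u \<otimes>\<^bsub>G\<^esub> w) \<oplus>\<^bsub>A\<^esub> y (inv\<^bsub>G\<^esub> u \<otimes>\<^bsub>G\<^esub> w))) =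
    (\<Oplus>\<^bsub>A\<^esub>u\<in>carrier G. g u \<otimes>\<^bsub>A\<^esub> act u (x (inv\<^bsub>G\<^esub> u \<otimes>\<^bsub>G\<^esub> w)))
    \<oplus>\<^bsub>A\<^esub> (\<Oplus>\<^bsub>A\<^esub>u\<in>carrier G. g u \<otimes>\<^bsub>A\<^esub> act u (y (inv\<^bsub>G\<^esub> u \<otimes>\<^bsub>G\<^esub> w)))" for w
    using term_closed[OF g xy(1)] term_closed[OF g xy(2)] TA_closed[OF xy(1)] TA_closed[OF xy(2)] TA_closed[OF g]
    by (intro trans[OF A.finsum_cong' A.finsum_addf]) (auto simp: A.r_distr act_closed act_add)
  then show "g \<otimes>\<^bsub>TA\<^esub> (x \<oplus>\<^bsub>TA\<^esub> y) = g \<otimes>\<^bsub>TA\<^esub> x \<oplus>\<^bsub>TA\<^esub> g \<otimes>\<^bsub>TA\<^esub> y"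
    by (auto simp: TA_mult TA_add)
qed (use g TA_mult_closed in auto)

lemma pure_mult:
  assumes "a \<in> carrier A" "b \<in> carrier A" "u \<in> carrier G" "v \<in> carrier G"
  shows "pure_elt A a u \<otimes>\<^bsub>TA\<^esub> pure_elt A b v = pure_elt A (a \<otimes>\<^bsub>A\<^esub> act u b) (u \<otimes>\<^bsub>G\<^esub> v)"
proof (rule ext)
  fix w
  show "(pure_elt A a u \<otimes>\<^bsub>TA\<^esub> pure_elt A b v) w = pure_elt A (a \<otimes>\<^bsub>A\<^esub> act u b) (u \<otimes>\<^bsub>G\<^esub> v) w"
  proof (cases "w \<in> carrier G")
    case True
    have eq: "inv\<^bsub>G\<^esub> u \<otimes>\<^bsub>G\<^esub> w = v \<longleftrightarrow> w = u \<otimes>\<^bsub>G\<^esub> v"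
      using assms True by (metis G.inv_closed G.inv_solve_left)
    have "(pure_elt A a u \<otimes>\<^bsub>TA\<^esub> pure_elt A b v) w =
      (\<Oplus>\<^bsub>A\<^esub>t\<in>carrier G. pure_elt A a u t \<otimes>\<^bsub>A\<^esub> act t (pure_elt A b v (inv\<^bsub>G\<^esub> t \<otimes>\<^bsub>G\<^esub> w)))"
      using True by (simp add: TA_mult)
    also have "\<dots> = (\<Oplus>\<^bsub>A\<^esub>t\<in>carrier G. if u = t then a \<otimes>\<^bsub>A\<^esub> act u (pure_elt A b v (inv\<^bsub>G\<^esub> u \<otimes>\<^bsub>G\<^esub> w)) else \<zero>\<^bsub>A\<^esub>)"
      by (rule A.finsum_cong') (use assms True in \<open>auto simp: pure_elt_def act_closed act_zero\<close>)
    also have "\<dots> = a \<otimes>\<^bsub>A\<^esub> act u (pure_elt A b v (inv\<^bsub>G\<^esub> u \<otimes>\<^bsub>G\<^esub> w))"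
      by (rule A.finsum_singleton) (use assms finite_G in \<open>auto simp: pure_elt_def act_closed act_zero\<close>)
    also have "\<dots> = pure_elt A (a \<otimes>\<^bsub>A\<^esub> act u b) (u \<otimes>\<^bsub>G\<^esub> v) w"
      using assms by (simp add: pure_elt_def act_zero eq)
    finally show ?thesis .
  next
    case False
    then show ?thesis using assms by (auto simp: TA_mult pure_elt_def)
  qed
qed

text \<open>
  Associativity is trilinear, so it reduces to elements \<open>a \<otimes> w\<close>, for which it is the
  compatibility of the action with products in \<open>A\<close> and in \<open>G\<close>.
\<close>

lemma TA_ring: "ring TA"
proof (rule ringI)
  show "abelian_group TA" by (rule TA_group)
  note hom_simps = add_hom_compose[OF mult_hom_left] add_hom_compose[OF mult_hom_right]
  have pm: "pure_elt A a u \<otimes>\<^bsub>TA\<^esub> pure_elt A b v \<otimes>\<^bsub>TA\<^esub> pure_elt A c w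
    = pure_elt A a u \<otimes>\<^bsub>TA\<^esub> (pure_elt A b v \<otimes>\<^bsub>TA\<^esub> pure_elt A c w)"
    if "a \<in> carrier A" "b \<in> carrier A" "c \<in> carrier A" "u \<in> carrier G" "v \<in> carrier G" "w \<in> carrier G"
    for a b c u v w
    using that by (simp add: pure_mult act_closed act_mult act_comp A.m_assoc G.m_assoc)
  have 1: "pure_elt A a u \<otimes>\<^bsub>TA\<^esub> pure_elt A b v \<otimes>\<^bsub>TA\<^esub> z = pure_elt A a u \<otimes>\<^bsub>TA\<^esub> (pure_elt A b v \<otimes>\<^bsub>TA\<^esub> z)"
    if "a \<in> carrier A" "b \<in> carrier A" "u \<in> carrier G" "v \<in> carrier G" "z \<in> carrier TA" for a b u v z
    by (rule TA_hom_eqI[OF mult_hom_right add_hom_compose[OF mult_hom_right mult_hom_right] TA_group _ that(5)])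
       (use that pm in \<open>auto intro!: TA_mult_closed pure_closed\<close>)
  have 2: "pure_elt A a u \<otimes>\<^bsub>TA\<^esub> y \<otimes>\<^bsub>TA\<^esub> z = pure_elt A a u \<otimes>\<^bsub>TA\<^esub> (y \<otimes>\<^bsub>TA\<^esub> z)"
    if "a \<in> carrier A" "u \<in> carrier G" "y \<in> carrier TA" "z \<in> carrier TA" for a u y z
    by (rule TA_hom_eqI[OF add_hom_compose[OF mult_hom_right mult_hom_left]
          add_hom_compose[OF mult_hom_left mult_hom_right] TA_group _ that(3)])
       (use that 1 in \<open>auto intro!: TA_mult_closed pure_closed\<close>)
  have 3: "x \<otimes>\<^bsub>TA\<^esub> y \<otimes>\<^bsub>TA\<^esub> z = x \<otimes>\<^bsub>TA\<^esub> (y \<otimes>\<^bsub>TA\<^esub> z)"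
    if "x \<in> carrier TA" "y \<in> carrier TA" "z \<in> carrier TA" for x y z
    by (rule TA_hom_eqI[OF add_hom_compose[OF mult_hom_left mult_hom_left]
          mult_hom_left TA_group _ that(1)])
       (use that 2 in \<open>auto intro!: TA_mult_closed pure_closed\<close>)
  have one: "\<one>\<^bsub>TA\<^esub> \<in> carrier TA" by (simp add: TA_one pure_closed)
  have idh: "add_hom TA TA (\<lambda>x. x)" by (simp add: add_hom_def)
  have l: "\<one>\<^bsub>TA\<^esub> \<otimes>\<^bsub>TA\<^esub> x = x" if "x \<in> carrier TA" for x
    by (rule TA_hom_eqI[OF mult_hom_right[OF one] idh TA_group _ that])
       (simp add: TA_one pure_mult act_id)
  have r: "x \<otimes>\<^bsub>TA\<^esub> \<one>\<^bsub>TA\<^esub> = x" if "x \<in> carrier TA" for x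
    by (rule TA_hom_eqI[OF mult_hom_left[OF one] idh TA_group _ that])
       (simp add: TA_one pure_mult act_unit)
  show "Group.monoid TA"
    by (rule monoidI) (use TA_mult_closed one 3 l r in auto)
  show "(x \<oplus>\<^bsub>TA\<^esub> y) \<otimes>\<^bsub>TA\<^esub> z = x \<otimes>\<^bsub>TA\<^esub> z \<oplus>\<^bsub>TA\<^esub> y \<otimes>\<^bsub>TA\<^esub> z"
    "z \<otimes>\<^bsub>TA\<^esub> (x \<oplus>\<^bsub>TA\<^esub> y) = z \<otimes>\<^bsub>TA\<^esub> x \<oplus>\<^bsub>TA\<^esub> z \<otimes>\<^bsub>TA\<^esub> y"
    if "x \<in> carrier TA" "y \<in> carrier TA" "z \<in> carrier TA" for x y z
    using add_hom_add[OF mult_hom_left] add_hom_add[OF mult_hom_right] that by auto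
qed

lemma subgroup_twisted_action:
  assumes "subgroup H G" shows "twisted_action A (G\<lparr>carrier := H\<rparr>) act"
proof -
  have s: "H \<subseteq> carrier G" by (rule subgroup.subset[OF assms])
  show ?thesis
    by (intro twisted_action.intro twisted_action_axioms.intro A.ring_axioms G.subgroup_imp_group assms)
       (use s finite_G act_closed act_add act_mult act_unit act_id act_comp in \<open>auto intro: finite_subset simp: subset_iff\<close>)
qed

end

text \<open>
  Given biadditivity, the remaining module axioms need to be verified only on elements \<open>a \<otimes> w\<close>.
\<close>

lemma (in twisted_action) left_moduleI:
  assumes M: "abelian_group M"
    and cl: "\<And>f. f \<in> carrier TA \<Longrightarrow> add_hom M M (\<lambda>x. f \<odot>\<^bsub>M\<^esub> x)"
    and sc: "\<And>x. x \<in> carrier M \<Longrightarrow> add_hom TA M (\<lambda>f. f \<odot>\<^bsub>M\<^esub> x)"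
    and pm: "\<And>a b u v x. a \<in> carrier A \<Longrightarrow> b \<in> carrier A \<Longrightarrow> u \<in> carrier G \<Longrightarrow> v \<in> carrier G \<Longrightarrow> x \<in> carrier M \<Longrightarrow>
      pure_elt A (a \<otimes>\<^bsub>A\<^esub> act u b) (u \<otimes>\<^bsub>G\<^esub> v) \<odot>\<^bsub>M\<^esub> x = pure_elt A a u \<odot>\<^bsub>M\<^esub> (pure_elt A b v \<odot>\<^bsub>M\<^esub> x)"
    and one: "\<And>x. x \<in> carrier M \<Longrightarrow> pure_elt A \<one>\<^bsub>A\<^esub> \<one>\<^bsub>G\<^esub> \<odot>\<^bsub>M\<^esub> x = x"
  shows "left_module TA M"
proof (intro left_module.intro left_module_axioms.intro TA_ring M)
  have 1: "pure_elt A a u \<otimes>\<^bsub>TA\<^esub> y \<odot>\<^bsub>M\<^esub> x = pure_elt A a u \<odot>\<^bsub>M\<^esub> (y \<odot>\<^bsub>M\<^esub> x)"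
    if "a \<in> carrier A" "u \<in> carrier G" "y \<in> carrier TA" "x \<in> carrier M" for a u y x
    by (rule TA_hom_eqI[OF add_hom_compose[OF mult_hom_right sc] add_hom_compose[OF sc cl] M _ that(3)])
       (use that pm in \<open>auto intro!: pure_closed simp: pure_mult\<close>)
  show "f \<otimes>\<^bsub>TA\<^esub> y \<odot>\<^bsub>M\<^esub> x = f \<odot>\<^bsub>M\<^esub> (y \<odot>\<^bsub>M\<^esub> x)"
    if "f \<in> carrier TA" "y \<in> carrier TA" "x \<in> carrier M" for f y x
    by (rule TA_hom_eqI[OF add_hom_compose[OF mult_hom_left sc] sc M _ that(1)])
       (use that 1 add_hom_closed[OF cl] in \<open>auto intro!: pure_closed\<close>)
qed (use add_hom_closed[OF cl] add_hom_add[OF cl] add_hom_add[OF sc] one in \<open>auto simp: TA_one\<close>)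

lemma (in abelian_group) finsum_subset_zero:
  assumes "finite B" "A \<subseteq> B" "f \<in> B \<rightarrow> carrier G" "\<And>x. x \<in> B - A \<Longrightarrow> f x = \<zero>"
  shows "finsum G f B = finsum G f A"
  using assms by (intro add.finprod_mono_neutral_cong_right) auto

text \<open>
  For a subgroup \<open>H\<close>, the algebra \<open>A[H]\<close> is a subset of \<open>A[G]\<close>, and the inclusion is the identity.
\<close>

locale twisted_subgroup = twisted_action A G act
  for A :: "('a, 'r) ring_scheme" (structure) and G :: "('g, 'k) monoid_scheme" (structure) and act +
  fixes H :: "'g set"
  assumes H_subgroup: "subgroup H G"
begin

abbreviation GH where "GH \<equiv> G\<lparr>carrier := H\<rparr>"

sublocale H: twisted_action A GH act by (rule subgroup_twisted_action[OF H_subgroup])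

lemma H_sub: "h \<in> H \<Longrightarrow> h \<in> carrier G" using subgroup.subset[OF H_subgroup] by blast
lemma H_one: "\<one>\<^bsub>G\<^esub> \<in> H" by (rule subgroup.one_closed[OF H_subgroup])

lemma TAH_sub: "f \<in> carrier H.TA \<Longrightarrow> f \<in> carrier TA"
  using H_sub H.TA_closed[of f] by (auto simp: TA_carrier H.TA_carrier)

lemma incl_hom: "add_hom H.TA TA (\<lambda>x. x)"
  using TAH_sub by (auto simp: add_hom_def TA_add H.TA_add)

text \<open>
  The part of \<open>f\<close> supported on the coset \<open>c H\<close>, written as \<open>(1 \<otimes> c) \<cdot> coef c f\<close> with
  \<open>coef c f\<close> in \<open>A[H]\<close>: since \<open>(1 \<otimes> c) (b \<otimes> h) = act c b \<otimes> c h\<close>, the coefficients have to be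
  twisted back by the inverse of \<open>c\<close>.
\<close>

definition coef :: "'g \<Rightarrow> ('g \<Rightarrow> 'a) \<Rightarrow> 'g \<Rightarrow> 'a" where
  "coef c f = (\<lambda>h. if h \<in> H then act (inv\<^bsub>G\<^esub> c) (f (c \<otimes>\<^bsub>G\<^esub> h)) else \<zero>\<^bsub>A\<^esub>)"

lemma coef_hom: "c \<in> carrier G \<Longrightarrow> add_hom TA H.TA (coef c)"
  by (rule add_homI)
     (auto simp: H.TA_carrier coef_def act_closed TA_closed TA_add H.TA_add act_add)

lemma coef_pure:
  assumes "c \<in> carrier G" "a \<in> carrier A" "w \<in> carrier G"
  shows "coef c (pure_elt A a w) = (if inv\<^bsub>G\<^esub> c \<otimes>\<^bsub>G\<^esub> w \<in> H
    then pure_elt A (act (inv\<^bsub>G\<^esub> c) a) (inv\<^bsub>G\<^esub> c \<otimes>\<^bsub>G\<^esub> w) else \<zero>\<^bsub>H.TA\<^esub>)"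
proof (rule ext)
  fix h
  have "c \<otimes>\<^bsub>G\<^esub> h = w \<longleftrightarrow> h = inv\<^bsub>G\<^esub> c \<otimes>\<^bsub>G\<^esub> w" if "h \<in> H"
    using assms that H_sub by (metis G.inv_closed G.inv_solve_left)
  then show "coef c (pure_elt A a w) h = (if inv\<^bsub>G\<^esub> c \<otimes>\<^bsub>G\<^esub> w \<in> H
    then pure_elt A (act (inv\<^bsub>G\<^esub> c) a) (inv\<^bsub>G\<^esub> c \<otimes>\<^bsub>G\<^esub> w) else \<zero>\<^bsub>H.TA\<^esub>) h"
    using assms by (auto simp: coef_def pure_elt_def H.TA_zero act_zero)
qed

text \<open>
  A coset \<open>c H\<close> is stable under right multiplication by \<open>H\<close>, so its part of \<open>f s\<close> only
  depends on its part of \<open>f\<close>.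
\<close>

lemma coef_mult:
  assumes "c \<in> carrier G" "f \<in> carrier TA" "s \<in> carrier H.TA"
  shows "coef c (f \<otimes>\<^bsub>TA\<^esub> s) = coef c f \<otimes>\<^bsub>H.TA\<^esub> s"
proof -
  interpret HT: ring H.TA by (rule H.TA_ring)
  have 0: "coef c (pure_elt A a w \<otimes>\<^bsub>TA\<^esub> pure_elt A b h) = coef c (pure_elt A a w) \<otimes>\<^bsub>H.TA\<^esub> pure_elt A b h"
    if "a \<in> carrier A" "w \<in> carrier G" "b \<in> carrier A" "h \<in> H" for a w b h
  proof -
    have "inv\<^bsub>G\<^esub> c \<otimes>\<^bsub>G\<^esub> (w \<otimes>\<^bsub>G\<^esub> h) \<in> H \<longleftrightarrow> inv\<^bsub>G\<^esub> c \<otimes>\<^bsub>G\<^esub> w \<in> H"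
    proof
      assume "inv\<^bsub>G\<^esub> c \<otimes>\<^bsub>G\<^esub> (w \<otimes>\<^bsub>G\<^esub> h) \<in> H"
      then have "inv\<^bsub>G\<^esub> c \<otimes>\<^bsub>G\<^esub> (w \<otimes>\<^bsub>G\<^esub> h) \<otimes>\<^bsub>G\<^esub> inv\<^bsub>G\<^esub> h \<in> H"
        using that by (intro subgroup.m_closed[OF H_subgroup _ subgroup.m_inv_closed[OF H_subgroup]])
      then show "inv\<^bsub>G\<^esub> c \<otimes>\<^bsub>G\<^esub> w \<in> H" using assms that H_sub by (simp add: G.m_assoc)
    next
      assume "inv\<^bsub>G\<^esub> c \<otimes>\<^bsub>G\<^esub> w \<in> H"
      then have "inv\<^bsub>G\<^esub> c \<otimes>\<^bsub>G\<^esub> w \<otimes>\<^bsub>G\<^esub> h \<in> H"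
        using that by (intro subgroup.m_closed[OF H_subgroup, of _ h])
      then show "inv\<^bsub>G\<^esub> c \<otimes>\<^bsub>G\<^esub> (w \<otimes>\<^bsub>G\<^esub> h) \<in> H" using assms that H_sub by (simp add: G.m_assoc)
    qed
    then show ?thesis
      using that assms(1) H_sub[OF that(4)]
      by (auto simp: pure_mult coef_pure act_closed act_mult H.pure_mult G.m_assoc
          act_comp[symmetric] H.pure_closed)
  qed
  have 1: "coef c (pure_elt A a w \<otimes>\<^bsub>TA\<^esub> s) = coef c (pure_elt A a w) \<otimes>\<^bsub>H.TA\<^esub> s"
    if "a \<in> carrier A" "w \<in> carrier G" for a w
    by (rule H.TA_hom_eqI[OF add_hom_compose[OF add_hom_compose[OF incl_hom mult_hom_right] coef_hom]
          H.mult_hom_right H.TA_group _ assms(3)])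
       (use that 0 assms add_hom_closed[OF coef_hom] in \<open>auto simp: pure_closed\<close>)
  show ?thesis
    by (rule TA_hom_eqI[OF add_hom_compose[OF mult_hom_left coef_hom]
          add_hom_compose[OF coef_hom H.mult_hom_left] H.TA_group _ assms(2)])
       (use assms 1 TAH_sub in auto)
qed

end

section \<open>Induced modules\<close>

locale induction = R: ring R + S: ring S
  for R :: "('a, 'r) ring_scheme" and S :: "('s, 'k) ring_scheme" +
  fixes \<phi> :: "'s \<Rightarrow> 'a" and B :: "('s, 'b) module"
  assumes phi_closed: "s \<in> carrier S \<Longrightarrow> \<phi> s \<in> carrier R"
    and B_module: "left_module S B"
begin

sublocale tensor_product S R "\<lambda>a s. a \<otimes>\<^bsub>R\<^esub> \<phi> s" B
  by (rule tensor_product.intro)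
     (use phi_closed left_module.smult_closed[OF B_module] left_module_groups[OF B_module]
       R.is_abelian_group in auto)

abbreviation act0 where "act0 \<equiv> (\<lambda>r (a, m). frag_of (r \<otimes>\<^bsub>R\<^esub> a, m))"
abbreviation Ind where "Ind \<equiv> induced_module R S \<phi> B"

lemma Ind_eq: "Ind = T act0" by (simp add: induced_module_def)

text \<open>
  Left multiplication commutes with the right action of \<open>S\<close>, so it is balanced and \<open>smult_coset\<close>
  applies.
\<close>

lemma
  assumes r: "r \<in> carrier R"
  shows Ind_smult_hom: "add_hom Ind Ind (\<lambda>C. r \<odot>\<^bsub>Ind\<^esub> C)"
    and Ind_smult_tens: "\<And>a b. a \<in> carrier R \<Longrightarrow> b \<in> carrier B \<Longrightarrow> r \<odot>\<^bsub>Ind\<^esub> tens a b = tens (r \<otimes>\<^bsub>R\<^esub> a) b"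
proof -
  have hom: "add_hom R R (\<lambda>a. r \<otimes>\<^bsub>R\<^esub> a)" using r by (auto simp: add_hom_def R.r_distr)
  have cl: "act0 r (a, b) \<in> carrier F" if "a \<in> carrier R" "b \<in> carrier B" for a b
    using that r by simp
  have left: "add_hom R (T act0) (\<lambda>a. K #>\<^bsub>F\<^esub> act0 r (a, b))" if "b \<in> carrier B" for b
    using add_hom_compose[OF hom tens_hom_left[OF that]] by (simp add: tens_def)
  have right: "add_hom B (T act0) (\<lambda>b. K #>\<^bsub>F\<^esub> act0 r (a, b))" if "a \<in> carrier R" for a
    using tens_hom_right[of "r \<otimes>\<^bsub>R\<^esub> a" act0] that r by (simp add: tens_def[abs_def])
  have bal: "K #>\<^bsub>F\<^esub> act0 r (a \<otimes>\<^bsub>R\<^esub> \<phi> t, b) = K #>\<^bsub>F\<^esub> act0 r (a, t \<odot>\<^bsub>B\<^esub> b)"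
    if "a \<in> carrier R" "t \<in> carrier S" "b \<in> carrier B" for a t b
    using tens_balanced[of "r \<otimes>\<^bsub>R\<^esub> a" t b] that r phi_closed by (simp add: tens_def R.m_assoc)
  show "add_hom Ind Ind (\<lambda>C. r \<odot>\<^bsub>Ind\<^esub> C)"
    unfolding Ind_eq by (rule smult_coset(1)[of act0 r, OF cl left right bal])
  show "r \<odot>\<^bsub>Ind\<^esub> tens a b = tens (r \<otimes>\<^bsub>R\<^esub> a) b" if "a \<in> carrier R" "b \<in> carrier B" for a b
    unfolding Ind_eq using smult_coset(2)[of act0 r, OF cl left right bal that] by (simp add: tens_def)
qed

lemma Ind_group: "abelian_group Ind" unfolding Ind_eq by (rule T_group)

lemma Ind_module: "left_module R Ind"
proof (intro left_module.intro left_module_axioms.intro R.ring_axioms Ind_group)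
  interpret I: abelian_group Ind by (rule Ind_group)
  note homs = Ind_smult_hom tens_closed[of _ _ act0, folded Ind_eq]
  note eqI = T_hom_eqI[of act0, folded Ind_eq]
  have idh: "add_hom Ind Ind (\<lambda>x. x)" by (simp add: add_hom_def)
  show "(a \<oplus>\<^bsub>R\<^esub> b) \<odot>\<^bsub>Ind\<^esub> x = a \<odot>\<^bsub>Ind\<^esub> x \<oplus>\<^bsub>Ind\<^esub> b \<odot>\<^bsub>Ind\<^esub> x"
    if "a \<in> carrier R" "b \<in> carrier R" "x \<in> carrier Ind" for a b x
  proof (rule eqI[OF Ind_smult_hom _ Ind_group _ that(3)])
    show "add_hom Ind Ind (\<lambda>x. a \<odot>\<^bsub>Ind\<^esub> x \<oplus>\<^bsub>Ind\<^esub> b \<odot>\<^bsub>Ind\<^esub> x)"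
      using add_hom_closed[OF Ind_smult_hom] that
      by (intro add_homI) (auto simp: add_hom_add[OF Ind_smult_hom] I.a_ac)
    show "(a \<oplus>\<^bsub>R\<^esub> b) \<odot>\<^bsub>Ind\<^esub> tens u v = a \<odot>\<^bsub>Ind\<^esub> tens u v \<oplus>\<^bsub>Ind\<^esub> b \<odot>\<^bsub>Ind\<^esub> tens u v"
      if "u \<in> carrier R" "v \<in> carrier B" for u v
      using that \<open>a \<in> carrier R\<close> \<open>b \<in> carrier R\<close> tens_add_left[of _ _ _ act0, folded Ind_eq]
      by (simp add: Ind_smult_tens R.l_distr)
  qed (use that in auto)
  show "(a \<otimes>\<^bsub>R\<^esub> b) \<odot>\<^bsub>Ind\<^esub> x = a \<odot>\<^bsub>Ind\<^esub> (b \<odot>\<^bsub>Ind\<^esub> x)"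
    if "a \<in> carrier R" "b \<in> carrier R" "x \<in> carrier Ind" for a b x
    by (rule eqI[OF Ind_smult_hom add_hom_compose[OF Ind_smult_hom Ind_smult_hom] Ind_group _ that(3)])
       (use that in \<open>auto simp: Ind_smult_tens R.m_assoc\<close>)
  show "\<one>\<^bsub>R\<^esub> \<odot>\<^bsub>Ind\<^esub> x = x" if "x \<in> carrier Ind" for x
    by (rule eqI[OF Ind_smult_hom idh Ind_group _ that]) (auto simp: Ind_smult_tens)
qed (use add_hom_closed[OF Ind_smult_hom] add_hom_add[OF Ind_smult_hom] in auto)

end

section \<open>Finite dimensional complex vector spaces\<close>

text \<open>
  Gaussian elimination: an equation with a nonzero coefficient at the unknown \<open>k\<close> is used to remove
  \<open>k\<close> from all other equations, leaving one equation and one unknown fewer.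
\<close>

lemma homogeneous_system_solution:
  fixes a :: "'j \<Rightarrow> 'i \<Rightarrow> complex"
  assumes "finite N" "finite J" "card N < card J"
  shows "\<exists>c. (\<exists>j\<in>J. c j \<noteq> 0) \<and> (\<forall>i\<in>N. (\<Sum>j\<in>J. c j * a j i) = 0)"
  using assms
proof (induction N arbitrary: J a rule: finite_induct)
  case empty
  then have "J \<noteq> {}" by auto
  then show ?case by (intro exI[of _ "\<lambda>_. 1"]) auto
next
  case (insert i N)
  show ?case
  proof (cases "\<forall>j\<in>J. a j i = 0")
    case True
    have "card N < card J" using insert by simp
    then obtain c where "\<exists>j\<in>J. c j \<noteq> 0" "\<forall>i\<in>N. (\<Sum>j\<in>J. c j * a j i) = 0"
      using insert.IH[OF insert.prems(1), of a] by blast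
    with True show ?thesis by (intro exI[of _ c]) auto
  next
    case False
    then obtain k where k: "k \<in> J" "a k i \<noteq> 0" by blast
    define J' where "J' = J - {k}"
    have J': "J = insert k J'" "k \<notin> J'" "finite J'" using k insert.prems by (auto simp: J'_def)
    have "card N < card J'" using insert J' by simp
    then obtain c where c: "\<exists>j\<in>J'. c j \<noteq> 0"
      "\<And>l. l \<in> N \<Longrightarrow> (\<Sum>j\<in>J'. c j * (a j l - a j i / a k i * a k l)) = 0"
      using insert.IH[OF J'(3), of "\<lambda>j l. a j l - a j i / a k i * a k l"] by blast
    \<comment> \<open>The removed unknown is determined by the equation \<open>i\<close>.\<close>
    define c' where "c' = c(k := - (\<Sum>j\<in>J'. c j * a j i) / a k i)"
    have c'J: "(\<Sum>j\<in>J'. c' j * f j) = (\<Sum>j\<in>J'. c j * f j)" for f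
      using J'(2) by (intro sum.cong) (auto simp: c'_def)
    have "(\<Sum>j\<in>J. c' j * a j l) = 0" if "l \<in> insert i N" for l
    proof (cases "l = i")
      case True
      then show ?thesis using k J' c'J by (simp add: c'_def)
    next
      case False
      then have "(\<Sum>j\<in>J'. c j * a j l) - (\<Sum>j\<in>J'. c j * a j i) / a k i * a k l = 0"
        using c(2)[of l] that by (simp add: algebra_simps sum_subtractf sum_distrib_left sum_divide_distrib)
      then show ?thesis using J' c'J by (simp add: c'_def algebra_simps)
    qed
    moreover have "\<exists>j\<in>J. c' j \<noteq> 0" using c(1) J' by (auto simp: c'_def)
    ultimately show ?thesis by blast
  qed
qed

lemma complex_ring_simps [simp]: "carrier complex_ring = UNIV" "x \<otimes>\<^bsub>complex_ring\<^esub> y = x * y"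
  "\<one>\<^bsub>complex_ring\<^esub> = 1" "\<zero>\<^bsub>complex_ring\<^esub> = 0" "x \<oplus>\<^bsub>complex_ring\<^esub> y = x + y"
  by (auto simp: complex_ring_def)

lemma complex_ring_ring: "ring complex_ring"
proof (rule ringI)
  show "abelian_group complex_ring"
    by (rule abelian_groupI) (auto intro: exI[of _ "- x" for x] simp: eq_neg_iff_add_eq_0[symmetric])
  show "Group.monoid complex_ring" by (rule monoidI) auto
qed (auto simp: algebra_simps)

interpretation CR: ring complex_ring by (rule complex_ring_ring)

lemma finsum_complex_ring: "finite A \<Longrightarrow> finsum complex_ring f A = sum f A"
  by (induction A rule: finite_induct) auto

text \<open>
  Vector spaces appear as modules over the ring of complex numbers, the form in which the underlying
  space of a group module is given.
\<close>

locale complex_space = left_module complex_ring V for V :: "(complex, 'v) module"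
begin

abbreviation sc (infixr \<open>\<cdot>\<close> 75) where "c \<cdot> x \<equiv> c \<odot>\<^bsub>V\<^esub> x"

lemma V_module: "left_module complex_ring V" by unfold_locales
lemma V_group: "abelian_group V" by unfold_locales

lemma sc_closed [simp]: "x \<in> carrier V \<Longrightarrow> c \<cdot> x \<in> carrier V" using smult_closed by simp
lemma sc_hom: "add_hom V V (\<lambda>x. c \<cdot> x)" by (rule left_module_smult_hom[OF V_module]) simp
lemma sc_hom2: "x \<in> carrier V \<Longrightarrow> add_hom complex_ring V (\<lambda>c. c \<cdot> x)"
  by (rule left_module_scalar_hom[OF V_module])
lemma sc_assoc: "x \<in> carrier V \<Longrightarrow> a \<cdot> b \<cdot> x = (a * b) \<cdot> x" using smult_assoc[of a b x] by simp
lemma sc_one [simp]: "x \<in> carrier V \<Longrightarrow> 1 \<cdot> x = x" using smult_one by simp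
lemma sc_0 [simp]: "x \<in> carrier V \<Longrightarrow> 0 \<cdot> x = \<zero>\<^bsub>V\<^esub>"
  using left_module_zero_smult[OF V_module] by simp
lemma sc_zero [simp]: "c \<cdot> \<zero>\<^bsub>V\<^esub> = \<zero>\<^bsub>V\<^esub>"
  using left_module_smult_zero[OF V_module] by simp
lemma sc_distl: "x \<in> carrier V \<Longrightarrow> (a + b) \<cdot> x = a \<cdot> x \<oplus>\<^bsub>V\<^esub> b \<cdot> x"
  using smult_l_distr[of a b x] by simp
lemma sc_distr: "x \<in> carrier V \<Longrightarrow> y \<in> carrier V \<Longrightarrow> c \<cdot> (x \<oplus>\<^bsub>V\<^esub> y) = c \<cdot> x \<oplus>\<^bsub>V\<^esub> c \<cdot> y"
  using smult_r_distr[of c x y] by simp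
lemma sc_neg: "x \<in> carrier V \<Longrightarrow> (- 1) \<cdot> x = \<ominus>\<^bsub>V\<^esub> x"
  using sc_distl[of x "-1" 1] by (simp add: M.minus_equality)
lemma sc_eq_zero:
  assumes "x \<in> carrier V" "c \<cdot> x = \<zero>\<^bsub>V\<^esub>" "c \<noteq> 0" shows "x = \<zero>\<^bsub>V\<^esub>"
proof -
  have "x = (inverse c * c) \<cdot> x" using assms by simp
  also have "\<dots> = inverse c \<cdot> c \<cdot> x" using sc_assoc assms(1) by simp
  finally show ?thesis using assms by simp
qed

lemma sc_sum: "finite I \<Longrightarrow> x \<in> carrier V \<Longrightarrow> (\<Sum>i\<in>I. c i) \<cdot> x = (\<Oplus>\<^bsub>V\<^esub>i\<in>I. c i \<cdot> x)"
  using add_hom_finsum[OF sc_hom2 CR.abelian_group_axioms V_group, of x I c]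
  by (simp add: finsum_complex_ring)

lemma sc_finsum: "finite I \<Longrightarrow> f \<in> I \<rightarrow> carrier V \<Longrightarrow> c \<cdot> (\<Oplus>\<^bsub>V\<^esub>i\<in>I. f i) = (\<Oplus>\<^bsub>V\<^esub>i\<in>I. c \<cdot> f i)"
  using add_hom_finsum[OF sc_hom V_group V_group, of I f c] by simp

lemma finsum_swap:
  assumes "finite I" "finite J" "\<And>i j. i \<in> I \<Longrightarrow> j \<in> J \<Longrightarrow> f i j \<in> carrier V"
  shows "(\<Oplus>\<^bsub>V\<^esub>i\<in>I. \<Oplus>\<^bsub>V\<^esub>j\<in>J. f i j) = (\<Oplus>\<^bsub>V\<^esub>j\<in>J. \<Oplus>\<^bsub>V\<^esub>i\<in>I. f i j)"
  using assms(1,3)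
proof (induction I rule: finite_induct)
  case empty
  then show ?case by simp
next
  case (insert i I)
  have "(\<Oplus>\<^bsub>V\<^esub>i\<in>insert i I. \<Oplus>\<^bsub>V\<^esub>j\<in>J. f i j) = (\<Oplus>\<^bsub>V\<^esub>j\<in>J. f i j) \<oplus>\<^bsub>V\<^esub> (\<Oplus>\<^bsub>V\<^esub>j\<in>J. \<Oplus>\<^bsub>V\<^esub>i\<in>I. f i j)"
    using insert by (simp add: Pi_def M.finsum_closed)
  also have "\<dots> = (\<Oplus>\<^bsub>V\<^esub>j\<in>J. f i j \<oplus>\<^bsub>V\<^esub> (\<Oplus>\<^bsub>V\<^esub>i\<in>I. f i j))"
    using insert by (intro M.finsum_addf[symmetric]) (auto intro!: M.finsum_closed)
  also have "\<dots> = (\<Oplus>\<^bsub>V\<^esub>j\<in>J. \<Oplus>\<^bsub>V\<^esub>i\<in>insert i I. f i j)"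
    using insert by (intro M.finsum_cong') (auto simp: Pi_def intro!: M.finsum_closed)
  finally show ?case .
qed

text \<open>
  Linear combinations of families, not of sets: the families below, such as the translates \<open>g u\<close> or the
  powers \<open>\<phi>\<^sup>k u\<close>, may have repetitions.
\<close>

definition lc where "lc c v J = (\<Oplus>\<^bsub>V\<^esub>j\<in>J. c j \<cdot> v j)"

lemma lc_closed: "v \<in> J \<rightarrow> carrier V \<Longrightarrow> lc c v J \<in> carrier V"
  by (auto simp: lc_def Pi_iff intro!: M.finsum_closed)

lemma lc_zero: "(\<And>j. j \<in> J \<Longrightarrow> c j = 0) \<Longrightarrow> v \<in> J \<rightarrow> carrier V \<Longrightarrow> lc c v J = \<zero>\<^bsub>V\<^esub>"
  unfolding lc_def by (rule trans[OF M.finsum_cong' M.finsum_zero]) (auto simp: Pi_iff)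

lemma lc_cong: "(\<And>j. j \<in> J \<Longrightarrow> c j = c' j) \<Longrightarrow> v \<in> J \<rightarrow> carrier V \<Longrightarrow> lc c v J = lc c' v J"
  unfolding lc_def by (intro M.finsum_cong') (auto simp: Pi_def)

lemma lc_insert:
  "finite J \<Longrightarrow> k \<notin> J \<Longrightarrow> v \<in> J \<rightarrow> carrier V \<Longrightarrow> v k \<in> carrier V \<Longrightarrow>
   lc c v (insert k J) = c k \<cdot> v k \<oplus>\<^bsub>V\<^esub> lc c v J"
  unfolding lc_def by (intro M.finsum_insert) (auto simp: Pi_def)

lemma lc_add:
  "v \<in> J \<rightarrow> carrier V \<Longrightarrow> lc c v J \<oplus>\<^bsub>V\<^esub> lc c' v J = lc (\<lambda>j. c j + c' j) v J"
  unfolding lc_def by (rule sym, rule trans[OF M.finsum_cong' M.finsum_addf]) (auto simp: Pi_iff sc_distl)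

lemma lc_scale:
  "finite J \<Longrightarrow> v \<in> J \<rightarrow> carrier V \<Longrightarrow> a \<cdot> lc c v J = lc (\<lambda>j. a * c j) v J"
  unfolding lc_def by (rule trans[OF sc_finsum M.finsum_cong']) (auto simp: Pi_iff sc_assoc)

text \<open>
  Expressing the family in the spanning one turns a vanishing combination into a homogeneous system with
  more unknowns than equations.
\<close>

lemma lc_dependent:
  assumes "finite N" "e \<in> N \<rightarrow> carrier V" "\<And>x. x \<in> carrier V \<Longrightarrow> \<exists>a. x = lc a e N"
    and "finite J" "v \<in> J \<rightarrow> carrier V" "card N < card J"
  shows "\<exists>c. (\<exists>j\<in>J. c j \<noteq> 0) \<and> lc c v J = \<zero>\<^bsub>V\<^esub>"
proof -
  have "\<forall>j\<in>J. \<exists>a. v j = lc a e N" using assms(3,5) by auto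
  then obtain a where a: "\<And>j. j \<in> J \<Longrightarrow> v j = lc (a j) e N" by metis
  obtain c where c: "\<exists>j\<in>J. c j \<noteq> 0" "\<And>i. i \<in> N \<Longrightarrow> (\<Sum>j\<in>J. c j * a j i) = 0"
    using homogeneous_system_solution[OF assms(1,4,6), of a] by blast
  have e: "\<And>i. i \<in> N \<Longrightarrow> e i \<in> carrier V" using assms(2) by auto
  have "lc c v J = (\<Oplus>\<^bsub>V\<^esub>j\<in>J. \<Oplus>\<^bsub>V\<^esub>i\<in>N. (c j * a j i) \<cdot> e i)"
    unfolding lc_def[of c]
  proof (rule M.finsum_cong')
    fix j assume "j \<in> J"
    then show "c j \<cdot> v j = (\<Oplus>\<^bsub>V\<^esub>i\<in>N. (c j * a j i) \<cdot> e i)"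
      using lc_scale[OF assms(1,2), of "c j" "a j"] a by (simp add: lc_def)
  qed (use e in \<open>auto intro!: M.finsum_closed\<close>)
  also have "\<dots> = (\<Oplus>\<^bsub>V\<^esub>i\<in>N. \<Oplus>\<^bsub>V\<^esub>j\<in>J. (c j * a j i) \<cdot> e i)"
    using e assms by (intro finsum_swap) auto
  also have "\<dots> = (\<Oplus>\<^bsub>V\<^esub>i\<in>N. \<zero>\<^bsub>V\<^esub>)"
    using e assms c(2) by (intro M.finsum_cong') (auto simp: sc_sum[symmetric])
  finally have "lc c v J = \<zero>\<^bsub>V\<^esub>" by simp
  with c show ?thesis by blast
qed

definition indep where
  "indep B \<longleftrightarrow> finite B \<and> B \<subseteq> carrier V \<and> (\<forall>c. lc c (\<lambda>b. b) B = \<zero>\<^bsub>V\<^esub> \<longrightarrow> (\<forall>b\<in>B. c b = 0))"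

text \<open>
  Uniqueness of the coefficients of every vector, restricted to \<open>B\<close>, is uniqueness for the zero
  vector, by subtraction.
\<close>

lemma is_basis_iff:
  "is_basis complex_ring V B \<longleftrightarrow> indep B \<and> (\<forall>x\<in>carrier V. \<exists>c. x = lc c (\<lambda>b. b) B)"
proof
  assume b: "is_basis complex_ring V B"
  then have B: "finite B" "(\<lambda>b. b) \<in> B \<rightarrow> carrier V" "B \<subseteq> carrier V" by (auto simp: is_basis_def)
  have u: "\<exists>!c. c \<in> B \<rightarrow>\<^sub>E UNIV \<and> x = lc c (\<lambda>b. b) B" if "x \<in> carrier V" for x
    using b that by (simp add: is_basis_def lc_def)
  have "\<forall>b\<in>B. c b = 0" if c: "lc c (\<lambda>b. b) B = \<zero>\<^bsub>V\<^esub>" for c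
  proof -
    have "lc (restrict c B) (\<lambda>b. b) B = \<zero>\<^bsub>V\<^esub>" using c lc_cong[OF _ B(2), of "restrict c B" c] by simp
    moreover have "lc (\<lambda>b\<in>B. 0) (\<lambda>b. b) B = \<zero>\<^bsub>V\<^esub>" by (rule lc_zero) (use B in auto)
    ultimately have "restrict c B = (\<lambda>b\<in>B. 0)" using u[OF M.zero_closed] by auto
    then show ?thesis by (metis restrict_apply')
  qed
  note zero = this
  show "indep B \<and> (\<forall>x\<in>carrier V. \<exists>c. x = lc c (\<lambda>b. b) B)" (is "_ \<and> ?S")
  proof
    show "indep B" using B zero by (simp add: indep_def)
    show ?S using ex1_implies_ex[OF u] by meson
  qed
next
  assume *: "indep B \<and> (\<forall>x\<in>carrier V. \<exists>c. x = lc c (\<lambda>b. b) B)"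
  then have B: "finite B" "(\<lambda>b. b) \<in> B \<rightarrow> carrier V" "B \<subseteq> carrier V" by (auto simp: indep_def)
  have "\<exists>!c. c \<in> B \<rightarrow>\<^sub>E UNIV \<and> x = lc c (\<lambda>b. b) B" if "x \<in> carrier V" for x
  proof -
    from bspec[OF conjunct2[OF *] that] obtain c where c: "x = lc c (\<lambda>b. b) B" ..
    have "x = lc (restrict c B) (\<lambda>b. b) B" using c lc_cong[OF _ B(2), of "restrict c B" c] by simp
    moreover have "c1 = c2" if "c1 \<in> B \<rightarrow>\<^sub>E UNIV" "c2 \<in> B \<rightarrow>\<^sub>E UNIV" "lc c1 (\<lambda>b. b) B = lc c2 (\<lambda>b. b) B" for c1 c2
    proof -
      have "lc (\<lambda>b. c1 b + (- 1) * c2 b) (\<lambda>b. b) B = lc c1 (\<lambda>b. b) B \<oplus>\<^bsub>V\<^esub> (- 1) \<cdot> lc c2 (\<lambda>b. b) B"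
        by (simp add: lc_scale[OF B(1,2)] lc_add[OF B(2)])
      also have "\<dots> = \<zero>\<^bsub>V\<^esub>" using that(3) lc_closed[OF B(2)] by (simp add: sc_neg M.r_neg)
      finally have "\<forall>b\<in>B. c1 b + (- 1) * c2 b = 0" using * unfolding indep_def by blast
      then show ?thesis using that by (intro PiE_ext[of c1 B "\<lambda>_. UNIV" c2]) auto
    qed
    ultimately show ?thesis by (intro ex1I[of _ "restrict c B"]) auto
  qed
  then show "is_basis complex_ring V B" using B by (simp add: is_basis_def lc_def)
qed

text \<open>
  An independent set of maximal size spans; sizes are bounded by that of the spanning family.
\<close>

lemma basis_exists:
  assumes "finite N" "e \<in> N \<rightarrow> carrier V" "\<And>x. x \<in> carrier V \<Longrightarrow> \<exists>a. x = lc a e N"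
  shows "\<exists>B. is_basis complex_ring V B"
proof -
  have bound: "card B \<le> card N" if B: "indep B" for B
  proof (rule ccontr)
    assume "\<not> card B \<le> card N"
    then have "card N < card B" by simp
    then have "\<exists>c. (\<exists>j\<in>B. c j \<noteq> 0) \<and> lc c (\<lambda>b. b) B = \<zero>\<^bsub>V\<^esub>"
      by (intro lc_dependent[OF assms]) (use B in \<open>auto simp: indep_def\<close>)
    then show False using B unfolding indep_def by blast
  qed
  have "indep {}" by (auto simp: indep_def)
  then obtain B where B: "indep B" "\<And>B'. indep B' \<Longrightarrow> card B' \<le> card B"
    using ex_has_greatest_nat[of indep "{}" card "Suc (card N)"] bound by (metis le_imp_less_Suc)
  have fin: "finite B" "B \<subseteq> carrier V" "(\<lambda>b. b) \<in> B \<rightarrow> carrier V" using B(1) by (auto simp: indep_def)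
  have "\<exists>c. x = lc c (\<lambda>b. b) B" if x: "x \<in> carrier V" for x
  proof (cases "x \<in> B")
    case True
    have "x = lc (\<lambda>b. if x = b then 1 else 0) (\<lambda>b. b) B"
    proof -
      have "lc (\<lambda>b. if x = b then 1 else 0) (\<lambda>b. b) B = (\<Oplus>\<^bsub>V\<^esub>b\<in>B. if x = b then b else \<zero>\<^bsub>V\<^esub>)"
        unfolding lc_def using fin by (intro M.finsum_cong') auto
      also have "\<dots> = x" using True fin by (intro M.finsum_singleton) auto
      finally show ?thesis by simp
    qed
    then show ?thesis by blast
  next
    case False
    have "\<not> indep (insert x B)" using B(2)[of "insert x B"] False fin by auto
    then obtain c where c: "lc c (\<lambda>b. b) (insert x B) = \<zero>\<^bsub>V\<^esub>" "\<exists>b\<in>insert x B. c b \<noteq> 0"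
      using fin x by (auto simp: indep_def)
    then have eq: "c x \<cdot> x \<oplus>\<^bsub>V\<^esub> lc c (\<lambda>b. b) B = \<zero>\<^bsub>V\<^esub>"
      using lc_insert[OF fin(1) False fin(3)] x by simp
    have "c x \<noteq> 0"
    proof
      assume "c x = 0"
      then have "lc c (\<lambda>b. b) B = \<zero>\<^bsub>V\<^esub>" using eq x lc_closed[OF fin(3)] by simp
      then show False using B(1) c(2) \<open>c x = 0\<close> by (auto simp: indep_def)
    qed
    have "c x \<cdot> x = \<ominus>\<^bsub>V\<^esub> lc c (\<lambda>b. b) B"
      using M.minus_equality[OF eq] x lc_closed[OF fin(3)] by simp
    also have "\<dots> = (- 1) \<cdot> lc c (\<lambda>b. b) B" using lc_closed[OF fin(3)] by (simp add: sc_neg)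
    finally have "inverse (c x) \<cdot> c x \<cdot> x = inverse (c x) \<cdot> (- 1) \<cdot> lc c (\<lambda>b. b) B" by simp
    then have "x = lc (\<lambda>b. inverse (c x) * (- 1 * c b)) (\<lambda>b. b) B"
      using \<open>c x \<noteq> 0\<close> x by (simp only: lc_scale[OF fin(1,3)]) (simp add: sc_assoc)
    then show ?thesis by blast
  qed
  then show ?thesis using B(1) is_basis_iff by blast
qed

lemma basis_card_unique:
  assumes "is_basis complex_ring V B" "is_basis complex_ring V B'"
  shows "card B = card B'"
proof -
  have "card B' \<le> card B" if "is_basis complex_ring V B" "is_basis complex_ring V B'" for B B'
  proof (rule ccontr)
    assume lt: "\<not> card B' \<le> card B"
    have B: "indep B" "\<And>x. x \<in> carrier V \<Longrightarrow> \<exists>c. x = lc c (\<lambda>b. b) B" and B': "indep B'"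
      using that is_basis_iff[of B] is_basis_iff[of B'] by meson+
    have "\<exists>c. (\<exists>j\<in>B'. c j \<noteq> 0) \<and> lc c (\<lambda>b. b) B' = \<zero>\<^bsub>V\<^esub>"
      by (rule lc_dependent[of B "\<lambda>b. b"]) (use lt B(1) B' B(2) in \<open>auto simp: indep_def\<close>)
    then show False using B' unfolding indep_def by meson
  qed
  then show ?thesis using assms by (meson le_antisym)
qed

lemma endomorphism_powers:
  assumes \<phi>: "add_hom V V \<phi>" and u: "u \<in> carrier V" shows "(\<phi> ^^ k) u \<in> carrier V"
  by (induction k) (use u add_hom_closed[OF \<phi>] in auto)

text \<open>
  If \<open>p(\<phi>) u = 0\<close> and \<open>p = (t - z) r\<close>, then \<open>w = r(\<phi>) u\<close> satisfies \<open>\<phi> w = z w\<close>.  Either \<open>w\<close> is an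
  eigenvector or the degree drops.
\<close>

lemma eigenvector_of_polynomial:
  assumes \<phi>: "add_hom V V \<phi>" and lin: "\<And>c x. x \<in> carrier V \<Longrightarrow> \<phi> (c \<cdot> x) = c \<cdot> \<phi> x"
    and u: "u \<in> carrier V" "u \<noteq> \<zero>\<^bsub>V\<^esub>"
  shows "p \<noteq> 0 \<Longrightarrow> degree p \<le> n \<Longrightarrow> lc (coeff p) (\<lambda>k. (\<phi> ^^ k) u) {..n} = \<zero>\<^bsub>V\<^esub> \<Longrightarrow>
    \<exists>w\<in>carrier V. \<exists>c. w \<noteq> \<zero>\<^bsub>V\<^esub> \<and> \<phi> w = c \<cdot> w"
proof (induction n arbitrary: p)
  case 0
  then have "coeff p 0 \<cdot> u = \<zero>\<^bsub>V\<^esub>" using u by (simp add: lc_def)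
  then have "coeff p 0 = 0" using sc_eq_zero u by blast
  then show ?case using 0 by (metis le_zero_eq leading_coeff_0_iff)
next
  case (Suc n)
  define v where "v = (\<lambda>k. (\<phi> ^^ k) u)"
  have v: "v k \<in> carrier V" "v (Suc k) = \<phi> (v k)" "\<phi> (v k) \<in> carrier V" "\<phi> (\<phi> (v k)) \<in> carrier V" for k
    using endomorphism_powers[OF \<phi> u(1)] add_hom_closed[OF \<phi>] by (auto simp: v_def)
  have vc: "v \<in> J \<rightarrow> carrier V" for J using v by auto
  have step: "lc c v {..Suc n} = lc c v {..n} \<oplus>\<^bsub>V\<^esub> c (Suc n) \<cdot> v (Suc n)" for c
    using lc_insert[of "{..n}" "Suc n" v c] v(1)[of "Suc n"] vc M.a_comm[OF lc_closed[OF vc], of "c (Suc n) \<cdot> v (Suc n)"]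
    by (simp add: atMost_Suc)
  show ?case
  proof (cases "degree p \<le> n")
    case True
    then have "coeff p (Suc n) = 0" by (simp add: coeff_eq_0)
    then have "lc (coeff p) v {..n} = \<zero>\<^bsub>V\<^esub>" using step[of "coeff p"] Suc.prems(3) v(1) lc_closed[OF vc] unfolding v_def[symmetric] by simp
    then show ?thesis using Suc True by (simp add: v_def)
  next
    case False
    then have deg: "degree p = Suc n" using Suc by simp
    then obtain z where "poly p z = 0"
      using fundamental_theorem_of_algebra[of p] by (metis constant_degree Zero_not_Suc)
    then obtain r where r: "p = [:- z, 1:] * r" by (metis dvdE poly_eq_0_iff_dvd)
    then have r0: "r \<noteq> 0" using Suc by auto
    then have "degree p = 1 + degree r" unfolding r by (subst degree_mult_eq) auto
    then have degr: "degree r = n" using deg by simp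
    define w where "w = lc (coeff r) v {..n}"
    have wc: "w \<in> carrier V" using lc_closed[OF vc] by (simp add: w_def)
    have cp: "coeff p k = (case k of 0 \<Rightarrow> 0 | Suc j \<Rightarrow> coeff r j) + (- z) * coeff r k" for k
      by (simp add: r coeff_pCons split: nat.split)
    have s: "lc c v {..Suc l} = lc c v {..l} \<oplus>\<^bsub>V\<^esub> c (Suc l) \<cdot> v (Suc l)" for c l
      using lc_insert[of "{..l}" "Suc l" v c] v(1)[of "Suc l"] vc M.a_comm[OF lc_closed[OF vc], of "c (Suc l) \<cdot> v (Suc l)"]
      by (simp add: atMost_Suc)
    \<comment> \<open>multiplication of the polynomial by \<open>t\<close> is application of \<open>\<phi>\<close>\<close>
    have shift: "lc (\<lambda>k. case k of 0 \<Rightarrow> 0 | Suc j \<Rightarrow> a j) v {..Suc m} = \<phi> (lc a v {..m})" for m a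
    proof (induction m)
      case 0
      show ?case unfolding s using v lin add_hom_closed[OF \<phi> v(1)] by (simp add: lc_def)
    next
      case (Suc m)
      show ?case
        unfolding s[of _ "Suc m"] s[of a m] Suc
        using add_hom_add[OF \<phi>, of "lc a v {..m}" "a (Suc m) \<cdot> v (Suc m)"] v lin lc_closed[OF vc] by simp
    qed
    have "coeff r (Suc n) = 0" using degr by (simp add: coeff_eq_0)
    then have rw: "lc (coeff r) v {..Suc n} = w" using step[of "coeff r"] v wc by (simp add: w_def)
    have "coeff p = (\<lambda>k. (case k of 0 \<Rightarrow> 0 | Suc j \<Rightarrow> coeff r j) + (- z) * coeff r k)"
      using cp by blast
    then have "lc (coeff p) v {..Suc n} = \<phi> w \<oplus>\<^bsub>V\<^esub> (- z) \<cdot> w"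
      using lc_add[OF vc, of "\<lambda>k. case k of 0 \<Rightarrow> 0 | Suc j \<Rightarrow> coeff r j" "{..Suc n}" "\<lambda>k. (- z) * coeff r k"]
        lc_scale[of "{..Suc n}" v "- z" "coeff r"] vc rw shift[of "coeff r" n]
      by (simp add: w_def)
    then have eq: "\<phi> w \<oplus>\<^bsub>V\<^esub> (- z) \<cdot> w = \<zero>\<^bsub>V\<^esub>" using Suc by (simp add: v_def)
    have pw: "\<phi> w = z \<cdot> w"
    proof -
      have "z \<cdot> w \<oplus>\<^bsub>V\<^esub> (- z) \<cdot> w = \<zero>\<^bsub>V\<^esub>" using sc_distl[OF wc, of z "- z"] wc by simp
      then show ?thesis using eq wc add_hom_closed[OF \<phi> wc]
        by (metis M.add.right_cancel sc_closed)
    qed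
    show ?thesis
    proof (cases "w = \<zero>\<^bsub>V\<^esub>")
      case True
      then show ?thesis using Suc.IH[OF r0] degr by (simp add: w_def v_def)
    next
      case False
      then show ?thesis using pw wc by blast
    qed
  qed
qed

text \<open>
  The vectors \<open>u, \<phi> u, \<phi>\<^sup>2 u, \<dots>\<close> are linearly dependent, which gives the polynomial.
\<close>

lemma eigenvector_exists:
  assumes \<phi>: "add_hom V V \<phi>" and lin: "\<And>c x. x \<in> carrier V \<Longrightarrow> \<phi> (c \<cdot> x) = c \<cdot> \<phi> x"
    and u: "u \<in> carrier V" "u \<noteq> \<zero>\<^bsub>V\<^esub>"
    and sp: "finite N" "e \<in> N \<rightarrow> carrier V" "\<And>x. x \<in> carrier V \<Longrightarrow> \<exists>a. x = lc a e N"
  shows "\<exists>w\<in>carrier V. \<exists>c. w \<noteq> \<zero>\<^bsub>V\<^esub> \<and> \<phi> w = c \<cdot> w"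
proof -
  obtain c where c: "\<exists>j\<in>{..card N}. c j \<noteq> 0" "lc c (\<lambda>k. (\<phi> ^^ k) u) {..card N} = \<zero>\<^bsub>V\<^esub>"
    using lc_dependent[OF sp, of "{..card N}" "\<lambda>k. (\<phi> ^^ k) u"] endomorphism_powers[OF \<phi> u(1)] by auto
  define p where "p = (\<Sum>k\<le>card N. monom (c k) k)"
  have cp: "coeff p k = (if k \<le> card N then c k else 0)" for k
    by (simp add: p_def coeff_sum)
  have "p \<noteq> 0" using c(1) cp by (metis atMost_iff coeff_0)
  moreover have "degree p \<le> card N" using cp by (intro degree_le) auto
  moreover have "lc (coeff p) (\<lambda>k. (\<phi> ^^ k) u) {..card N} = \<zero>\<^bsub>V\<^esub>"
    using c(2) lc_cong[of "{..card N}" "coeff p" c] endomorphism_powers[OF \<phi> u(1)] cp by (simp add: Pi_def)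
  ultimately show ?thesis using eigenvector_of_polynomial[OF \<phi> lin u] by blast
qed

end

section \<open>Homomorphisms, isomorphisms and simple modules\<close>

lemma submodule_closed:
  assumes "submodule N R M"
  shows "N \<subseteq> carrier M" "\<zero>\<^bsub>M\<^esub> \<in> N" "\<And>x y. x \<in> N \<Longrightarrow> y \<in> N \<Longrightarrow> x \<oplus>\<^bsub>M\<^esub> y \<in> N"
    "\<And>a x. a \<in> carrier R \<Longrightarrow> x \<in> N \<Longrightarrow> a \<odot>\<^bsub>M\<^esub> x \<in> N"
proof -
  interpret submodule N R M by fact
  show "N \<subseteq> carrier M" using subset by simp
  show "\<zero>\<^bsub>M\<^esub> \<in> N" using one_closed by simp
  show "\<And>x y. x \<in> N \<Longrightarrow> y \<in> N \<Longrightarrow> x \<oplus>\<^bsub>M\<^esub> y \<in> N" using m_closed by simp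
qed (rule submodule.smult_closed[OF assms])

lemma left_module_submoduleI:
  assumes M: "left_module R M" and "N \<subseteq> carrier M" "\<zero>\<^bsub>M\<^esub> \<in> N"
    and "\<And>x y. x \<in> N \<Longrightarrow> y \<in> N \<Longrightarrow> x \<oplus>\<^bsub>M\<^esub> y \<in> N"
    and sm: "\<And>a x. a \<in> carrier R \<Longrightarrow> x \<in> N \<Longrightarrow> a \<odot>\<^bsub>M\<^esub> x \<in> N"
  shows "submodule N R M"
proof -
  interpret left_module R M by (rule M)
  have neg: "inv\<^bsub>add_monoid M\<^esub> x \<in> N" if x: "x \<in> N" for x
  proof -
    have xM: "x \<in> carrier M" using x assms(2) by blast
    have "(\<ominus>\<^bsub>R\<^esub> \<one>\<^bsub>R\<^esub>) \<odot>\<^bsub>M\<^esub> x \<oplus>\<^bsub>M\<^esub> x = \<zero>\<^bsub>M\<^esub>"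
      using smult_l_distr[of "\<ominus>\<^bsub>R\<^esub> \<one>\<^bsub>R\<^esub>" "\<one>\<^bsub>R\<^esub>" x] xM smult_one left_module_zero_smult[OF M]
      by (simp add: R.l_neg)
    then have "\<ominus>\<^bsub>M\<^esub> x = (\<ominus>\<^bsub>R\<^esub> \<one>\<^bsub>R\<^esub>) \<odot>\<^bsub>M\<^esub> x"
      using M.minus_equality xM smult_closed by simp
    then show ?thesis using sm[OF _ x, of "\<ominus>\<^bsub>R\<^esub> \<one>\<^bsub>R\<^esub>"] by (simp add: a_inv_def)
  qed
  show ?thesis
    by (intro submodule.intro subgroup.intro submodule_axioms.intro) (use assms neg in auto)
qed

definition mod_hom :: "('a, 'r) ring_scheme \<Rightarrow> ('a, 'b, 'm) module_scheme \<Rightarrow> ('a, 'c, 'n) module_scheme \<Rightarrow> ('b \<Rightarrow> 'c) \<Rightarrow> bool" where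
  "mod_hom R M N f \<longleftrightarrow> add_hom M N f \<and> (\<forall>a\<in>carrier R. \<forall>x\<in>carrier M. f (a \<odot>\<^bsub>M\<^esub> x) = a \<odot>\<^bsub>N\<^esub> f x)"

lemma mod_homD: "mod_hom R M N f \<Longrightarrow> add_hom M N f"
  "mod_hom R M N f \<Longrightarrow> a \<in> carrier R \<Longrightarrow> x \<in> carrier M \<Longrightarrow> f (a \<odot>\<^bsub>M\<^esub> x) = a \<odot>\<^bsub>N\<^esub> f x"
  by (auto simp: mod_hom_def)

lemma module_isomorphic_iff:
  "module_isomorphic R M N \<longleftrightarrow> left_module R M \<and> left_module R N \<and>
     (\<exists>f. bij_betw f (carrier M) (carrier N) \<and> mod_hom R M N f)"
  unfolding module_isomorphic_def mod_hom_def add_hom_def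
  by (auto simp: bij_betw_apply)

lemma module_isomorphic_refl: "left_module R M \<Longrightarrow> module_isomorphic R M M"
  unfolding module_isomorphic_def by (auto intro!: exI[of _ "\<lambda>x. x"] simp: bij_betw_def)

lemma module_isomorphic_trans:
  assumes "module_isomorphic R M N" "module_isomorphic R N P" shows "module_isomorphic R M P"
proof -
  obtain f g where f: "bij_betw f (carrier M) (carrier N)" "mod_hom R M N f"
    and g: "bij_betw g (carrier N) (carrier P)" "mod_hom R N P g"
    using assms unfolding module_isomorphic_iff by blast
  have "bij_betw (g \<circ> f) (carrier M) (carrier P)" by (rule bij_betw_trans[OF f(1) g(1)])
  moreover have "mod_hom R M P (g \<circ> f)"
    using f(2) g(2) by (auto simp: mod_hom_def add_hom_def)
  ultimately show ?thesis using assms unfolding module_isomorphic_iff by blast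
qed

lemma module_isomorphic_sym:
  assumes "module_isomorphic R M N" shows "module_isomorphic R N M"
proof -
  obtain f where f: "bij_betw f (carrier M) (carrier N)" "mod_hom R M N f"
    using assms unfolding module_isomorphic_iff by blast
  interpret M: left_module R M using assms by (simp add: module_isomorphic_iff)
  interpret N: left_module R N using assms by (simp add: module_isomorphic_iff)
  let ?g = "inv_into (carrier M) f"
  have g: "bij_betw ?g (carrier N) (carrier M)" by (rule bij_betw_inv_into[OF f(1)])
  have gc: "?g y \<in> carrier M" "f (?g y) = y" if "y \<in> carrier N" for y
    using that g f(1) bij_betw_inv_into_right[OF f(1)] by (auto dest: bij_betw_apply)
  have gf: "?g (f x) = x" if "x \<in> carrier M" for x
    using that f(1) bij_betw_inv_into_left by metis
  have "mod_hom R N M ?g"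
    unfolding mod_hom_def
  proof (intro conjI add_homI ballI)
    fix x y assume xy: "x \<in> carrier N" "y \<in> carrier N"
    have "?g (x \<oplus>\<^bsub>N\<^esub> y) = ?g (f (?g x \<oplus>\<^bsub>M\<^esub> ?g y))"
      using xy gc add_hom_add[OF mod_homD(1)[OF f(2)]] by simp
    then show "?g (x \<oplus>\<^bsub>N\<^esub> y) = ?g x \<oplus>\<^bsub>M\<^esub> ?g y" using gf xy gc by simp
  next
    fix a x assume ax: "a \<in> carrier R" "x \<in> carrier N"
    have "?g (a \<odot>\<^bsub>N\<^esub> x) = ?g (f (a \<odot>\<^bsub>M\<^esub> ?g x))"
      using ax gc mod_homD(2)[OF f(2)] by simp
    then show "?g (a \<odot>\<^bsub>N\<^esub> x) = a \<odot>\<^bsub>M\<^esub> ?g x" using gf ax gc M.smult_closed by simp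
  qed (use gc in auto)
  then show ?thesis using assms g unfolding module_isomorphic_iff by blast
qed

lemma mod_hom_kernel:
  assumes "left_module R M" "left_module R N" "mod_hom R M N f"
  shows "submodule {x \<in> carrier M. f x = \<zero>\<^bsub>N\<^esub>} R M"
proof -
  interpret M: left_module R M by fact
  interpret N: left_module R N by fact
  note h = mod_homD[OF assms(3)]
  show ?thesis
    using add_hom_zero[OF h(1) M.abelian_group_axioms N.abelian_group_axioms] left_module_smult_zero[OF assms(2)]
    by (intro left_module_submoduleI[OF assms(1)])
       (auto simp: add_hom_add[OF h(1)] h(2) M.smult_closed)
qed

lemma mod_hom_image:
  assumes "left_module R M" "left_module R N" "mod_hom R M N f" "submodule S R M"
  shows "submodule (f ` S) R N"
proof -
  interpret M: left_module R M by fact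
  interpret N: left_module R N by fact
  note h = mod_homD[OF assms(3)]
  note S = submodule_closed[OF assms(4)]
  have z: "f \<zero>\<^bsub>M\<^esub> = \<zero>\<^bsub>N\<^esub>" by (rule add_hom_zero[OF h(1) M.abelian_group_axioms N.abelian_group_axioms])
  show ?thesis
  proof (rule left_module_submoduleI[OF assms(2)])
    show "f ` S \<subseteq> carrier N" using S(1) add_hom_closed[OF h(1)] by blast
    show "\<zero>\<^bsub>N\<^esub> \<in> f ` S" using z S(2) by force
    show "x \<oplus>\<^bsub>N\<^esub> y \<in> f ` S" if "x \<in> f ` S" "y \<in> f ` S" for x y
      using that S(1,3) by (auto simp: add_hom_add[OF h(1), symmetric] subset_iff)
    show "a \<odot>\<^bsub>N\<^esub> x \<in> f ` S" if "a \<in> carrier R" "x \<in> f ` S" for a x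
      using that S(1,4) by (auto simp: h(2)[symmetric] subset_iff)
  qed
qed

lemma whole_submodule: "left_module R M \<Longrightarrow> submodule (carrier M) R M"
  by (rule left_module_submoduleI) (auto simp: left_module.smult_closed dest: left_module_groups abelian_groupE)

lemma simple_moduleD:
  assumes "simple_module R M"
  shows "left_module R M" "\<And>N x. submodule N R M \<Longrightarrow> x \<in> N \<Longrightarrow> x \<noteq> \<zero>\<^bsub>M\<^esub> \<Longrightarrow> N = carrier M"
    "\<exists>x\<in>carrier M. x \<noteq> \<zero>\<^bsub>M\<^esub>"
proof -
  show m: "left_module R M" using assms by (simp add: simple_module_def)
  show "\<And>N x. submodule N R M \<Longrightarrow> x \<in> N \<Longrightarrow> x \<noteq> \<zero>\<^bsub>M\<^esub> \<Longrightarrow> N = carrier M"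
    using assms unfolding simple_module_def by blast
  show "\<exists>x\<in>carrier M. x \<noteq> \<zero>\<^bsub>M\<^esub>"
    using assms abelian_groupE(2)[OF left_module_groups(1)[OF m]] unfolding simple_module_def by blast
qed

text \<open>
  Schur's lemma: kernel and image of a nonzero map are submodules, so they are zero and everything.
\<close>

lemma schur_isomorphic:
  assumes M: "simple_module R M" and N: "simple_module R N" and f: "mod_hom R M N f"
    and x: "x \<in> carrier M" "f x \<noteq> \<zero>\<^bsub>N\<^esub>"
  shows "module_isomorphic R M N"
proof -
  note m = simple_moduleD[OF M] and n = simple_moduleD[OF N]
  interpret M: left_module R M by (rule m)
  interpret N: left_module R N by (rule n)
  note h = mod_homD[OF f]
  have im: "f ` carrier M = carrier N"
    by (rule n(2)[OF mod_hom_image[OF m(1) n(1) f whole_submodule[OF m(1)]]]) (use x in auto)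
  have ker: "y = \<zero>\<^bsub>M\<^esub>" if "y \<in> carrier M" "f y = \<zero>\<^bsub>N\<^esub>" for y
  proof (rule ccontr)
    assume "y \<noteq> \<zero>\<^bsub>M\<^esub>"
    then have "{x \<in> carrier M. f x = \<zero>\<^bsub>N\<^esub>} = carrier M"
      using m(2)[OF mod_hom_kernel[OF m(1) n(1) f], of y] that by simp
    then show False using x by blast
  qed
  have "inj_on f (carrier M)"
  proof (rule inj_onI)
    fix y z assume yz: "y \<in> carrier M" "z \<in> carrier M" "f y = f z"
    have "f (y \<oplus>\<^bsub>M\<^esub> \<ominus>\<^bsub>M\<^esub> z) = f y \<oplus>\<^bsub>N\<^esub> \<ominus>\<^bsub>N\<^esub> f z"
      using yz add_hom_add[OF h(1), of y "\<ominus>\<^bsub>M\<^esub> z"] add_hom_neg[OF h(1) M.abelian_group_axioms N.abelian_group_axioms, of z] by simp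
    then have "y \<oplus>\<^bsub>M\<^esub> \<ominus>\<^bsub>M\<^esub> z = \<zero>\<^bsub>M\<^esub>"
      using yz ker[of "y \<oplus>\<^bsub>M\<^esub> \<ominus>\<^bsub>M\<^esub> z"] add_hom_closed[OF h(1)] by (simp add: N.r_neg)
    then show "y = z" using yz by (metis M.M.minus_equality M.M.minus_minus M.M.a_inv_closed)
  qed
  then show ?thesis using im f m(1) n(1) unfolding module_isomorphic_iff bij_betw_def by blast
qed

lemma simple_module_isomorphic:
  assumes M: "simple_module R M" and iso: "module_isomorphic R M N"
  shows "simple_module R N"
proof -
  obtain g where g: "bij_betw g (carrier N) (carrier M)" "mod_hom R N M g"
    using module_isomorphic_sym[OF iso] unfolding module_isomorphic_iff by blast
  have l: "left_module R M" "left_module R N" using iso by (auto simp: module_isomorphic_iff)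
  note gr = left_module_groups(1)[OF l(1)] left_module_groups(1)[OF l(2)]
  note m = simple_moduleD[OF M]
  have z: "g \<zero>\<^bsub>N\<^esub> = \<zero>\<^bsub>M\<^esub>" by (rule add_hom_zero[OF mod_homD(1)[OF g(2)] gr(2,1)])
  have "S = {\<zero>\<^bsub>N\<^esub>} \<or> S = carrier N" if S: "submodule S R N" for S
  proof (cases "S = {\<zero>\<^bsub>N\<^esub>}")
    case False
    then obtain x where x: "x \<in> S" "x \<noteq> \<zero>\<^bsub>N\<^esub>" using submodule_closed(2)[OF S] by blast
    have xN: "x \<in> carrier N" "\<zero>\<^bsub>N\<^esub> \<in> carrier N"
      using submodule_closed(1,2)[OF S] x by auto
    then have "g x \<noteq> \<zero>\<^bsub>M\<^esub>" using x z g(1) by (metis bij_betw_inv_into_left)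
    then have "g ` S = carrier M"
      using m(2)[OF mod_hom_image[OF l(2,1) g(2) S], of "g x"] x by blast
    then have "S = carrier N"
      using g(1) submodule_closed(1)[OF S] unfolding bij_betw_def by (metis inj_on_image_eq_iff order_refl)
    then show ?thesis ..
  qed simp
  moreover have "carrier N \<noteq> {\<zero>\<^bsub>N\<^esub>}"
  proof
    assume "carrier N = {\<zero>\<^bsub>N\<^esub>}"
    then have "carrier M = {\<zero>\<^bsub>M\<^esub>}" using g(1) z unfolding bij_betw_def by force
    then show False using M by (simp add: simple_module_def)
  qed
  ultimately show ?thesis using l(2) by (simp add: simple_module_def)
qed

text \<open>
  Transport of structure, used to move a module to a prescribed type of elements.
\<close>

lemma image_module:
  fixes \<iota> :: "'b \<Rightarrow> 'c"
  assumes M: "left_module R M" and inj: "inj_on \<iota> (carrier M)"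
  shows "\<exists>N :: ('a, 'c) module. module_isomorphic R M N"
proof -
  interpret M: left_module R M by (rule M)
  let ?\<kappa> = "inv_into (carrier M) \<iota>"
  define N :: "('a, 'c) module" where "N = \<lparr>carrier = \<iota> ` carrier M, monoid.mult = undefined, one = undefined,
     zero = \<iota> \<zero>\<^bsub>M\<^esub>, add = (\<lambda>x y. \<iota> (?\<kappa> x \<oplus>\<^bsub>M\<^esub> ?\<kappa> y)), module.smult = (\<lambda>a x. \<iota> (a \<odot>\<^bsub>M\<^esub> ?\<kappa> x))\<rparr>"
  have k[simp]: "?\<kappa> (\<iota> x) = x" if "x \<in> carrier M" for x using inj that by simp
  have N[simp]: "carrier N = \<iota> ` carrier M" "\<zero>\<^bsub>N\<^esub> = \<iota> \<zero>\<^bsub>M\<^esub>"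
    "x \<oplus>\<^bsub>N\<^esub> y = \<iota> (?\<kappa> x \<oplus>\<^bsub>M\<^esub> ?\<kappa> y)" "a \<odot>\<^bsub>N\<^esub> x = \<iota> (a \<odot>\<^bsub>M\<^esub> ?\<kappa> x)" for a x y
    by (auto simp: N_def)
  have "abelian_group N"
  proof (rule abelian_groupI)
    fix x assume "x \<in> carrier N"
    then obtain a where a: "a \<in> carrier M" "x = \<iota> a" by auto
    then show "\<exists>y\<in>carrier N. y \<oplus>\<^bsub>N\<^esub> x = \<zero>\<^bsub>N\<^esub>"
      by (intro bexI[of _ "\<iota> (\<ominus>\<^bsub>M\<^esub> a)"]) (auto simp: M.M.l_neg)
  qed (auto simp: M.M.a_ac)
  then have "left_module R N"
    by (intro left_module.intro left_module_axioms.intro M.R.ring_axioms)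
       (auto simp: M.smult_closed M.smult_l_distr M.smult_r_distr M.smult_assoc M.smult_one)
  moreover have "mod_hom R M N \<iota>" by (auto simp: mod_hom_def add_hom_def)
  ultimately have "module_isomorphic R M N"
    using M inj unfolding module_isomorphic_iff by (auto simp: bij_betw_def)
  then show ?thesis by blast
qed

section \<open>Modules over the group algebra of a finite group\<close>

locale finite_group = group G for G :: "('g, 'k) monoid_scheme" (structure) +
  assumes finite_carrier: "finite (carrier G)"
begin

sublocale CG: twisted_action complex_ring G "\<lambda>w c. c"
  by (intro twisted_action.intro twisted_action_axioms.intro complex_ring_ring group_axioms)
     (auto simp: finite_carrier)

abbreviation CA where "CA \<equiv> group_algebra G"

lemmas CA_def = group_algebra_def[of G]
lemmas CA_group = CG.TA_group[folded CA_def]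
lemmas CA_ring = CG.TA_ring[folded CA_def]
lemmas CA_carrier = CG.TA_carrier[folded CA_def]
lemmas CA_add = CG.TA_add[folded CA_def]
lemmas CA_zero = CG.TA_zero[folded CA_def]
lemmas CA_one = CG.TA_one[folded CA_def]
lemmas CA_pure_closed = CG.pure_closed[folded CA_def]
lemmas CA_pure_mult = CG.pure_mult[folded CA_def]
lemmas CA_hom_eqI = CG.TA_hom_eqI[folded CA_def]

lemma CA_mult: "f \<otimes>\<^bsub>CA\<^esub> g = (\<lambda>w. if w \<in> carrier G then \<Sum>u\<in>carrier G. f u * g (inv u \<otimes> w) else 0)"
  unfolding CA_def CG.TA_mult by (rule ext) (simp add: finsum_complex_ring finite_carrier)

end

text \<open>
  A module over the group algebra is studied through its underlying vector space and the action of
  the group elements.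
\<close>

locale gmodule = finite_group G + U: left_module "group_algebra G" U
  for G :: "('g, 'k) monoid_scheme" (structure) and U :: "('g \<Rightarrow> complex, 'u) module"
begin

abbreviation VU where "VU \<equiv> underlying_space G U"

lemma U_module: "left_module CA U" by unfold_locales
lemma U_group: "abelian_group U" by unfold_locales

lemma VU_simps [simp]: "carrier VU = carrier U" "\<zero>\<^bsub>VU\<^esub> = \<zero>\<^bsub>U\<^esub>" "x \<oplus>\<^bsub>VU\<^esub> y = x \<oplus>\<^bsub>U\<^esub> y"
  by (auto simp: underlying_space_def restrict_scalars_def)

lemma VU_smult: "c \<odot>\<^bsub>VU\<^esub> x = pure_elt complex_ring c \<one> \<odot>\<^bsub>U\<^esub> x"
  by (simp add: underlying_space_def restrict_scalars_def)

lemma VU_group: "abelian_group VU"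
  using abelian_groupE[OF U_group] by (intro abelian_groupI) auto

lemma VU_module: "left_module complex_ring VU"
proof (intro left_module.intro left_module_axioms.intro complex_ring_ring VU_group)
  have h: "pure_elt complex_ring (a + b) \<one> = pure_elt complex_ring a \<one> \<oplus>\<^bsub>CA\<^esub> pure_elt complex_ring b \<one>" for a b
    by (auto simp: CA_add pure_elt_def)
  have m: "pure_elt complex_ring (a * b) \<one> = pure_elt complex_ring a \<one> \<otimes>\<^bsub>CA\<^esub> pure_elt complex_ring b \<one>" for a b
    using CA_pure_mult[of a b \<one> \<one>] by simp
  show "a \<odot>\<^bsub>VU\<^esub> x \<in> carrier VU" if "a \<in> carrier complex_ring" "x \<in> carrier VU" for a x
    using that by (simp add: VU_smult U.smult_closed CA_pure_closed)
  show "(a \<oplus>\<^bsub>complex_ring\<^esub> b) \<odot>\<^bsub>VU\<^esub> x = a \<odot>\<^bsub>VU\<^esub> x \<oplus>\<^bsub>VU\<^esub> b \<odot>\<^bsub>VU\<^esub> x" if "x \<in> carrier VU" for a b x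
    using that by (simp add: VU_smult h U.smult_l_distr CA_pure_closed)
  show "a \<odot>\<^bsub>VU\<^esub> (x \<oplus>\<^bsub>VU\<^esub> y) = a \<odot>\<^bsub>VU\<^esub> x \<oplus>\<^bsub>VU\<^esub> a \<odot>\<^bsub>VU\<^esub> y" if "x \<in> carrier VU" "y \<in> carrier VU" for a x y
    using that by (simp add: VU_smult U.smult_r_distr CA_pure_closed)
  show "(a \<otimes>\<^bsub>complex_ring\<^esub> b) \<odot>\<^bsub>VU\<^esub> x = a \<odot>\<^bsub>VU\<^esub> (b \<odot>\<^bsub>VU\<^esub> x)" if "x \<in> carrier VU" for a b x
    using that by (simp add: VU_smult m U.smult_assoc CA_pure_closed)
  show "\<one>\<^bsub>complex_ring\<^esub> \<odot>\<^bsub>VU\<^esub> x = x" if "x \<in> carrier VU" for x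
    using that U.smult_one[of x] by (simp add: VU_smult CA_one)
qed

sublocale V: complex_space VU
  using VU_module by (simp add: complex_space_def)

lemma id_hom: "add_hom U VU (\<lambda>x. x)" by (simp add: add_hom_def)

lemma finsum_VU: "finite I \<Longrightarrow> f \<in> I \<rightarrow> carrier U \<Longrightarrow> finsum U f I = finsum VU f I"
  using add_hom_finsum[OF id_hom U_group VU_group, of I f] by simp

definition ga where "ga g x = pure_elt complex_ring 1 g \<odot>\<^bsub>U\<^esub> x"

lemma ga_closed [simp]: "g \<in> carrier G \<Longrightarrow> x \<in> carrier U \<Longrightarrow> ga g x \<in> carrier U"
  by (simp add: ga_def U.smult_closed CA_pure_closed)

lemma ga_hom: "g \<in> carrier G \<Longrightarrow> add_hom U U (ga g)"
  unfolding ga_def[abs_def] by (rule left_module_smult_hom[OF U_module]) (simp add: CA_pure_closed)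

lemma ga_mult: "g \<in> carrier G \<Longrightarrow> h \<in> carrier G \<Longrightarrow> x \<in> carrier U \<Longrightarrow> ga (g \<otimes> h) x = ga g (ga h x)"
  using CA_pure_mult[of 1 1 g h] by (simp add: ga_def U.smult_assoc[symmetric] CA_pure_closed)

lemma ga_one: "x \<in> carrier U \<Longrightarrow> ga \<one> x = x"
  using U.smult_one[of x] by (simp add: ga_def CA_one)

lemma pure_smult: "g \<in> carrier G \<Longrightarrow> x \<in> carrier U \<Longrightarrow>
  pure_elt complex_ring c g \<odot>\<^bsub>U\<^esub> x = c \<odot>\<^bsub>VU\<^esub> ga g x"
  using CA_pure_mult[of c 1 \<one> g] by (simp add: ga_def VU_smult U.smult_assoc[symmetric] CA_pure_closed)

lemma ga_sc: "g \<in> carrier G \<Longrightarrow> x \<in> carrier U \<Longrightarrow> ga g (c \<odot>\<^bsub>VU\<^esub> x) = c \<odot>\<^bsub>VU\<^esub> ga g x"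
  using CA_pure_mult[of 1 c g \<one>] pure_smult[of g x c]
  by (simp add: ga_def VU_smult U.smult_assoc[symmetric] CA_pure_closed)

text \<open>
  The action of the group algebra is controlled by the finitely many translates \<open>g x\<close>.
\<close>

lemma smult_expand:
  assumes f: "f \<in> carrier CA" and x: "x \<in> carrier U"
  shows "f \<odot>\<^bsub>U\<^esub> x = V.lc f (\<lambda>g. ga g x) (carrier G)"
proof (rule CA_hom_eqI[OF left_module_scalar_hom[OF U_module x] _ U_group _ f])
  have fs: "(\<lambda>g. ga g x) \<in> carrier G \<rightarrow> carrier VU" using x by auto
  show "add_hom CA U (\<lambda>f. V.lc f (\<lambda>g. ga g x) (carrier G))"
    using V.lc_closed[OF fs] V.lc_add[OF fs] by (intro add_homI) (auto simp: CA_add)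
  fix c :: complex and w assume w: "w \<in> carrier G"
  have "V.lc (pure_elt complex_ring c w) (\<lambda>g. ga g x) (carrier G)
    = (\<Oplus>\<^bsub>VU\<^esub>g\<in>carrier G. if w = g then c \<odot>\<^bsub>VU\<^esub> ga g x else \<zero>\<^bsub>VU\<^esub>)"
    unfolding V.lc_def by (rule V.M.finsum_cong')
      (use x w V.sc_closed in \<open>auto simp: pure_elt_def V.sc_0[simplified]\<close>)
  also have "\<dots> = c \<odot>\<^bsub>VU\<^esub> ga w x"
    by (rule V.M.finsum_singleton) (use x w V.sc_closed finite_carrier in auto)
  finally show "pure_elt complex_ring c w \<odot>\<^bsub>U\<^esub> x = V.lc (pure_elt complex_ring c w) (\<lambda>g. ga g x) (carrier G)"
    using w x by (simp add: pure_smult)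
qed

lemma mod_hom_sc:
  assumes "mod_hom CA U U' f" "x \<in> carrier U"
  shows "f (c \<odot>\<^bsub>VU\<^esub> x) = c \<odot>\<^bsub>underlying_space G U'\<^esub> f x"
  using mod_homD(2)[OF assms(1) _ assms(2)] CA_pure_closed
  by (simp add: VU_smult) (simp add: underlying_space_def restrict_scalars_def)

lemma cyclic_submodule:
  assumes "u \<in> carrier U" shows "submodule ((\<lambda>a. a \<odot>\<^bsub>U\<^esub> u) ` carrier CA) CA U"
proof -
  interpret CA: ring CA by (rule CA_ring)
  show ?thesis
  proof (rule left_module_submoduleI[OF U_module])
    show "\<zero>\<^bsub>U\<^esub> \<in> (\<lambda>a. a \<odot>\<^bsub>U\<^esub> u) ` carrier CA"
      using left_module_zero_smult[OF U_module assms] by force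
    show "x \<oplus>\<^bsub>U\<^esub> y \<in> (\<lambda>a. a \<odot>\<^bsub>U\<^esub> u) ` carrier CA"
      if "x \<in> (\<lambda>a. a \<odot>\<^bsub>U\<^esub> u) ` carrier CA" "y \<in> (\<lambda>a. a \<odot>\<^bsub>U\<^esub> u) ` carrier CA" for x y
      using that assms by (auto simp: U.smult_l_distr[symmetric])
    show "a \<odot>\<^bsub>U\<^esub> x \<in> (\<lambda>a. a \<odot>\<^bsub>U\<^esub> u) ` carrier CA"
      if "a \<in> carrier CA" "x \<in> (\<lambda>a. a \<odot>\<^bsub>U\<^esub> u) ` carrier CA" for a x
      using that assms by (auto simp: U.smult_assoc[symmetric])
  qed (use assms U.smult_closed in auto)
qed

end

locale simple_gmodule = gmodule +
  assumes simple: "simple_module (group_algebra G) U"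
begin

text \<open>
  In a simple module every nonzero vector generates, so its finitely many translates span; in
  particular simple modules are finite dimensional.
\<close>

lemma spanned:
  assumes "u \<in> carrier U" "u \<noteq> \<zero>\<^bsub>U\<^esub>" "x \<in> carrier U"
  shows "\<exists>a. x = V.lc a (\<lambda>g. ga g u) (carrier G)"
proof -
  have "\<one>\<^bsub>CA\<^esub> \<in> carrier CA" using CA_ring by (simp add: ring.ring_simprules)
  then have "(\<lambda>a. a \<odot>\<^bsub>U\<^esub> u) ` carrier CA = carrier U"
    by (intro simple_moduleD(2)[OF simple cyclic_submodule, of u u])
       (use assms U.smult_one[of u] in \<open>auto intro!: image_eqI[of u _ "\<one>\<^bsub>CA\<^esub>"]\<close>)
  then obtain a where "a \<in> carrier CA" "x = a \<odot>\<^bsub>U\<^esub> u" using assms(3) by blast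
  then show ?thesis using smult_expand assms(1) by blast
qed

lemma basis: "\<exists>B. is_basis complex_ring VU B"
proof -
  obtain u where u: "u \<in> carrier U" "u \<noteq> \<zero>\<^bsub>U\<^esub>" using simple_moduleD(3)[OF simple] by blast
  show ?thesis
    by (rule V.basis_exists[of "carrier G" "\<lambda>g. ga g u"]) (use u finite_carrier spanned in auto)
qed

text \<open>
  An endomorphism of a simple module has an eigenvector, and the eigenspace is a submodule.
\<close>

lemma schur_scalar:
  assumes f: "mod_hom CA U U f"
  shows "\<exists>c. \<forall>x\<in>carrier U. f x = c \<odot>\<^bsub>VU\<^esub> x"
proof -
  obtain u where u: "u \<in> carrier U" "u \<noteq> \<zero>\<^bsub>U\<^esub>" using simple_moduleD(3)[OF simple] by blast
  have fV: "add_hom VU VU f" using mod_homD(1)[OF f] by (simp add: add_hom_def)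
  have "\<exists>w\<in>carrier VU. \<exists>c. w \<noteq> \<zero>\<^bsub>VU\<^esub> \<and> f w = c \<odot>\<^bsub>VU\<^esub> w"
    by (rule V.eigenvector_exists[OF fV, of u "carrier G" "\<lambda>g. ga g u"])
       (use u finite_carrier spanned mod_hom_sc[OF f] in auto)
  then obtain w c where w: "w \<in> carrier U" "w \<noteq> \<zero>\<^bsub>U\<^esub>" "f w = c \<odot>\<^bsub>VU\<^esub> w" by auto
  have "submodule {x \<in> carrier U. f x = c \<odot>\<^bsub>VU\<^esub> x} CA U"
  proof (rule left_module_submoduleI[OF U_module])
    have "c \<odot>\<^bsub>VU\<^esub> (a \<odot>\<^bsub>U\<^esub> x) = a \<odot>\<^bsub>U\<^esub> (c \<odot>\<^bsub>VU\<^esub> x)" if a: "a \<in> carrier CA" and x: "x \<in> carrier U" for a x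
    proof -
      have cx: "c \<odot>\<^bsub>VU\<^esub> x \<in> carrier U" using V.sc_closed x by simp
      show ?thesis
      proof (rule CA_hom_eqI[OF add_hom_compose[OF left_module_scalar_hom[OF U_module x], of U "\<lambda>y. c \<odot>\<^bsub>VU\<^esub> y"]
              left_module_scalar_hom[OF U_module cx] U_group _ a])
        show "add_hom U U (\<lambda>y. c \<odot>\<^bsub>VU\<^esub> y)" using V.sc_hom by (simp add: add_hom_def)
        fix d :: complex and g assume "g \<in> carrier G"
        then show "c \<odot>\<^bsub>VU\<^esub> (pure_elt complex_ring d g \<odot>\<^bsub>U\<^esub> x) = pure_elt complex_ring d g \<odot>\<^bsub>U\<^esub> (c \<odot>\<^bsub>VU\<^esub> x)"
          using x cx by (simp add: pure_smult ga_sc V.sc_assoc mult.commute)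
      qed
    qed
    then show "\<And>a x. a \<in> carrier CA \<Longrightarrow> x \<in> {x \<in> carrier U. f x = c \<odot>\<^bsub>VU\<^esub> x} \<Longrightarrow>
      a \<odot>\<^bsub>U\<^esub> x \<in> {x \<in> carrier U. f x = c \<odot>\<^bsub>VU\<^esub> x}"
      by (auto simp: mod_homD(2)[OF f] U.smult_closed)
    show "\<zero>\<^bsub>U\<^esub> \<in> {x \<in> carrier U. f x = c \<odot>\<^bsub>VU\<^esub> x}"
      using add_hom_zero[OF mod_homD(1)[OF f] U_group U_group] V.sc_zero by simp
  qed (use V.sc_distr in \<open>auto simp: add_hom_add[OF mod_homD(1)[OF f]]\<close>)
  from simple_moduleD(2)[OF simple this, of w] w show ?thesis by blast
qed

end

section \<open>The density theorem\<close>

context finite_group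
begin

lemma simple_gmoduleI:
  assumes "simple_module CA U" shows "simple_gmodule G U"
  using assms simple_moduleD(1)[OF assms]
  by (intro simple_gmodule.intro gmodule.intro simple_gmodule_axioms.intro finite_group_axioms)

text \<open>
  Induction on the number of prescribed values.  Let \<open>E\<close> be the new vector in \<open>M x\<close> and \<open>An\<close> the
  annihilator of the old ones.  If \<open>An E \<noteq> 0\<close>, then \<open>An E = M x\<close> by simplicity, and the value at \<open>E\<close> can be
  corrected without changing the old ones.  Otherwise \<open>a E\<close> depends only on the values of \<open>a\<close> at the
  old vectors, which by induction are arbitrary; so there are module homomorphisms \<open>\<psi>\<close> from the
  modules of the old vectors to \<open>M x\<close> with \<open>E = \<Sum> \<psi> (old vector)\<close>.  By Schur's lemma these are zero
  or scalars, and \<open>E\<close> is a linear combination of old vectors in \<open>M x\<close>, against independence.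
\<close>

lemma density:
  fixes M :: "'x \<Rightarrow> ('g \<Rightarrow> complex, 'u) module" and e :: "'x \<Rightarrow> 'i \<Rightarrow> 'u"
  assumes simple: "\<And>x. x \<in> X \<Longrightarrow> simple_module CA (M x)"
    and noniso: "\<And>x y. x \<in> X \<Longrightarrow> y \<in> X \<Longrightarrow> x \<noteq> y \<Longrightarrow> \<not> module_isomorphic CA (M x) (M y)"
    and e: "\<And>x i. x \<in> X \<Longrightarrow> i \<in> I x \<Longrightarrow> e x i \<in> carrier (M x)"
    and indep: "\<And>x N c. x \<in> X \<Longrightarrow> finite N \<Longrightarrow> N \<subseteq> I x \<Longrightarrow>
      complex_space.lc (underlying_space G (M x)) c (e x) N = \<zero>\<^bsub>M x\<^esub> \<Longrightarrow> \<forall>i\<in>N. c i = 0"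
    and "finite J" "J \<subseteq> Sigma X I"
    and "\<And>x i. (x, i) \<in> J \<Longrightarrow> t x i \<in> carrier (M x)"
  shows "\<exists>a\<in>carrier CA. \<forall>(x, i)\<in>J. a \<odot>\<^bsub>M x\<^esub> e x i = t x i"
  using assms(5-7)
proof (induction J arbitrary: t rule: finite_induct)
  case empty
  then show ?case using abelian_groupE(2)[OF CA_group] by blast
next
  case (insert j J)
  interpret CA: ring CA by (rule CA_ring)
  obtain x k where j: "j = (x, k)" by force
  have xk: "x \<in> X" "k \<in> I x" using insert.prems j by auto
  have Jsub: "J \<subseteq> Sigma X I" using insert.prems by auto
  have mod: "left_module CA (M y)" if "y \<in> X" for y using simple_moduleD(1)[OF simple[OF that]] .
  interpret Mx: simple_gmodule G "M x" by (rule simple_gmoduleI[OF simple[OF xk(1)]])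
  define E where "E = e x k"
  have E: "E \<in> carrier (M x)" using e xk by (simp add: E_def)
  have eJ: "e y i \<in> carrier (M y)" "left_module CA (M y)" "y \<in> X" if "(y, i) \<in> J" for y i
    using that Jsub e mod by auto
  define An where "An = {a \<in> carrier CA. \<forall>(y, i)\<in>J. a \<odot>\<^bsub>M y\<^esub> e y i = \<zero>\<^bsub>M y\<^esub>}"
  have An_sub: "submodule ((\<lambda>a. a \<odot>\<^bsub>M x\<^esub> E) ` An) CA (M x)"
  proof (rule left_module_submoduleI[OF mod[OF xk(1)]])
    show "(\<lambda>a. a \<odot>\<^bsub>M x\<^esub> E) ` An \<subseteq> carrier (M x)" using E by (auto simp: An_def Mx.U.smult_closed)
    have "\<zero>\<^bsub>CA\<^esub> \<in> An" using left_module_zero_smult eJ by (fastforce simp: An_def)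
    then show "\<zero>\<^bsub>M x\<^esub> \<in> (\<lambda>a. a \<odot>\<^bsub>M x\<^esub> E) ` An"
      using left_module_zero_smult[OF mod[OF xk(1)] E] by force
    show "u \<oplus>\<^bsub>M x\<^esub> v \<in> (\<lambda>a. a \<odot>\<^bsub>M x\<^esub> E) ` An"
      if uv: "u \<in> (\<lambda>a. a \<odot>\<^bsub>M x\<^esub> E) ` An" "v \<in> (\<lambda>a. a \<odot>\<^bsub>M x\<^esub> E) ` An" for u v
    proof -
      obtain a b where ab: "a \<in> An" "b \<in> An" "u = a \<odot>\<^bsub>M x\<^esub> E" "v = b \<odot>\<^bsub>M x\<^esub> E" using uv by blast
      have "(a \<oplus>\<^bsub>CA\<^esub> b) \<odot>\<^bsub>M y\<^esub> e y i = \<zero>\<^bsub>M y\<^esub>" if yi: "(y, i) \<in> J" for y i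
      proof -
        interpret left_module CA "M y" using eJ yi by blast
        show ?thesis using ab yi eJ[OF yi] by (force simp: An_def smult_l_distr)
      qed
      then have "a \<oplus>\<^bsub>CA\<^esub> b \<in> An" using ab by (auto simp: An_def)
      moreover have "u \<oplus>\<^bsub>M x\<^esub> v = (a \<oplus>\<^bsub>CA\<^esub> b) \<odot>\<^bsub>M x\<^esub> E"
        using ab E by (simp add: An_def Mx.U.smult_l_distr)
      ultimately show ?thesis by blast
    qed
    show "a \<odot>\<^bsub>M x\<^esub> u \<in> (\<lambda>a. a \<odot>\<^bsub>M x\<^esub> E) ` An"
      if au: "a \<in> carrier CA" "u \<in> (\<lambda>a. a \<odot>\<^bsub>M x\<^esub> E) ` An" for a u
    proof -
      obtain b where b: "b \<in> An" "u = b \<odot>\<^bsub>M x\<^esub> E" using au by blast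
      have "(a \<otimes>\<^bsub>CA\<^esub> b) \<odot>\<^bsub>M y\<^esub> e y i = \<zero>\<^bsub>M y\<^esub>" if yi: "(y, i) \<in> J" for y i
      proof -
        interpret left_module CA "M y" using eJ yi by blast
        show ?thesis using b au yi eJ[OF yi] left_module_smult_zero[OF eJ(2)[OF yi]]
          by (force simp: An_def smult_assoc)
      qed
      then have "a \<otimes>\<^bsub>CA\<^esub> b \<in> An" using b au by (auto simp: An_def)
      moreover have "a \<odot>\<^bsub>M x\<^esub> u = (a \<otimes>\<^bsub>CA\<^esub> b) \<odot>\<^bsub>M x\<^esub> E"
        using b au E by (simp add: An_def Mx.U.smult_assoc)
      ultimately show ?thesis by blast
    qed
  qed
  have solve: "\<exists>a\<in>carrier CA. \<forall>(y, i)\<in>J. a \<odot>\<^bsub>M y\<^esub> e y i = t y i"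
    if "\<And>y i. (y, i) \<in> J \<Longrightarrow> t y i \<in> carrier (M y)" for t
    using insert.IH[OF Jsub, of t] that by blast
  show ?case
  proof (cases "\<exists>a\<in>An. a \<odot>\<^bsub>M x\<^esub> E \<noteq> \<zero>\<^bsub>M x\<^esub>")
    case True
    then have full: "(\<lambda>a. a \<odot>\<^bsub>M x\<^esub> E) ` An = carrier (M x)"
      using simple_moduleD(2)[OF simple[OF xk(1)] An_sub] by blast
    have "\<exists>a\<in>carrier CA. \<forall>(y, i)\<in>J. a \<odot>\<^bsub>M y\<^esub> e y i = t y i"
      by (rule solve) (rule insert.prems(2), simp)
    then obtain a where a0: "a \<in> carrier CA" "\<forall>(y, i)\<in>J. a \<odot>\<^bsub>M y\<^esub> e y i = t y i" ..
    have a: "a \<in> carrier CA" "\<And>y i. (y, i) \<in> J \<Longrightarrow> a \<odot>\<^bsub>M y\<^esub> e y i = t y i"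
      using a0 by auto
    have tx: "t x k \<in> carrier (M x)" using insert.prems j by auto
    have aE: "a \<odot>\<^bsub>M x\<^esub> E \<in> carrier (M x)" using a E by (simp add: Mx.U.smult_closed)
    have "t x k \<ominus>\<^bsub>M x\<^esub> a \<odot>\<^bsub>M x\<^esub> E \<in> carrier (M x)" using tx aE by simp
    then have "t x k \<ominus>\<^bsub>M x\<^esub> a \<odot>\<^bsub>M x\<^esub> E \<in> (\<lambda>a. a \<odot>\<^bsub>M x\<^esub> E) ` An" unfolding full .
    then obtain b where b: "b \<in> An" "b \<odot>\<^bsub>M x\<^esub> E = t x k \<ominus>\<^bsub>M x\<^esub> a \<odot>\<^bsub>M x\<^esub> E"
      by (metis (no_types, lifting) imageE)
    have "(a \<oplus>\<^bsub>CA\<^esub> b) \<odot>\<^bsub>M y\<^esub> e y i = t y i" if yi: "(y, i) \<in> J" for y i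
    proof -
      interpret left_module CA "M y" using eJ yi by blast
      have "b \<odot>\<^bsub>M y\<^esub> e y i = \<zero>\<^bsub>M y\<^esub>" "t y i \<in> carrier (M y)" using b yi insert.prems by (auto simp: An_def)
      then show ?thesis using a b yi eJ[OF yi] by (simp add: An_def smult_l_distr)
    qed
    moreover have "(a \<oplus>\<^bsub>CA\<^esub> b) \<odot>\<^bsub>M x\<^esub> e x k = t x k"
    proof -
      have "(a \<oplus>\<^bsub>CA\<^esub> b) \<odot>\<^bsub>M x\<^esub> E = a \<odot>\<^bsub>M x\<^esub> E \<oplus>\<^bsub>M x\<^esub> (t x k \<oplus>\<^bsub>M x\<^esub> \<ominus>\<^bsub>M x\<^esub> (a \<odot>\<^bsub>M x\<^esub> E))"
        using a b E by (simp add: An_def Mx.U.smult_l_distr a_minus_def)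
      also have "\<dots> = t x k" using aE tx by (simp add: Mx.U.M.a_lcomm Mx.U.M.r_neg)
      finally show ?thesis by (simp add: E_def)
    qed
    ultimately show ?thesis using a(1) b(1) j by (intro bexI[of _ "a \<oplus>\<^bsub>CA\<^esub> b"]) (auto simp: An_def)
  next
    case False
    have agree: "a \<odot>\<^bsub>M x\<^esub> E = b \<odot>\<^bsub>M x\<^esub> E"
      if ab: "a \<in> carrier CA" "b \<in> carrier CA" "\<And>y i. (y, i) \<in> J \<Longrightarrow> a \<odot>\<^bsub>M y\<^esub> e y i = b \<odot>\<^bsub>M y\<^esub> e y i" for a b
    proof -
      have "(a \<oplus>\<^bsub>CA\<^esub> \<ominus>\<^bsub>CA\<^esub> b) \<odot>\<^bsub>M y\<^esub> e y i = \<zero>\<^bsub>M y\<^esub>" if yi: "(y, i) \<in> J" for y i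
      proof -
        interpret left_module CA "M y" using eJ yi by blast
        show ?thesis using ab yi eJ[OF yi] add_hom_neg[OF left_module_scalar_hom[OF eJ(2,1)[OF yi]] CA_group, of b]
          by (simp add: smult_l_distr smult_closed M.r_neg M.abelian_group_axioms)
      qed
      then have "a \<oplus>\<^bsub>CA\<^esub> \<ominus>\<^bsub>CA\<^esub> b \<in> An" using ab by (auto simp: An_def)
      then have z: "(a \<oplus>\<^bsub>CA\<^esub> \<ominus>\<^bsub>CA\<^esub> b) \<odot>\<^bsub>M x\<^esub> E = \<zero>\<^bsub>M x\<^esub>" using False by blast
      have aE: "a \<odot>\<^bsub>M x\<^esub> E \<in> carrier (M x)" "b \<odot>\<^bsub>M x\<^esub> E \<in> carrier (M x)" using ab E by (auto simp: Mx.U.smult_closed)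
      have "a = (a \<oplus>\<^bsub>CA\<^esub> \<ominus>\<^bsub>CA\<^esub> b) \<oplus>\<^bsub>CA\<^esub> b" using ab by (simp add: CA.a_assoc CA.l_neg)
      then have "a \<odot>\<^bsub>M x\<^esub> E = (a \<oplus>\<^bsub>CA\<^esub> \<ominus>\<^bsub>CA\<^esub> b) \<odot>\<^bsub>M x\<^esub> E \<oplus>\<^bsub>M x\<^esub> b \<odot>\<^bsub>M x\<^esub> E"
        using ab E by (metis CA.a_inv_closed CA.add.m_closed Mx.U.smult_l_distr)
      then show ?thesis using z aE by simp
    qed
    \<comment> \<open>prescribe the value \<open>u\<close> at one old vector and zero at the others\<close>
    define D :: "'x \<Rightarrow> 'i \<Rightarrow> 'u \<Rightarrow> 'x \<Rightarrow> 'i \<Rightarrow> 'u" where "D y i u z l = (if (z, l) = (y, i) then u else \<zero>\<^bsub>M z\<^esub>)" for y i u z l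
    have ex: "\<exists>a\<in>carrier CA. \<forall>(z, l)\<in>J. a \<odot>\<^bsub>M z\<^esub> e z l = D y i u z l"
      if "(y, i) \<in> J" "u \<in> carrier (M y)" for y i u
      by (rule solve) (use that abelian_groupE(2)[OF left_module_groups(1)[OF eJ(2)]] in \<open>auto simp: D_def\<close>)
    define A where "A y i u = (SOME a. a \<in> carrier CA \<and> (\<forall>(z, l)\<in>J. a \<odot>\<^bsub>M z\<^esub> e z l = D y i u z l))" for y i u
    have A: "A y i u \<in> carrier CA" "(z, l) \<in> J \<Longrightarrow> A y i u \<odot>\<^bsub>M z\<^esub> e z l = D y i u z l"
      if "(y, i) \<in> J" "u \<in> carrier (M y)" for y i u z l
      using someI_ex[OF ex[OF that, unfolded Bex_def]] unfolding A_def[symmetric] by auto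
    define \<psi> :: "'x \<Rightarrow> 'i \<Rightarrow> 'u \<Rightarrow> 'u" where "\<psi> y i u = A y i u \<odot>\<^bsub>M x\<^esub> E" for y i u
    have \<psi>: "mod_hom CA (M y) (M x) (\<psi> y i)" if yi: "(y, i) \<in> J" for y i
      unfolding mod_hom_def
    proof (intro conjI add_homI ballI)
      interpret My: left_module CA "M y" using eJ yi by blast
      show "\<psi> y i u \<in> carrier (M x)" if "u \<in> carrier (M y)" for u
        using A yi that E by (simp add: \<psi>_def Mx.U.smult_closed)
      show "\<psi> y i (u \<oplus>\<^bsub>M y\<^esub> v) = \<psi> y i u \<oplus>\<^bsub>M x\<^esub> \<psi> y i v" if uv: "u \<in> carrier (M y)" "v \<in> carrier (M y)" for u v
      proof -
        have "A y i (u \<oplus>\<^bsub>M y\<^esub> v) \<odot>\<^bsub>M x\<^esub> E = (A y i u \<oplus>\<^bsub>CA\<^esub> A y i v) \<odot>\<^bsub>M x\<^esub> E"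
        proof (rule agree)
          fix z l assume zl: "(z, l) \<in> J"
          interpret Mz: left_module CA "M z" using eJ zl by blast
          show "A y i (u \<oplus>\<^bsub>M y\<^esub> v) \<odot>\<^bsub>M z\<^esub> e z l = (A y i u \<oplus>\<^bsub>CA\<^esub> A y i v) \<odot>\<^bsub>M z\<^esub> e z l"
            using A yi uv zl eJ[OF zl] by (auto simp: Mz.smult_l_distr D_def)
        qed (use A yi uv in auto)
        then show ?thesis using A yi uv E by (simp add: \<psi>_def Mx.U.smult_l_distr)
      qed
      show "\<psi> y i (b \<odot>\<^bsub>M y\<^esub> u) = b \<odot>\<^bsub>M x\<^esub> \<psi> y i u" if bu: "b \<in> carrier CA" "u \<in> carrier (M y)" for b u
      proof -
        have "A y i (b \<odot>\<^bsub>M y\<^esub> u) \<odot>\<^bsub>M x\<^esub> E = (b \<otimes>\<^bsub>CA\<^esub> A y i u) \<odot>\<^bsub>M x\<^esub> E"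
        proof (rule agree)
          fix z l assume zl: "(z, l) \<in> J"
          interpret Mz: left_module CA "M z" using eJ zl by blast
          show "A y i (b \<odot>\<^bsub>M y\<^esub> u) \<odot>\<^bsub>M z\<^esub> e z l = (b \<otimes>\<^bsub>CA\<^esub> A y i u) \<odot>\<^bsub>M z\<^esub> e z l"
            using A yi bu zl eJ[OF zl] left_module_smult_zero[OF Mz.left_module_axioms bu(1)]
            by (auto simp: Mz.smult_assoc D_def My.smult_closed)
        qed (use A yi bu in \<open>auto simp: My.smult_closed\<close>)
        then show ?thesis using A yi bu E by (simp add: \<psi>_def Mx.U.smult_assoc)
      qed
    qed
    have \<psi>0: "\<psi> y i u = \<zero>\<^bsub>M x\<^esub>" if "(y, i) \<in> J" "y \<noteq> x" "u \<in> carrier (M y)" for y i u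
      using schur_isomorphic[OF simple simple \<psi>] noniso that eJ(3) xk(1) by blast
    have "\<forall>i. \<exists>c. (x, i) \<in> J \<longrightarrow> (\<forall>u\<in>carrier (M x). \<psi> x i u = c \<odot>\<^bsub>Mx.VU\<^esub> u)"
      using Mx.schur_scalar[OF \<psi>] by blast
    then obtain c where c: "\<And>i u. (x, i) \<in> J \<Longrightarrow> u \<in> carrier (M x) \<Longrightarrow> \<psi> x i u = c i \<odot>\<^bsub>Mx.VU\<^esub> u"
      by metis
    \<comment> \<open>\<open>S\<close> takes the same values at the old vectors as the unit element, hence fixes \<open>E\<close>\<close>
    define S where "S = finsum CA (\<lambda>(y, i). A y i (e y i)) J"
    have Ac: "(\<lambda>(y, i). A y i (e y i)) \<in> J \<rightarrow> carrier CA" using A(1) eJ(1) by auto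
    have Ssm: "S \<odot>\<^bsub>M z\<^esub> u = finsum (M z) (\<lambda>(y, i). A y i (e y i) \<odot>\<^bsub>M z\<^esub> u) J" if z: "z \<in> X" "u \<in> carrier (M z)" for z u
      using add_hom_finsum[OF left_module_scalar_hom[OF mod[OF z(1)] z(2)] CA_group
          left_module_groups(1)[OF mod[OF z(1)]] insert.hyps(1) Ac]
      by (simp add: S_def case_prod_unfold)
    have one: "\<one>\<^bsub>CA\<^esub> \<odot>\<^bsub>M x\<^esub> E = S \<odot>\<^bsub>M x\<^esub> E"
    proof (rule agree)
      show "S \<in> carrier CA" unfolding S_def by (rule CA.finsum_closed[OF Ac])
      fix z l assume zl: "(z, l) \<in> J"
      interpret Mz: left_module CA "M z" using eJ zl by blast
      have "S \<odot>\<^bsub>M z\<^esub> e z l = (\<Oplus>\<^bsub>M z\<^esub>p\<in>J. if (z, l) = p then e z l else \<zero>\<^bsub>M z\<^esub>)"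
        unfolding Ssm[OF eJ(3,1)[OF zl]]
        by (rule Mz.M.finsum_cong') (use A(2) eJ(1) zl Mz.M.zero_closed in \<open>auto simp: D_def split: if_splits\<close>)
      also have "\<dots> = e z l"
        by (rule Mz.M.finsum_singleton) (use zl eJ insert.hyps in auto)
      finally show "\<one>\<^bsub>CA\<^esub> \<odot>\<^bsub>M z\<^esub> e z l = S \<odot>\<^bsub>M z\<^esub> e z l"
        using Mz.smult_one eJ(1)[OF zl] by simp
    qed simp
    define N where "N = {i. (x, i) \<in> J}"
    have N: "finite N" "N \<subseteq> I x" "k \<notin> N"
      using insert.hyps Jsub j finite_vimageI[OF insert.hyps(1), of "Pair x"] by (auto simp: N_def vimage_def inj_on_def)
    have eN: "e x i \<in> carrier (M x)" if "i \<in> N" for i using that eJ by (auto simp: N_def image_iff)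
    have "E = finsum (M x) (\<lambda>(y, i). \<psi> y i (e y i)) J"
      using one Mx.U.smult_one[OF E] Ssm[OF xk(1) E] by (simp add: \<psi>_def)
    also have "\<dots> = finsum (M x) (\<lambda>(y, i). \<psi> y i (e y i)) (Pair x ` N)"
    proof (rule Mx.U.M.finsum_subset_zero)
      show "finite J" by (rule insert.hyps)
      show "Pair x ` N \<subseteq> J" by (auto simp: N_def)
      show "(\<lambda>(y, i). \<psi> y i (e y i)) \<in> J \<rightarrow> carrier (M x)"
        using eJ(1) add_hom_closed[OF mod_homD(1)[OF \<psi>]] by auto
      fix p assume p: "p \<in> J - Pair x ` N"
      then obtain y i where "p = (y, i)" "(y, i) \<in> J" "y \<noteq> x" by (cases p) (auto simp: N_def)
      then show "(case p of (y, i) \<Rightarrow> \<psi> y i (e y i)) = \<zero>\<^bsub>M x\<^esub>" using \<psi>0 eJ(1) by simp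
    qed
    also have "\<dots> = (\<Oplus>\<^bsub>M x\<^esub>i\<in>N. \<psi> x i (e x i))"
      using eJ(1) add_hom_closed[OF mod_homD(1)[OF \<psi>]]
      by (subst Mx.U.M.finsum_reindex) (auto simp: N_def inj_on_def)
    also have "\<dots> = (\<Oplus>\<^bsub>M x\<^esub>i\<in>N. c i \<odot>\<^bsub>Mx.VU\<^esub> e x i)"
      by (rule Mx.U.M.finsum_cong') (use c eJ(1) Mx.V.sc_closed in \<open>auto simp: N_def\<close>)
    also have "\<dots> = Mx.V.lc c (e x) N"
      unfolding Mx.V.lc_def by (rule Mx.finsum_VU) (use N eN Mx.V.sc_closed in auto)
    finally have Elc: "E = Mx.V.lc c (e x) N" .
    \<comment> \<open>the relation \<open>E = \<Sum> c\<^sub>i e\<^sub>i\<close> as a vanishing linear combination\<close>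
    define c' where "c' = c(k := - 1)"
    have lN: "Mx.V.lc c' (e x) N = E"
      unfolding Elc by (rule Mx.V.lc_cong) (use N eN in \<open>auto simp: c'_def\<close>)
    have "Mx.V.lc c' (e x) (insert k N) = c' k \<odot>\<^bsub>Mx.VU\<^esub> e x k \<oplus>\<^bsub>Mx.VU\<^esub> Mx.V.lc c' (e x) N"
      by (rule Mx.V.lc_insert) (use N eN E in \<open>auto simp: E_def\<close>)
    also have "\<dots> = \<zero>\<^bsub>M x\<^esub>"
      unfolding lN using Mx.V.sc_neg[of E] Mx.V.M.l_neg[of E] E by (simp add: c'_def E_def[symmetric])
    finally have "\<forall>i\<in>insert k N. c' i = 0"
      using indep[OF xk(1), of "insert k N" c'] N xk by simp
    then show ?thesis by (simp add: c'_def)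
  qed
qed

end

section \<open>Simple modules and the regular representation\<close>

lemma (in complex_space) indep_family:
  assumes B: "indep B" and e: "bij_betw e {..<d} B" and N: "N \<subseteq> {..<d :: nat}"
    and z: "lc c e N = \<zero>\<^bsub>V\<^esub>"
  shows "\<forall>i\<in>N. c i = 0"
proof -
  define c' where "c' b = (if inv_into {..<d} e b \<in> N then c (inv_into {..<d} e b) else 0)" for b
  have inv: "inv_into {..<d} e (e i) = i" if "i < d" for i
    using e that by (simp add: bij_betw_def)
  have eV: "e i \<in> carrier V" if "i < d" for i
    using bij_betw_apply[OF e, of i] that B by (auto simp: indep_def)
  have Be: "B = e ` {..<d}" "inj_on e {..<d}" using e by (auto simp: bij_betw_def)
  have "lc c' (\<lambda>b. b) B = (\<Oplus>\<^bsub>V\<^esub>i\<in>{..<d}. c' (e i) \<cdot> e i)"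
    unfolding lc_def Be(1) by (rule M.finsum_reindex) (use Be(2) eV in auto)
  also have "\<dots> = (\<Oplus>\<^bsub>V\<^esub>i\<in>N. c' (e i) \<cdot> e i)"
    by (rule M.finsum_subset_zero) (use N eV inv in \<open>auto simp: c'_def\<close>)
  also have "\<dots> = lc c e N"
    unfolding lc_def by (rule M.finsum_cong') (use N eV inv in \<open>auto simp: c'_def subset_iff\<close>)
  finally have c0: "\<forall>b\<in>B. c' b = 0" using z B by (simp add: indep_def)
  have "c i = 0" if "i \<in> N" for i
  proof -
    have "i < d" using that N by auto
    then have "c' (e i) = 0" using c0 by (auto simp: Be(1))
    then show ?thesis using that inv[OF \<open>i < d\<close>] by (simp add: c'_def)
  qed
  then show ?thesis by blast
qed

lemma (in gmodule) sc_smult_commute: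
  assumes a: "a \<in> carrier CA" and x: "x \<in> carrier U"
  shows "a \<odot>\<^bsub>U\<^esub> (c \<odot>\<^bsub>VU\<^esub> x) = c \<odot>\<^bsub>VU\<^esub> (a \<odot>\<^bsub>U\<^esub> x)"
proof -
  have cx: "c \<odot>\<^bsub>VU\<^esub> x \<in> carrier U" using V.sc_closed x by simp
  have "add_hom U U (\<lambda>y. c \<odot>\<^bsub>VU\<^esub> y)" using V.sc_hom by (simp add: add_hom_def)
  from CA_hom_eqI[OF left_module_scalar_hom[OF U_module cx]
      add_hom_compose[OF left_module_scalar_hom[OF U_module x] this] U_group _ a]
  show ?thesis using x cx by (simp add: pure_smult ga_sc V.sc_assoc mult.commute)
qed

context finite_group
begin

abbreviation Irr where "Irr \<equiv> irr_classes G"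

definition iso_rel where
  "iso_rel = {(U, U' :: 'g cmodule). simple_module CA U \<and> simple_module CA U' \<and> module_isomorphic CA U U'}"

lemma irr_classes_eq: "Irr = {U. simple_module CA U} // iso_rel"
  by (simp add: irr_classes_def iso_rel_def)

lemma iso_rel_equiv: "equiv {U. simple_module CA U} iso_rel"
proof (rule equivI)
  show "iso_rel \<subseteq> {U. simple_module CA U} \<times> {U. simple_module CA U}" by (auto simp: iso_rel_def)
  show "refl_on {U. simple_module CA U} iso_rel"
    by (auto simp: refl_on_def iso_rel_def intro: module_isomorphic_refl simple_moduleD(1))
  show "sym iso_rel" by (auto simp: sym_def iso_rel_def intro: module_isomorphic_sym)
  show "trans iso_rel" by (auto simp: trans_def iso_rel_def intro: module_isomorphic_trans)
qed

lemma class_rep_in: "\<chi> \<in> Irr \<Longrightarrow> class_rep \<chi> \<in> \<chi>"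
  unfolding class_rep_def irr_classes_eq
  by (rule someI_ex) (use in_quotient_imp_non_empty[OF iso_rel_equiv] in blast)

lemma class_rep_simple: "\<chi> \<in> Irr \<Longrightarrow> simple_module CA (class_rep \<chi>)"
  using class_rep_in in_quotient_imp_subset[OF iso_rel_equiv] unfolding irr_classes_eq by blast

lemma class_rep_gmodule: "\<chi> \<in> Irr \<Longrightarrow> simple_gmodule G (class_rep \<chi>)"
  by (intro simple_gmoduleI class_rep_simple)

lemma class_rep_noniso:
  assumes "\<chi> \<in> Irr" "\<psi> \<in> Irr" "module_isomorphic CA (class_rep \<chi>) (class_rep \<psi>)"
  shows "\<chi> = \<psi>"
proof -
  have "(class_rep \<chi>, class_rep \<psi>) \<in> iso_rel"
    using assms class_rep_simple by (simp add: iso_rel_def)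
  then show ?thesis
    using quotient_eqI[OF iso_rel_equiv assms(1)[unfolded irr_classes_eq] assms(2)[unfolded irr_classes_eq]]
      class_rep_in assms by blast
qed

text \<open>
  The classes consist of modules with one fixed type of elements; any simple module whose
  elements embed into that type is isomorphic to one of them.
\<close>

lemma simple_module_has_class:
  fixes M :: "('g \<Rightarrow> complex, 'u) module" and \<iota> :: "'u \<Rightarrow> nat \<Rightarrow> complex"
  assumes "simple_module CA M" "inj_on \<iota> (carrier M)"
  shows "\<exists>\<chi>\<in>Irr. module_isomorphic CA (class_rep \<chi>) M"
proof -
  obtain N :: "'g cmodule" where N: "module_isomorphic CA M N"
    using image_module[of CA M \<iota>] assms simple_moduleD(1) by blast
  have sN: "simple_module CA N" by (rule simple_module_isomorphic[OF assms(1) N])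
  define \<chi> where "\<chi> = iso_rel `` {N}"
  have chi: "\<chi> \<in> Irr" unfolding irr_classes_eq \<chi>_def by (rule quotientI) (simp add: sN)
  then have "(N, class_rep \<chi>) \<in> iso_rel" using class_rep_in[OF chi] by (auto simp: \<chi>_def)
  then have "module_isomorphic CA N (class_rep \<chi>)" by (simp add: iso_rel_def)
  then show ?thesis using chi module_isomorphic_sym module_isomorphic_trans N by blast
qed

definition left_ideal :: "('g \<Rightarrow> complex) set \<Rightarrow> bool" where
  "left_ideal S \<longleftrightarrow> S \<subseteq> carrier CA \<and> \<zero>\<^bsub>CA\<^esub> \<in> S \<and> (\<forall>x\<in>S. \<forall>y\<in>S. x \<oplus>\<^bsub>CA\<^esub> y \<in> S) \<and>
    (\<forall>a\<in>carrier CA. \<forall>x\<in>S. a \<otimes>\<^bsub>CA\<^esub> x \<in> S)"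

definition ideal_module :: "('g \<Rightarrow> complex) set \<Rightarrow> ('g \<Rightarrow> complex, 'g \<Rightarrow> complex) module" where
  "ideal_module S = \<lparr>carrier = S, monoid.mult = undefined, one = undefined,
     zero = \<zero>\<^bsub>CA\<^esub>, add = add CA, module.smult = monoid.mult CA\<rparr>"

lemma left_ideal_module:
  assumes "left_ideal S" shows "left_module CA (ideal_module S)"
proof -
  interpret CA: ring CA by (rule CA_ring)
  have s[simp]: "x \<in> S \<Longrightarrow> x \<in> carrier CA" for x using assms by (auto simp: left_ideal_def)
  have "abelian_group (ideal_module S)"
  proof (rule abelian_groupI)
    fix x assume x: "x \<in> carrier (ideal_module S)"
    then have "(\<ominus>\<^bsub>CA\<^esub> \<one>\<^bsub>CA\<^esub>) \<otimes>\<^bsub>CA\<^esub> x \<in> S" using assms by (auto simp: left_ideal_def ideal_module_def)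
    then have "\<ominus>\<^bsub>CA\<^esub> x \<in> S" using x by (simp add: CA.l_minus ideal_module_def)
    then show "\<exists>y\<in>carrier (ideal_module S). y \<oplus>\<^bsub>ideal_module S\<^esub> x = \<zero>\<^bsub>ideal_module S\<^esub>"
      using x by (intro bexI[of _ "\<ominus>\<^bsub>CA\<^esub> x"]) (auto simp: ideal_module_def CA.l_neg)
  qed (use assms in \<open>auto simp: left_ideal_def ideal_module_def CA.a_ac\<close>)
  then show ?thesis
    by (intro left_module.intro left_module_axioms.intro CA_ring)
       (use assms in \<open>auto simp: left_ideal_def ideal_module_def CA.l_distr CA.r_distr CA.m_assoc\<close>)
qed

definition scalar :: "complex \<Rightarrow> ('g \<Rightarrow> complex) \<Rightarrow> 'g \<Rightarrow> complex" where
  "scalar c f = (\<lambda>w. c * f w)"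

lemma scalar_eq: "f \<in> carrier CA \<Longrightarrow> pure_elt complex_ring c \<one> \<otimes>\<^bsub>CA\<^esub> f = scalar c f"
proof (rule ext)
  fix w assume f: "f \<in> carrier CA"
  show "(pure_elt complex_ring c \<one> \<otimes>\<^bsub>CA\<^esub> f) w = scalar c f w"
  proof (cases "w \<in> carrier G")
    case True
    have "(\<Sum>u\<in>carrier G. pure_elt complex_ring c \<one> u * f (inv u \<otimes> w))
      = (\<Sum>u\<in>carrier G. if u = \<one> then c * f w else 0)"
      by (rule sum.cong) (use True in \<open>auto simp: pure_elt_def\<close>)
    then show ?thesis using True finite_carrier by (simp add: CA_mult scalar_def)
  next
    case False
    then show ?thesis using f by (auto simp: CA_mult scalar_def CA_carrier)
  qed
qed

text \<open>
  A dimension argument without dimensions.  Fix an enumeration of the group and let \<open>P S\<close> be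
  the set of positions of leading coefficients of elements of \<open>S\<close>.  By elimination, \<open>S' \<subseteq> S\<close> and
  \<open>P S' = P S\<close> imply \<open>S' = S\<close>; so a nonzero left ideal with the smallest number of leading positions is
  minimal.
\<close>

lemma minimal_left_ideal:
  assumes J: "left_ideal J" "x \<in> J" "x \<noteq> \<zero>\<^bsub>CA\<^esub>"
  shows "\<exists>S. S \<subseteq> J \<and> left_ideal S \<and> S \<noteq> {\<zero>\<^bsub>CA\<^esub>} \<and>
    (\<forall>S'. left_ideal S' \<longrightarrow> S' \<subseteq> S \<longrightarrow> S' = {\<zero>\<^bsub>CA\<^esub>} \<or> S' = S)"
proof -
  define n where "n = card (carrier G)"
  obtain \<gamma> where \<gamma>: "bij_betw \<gamma> {..<n} (carrier G)"
    using ex_bij_betw_nat_finite[OF finite_carrier] by (auto simp: n_def atLeast0LessThan)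
  define lead where "lead f k \<longleftrightarrow> k < n \<and> f (\<gamma> k) \<noteq> 0 \<and> (\<forall>l<k. f (\<gamma> l) = 0)" for f :: "'g \<Rightarrow> complex" and k
  define P where "P S = {k. \<exists>f\<in>S. lead f k}" for S
  have P_fin: "finite (P S)" for S by (rule finite_subset[of _ "{..<n}"]) (auto simp: P_def lead_def)
  have ex_lead: "\<exists>k. lead f k" if f: "f \<in> carrier CA" "f \<noteq> \<zero>\<^bsub>CA\<^esub>" for f
  proof -
    obtain w where "f w \<noteq> 0" using f(2) by (auto simp: CA_zero fun_eq_iff)
    then have "w \<in> carrier G" "f w \<noteq> 0" using f(1) by (auto simp: CA_carrier)
    then have "\<exists>k. k < n \<and> f (\<gamma> k) \<noteq> 0"
      using \<gamma> by (metis bij_betw_iff_bijections lessThan_iff)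
    then have "\<exists>k. (k < n \<and> f (\<gamma> k) \<noteq> 0) \<and> (\<forall>l<k. \<not> (l < n \<and> f (\<gamma> l) \<noteq> 0))"
      by (rule exists_least_iff[THEN iffD1])
    then show ?thesis unfolding lead_def using less_trans by blast
  qed
  have P_inj: "S' = S" if S: "left_ideal S" "left_ideal S'" "S' \<subseteq> S" "P S' = P S" for S S'
  proof (rule ccontr)
    assume "S' \<noteq> S"
    then obtain f where f: "f \<in> S - S'" using S by blast
    have S'0: "\<zero>\<^bsub>CA\<^esub> \<in> S'" using S by (simp add: left_ideal_def)
    have sub: "f \<in> carrier CA" if "f \<in> S" for f using that S by (auto simp: left_ideal_def)
    \<comment> \<open>subtracting multiples of elements of the smaller ideal pushes the leading position of \<open>f\<close> up
      beyond every bound\<close>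
    have "\<exists>f\<in>S - S'. \<exists>k\<ge>m. lead f k" for m
    proof (induction m)
      case 0
      have "f \<noteq> \<zero>\<^bsub>CA\<^esub>" using f S'0 by auto
      then have "\<exists>k. lead f k" using ex_lead[of f] sub f by auto
      then show ?case using f by auto
    next
      case (Suc m)
      then obtain f k where f: "f \<in> S - S'" "k \<ge> m" "lead f k" by blast
      show ?case
      proof (cases "k = m")
        case False
        then show ?thesis using f by (intro bexI[of _ f] exI[of _ k]) auto
      next
        case True
        have "k \<in> P S'" using f S(4) by (auto simp: P_def)
        then obtain g where g: "g \<in> S'" "lead g k" by (auto simp: P_def)
        define h where "h = scalar (- f (\<gamma> k) / g (\<gamma> k)) g"
        have gk: "g (\<gamma> k) \<noteq> 0" using g by (simp add: lead_def)
        have gS: "g \<in> S" using g S by blast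
        have sc: "scalar c g \<in> S'" for c
          using S(2) g CA_pure_closed[of c \<one>] scalar_eq[OF sub[OF gS], of c]
          unfolding left_ideal_def by (metis UNIV_I complex_ring_simps(1) one_closed)
        have hS: "h \<in> S'" unfolding h_def by (rule sc)
        have fh: "f \<oplus>\<^bsub>CA\<^esub> h \<in> S" using f hS S by (auto simp: left_ideal_def)
        have "f = (f \<oplus>\<^bsub>CA\<^esub> h) \<oplus>\<^bsub>CA\<^esub> scalar (f (\<gamma> k) / g (\<gamma> k)) g"
          by (auto simp: CA_add h_def scalar_def)
        then have "f \<oplus>\<^bsub>CA\<^esub> h \<notin> S'" using f sc S(2) by (metis DiffD2 left_ideal_def)
        moreover from this have "f \<oplus>\<^bsub>CA\<^esub> h \<noteq> \<zero>\<^bsub>CA\<^esub>" using S'0 by metis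
        then obtain l where l: "lead (f \<oplus>\<^bsub>CA\<^esub> h) l" using ex_lead sub fh by blast
        have "(f \<oplus>\<^bsub>CA\<^esub> h) (\<gamma> i) = 0" if "i \<le> k" for i
          using that f(3) g(2) gk by (cases "i = k") (auto simp: CA_add h_def scalar_def lead_def)
        then have "l \<ge> Suc m" using l True by (metis lead_def not_less_eq_eq)
        ultimately show ?thesis using fh l by blast
      qed
    qed
    from this[of n] show False by (auto simp: lead_def)
  qed
  define Q where "Q S \<longleftrightarrow> S \<subseteq> J \<and> left_ideal S \<and> S \<noteq> {\<zero>\<^bsub>CA\<^esub>}" for S
  have "Q J" using J by (auto simp: Q_def)
  then obtain S where S: "Q S" "\<And>S'. Q S' \<Longrightarrow> card (P S) \<le> card (P S')"
    using ex_has_least_nat[of Q J "\<lambda>S. card (P S)"] by blast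
  have "S' = {\<zero>\<^bsub>CA\<^esub>} \<or> S' = S" if S': "left_ideal S'" "S' \<subseteq> S" for S'
  proof (cases "S' = {\<zero>\<^bsub>CA\<^esub>}")
    case False
    then have "Q S'" using S' S(1) by (auto simp: Q_def)
    have "P S' \<subseteq> P S" using S' by (auto simp: P_def)
    then have "P S' = P S" using S(2)[OF \<open>Q S'\<close>] card_seteq[OF P_fin] by blast
    then show ?thesis using P_inj S(1) S' by (auto simp: Q_def)
  qed simp
  then show ?thesis using S(1) unfolding Q_def by blast
qed

text \<open>
  The conjugate linear anti-involution with \<open>g\<^sup>* = g\<^sup>-\<^sup>1\<close>.
\<close>

definition star :: "('g \<Rightarrow> complex) \<Rightarrow> 'g \<Rightarrow> complex" where
  "star f = (\<lambda>w. if w \<in> carrier G then cnj (f (inv w)) else 0)"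

lemma star_closed: "f \<in> carrier CA \<Longrightarrow> star f \<in> carrier CA"
  by (auto simp: CA_carrier star_def)

text \<open>
  Positivity: the coefficient of \<open>f f\<^sup>*\<close> at the unit element is \<open>\<Sum> |f g|\<^sup>2\<close>.
\<close>

lemma mult_star_zero:
  assumes "f \<in> carrier CA" "f \<otimes>\<^bsub>CA\<^esub> star f = \<zero>\<^bsub>CA\<^esub>" shows "f = \<zero>\<^bsub>CA\<^esub>"
proof -
  have "0 = (f \<otimes>\<^bsub>CA\<^esub> star f) \<one>" using assms by (simp add: CA_zero)
  also have "\<dots> = (\<Sum>u\<in>carrier G. of_real ((cmod (f u))\<^sup>2))"
    unfolding CA_mult by (simp add: star_def complex_norm_square del: of_real_power)
  finally have "(\<Sum>u\<in>carrier G. (cmod (f u))\<^sup>2) = 0"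
    by (metis of_real_eq_0_iff of_real_sum)
  then have "\<forall>u\<in>carrier G. f u = 0" using finite_carrier by (simp add: sum_nonneg_eq_0_iff)
  then show ?thesis using assms(1) by (auto simp: CA_zero CA_carrier)
qed

lemma star_mult_star:
  assumes "f \<in> carrier CA" shows "star (f \<otimes>\<^bsub>CA\<^esub> star f) = f \<otimes>\<^bsub>CA\<^esub> star f"
proof (rule ext)
  fix w
  show "star (f \<otimes>\<^bsub>CA\<^esub> star f) w = (f \<otimes>\<^bsub>CA\<^esub> star f) w"
  proof (cases "w \<in> carrier G")
    case w: True
    have "star (f \<otimes>\<^bsub>CA\<^esub> star f) w = (\<Sum>u\<in>carrier G. cnj (f u) * f (w \<otimes> u))"
      using w by (simp add: star_def CA_mult inv_mult_group)
    also have "\<dots> = (\<Sum>v\<in>carrier G. cnj (f (inv w \<otimes> v)) * f v)"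
      by (rule sum.reindex_bij_witness[of _ "\<lambda>v. inv w \<otimes> v" "\<lambda>u. w \<otimes> u"])
         (use w in \<open>auto simp: m_assoc[symmetric]\<close>)
    also have "\<dots> = (f \<otimes>\<^bsub>CA\<^esub> star f) w"
      using w by (auto simp: CA_mult star_def inv_mult_group mult.commute intro!: sum.cong)
    finally show ?thesis .
  qed (simp add: star_def CA_mult)
qed

text \<open>
  The annihilator of all simple modules is a left ideal; if it is nonzero, it contains a minimal one,
  \<open>S\<close>.  Then \<open>S\<close> is a simple module, hence \<open>S\<close> annihilates \<open>S\<close>.  For \<open>s\<close> in \<open>S\<close> also \<open>s\<^sup>* s\<close> is in
  \<open>S\<close>, so \<open>r = s s\<^sup>*\<close> has \<open>r r = s (s\<^sup>* s) s\<^sup>* = 0\<close>.  As \<open>r = r\<^sup>*\<close>, positivity gives \<open>r = 0\<close>, and then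
  \<open>s = 0\<close>.
\<close>

lemma irr_faithful:
  assumes a: "a \<in> carrier CA"
    and zero: "\<And>\<chi> u. \<chi> \<in> Irr \<Longrightarrow> u \<in> carrier (class_rep \<chi>) \<Longrightarrow> a \<odot>\<^bsub>class_rep \<chi>\<^esub> u = \<zero>\<^bsub>class_rep \<chi>\<^esub>"
  shows "a = \<zero>\<^bsub>CA\<^esub>"
proof (rule ccontr)
  assume a0: "a \<noteq> \<zero>\<^bsub>CA\<^esub>"
  interpret CA: ring CA by (rule CA_ring)
  define J where "J = {a \<in> carrier CA. \<forall>\<chi>\<in>Irr. \<forall>u\<in>carrier (class_rep \<chi>). a \<odot>\<^bsub>class_rep \<chi>\<^esub> u = \<zero>\<^bsub>class_rep \<chi>\<^esub>}"
  have mod: "left_module CA (class_rep \<chi>)" if "\<chi> \<in> Irr" for \<chi>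
    using simple_moduleD(1)[OF class_rep_simple[OF that]] .
  have J: "left_ideal J"
    unfolding left_ideal_def
  proof (intro conjI ballI)
    show "\<zero>\<^bsub>CA\<^esub> \<in> J" using left_module_zero_smult[OF mod] by (auto simp: J_def)
    show "x \<oplus>\<^bsub>CA\<^esub> y \<in> J" if "x \<in> J" "y \<in> J" for x y
      using that left_module_groups(1)[OF mod] by (auto simp: J_def left_module.smult_l_distr[OF mod] abelian_groupE)
    show "b \<otimes>\<^bsub>CA\<^esub> x \<in> J" if "b \<in> carrier CA" "x \<in> J" for b x
      using that left_module_smult_zero[OF mod] by (auto simp: J_def left_module.smult_assoc[OF mod])
  qed (auto simp: J_def)
  have "a \<in> J" using a zero by (simp add: J_def)
  from minimal_left_ideal[OF J this a0] obtain S where S: "S \<subseteq> J" "left_ideal S" "S \<noteq> {\<zero>\<^bsub>CA\<^esub>}"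
    "\<And>S'. left_ideal S' \<Longrightarrow> S' \<subseteq> S \<Longrightarrow> S' = {\<zero>\<^bsub>CA\<^esub>} \<or> S' = S" by blast
  have SCA: "s \<in> carrier CA" if "s \<in> S" for s using that S(2) by (auto simp: left_ideal_def)
  have simple: "simple_module CA (ideal_module S)"
    unfolding simple_module_def
  proof (intro conjI allI impI)
    show "left_module CA (ideal_module S)" by (rule left_ideal_module[OF S(2)])
    show "carrier (ideal_module S) \<noteq> {\<zero>\<^bsub>ideal_module S\<^esub>}" using S(3) by (simp add: ideal_module_def)
    fix N assume N: "submodule N CA (ideal_module S)"
    have "left_ideal N" "N \<subseteq> S"
      using submodule_closed[OF N] S(2) by (auto simp: left_ideal_def ideal_module_def)
    then show "N = {\<zero>\<^bsub>ideal_module S\<^esub>} \<or> N = carrier (ideal_module S)"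
      using S(4) by (simp add: ideal_module_def)
  qed
  define n where "n = card (carrier G)"
  obtain \<gamma> where \<gamma>: "bij_betw \<gamma> {..<n} (carrier G)"
    using ex_bij_betw_nat_finite[OF finite_carrier] by (auto simp: n_def atLeast0LessThan)
  \<comment> \<open>the elements of \<open>S\<close> are encoded as sequences, the type of elements in the definition of the
    isomorphism classes\<close>
  have "inj_on (\<lambda>f i. if i < n then f (\<gamma> i) else 0) (carrier (ideal_module S))"
  proof (rule inj_onI)
    fix f g :: "'g \<Rightarrow> complex"
    assume fg: "f \<in> carrier (ideal_module S)" "g \<in> carrier (ideal_module S)"
      "(\<lambda>i. if i < n then f (\<gamma> i) else 0) = (\<lambda>i. if i < n then g (\<gamma> i) else 0)"
    show "f = g"
    proof (rule ext)
      fix w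
      show "f w = g w"
      proof (cases "w \<in> carrier G")
        case True
        then obtain i where "i < n" "w = \<gamma> i" using \<gamma> by (metis bij_betw_iff_bijections lessThan_iff)
        then show ?thesis using fun_cong[OF fg(3), of i] by simp
      next
        case False
        then have "f w = 0" "g w = 0" using fg(1,2) SCA by (auto simp: ideal_module_def CA_carrier)
        then show ?thesis by simp
      qed
    qed
  qed
  from simple_module_has_class[OF simple this] obtain \<chi> where
    \<chi>: "\<chi> \<in> Irr" "module_isomorphic CA (class_rep \<chi>) (ideal_module S)" by blast
  then obtain f where f: "bij_betw f (carrier (class_rep \<chi>)) (carrier (ideal_module S))"
    "mod_hom CA (class_rep \<chi>) (ideal_module S) f" unfolding module_isomorphic_iff by blast
  have kill: "s \<otimes>\<^bsub>CA\<^esub> t = \<zero>\<^bsub>CA\<^esub>" if st: "s \<in> S" "t \<in> S" for s t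
  proof -
    have "t \<in> carrier (ideal_module S)" using st by (simp add: ideal_module_def)
    then obtain u where u: "u \<in> carrier (class_rep \<chi>)" "t = f u"
      using f(1) unfolding bij_betw_def by blast
    have sJ: "s \<odot>\<^bsub>class_rep \<chi>\<^esub> u = \<zero>\<^bsub>class_rep \<chi>\<^esub>" "s \<in> carrier CA" using S(1) st u \<chi> by (auto simp: J_def)
    have "s \<odot>\<^bsub>ideal_module S\<^esub> t = f (s \<odot>\<^bsub>class_rep \<chi>\<^esub> u)" using mod_homD(2)[OF f(2) sJ(2) u(1)] u(2) by metis
    also have "\<dots> = \<zero>\<^bsub>ideal_module S\<^esub>"
      unfolding sJ by (rule add_hom_zero[OF mod_homD(1)[OF f(2)] left_module_groups(1)[OF mod[OF \<chi>(1)]]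
          left_module_groups(1)[OF left_ideal_module[OF S(2)]]])
    finally show ?thesis by (simp add: ideal_module_def)
  qed
  have "\<zero>\<^bsub>CA\<^esub> \<in> S" using S(2) by (simp add: left_ideal_def)
  then obtain s where s: "s \<in> S" "s \<noteq> \<zero>\<^bsub>CA\<^esub>" using S(3) by blast
  define r where "r = s \<otimes>\<^bsub>CA\<^esub> star s"
  have sC: "s \<in> carrier CA" "star s \<in> carrier CA" using SCA s star_closed by auto
  have "star s \<otimes>\<^bsub>CA\<^esub> s \<in> S" using S(2) s sC by (auto simp: left_ideal_def)
  then have "s \<otimes>\<^bsub>CA\<^esub> (star s \<otimes>\<^bsub>CA\<^esub> s) = \<zero>\<^bsub>CA\<^esub>" using kill s by blast
  then have "r \<otimes>\<^bsub>CA\<^esub> r = \<zero>\<^bsub>CA\<^esub>" using sC unfolding r_def by (metis CA.l_null CA.m_assoc CA.m_closed)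
  then have "r \<otimes>\<^bsub>CA\<^esub> star r = \<zero>\<^bsub>CA\<^esub>" unfolding r_def using star_mult_star[OF sC(1)] by simp
  then have "r = \<zero>\<^bsub>CA\<^esub>" using mult_star_zero[of r] sC by (simp add: r_def)
  then show False using mult_star_zero[OF sC(1)] s(2) by (simp add: r_def)
qed

text \<open>
  By density there are elements \<open>a \<chi>\<close> which fix a chosen nonzero vector of \<open>\<chi>\<close> and annihilate
  those of the other classes; they are linearly independent in a space of dimension \<open>|G|\<close>.
\<close>

lemma irr_card_bound:
  assumes F: "F \<subseteq> Irr" "finite F" shows "card F \<le> card (carrier G)"
proof (rule ccontr)
  assume "\<not> card F \<le> card (carrier G)"
  then have lt: "card (carrier G) < card F" by simp
  interpret CA: ring CA by (rule CA_ring)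
  have simple: "simple_module CA (class_rep \<chi>)" if "\<chi> \<in> F" for \<chi> using F that class_rep_simple by blast
  have "\<exists>u. u \<in> carrier (class_rep \<chi>) \<and> u \<noteq> \<zero>\<^bsub>class_rep \<chi>\<^esub>" if "\<chi> \<in> F" for \<chi>
    using simple_moduleD(3)[OF simple[OF that]] by blast
  then obtain u where u: "\<And>\<chi>. \<chi> \<in> F \<Longrightarrow> u \<chi> \<in> carrier (class_rep \<chi>)" "\<And>\<chi>. \<chi> \<in> F \<Longrightarrow> u \<chi> \<noteq> \<zero>\<^bsub>class_rep \<chi>\<^esub>"
    by metis
  define D where "D \<chi> \<psi> = (if \<chi> = \<psi> then u \<chi> else \<zero>\<^bsub>class_rep \<psi>\<^esub>)" for \<chi> \<psi>
  have "\<exists>a\<in>carrier CA. \<forall>(\<psi>, i :: nat)\<in>F \<times> {0}. a \<odot>\<^bsub>class_rep \<psi>\<^esub> u \<psi> = D \<chi> \<psi>" if chi: "\<chi> \<in> F" for \<chi>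
  proof (rule density[of F class_rep "\<lambda>_. {0}" "\<lambda>\<psi> i. u \<psi>" "F \<times> {0}" "\<lambda>\<psi> i. D \<chi> \<psi>"])
    fix \<psi> :: "'g cmodule set" and N :: "nat set" and c assume *: "\<psi> \<in> F" "finite N" "N \<subseteq> {0}"
      "complex_space.lc (underlying_space G (class_rep \<psi>)) c (\<lambda>i. u \<psi>) N = \<zero>\<^bsub>class_rep \<psi>\<^esub>"
    interpret P: simple_gmodule G "class_rep \<psi>" by (rule simple_gmoduleI[OF simple[OF *(1)]])
    show "\<forall>i\<in>N. c i = 0"
    proof (cases "N = {}")
      case False
      then have "N = {0}" using * by blast
      then have "c 0 \<odot>\<^bsub>P.VU\<^esub> u \<psi> = \<zero>\<^bsub>class_rep \<psi>\<^esub>"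
        using *(4) u(1)[OF *(1)] P.V.sc_closed[of "u \<psi>" "c 0"] by (simp add: P.V.lc_def)
      then show ?thesis using P.V.sc_eq_zero[of "u \<psi>" "c 0"] u[OF *(1)] \<open>N = {0}\<close> by auto
    qed simp
  next
    show "D \<chi> \<psi> \<in> carrier (class_rep \<psi>)" if "(\<psi>, i) \<in> F \<times> {0::nat}" for \<psi> i
      using that u chi abelian_groupE(2)[OF left_module_groups(1)[OF simple_moduleD(1)[OF simple]]] by (auto simp: D_def)
    show "\<not> module_isomorphic CA (class_rep \<psi>) (class_rep \<psi>')" if "\<psi> \<in> F" "\<psi>' \<in> F" "\<psi> \<noteq> \<psi>'" for \<psi> \<psi>'
      using class_rep_noniso that F(1) by blast
  qed (use F(2) u simple in auto)
  then have "\<forall>\<chi>. \<exists>a. \<chi> \<in> F \<longrightarrow> a \<in> carrier CA \<and> (\<forall>\<psi>\<in>F. a \<odot>\<^bsub>class_rep \<psi>\<^esub> u \<psi> = D \<chi> \<psi>)"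
    by fastforce
  then obtain a where a: "\<And>\<chi>. \<chi> \<in> F \<Longrightarrow> a \<chi> \<in> carrier CA"
    "\<And>\<chi> \<psi>. \<chi> \<in> F \<Longrightarrow> \<psi> \<in> F \<Longrightarrow> a \<chi> \<odot>\<^bsub>class_rep \<psi>\<^esub> u \<psi> = D \<chi> \<psi>" by metis
  obtain c \<psi> where c: "\<psi> \<in> F" "c \<psi> \<noteq> 0" "\<And>g. g \<in> carrier G \<Longrightarrow> (\<Sum>\<chi>\<in>F. c \<chi> * a \<chi> g) = 0"
    using homogeneous_system_solution[OF finite_carrier F(2) lt, of a] by blast
  let ?f = "\<lambda>\<chi>. pure_elt complex_ring (c \<chi>) \<one> \<otimes>\<^bsub>CA\<^esub> a \<chi>"
  have fc: "?f \<in> F \<rightarrow> carrier CA" using a CA_pure_closed by auto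
  have S0: "finsum CA ?f F = \<zero>\<^bsub>CA\<^esub>"
  proof (rule ext)
    fix w
    have "add_hom CA complex_ring (\<lambda>f. f w)" by (simp add: add_hom_def CA_add)
    from add_hom_finsum[OF this CA_group CR.abelian_group_axioms F(2) fc]
    have "finsum CA ?f F w = (\<Sum>\<chi>\<in>F. c \<chi> * a \<chi> w)"
      using F(2) a scalar_eq by (simp add: finsum_complex_ring scalar_def)
    also have "\<dots> = 0"
    proof (cases "w \<in> carrier G")
      case False
      then have "a \<chi> w = 0" if "\<chi> \<in> F" for \<chi> using a(1)[OF that] by (simp add: CA_carrier)
      then show ?thesis by simp
    qed (rule c(3))
    finally show "finsum CA ?f F w = \<zero>\<^bsub>CA\<^esub> w" by (simp add: CA_zero)
  qed
  interpret P: simple_gmodule G "class_rep \<psi>" by (rule simple_gmoduleI[OF simple[OF c(1)]])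
  have "\<zero>\<^bsub>class_rep \<psi>\<^esub> = finsum CA ?f F \<odot>\<^bsub>class_rep \<psi>\<^esub> u \<psi>"
    unfolding S0 using left_module_zero_smult[OF P.U_module u(1)[OF c(1)]] by simp
  also have "\<dots> = (\<Oplus>\<^bsub>class_rep \<psi>\<^esub>\<chi>\<in>F. ?f \<chi> \<odot>\<^bsub>class_rep \<psi>\<^esub> u \<psi>)"
    by (rule add_hom_finsum[OF left_module_scalar_hom[OF P.U_module u(1)[OF c(1)]] CA_group P.U_group F(2) fc])
  also have "\<dots> = (\<Oplus>\<^bsub>class_rep \<psi>\<^esub>\<chi>\<in>F. if \<psi> = \<chi> then c \<psi> \<odot>\<^bsub>P.VU\<^esub> u \<psi> else \<zero>\<^bsub>class_rep \<psi>\<^esub>)"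
    by (rule P.U.M.finsum_cong')
       (use a u c(1) P.V.sc_closed P.V.sc_zero in
         \<open>auto simp: P.U.smult_assoc CA_pure_closed P.VU_smult[symmetric] D_def\<close>)
  also have "\<dots> = c \<psi> \<odot>\<^bsub>P.VU\<^esub> u \<psi>"
    by (rule P.U.M.finsum_singleton) (use F c(1) u P.V.sc_closed in auto)
  finally show False using P.V.sc_eq_zero[of "u \<psi>" "c \<psi>"] u[OF c(1)] c(2) by simp
qed

lemma irr_finite: "finite Irr"
  using finite_if_finite_subsets_card_bdd[of Irr "card (carrier G)"] irr_card_bound by blast

lemma class_basis:
  assumes "\<chi> \<in> Irr"
  shows "\<exists>B. is_basis complex_ring (underlying_space G (class_rep \<chi>)) B \<and> card B = class_dim G \<chi>"
proof -
  interpret P: simple_gmodule G "class_rep \<chi>" by (rule class_rep_gmodule[OF assms])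
  obtain B where B: "is_basis complex_ring P.VU B" using P.basis by blast
  have "class_dim G \<chi> = card B"
    unfolding class_dim_def by (rule the_equality) (use B P.V.basis_card_unique in blast)+
  then show ?thesis using B by auto
qed

text \<open>
  \<open>\<complex>G \<cong> \<Oplus> \<chi>\<^sup>d\<close> with \<open>d = dim \<chi>\<close>, in the form in which it is used: for bases \<open>e \<chi>\<close> of the
  simple modules, the map \<open>a \<mapsto> (a e\<^sub>\<chi>\<^sub>,\<^sub>i)\<close> is onto and injective.
\<close>

theorem regular_representation:
  obtains e where
    "\<And>\<chi> i. \<chi> \<in> Irr \<Longrightarrow> i < class_dim G \<chi> \<Longrightarrow> e \<chi> i \<in> carrier (class_rep \<chi>)"
    "\<And>t. (\<And>\<chi> i. \<chi> \<in> Irr \<Longrightarrow> i < class_dim G \<chi> \<Longrightarrow> t \<chi> i \<in> carrier (class_rep \<chi>)) \<Longrightarrow>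
       \<exists>a\<in>carrier CA. \<forall>\<chi>\<in>Irr. \<forall>i<class_dim G \<chi>. a \<odot>\<^bsub>class_rep \<chi>\<^esub> e \<chi> i = t \<chi> i"
    "\<And>a. a \<in> carrier CA \<Longrightarrow> (\<And>\<chi> i. \<chi> \<in> Irr \<Longrightarrow> i < class_dim G \<chi> \<Longrightarrow>
       a \<odot>\<^bsub>class_rep \<chi>\<^esub> e \<chi> i = \<zero>\<^bsub>class_rep \<chi>\<^esub>) \<Longrightarrow> a = \<zero>\<^bsub>CA\<^esub>"
proof -
  obtain B where B: "\<And>\<chi>. \<chi> \<in> Irr \<Longrightarrow> is_basis complex_ring (underlying_space G (class_rep \<chi>)) (B \<chi>)"
    "\<And>\<chi>. \<chi> \<in> Irr \<Longrightarrow> card (B \<chi>) = class_dim G \<chi>" using class_basis by metis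
  have "\<exists>e. bij_betw e {..<class_dim G \<chi>} (B \<chi>)" if "\<chi> \<in> Irr" for \<chi>
    using ex_bij_betw_nat_finite[of "B \<chi>"] B[OF that] by (auto simp: is_basis_def atLeast0LessThan)
  then obtain e where e: "\<And>\<chi>. \<chi> \<in> Irr \<Longrightarrow> bij_betw (e \<chi>) {..<class_dim G \<chi>} (B \<chi>)" by metis
  have ec: "e \<chi> i \<in> carrier (class_rep \<chi>)" if "\<chi> \<in> Irr" "i < class_dim G \<chi>" for \<chi> i
  proof -
    interpret P: simple_gmodule G "class_rep \<chi>" by (rule class_rep_gmodule[OF that(1)])
    show ?thesis using B(1)[OF that(1)] bij_betw_apply[OF e[OF that(1)], of i] that(2) by (auto simp: is_basis_def)
  qed
  show ?thesis
  proof (rule that[of e])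
    show "\<exists>a\<in>carrier CA. \<forall>\<chi>\<in>Irr. \<forall>i<class_dim G \<chi>. a \<odot>\<^bsub>class_rep \<chi>\<^esub> e \<chi> i = t \<chi> i"
      if t: "\<And>\<chi> i. \<chi> \<in> Irr \<Longrightarrow> i < class_dim G \<chi> \<Longrightarrow> t \<chi> i \<in> carrier (class_rep \<chi>)" for t
    proof -
      have "\<exists>a\<in>carrier CA. \<forall>(\<chi>, i)\<in>Sigma Irr (\<lambda>\<chi>. {..<class_dim G \<chi>}). a \<odot>\<^bsub>class_rep \<chi>\<^esub> e \<chi> i = t \<chi> i"
      proof (rule density[of Irr class_rep "\<lambda>\<chi>. {..<class_dim G \<chi>}"])
        fix \<chi> N c assume *: "\<chi> \<in> Irr" "finite N" "N \<subseteq> {..<class_dim G \<chi>}"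
          "complex_space.lc (underlying_space G (class_rep \<chi>)) c (e \<chi>) N = \<zero>\<^bsub>class_rep \<chi>\<^esub>"
        interpret P: simple_gmodule G "class_rep \<chi>" by (rule class_rep_gmodule[OF *(1)])
        show "\<forall>i\<in>N. c i = 0"
          by (rule P.V.indep_family[OF _ e[OF *(1)] *(3)])
             (use * B(1)[OF *(1)] P.V.is_basis_iff[of "B \<chi>"] in auto)
        next
          show "\<not> module_isomorphic CA (class_rep \<psi>) (class_rep \<psi>')" if "\<psi> \<in> Irr" "\<psi>' \<in> Irr" "\<psi> \<noteq> \<psi>'" for \<psi> \<psi>'
            using class_rep_noniso that by blast
      qed (use irr_finite class_rep_simple ec t in auto)
      then show ?thesis by fast
    qed
    show "a = \<zero>\<^bsub>CA\<^esub>" if a: "a \<in> carrier CA"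
      and z: "\<And>\<chi> i. \<chi> \<in> Irr \<Longrightarrow> i < class_dim G \<chi> \<Longrightarrow> a \<odot>\<^bsub>class_rep \<chi>\<^esub> e \<chi> i = \<zero>\<^bsub>class_rep \<chi>\<^esub>" for a
    proof (rule irr_faithful[OF a])
      fix \<chi> u assume *: "\<chi> \<in> Irr" "u \<in> carrier (class_rep \<chi>)"
      interpret P: simple_gmodule G "class_rep \<chi>" by (rule class_rep_gmodule[OF *(1)])
      have Bc: "finite (B \<chi>)" "B \<chi> \<subseteq> carrier (class_rep \<chi>)" using B(1)[OF *(1)] by (auto simp: is_basis_def)
      have "\<forall>x\<in>carrier P.VU. \<exists>c. x = P.V.lc c (\<lambda>b. b) (B \<chi>)" using B(1)[OF *(1)] P.V.is_basis_iff[of "B \<chi>"] by meson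
      from bspec[OF this, of u] * obtain c where "u = P.V.lc c (\<lambda>b. b) (B \<chi>)" by auto
      then have "u = (\<Oplus>\<^bsub>class_rep \<chi>\<^esub>b\<in>B \<chi>. c b \<odot>\<^bsub>P.VU\<^esub> b)"
        using Bc P.V.sc_closed by (simp add: P.V.lc_def P.finsum_VU[symmetric] subset_iff)
      then have "a \<odot>\<^bsub>class_rep \<chi>\<^esub> u = (\<Oplus>\<^bsub>class_rep \<chi>\<^esub>b\<in>B \<chi>. a \<odot>\<^bsub>class_rep \<chi>\<^esub> (c b \<odot>\<^bsub>P.VU\<^esub> b))"
        using add_hom_finsum[OF left_module_smult_hom[OF P.U_module a] P.U_group P.U_group Bc(1),
            of "\<lambda>b. c b \<odot>\<^bsub>P.VU\<^esub> b"] Bc P.V.sc_closed by (simp add: subset_iff)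
      also have "\<dots> = (\<Oplus>\<^bsub>class_rep \<chi>\<^esub>b\<in>B \<chi>. \<zero>\<^bsub>class_rep \<chi>\<^esub>)"
      proof (rule P.U.M.finsum_cong')
        fix b assume b: "b \<in> B \<chi>"
        then obtain i where "i < class_dim G \<chi>" "b = e \<chi> i"
          using e[OF *(1)] by (metis bij_betw_iff_bijections lessThan_iff)
        then have "a \<odot>\<^bsub>class_rep \<chi>\<^esub> b = \<zero>\<^bsub>class_rep \<chi>\<^esub>" using z *(1) by simp
        then show "a \<odot>\<^bsub>class_rep \<chi>\<^esub> (c b \<odot>\<^bsub>P.VU\<^esub> b) = \<zero>\<^bsub>class_rep \<chi>\<^esub>"
          using P.sc_smult_commute[OF a, of b "c b"] b Bc P.V.sc_zero by auto
      qed auto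
      finally show "a \<odot>\<^bsub>class_rep \<chi>\<^esub> u = \<zero>\<^bsub>class_rep \<chi>\<^esub>" by simp
    qed
  qed (rule ec)
qed

end

section \<open>Linear maps out of spaces with a given basis\<close>

text \<open>
  Both the product of the quantum torus and its action on \<open>M\<close> are defined by sums over supports.
  Written as \<open>plin F f\<close>, additivity of such a sum in \<open>f\<close> follows once from additivity of \<open>F\<close> in the
  coefficient.
\<close>

definition plin :: "('k \<Rightarrow> complex \<Rightarrow> 'b::ab_group_add) \<Rightarrow> ('k \<Rightarrow>\<^sub>0 complex) \<Rightarrow> 'b" where
  "plin F f = (\<Sum>k\<in>Poly_Mapping.keys f. F k (Poly_Mapping.lookup f k))"

lemma plin_add:
  assumes "\<And>k a b. F k (a + b) = F k a + F k b"
  shows "plin F (f + g) = plin F f + plin F g"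
proof -
  have "F k 0 = 0" for k using assms[of k 0 0] by simp
  then show ?thesis unfolding plin_def using assms by (intro setsum_keys_plus_distrib) auto
qed

lemma plin_single: "F k 0 = 0 \<Longrightarrow> plin F (Poly_Mapping.single k c) = F k c"
  by (cases "c = 0") (auto simp: plin_def)

lemma plin_add_fun: "plin (\<lambda>k c. F k c + F' k c) f = plin F f + plin F' f"
  by (simp add: plin_def sum.distrib)

abbreviation single where "single \<equiv> Poly_Mapping.single"

lemma single_sum_expand: "(f :: 'k \<Rightarrow>\<^sub>0 complex) = (\<Sum>k\<in>Poly_Mapping.keys f. single k (Poly_Mapping.lookup f k))"
proof (rule poly_mapping_eqI)
  fix i
  have "(\<Sum>k\<in>Poly_Mapping.keys f. Poly_Mapping.lookup (single k (Poly_Mapping.lookup f k)) i)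
    = (\<Sum>k\<in>Poly_Mapping.keys f. if k = i then Poly_Mapping.lookup f i else 0)"
    by (rule sum.cong) (auto simp: lookup_single when_def)
  also have "\<dots> = Poly_Mapping.lookup f i" by (simp add: in_keys_iff)
  finally show "Poly_Mapping.lookup f i = Poly_Mapping.lookup (\<Sum>k\<in>Poly_Mapping.keys f. single k (Poly_Mapping.lookup f k)) i"
    by (simp add: lookup_sum)
qed

lemma pm_induct [consumes 1, case_names zero single add]:
  fixes f :: "'k \<Rightarrow>\<^sub>0 complex"
  assumes "Poly_Mapping.keys f \<subseteq> K" "P 0" "\<And>k c. k \<in> K \<Longrightarrow> P (single k c)"
    "\<And>f g. P f \<Longrightarrow> P g \<Longrightarrow> P (f + g)"
  shows "P f"
proof -
  have "P (\<Sum>k\<in>J. single k (Poly_Mapping.lookup f k))" if "finite J" "J \<subseteq> K" for J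
    using that by (induction J rule: finite_induct) (auto intro: assms)
  from this[OF finite_keys assms(1)] show ?thesis by (simp flip: single_sum_expand)
qed

lemma keys_add_subset: "Poly_Mapping.keys f \<subseteq> K \<Longrightarrow> Poly_Mapping.keys g \<subseteq> K \<Longrightarrow> Poly_Mapping.keys (f + g) \<subseteq> K"
  by (meson Un_least keys_add order.trans)

lemma keys_single_subset: "k \<in> K \<Longrightarrow> Poly_Mapping.keys (single k c) \<subseteq> K"
  by simp

lemma keys_plin_subset:
  assumes "\<And>k. k \<in> Poly_Mapping.keys f \<Longrightarrow> Poly_Mapping.keys (F k (Poly_Mapping.lookup f k)) \<subseteq> K"
  shows "Poly_Mapping.keys (plin F f) \<subseteq> K"
  unfolding plin_def using keys_sum[of "\<lambda>k. F k (Poly_Mapping.lookup f k)" "Poly_Mapping.keys f"] assms by fast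

lemma push_plin: "push g p = plin (\<lambda>k c. single (g k) c) p"
  by (simp add: push_def plin_def)

lemma push_add: "push g (p + p') = push g p + push g p'"
  unfolding push_plin by (rule plin_add) (simp add: single_add)

lemma push_single: "push g (single k c) = single (g k) c"
  unfolding push_plin by (rule plin_single) simp

lemma keys_push: "Poly_Mapping.keys f \<subseteq> K \<Longrightarrow> g ` K \<subseteq> K' \<Longrightarrow> Poly_Mapping.keys (push g f) \<subseteq> K'"
  unfolding push_plin by (intro keys_plin_subset keys_single_subset) blast

lemma pm_group:
  fixes R :: "('k \<Rightarrow>\<^sub>0 complex, 'm) ring_scheme"
  assumes "carrier R = {f. Poly_Mapping.keys f \<subseteq> K}" "add R = (+)" "zero R = 0"
  shows "abelian_group R"
proof (rule abelian_groupI)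
  show "\<exists>y\<in>carrier R. y \<oplus>\<^bsub>R\<^esub> x = \<zero>\<^bsub>R\<^esub>" if "x \<in> carrier R" for x
    using that assms by (intro bexI[of _ "- x"]) auto
qed (simp_all add: assms keys_add_subset add_ac)

text \<open>
  Additive maps are compared on all multiples \<open>c e\<^sub>k\<close> of basis vectors, since they need not be
  complex linear.
\<close>

lemma pm_hom_eqI:
  fixes R :: "('k \<Rightarrow>\<^sub>0 complex, 'm) ring_scheme"
  assumes R: "carrier R = {f. Poly_Mapping.keys f \<subseteq> K}" "add R = (+)" "zero R = 0"
    and f: "add_hom R Q f" and g: "add_hom R Q g" and Q: "abelian_group Q"
    and eq: "\<And>k c. k \<in> K \<Longrightarrow> f (single k c) = g (single k c)" and x: "x \<in> carrier R"
  shows "f x = g x"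
proof -
  have "Poly_Mapping.keys x \<subseteq> K" using x R by simp
  then have "Poly_Mapping.keys x \<subseteq> K \<and> f x = g x"
  proof (induction rule: pm_induct)
    case zero
    show ?case using add_hom_zero[OF f pm_group[OF R] Q] add_hom_zero[OF g pm_group[OF R] Q] R by simp
  next
    case (add a b)
    then show ?case using add_hom_add[OF f, of a b] add_hom_add[OF g, of a b] R keys_add_subset[of a K b] by simp
  qed (use eq in auto)
  then show ?thesis by simp
qed

section \<open>Lattices and the Weyl group\<close>

lemma lattice_closed:
  assumes "is_lattice scale V L" "Modules.module scale"
  shows "0 \<in> L" "x \<in> L \<Longrightarrow> y \<in> L \<Longrightarrow> x + y \<in> L" "x \<in> L \<Longrightarrow> - x \<in> L"
proof -
  interpret Modules.module scale by fact
  obtain B where L: "L = range (\<lambda>c :: 'a \<Rightarrow> int. \<Sum>b\<in>B. scale (of_int (c b)) b)"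
    using assms(1) unfolding is_lattice_def by blast
  have "(\<Sum>b\<in>B. scale (of_int ((\<lambda>_. 0 :: int) b)) b) \<in> L" unfolding L by (rule rangeI)
  then show "0 \<in> L" by simp
  have "x + y \<in> L" if xy: "x \<in> L" "y \<in> L" for x y
  proof -
    obtain c where "x = (\<Sum>b\<in>B. scale (of_int (c b)) b)" using xy(1) unfolding L by (rule rangeE)
    moreover obtain d where "y = (\<Sum>b\<in>B. scale (of_int (d b)) b)" using xy(2) unfolding L by (rule rangeE)
    ultimately have "x + y = (\<Sum>b\<in>B. scale (of_int ((\<lambda>b. c b + d b) b)) b)"
      by (simp add: sum.distrib scale_left_distrib)
    then show ?thesis unfolding L by (rule range_eqI[where x = "\<lambda>b. c b + d b"])
  qed
  then show "x \<in> L \<Longrightarrow> y \<in> L \<Longrightarrow> x + y \<in> L" .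
  have "- x \<in> L" if x: "x \<in> L" for x
  proof -
    obtain c where "x = (\<Sum>b\<in>B. scale (of_int (c b)) b)" using x unfolding L by (rule rangeE)
    then have "- x = (\<Sum>b\<in>B. scale (of_int ((\<lambda>b. - c b) b)) b)"
      by (simp add: sum_negf)
    then show ?thesis unfolding L by (rule range_eqI[where x = "\<lambda>b. - c b"])
  qed
  then show "x \<in> L \<Longrightarrow> - x \<in> L" .
qed

lemma dual_module: "Modules.module dual_scale"
  by unfold_locales (auto simp: dual_scale_def fun_eq_iff algebra_simps)

lemma lattice_dual_linear:
  assumes "is_lattice dual_scale dual_space L" "x \<in> L" shows "linear x"
proof -
  interpret D: Modules.module dual_scale by (rule dual_module)
  obtain B where B: "D.span B = dual_space" and L: "L = range (\<lambda>c. \<Sum>b\<in>B. dual_scale (of_int (c b)) b)"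
    using assms(1) unfolding is_lattice_def by blast
  obtain c where "x = (\<Sum>b\<in>B. dual_scale (of_int (c b)) b)" using assms(2) unfolding L by (rule rangeE)
  then have "x \<in> D.span B" by (simp only:) (intro D.span_sum D.span_scale D.span_base)
  then show ?thesis unfolding B by (simp add: dual_space_def)
qed

text \<open>
  A reflection maps the finite set of roots injectively into itself, hence onto; the generated group
  inherits the property.
\<close>

lemma reflections_permute:
  assumes "reduced_root_system \<Delta>" "w \<in> carrier (weyl_group \<Delta>)"
  shows "bij w \<and> linear w \<and> w ` \<Delta> = \<Delta>"
proof -
  have fin: "finite \<Delta>" using assms(1) by (simp add: reduced_root_system_def)
  have gen: "bij h \<and> linear h \<and> h ` \<Delta> = \<Delta>"
    if h0: "h \<in> carrier (BijGroup UNIV) \<inter> {(\<lambda>v. v - f v *\<^sub>R \<alpha>) | \<alpha> f. \<alpha> \<in> \<Delta> \<and> is_coroot \<Delta> \<alpha> f}" for h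
  proof -
    have "bij h" using h0 by (simp add: BijGroup_def Bij_def)
    then obtain \<alpha> f where h: "h = (\<lambda>v. v - f v *\<^sub>R \<alpha>)" "is_coroot \<Delta> \<alpha> f" "bij h"
      using h0 by blast
    have "linear f" using h by (simp add: is_coroot_def)
    then interpret f: linear f .
    have "linear h" unfolding h(1)
      by (rule linearI) (auto simp: f.add f.scale algebra_simps)
    moreover have "h ` \<Delta> \<subseteq> \<Delta>" using h by (simp add: is_coroot_def)
    then have "h ` \<Delta> = \<Delta>"
      using fin h(3) by (intro card_seteq) (auto simp: card_image inj_on_subset[OF bij_is_inj])
    ultimately show ?thesis using h by blast
  qed
  have "w \<in> generate (BijGroup UNIV) (carrier (BijGroup UNIV) \<inter>
     {(\<lambda>v. v - f v *\<^sub>R \<alpha>) | \<alpha> f. \<alpha> \<in> \<Delta> \<and> is_coroot \<Delta> \<alpha> f})"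
    using assms(2) by (simp add: weyl_group_def carrier_subgroup_generated)
  then show ?thesis
  proof (induction rule: generate.induct)
    case one
    then show ?case by (simp add: BijGroup_def linear_id[unfolded id_def] bij_id[unfolded id_def])
  next
    case (incl h)
    then show ?case by (rule gen)
  next
    case (inv h)
    then have h: "bij h" "linear h" "h ` \<Delta> = \<Delta>" using gen by auto
    then have "inv\<^bsub>BijGroup UNIV\<^esub> h = inv_into UNIV h" by (simp add: inv_BijGroup Bij_def fun_eq_iff)
    moreover have "linear (inv_into UNIV h)" proof -
      interpret h: linear h by (rule h)
      have hv: "h (inv_into UNIV h v) = v" for v using h(1) by (simp add: bij_is_surj surj_f_inv_f)
      show ?thesis
        by (intro linearI; rule injD[OF bij_is_inj[OF h(1)]]) (simp_all add: h.add h.scale hv)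
    qed
    moreover have "inv_into UNIV h ` \<Delta> = \<Delta>" using h by (metis bij_is_inj image_inv_f_f)
    ultimately show ?case using h by (simp add: bij_imp_bij_inv)
  next
    case (eng h1 h2)
    then have "h1 \<otimes>\<^bsub>BijGroup UNIV\<^esub> h2 = h1 \<circ> h2" by (simp add: BijGroup_def Bij_def compose_def fun_eq_iff)
    moreover have "(h1 \<circ> h2) ` \<Delta> = \<Delta>" using eng by (simp only: image_comp[symmetric])
    moreover have "bij (h1 \<circ> h2)" by (rule bij_comp) (simp_all only: eng)
    moreover have "linear (h1 \<circ> h2)" by (rule linear_compose) (simp_all only: eng)
    ultimately show ?case by (simp only:)
  qed
qed

section \<open>The quantum torus and its twisted group algebra\<close>

context quantum_torus_setup
begin

abbreviation WG where "WG \<equiv> weyl_group \<Delta>"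
abbreviation W where "W \<equiv> carrier WG"
abbreviation H where "H \<equiv> quantum_torus X Y n s"
abbreviation wi where "wi w \<equiv> inv_into UNIV w"
abbreviation Pq where "Pq x y \<equiv> qpair n s x y"

lemma s_nonzero: "s \<noteq> 0"
  using s_root n_pos q_nonzero by (metis power_0_left not_gr_zero)

lemma X_zero: "0 \<in> X" and X_add: "x \<in> X \<Longrightarrow> x' \<in> X \<Longrightarrow> x + x' \<in> X"
  using lattice_closed[OF X_lattice dual_module] by auto

lemma Y_zero: "0 \<in> Y" and Y_add: "y \<in> Y \<Longrightarrow> y' \<in> Y \<Longrightarrow> y + y' \<in> Y" and Y_neg: "y \<in> Y \<Longrightarrow> - y \<in> Y"
  using lattice_closed[OF Y_lattice] real_vector.module_axioms by auto

lemma X_linear: "x \<in> X \<Longrightarrow> linear x"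
  using lattice_dual_linear[OF X_lattice] .

lemma Pq_nonzero: "Pq x y \<noteq> 0" using s_nonzero by (simp add: qpair_def)

lemma floor_add_Ints: "a \<in> \<int> \<Longrightarrow> \<lfloor>a + b\<rfloor> = \<lfloor>a\<rfloor> + \<lfloor>b :: real\<rfloor>"
  by (auto elim: Ints_cases)

lemma Pq_add_left: "x \<in> X \<Longrightarrow> x' \<in> X \<Longrightarrow> y \<in> Y \<Longrightarrow> Pq (x + x') y = Pq x y * Pq x' y"
  using floor_add_Ints[OF pairing] s_nonzero by (simp add: qpair_def distrib_left power_int_add)

lemma Pq_add_right: "x \<in> X \<Longrightarrow> y \<in> Y \<Longrightarrow> y' \<in> Y \<Longrightarrow> Pq x (y + y') = Pq x y * Pq x y'"
  using floor_add_Ints[OF pairing] s_nonzero linear_add[OF X_linear, of x y y']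
  by (simp add: qpair_def distrib_left power_int_add)

lemma Pq_zero_left: "Pq 0 y = 1" by (simp add: qpair_def)
lemma Pq_zero_right: "x \<in> X \<Longrightarrow> Pq x 0 = 1" using linear_0[OF X_linear, of x] by (simp add: qpair_def)

lemma W_group: "group WG"
  unfolding weyl_group_def by (rule group.group_subgroup_generated[OF group_BijGroup])

lemma W_bij: "w \<in> W \<Longrightarrow> bij w" and W_linear: "w \<in> W \<Longrightarrow> linear w" and W_Delta: "w \<in> W \<Longrightarrow> w ` \<Delta> = \<Delta>"
  using reflections_permute[OF root_system] by blast+

lemma W_mult: "w \<in> W \<Longrightarrow> v \<in> W \<Longrightarrow> w \<otimes>\<^bsub>WG\<^esub> v = w \<circ> v"
proof -
  assume wv: "w \<in> W" "v \<in> W"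
  then have "w \<in> Bij UNIV" "v \<in> Bij UNIV" using W_bij[OF wv(1)] W_bij[OF wv(2)] by (auto simp: Bij_def)
  moreover have "w \<otimes>\<^bsub>WG\<^esub> v = w \<otimes>\<^bsub>BijGroup UNIV\<^esub> v"
    by (simp only: weyl_group_def subgroup_generated_def) simp
  ultimately show ?thesis by (simp add: BijGroup_def compose_def fun_eq_iff)
qed

lemma W_one: "\<one>\<^bsub>WG\<^esub> = id"
  by (simp add: weyl_group_def subgroup_generated_def BijGroup_def fun_eq_iff)

lemma W_inv: "w \<in> W \<Longrightarrow> inv\<^bsub>WG\<^esub> w = wi w"
proof (rule group.inv_equality[OF W_group])
  assume w: "w \<in> W"
  interpret G: group WG by (rule W_group)
  have "w \<circ> inv\<^bsub>WG\<^esub> w = id" using w W_mult[of w "inv\<^bsub>WG\<^esub> w"] by (simp add: W_one)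
  then have "wi w (w (m_inv WG w v)) = wi w v" for v by (metis comp_apply id_apply)
  then have "inv\<^bsub>WG\<^esub> w = wi w" using inv_f_f[OF bij_is_inj[OF W_bij[OF w]]] by auto
  then show "wi w \<in> W" using w G.inv_closed by metis
  then show "wi w \<otimes>\<^bsub>WG\<^esub> w = \<one>\<^bsub>WG\<^esub>" using w W_bij by (simp add: W_mult W_one bij_is_inj)
qed

lemma W_inv_apply: "w \<in> W \<Longrightarrow> w (wi w v) = v" "w \<in> W \<Longrightarrow> wi w (w v) = v"
  using W_bij by (auto simp: bij_is_inj bij_is_surj surj_f_inv_f)

lemma wi_W: "w \<in> W \<Longrightarrow> wi w \<in> W"
  using W_inv group.inv_closed[OF W_group] by metis

text \<open>
  A linear map is determined by its values on the roots, which span, and these form one of the finitely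
  many maps of the roots into themselves.
\<close>

lemma W_finite: "finite W"
proof -
  have fin: "finite \<Delta>" and sp: "span \<Delta> = UNIV"
    using root_system by (simp_all only: reduced_root_system_def)
  have "inj_on (\<lambda>w. restrict w \<Delta>) W"
  proof (rule inj_onI)
    fix v w assume *: "v \<in> W" "w \<in> W" "restrict v \<Delta> = restrict w \<Delta>"
    have eq: "v b = w b" if "b \<in> \<Delta>" for b
      using fun_cong[OF *(3), of b] by (simp only: restrict_apply that if_True)
    have "linear (\<lambda>x. v x - w x)" using * W_linear by (intro linear_compose_sub) auto
    then have "v x - w x = 0" for x
      using linear_eq_0_on_span[of "\<lambda>x. v x - w x" \<Delta> x] eq sp by simp
    then have "v x = w x" for x by simp
    then show "v = w" by (rule ext)
  qed
  moreover have "(\<lambda>w. restrict w \<Delta>) ` W \<subseteq> \<Delta> \<rightarrow>\<^sub>E \<Delta>" using W_Delta by fastforce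
  ultimately show ?thesis using fin by (meson finite_PiE finite_imageD finite_subset)
qed

lemma dual_act_closed: "w \<in> W \<Longrightarrow> x \<in> X \<Longrightarrow> dual_act w x \<in> X" using X_invariant by blast
lemma W_Y: "w \<in> W \<Longrightarrow> y \<in> Y \<Longrightarrow> w y \<in> Y" using Y_invariant by blast
lemma dual_act_add: "dual_act w (x + x') = dual_act w x + dual_act w x'" by (auto simp: dual_act_def)
lemma dual_act_zero: "dual_act w 0 = 0" by (auto simp: dual_act_def)
lemma dual_act_id: "dual_act id x = x" by (auto simp: dual_act_def)
lemma dual_act_comp: "w \<in> W \<Longrightarrow> v \<in> W \<Longrightarrow> dual_act (w \<circ> v) x = dual_act w (dual_act v x)"
  using W_bij by (simp add: dual_act_def o_inv_distrib)
lemma dual_act_wi: "w \<in> W \<Longrightarrow> dual_act (wi w) (dual_act w x) = x" "w \<in> W \<Longrightarrow> dual_act w (dual_act (wi w) x) = x"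
  by (simp_all add: dual_act_def inv_inv_eq fun_eq_iff W_inv_apply W_bij)
lemma Pq_dual_act: "w \<in> W \<Longrightarrow> Pq (dual_act w x) (w y) = Pq x y"
  using W_inv_apply by (simp add: qpair_def dual_act_def)
lemma Pq_dual_act_wi: "w \<in> W \<Longrightarrow> Pq (dual_act (wi w) x) y = Pq x (w y)"
  using W_bij by (simp add: qpair_def dual_act_def inv_inv_eq)

lemma H_carrier: "carrier H = {f. Poly_Mapping.keys f \<subseteq> X \<times> Y}" "add H = (+)" "zero H = 0" "one H = single (0, 0) 1"
  by (auto simp: quantum_torus_def)

lemma H_mult_plin: "f \<otimes>\<^bsub>H\<^esub> g = plin (\<lambda>k a. plin (\<lambda>l b.
    single (fst k + fst l, snd k + snd l) (a * b * inverse (Pq (fst l) (snd k)))) g) f"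
  by (simp add: quantum_torus_def plin_def case_prod_unfold)

lemmas H_group = pm_group[OF H_carrier(1-3)]
lemmas H_hom_eqI = pm_hom_eqI[OF H_carrier(1-3)]

lemma H_mult_single:
  "single (x, y) a \<otimes>\<^bsub>H\<^esub> single (x', y') b = single (x + x', y + y') (a * b * inverse (Pq x' y))"
  unfolding H_mult_plin by (subst plin_single, subst plin_single, simp_all) (simp_all add: plin_def plin_single)

lemma H_mult_add_left: "(f + f') \<otimes>\<^bsub>H\<^esub> g = f \<otimes>\<^bsub>H\<^esub> g + f' \<otimes>\<^bsub>H\<^esub> g"
  unfolding H_mult_plin
  by (rule plin_add) (simp add: distrib_right single_add plin_add_fun)

lemma H_mult_add_right: "g \<otimes>\<^bsub>H\<^esub> (f + f') = g \<otimes>\<^bsub>H\<^esub> f + g \<otimes>\<^bsub>H\<^esub> f'"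
proof -
  define F :: "('h \<Rightarrow> real) \<times> 'h \<Rightarrow> complex \<Rightarrow> ('h \<Rightarrow> real) \<times> 'h \<Rightarrow> complex \<Rightarrow> 'h qtorus"
    where "F k a l b = single (fst k + fst l, snd k + snd l) (a * b * inverse (Pq (fst l) (snd k)))" for k a l b
  have F: "F k a l (b + c) = F k a l b + F k a l c" for k a l b c
    unfolding F_def by (simp only: distrib_left distrib_right single_add)
  have "plin (F k a) (f + f') = plin (F k a) f + plin (F k a) f'" for k a
    by (rule plin_add) (rule F)
  then have "plin (\<lambda>k a. plin (F k a) (f + f')) g = plin (\<lambda>k a. plin (F k a) f) g + plin (\<lambda>k a. plin (F k a) f') g"
    by (simp only: plin_add_fun)
  then show ?thesis unfolding H_mult_plin F_def .
qed

lemma H_mult_closed: "f \<in> carrier H \<Longrightarrow> g \<in> carrier H \<Longrightarrow> f \<otimes>\<^bsub>H\<^esub> g \<in> carrier H"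
  unfolding H_mult_plin H_carrier
  by (intro CollectI keys_plin_subset keys_single_subset) (auto dest!: subsetD intro: X_add Y_add)

lemma H_hom_left: "g \<in> carrier H \<Longrightarrow> add_hom H H (\<lambda>f. f \<otimes>\<^bsub>H\<^esub> g)"
  by (rule add_homI) (auto simp: H_mult_closed H_mult_add_left H_carrier(2))

lemma H_hom_right: "g \<in> carrier H \<Longrightarrow> add_hom H H (\<lambda>f. g \<otimes>\<^bsub>H\<^esub> f)"
  by (rule add_homI) (auto simp: H_mult_closed H_mult_add_right H_carrier(2))

lemma H_single_closed: "x \<in> X \<Longrightarrow> y \<in> Y \<Longrightarrow> single (x, y) a \<in> carrier H"
  by (simp add: H_carrier)

lemma H_one_closed: "\<one>\<^bsub>H\<^esub> \<in> carrier H" by (simp add: H_carrier X_zero Y_zero)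

lemma id_add_hom: "add_hom R R (\<lambda>x. x)" by (simp add: add_hom_def)

lemma H_assoc_single:
  assumes "x \<in> X" "y \<in> Y" "x' \<in> X" "y' \<in> Y" "x'' \<in> X" "y'' \<in> Y"
  shows "single (x, y) a \<otimes>\<^bsub>H\<^esub> single (x', y') b \<otimes>\<^bsub>H\<^esub> single (x'', y'') c
    = single (x, y) a \<otimes>\<^bsub>H\<^esub> (single (x', y') b \<otimes>\<^bsub>H\<^esub> single (x'', y'') c)"
  using assms by (simp add: H_mult_single Pq_add_left Pq_add_right add.assoc mult_ac)

lemma H_one_single: "k \<in> X \<times> Y \<Longrightarrow> \<one>\<^bsub>H\<^esub> \<otimes>\<^bsub>H\<^esub> single k c = single k c"
  by (cases k) (simp add: H_carrier(4) H_mult_single Pq_zero_right)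

lemma H_single_one: "k \<in> X \<times> Y \<Longrightarrow> single k c \<otimes>\<^bsub>H\<^esub> \<one>\<^bsub>H\<^esub> = single k c"
  by (cases k) (simp add: H_carrier(4) H_mult_single Pq_zero_left)

text \<open>
  Associativity and the unit laws are additive in each argument and are checked on monomials.
\<close>

lemma H_ring: "ring H"
proof (rule ringI)
  show "abelian_group H" by (rule H_group)
  have 1: "single k a \<otimes>\<^bsub>H\<^esub> single l b \<otimes>\<^bsub>H\<^esub> h = single k a \<otimes>\<^bsub>H\<^esub> (single l b \<otimes>\<^bsub>H\<^esub> h)"
    if "h \<in> carrier H" "k \<in> X \<times> Y" "l \<in> X \<times> Y" for h k l a b
    by (rule H_hom_eqI[OF H_hom_right add_hom_compose[OF H_hom_right H_hom_right] H_group _ that(1)])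
       (use that in \<open>auto intro!: H_mult_closed H_single_closed H_assoc_single\<close>)
  have 2: "single k a \<otimes>\<^bsub>H\<^esub> g \<otimes>\<^bsub>H\<^esub> h = single k a \<otimes>\<^bsub>H\<^esub> (g \<otimes>\<^bsub>H\<^esub> h)"
    if "g \<in> carrier H" "h \<in> carrier H" "k \<in> X \<times> Y" for g h k a
    by (rule H_hom_eqI[OF add_hom_compose[OF H_hom_right H_hom_left] add_hom_compose[OF H_hom_left H_hom_right] H_group _ that(1)])
       (use that 1 in \<open>auto intro!: H_mult_closed H_single_closed\<close>)
  have 3: "f \<otimes>\<^bsub>H\<^esub> g \<otimes>\<^bsub>H\<^esub> h = f \<otimes>\<^bsub>H\<^esub> (g \<otimes>\<^bsub>H\<^esub> h)"
    if "f \<in> carrier H" "g \<in> carrier H" "h \<in> carrier H" for f g h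
    by (rule H_hom_eqI[OF add_hom_compose[OF H_hom_left H_hom_left] H_hom_left H_group _ that(1)])
       (use that 2 in \<open>auto intro!: H_mult_closed\<close>)
  have l: "\<one>\<^bsub>H\<^esub> \<otimes>\<^bsub>H\<^esub> f = f" if "f \<in> carrier H" for f
    by (rule H_hom_eqI[OF H_hom_right[OF H_one_closed] id_add_hom H_group _ that])
       (rule H_one_single)
  have r: "f \<otimes>\<^bsub>H\<^esub> \<one>\<^bsub>H\<^esub> = f" if "f \<in> carrier H" for f
    by (rule H_hom_eqI[OF H_hom_left[OF H_one_closed] id_add_hom H_group _ that])
       (rule H_single_one)
  show "Group.monoid H" by (rule monoidI) (use 3 l r H_mult_closed H_one_closed in auto)
qed (simp_all add: H_mult_add_left H_mult_add_right H_carrier)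

lemma qact_single: "qtorus_act w (single (x, y) a) = single (dual_act w x, w y) a"
  by (simp add: qtorus_act_def push_single)

lemma qact_closed: "w \<in> W \<Longrightarrow> f \<in> carrier H \<Longrightarrow> qtorus_act w f \<in> carrier H"
  unfolding H_carrier qtorus_act_def
  by (intro CollectI keys_push[of _ "X \<times> Y"]) (auto intro: dual_act_closed W_Y)

lemma qact_hom: "w \<in> W \<Longrightarrow> add_hom H H (qtorus_act w)"
  by (rule add_homI) (simp add: qact_closed, simp add: qtorus_act_def push_add H_carrier(2))

lemma qact_mult:
  assumes w: "w \<in> W" and fg: "f \<in> carrier H" "g \<in> carrier H"
  shows "qtorus_act w (f \<otimes>\<^bsub>H\<^esub> g) = qtorus_act w f \<otimes>\<^bsub>H\<^esub> qtorus_act w g"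
proof -
  note c = H_mult_closed qact_closed[OF w] H_single_closed
  have 0: "qtorus_act w (single (x, y) a \<otimes>\<^bsub>H\<^esub> single (x', y') b) = qtorus_act w (single (x, y) a) \<otimes>\<^bsub>H\<^esub> qtorus_act w (single (x', y') b)"
    for x y a x' y' b
    by (simp add: H_mult_single qact_single dual_act_add linear_add[OF W_linear[OF w]] Pq_dual_act[OF w])
  have 1: "qtorus_act w (single k a \<otimes>\<^bsub>H\<^esub> g) = qtorus_act w (single k a) \<otimes>\<^bsub>H\<^esub> qtorus_act w g" if "k \<in> X \<times> Y" for k a
    by (rule H_hom_eqI[OF add_hom_compose[OF H_hom_right qact_hom[OF w]] add_hom_compose[OF qact_hom[OF w] H_hom_right] H_group _ fg(2)])
       (use that 0 in \<open>auto intro!: c\<close>)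
  show ?thesis
    by (rule H_hom_eqI[OF add_hom_compose[OF H_hom_left qact_hom[OF w]] add_hom_compose[OF qact_hom[OF w] H_hom_left] H_group _ fg(1)])
       (use 1 fg in \<open>auto intro!: c\<close>)
qed

lemma qact_comp:
  assumes "w \<in> W" "v \<in> W" "f \<in> carrier H"
  shows "qtorus_act (w \<otimes>\<^bsub>WG\<^esub> v) f = qtorus_act w (qtorus_act v f)"
proof -
  have wv: "w \<otimes>\<^bsub>WG\<^esub> v \<in> W" using assms group.is_monoid[OF W_group] by (simp add: monoid.m_closed)
  show ?thesis
    by (rule H_hom_eqI[OF qact_hom[OF wv] add_hom_compose[OF qact_hom qact_hom] H_group _ assms(3)])
       (use assms in \<open>auto simp: qact_single W_mult dual_act_comp\<close>)
qed

lemma qact_id: "f \<in> carrier H \<Longrightarrow> qtorus_act \<one>\<^bsub>WG\<^esub> f = f"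
proof -
  assume f: "f \<in> carrier H"
  have one: "\<one>\<^bsub>WG\<^esub> \<in> W" by (rule monoid.one_closed[OF group.is_monoid[OF W_group]])
  show ?thesis
    by (rule H_hom_eqI[OF qact_hom[OF one] id_add_hom H_group _ f])
       (clarify, simp add: W_one qact_single dual_act_id)
qed

text \<open>
  The Weyl group preserves the pairing, hence acts on the quantum torus by ring automorphisms.
\<close>

lemma twisted_WH: "twisted_action H WG qtorus_act"
proof (intro twisted_action.intro twisted_action_axioms.intro H_ring W_group W_finite)
  show "qtorus_act w \<one>\<^bsub>H\<^esub> = \<one>\<^bsub>H\<^esub>" if "w \<in> W" for w
    using linear_0[OF W_linear[OF that]] by (simp add: H_carrier qact_single dual_act_zero)
qed (use qact_closed qact_mult qact_comp qact_id add_hom_add[OF qact_hom] in auto)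

end

section \<open>Coordinates of induced modules\<close>

lemma add_hom_finsum_fun:
  assumes "abelian_group B" "finite I" "\<And>i. i \<in> I \<Longrightarrow> add_hom A B (f i)"
  shows "add_hom A B (\<lambda>x. \<Oplus>\<^bsub>B\<^esub>i\<in>I. f i x)"
proof -
  interpret B: abelian_group B by fact
  note h = assms(3)[unfolded add_hom_def]
  show ?thesis
  proof (rule add_homI)
    fix x assume "x \<in> carrier A"
    then show "(\<Oplus>\<^bsub>B\<^esub>i\<in>I. f i x) \<in> carrier B" using h by (intro B.finsum_closed) auto
  next
    fix x y assume xy: "x \<in> carrier A" "y \<in> carrier A"
    show "(\<Oplus>\<^bsub>B\<^esub>i\<in>I. f i (x \<oplus>\<^bsub>A\<^esub> y)) = (\<Oplus>\<^bsub>B\<^esub>i\<in>I. f i x) \<oplus>\<^bsub>B\<^esub> (\<Oplus>\<^bsub>B\<^esub>i\<in>I. f i y)"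
      by (rule trans[OF B.finsum_cong' B.finsum_addf]) (use h xy in auto)
  qed
qed

context twisted_action
begin

text \<open>
  \<open>A[G]\<close> is a free right \<open>A\<close>-module with basis \<open>1 \<otimes> w\<close>: since
  \<open>(1 \<otimes> w) (a \<otimes> 1) = act w a \<otimes> w\<close>, the coordinate of \<open>f\<close> at \<open>w\<close> is \<open>f w\<close> twisted back by the inverse of
  \<open>w\<close>.
\<close>

lemma induced_coproduct_base:
  assumes B: "left_module A B"
  defines "\<phi> \<equiv> (\<lambda>a. pure_elt A a \<one>\<^bsub>G\<^esub>)"
  obtains p where "add_coproduct (induced_module TA A \<phi> B) (carrier G) (\<lambda>_. B)
    (\<lambda>w. tensor_product.tens A TA (\<lambda>f a. f \<otimes>\<^bsub>TA\<^esub> \<phi> a) B (pure_elt A \<one>\<^bsub>A\<^esub> w)) p"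
proof -
  interpret induction TA A \<phi> B
    by (intro induction.intro induction_axioms.intro TA_ring A.ring_axioms B) (simp add: \<phi>_def pure_closed)
  interpret B: left_module A B by (rule B)
  have cm: "act (inv\<^bsub>G\<^esub> w) ((f \<otimes>\<^bsub>TA\<^esub> \<phi> a) w) = act (inv\<^bsub>G\<^esub> w) (f w) \<otimes>\<^bsub>A\<^esub> a"
    if w: "w \<in> carrier G" and f: "f \<in> carrier TA" and a: "a \<in> carrier A" for w f a
  proof -
    have ev: "add_hom TA A (\<lambda>f. act (inv\<^bsub>G\<^esub> w) (f w))"
      using w by (auto simp: add_hom_def TA_add TA_closed act_closed act_add)
    have am: "add_hom A A (\<lambda>b. b \<otimes>\<^bsub>A\<^esub> a)" using a by (auto simp: add_hom_def A.l_distr)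
    have pa: "\<phi> a \<in> carrier TA" using a by (simp add: phi_closed)
    show ?thesis
    proof (rule TA_hom_eqI[OF add_hom_compose[OF mult_hom_left[OF pa] ev] add_hom_compose[OF ev am] A.abelian_group_axioms _ f])
      fix b u assume bu: "b \<in> carrier A" "u \<in> carrier G"
      then have "pure_elt A b u \<otimes>\<^bsub>TA\<^esub> \<phi> a = pure_elt A (b \<otimes>\<^bsub>A\<^esub> act u a) u"
        using a by (simp add: \<phi>_def pure_mult)
      then show "act (inv\<^bsub>G\<^esub> w) ((pure_elt A b u \<otimes>\<^bsub>TA\<^esub> \<phi> a) w) = act (inv\<^bsub>G\<^esub> w) (pure_elt A b u w) \<otimes>\<^bsub>A\<^esub> a"
        using bu a w by (auto simp: pure_elt_def act_mult act_closed act_comp[symmetric] act_id act_zero)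
    qed
  qed
  have span: "f \<in> add_span TA {pure_elt A \<one>\<^bsub>A\<^esub> w \<otimes>\<^bsub>TA\<^esub> \<phi> t |w t. w \<in> carrier G \<and> t \<in> carrier A}"
    if f: "f \<in> carrier TA" for f
  proof (rule add_span_trans[OF _ TA_span[OF f]])
    fix x assume "x \<in> pures"
    then obtain a w where aw: "x = pure_elt A a w" "a \<in> carrier A" "w \<in> carrier G" by blast
    have "x = pure_elt A \<one>\<^bsub>A\<^esub> w \<otimes>\<^bsub>TA\<^esub> \<phi> (act (inv\<^bsub>G\<^esub> w) a)"
      using aw by (simp add: \<phi>_def pure_mult act_closed act_comp[symmetric] act_id)
    then show "x \<in> add_span TA {pure_elt A \<one>\<^bsub>A\<^esub> w \<otimes>\<^bsub>TA\<^esub> \<phi> t |w t. w \<in> carrier G \<and> t \<in> carrier A}"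
      using aw act_closed[of "inv\<^bsub>G\<^esub> w" a] by (intro add_span.base) blast
  qed
  show ?thesis
  proof (rule coproduct_of_free[where I = "carrier G" and r = "pure_elt A \<one>\<^bsub>A\<^esub>" and act = act0
        and c = "\<lambda>w f. act (inv\<^bsub>G\<^esub> w) (f w)"])
    show "act (inv\<^bsub>G\<^esub> i) ((a \<oplus>\<^bsub>TA\<^esub> a') i) \<odot>\<^bsub>B\<^esub> b = act (inv\<^bsub>G\<^esub> i) (a i) \<odot>\<^bsub>B\<^esub> b \<oplus>\<^bsub>B\<^esub> act (inv\<^bsub>G\<^esub> i) (a' i) \<odot>\<^bsub>B\<^esub> b"
      if "i \<in> carrier G" "a \<in> carrier TA" "a' \<in> carrier TA" "b \<in> carrier B" for i a a' b
      using that by (simp add: TA_add act_add TA_closed act_closed B.smult_l_distr)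
    show "act (inv\<^bsub>G\<^esub> i) ((a \<otimes>\<^bsub>TA\<^esub> \<phi> t) i) \<odot>\<^bsub>B\<^esub> b = act (inv\<^bsub>G\<^esub> i) (a i) \<odot>\<^bsub>B\<^esub> (t \<odot>\<^bsub>B\<^esub> b)"
      if "i \<in> carrier G" "a \<in> carrier TA" "t \<in> carrier A" "b \<in> carrier B" for i a t b
      using that by (simp add: cm TA_closed act_closed B.smult_assoc)
    show "act (inv\<^bsub>G\<^esub> i) (pure_elt A \<one>\<^bsub>A\<^esub> i i) \<odot>\<^bsub>B\<^esub> b = b" if "i \<in> carrier G" "b \<in> carrier B" for i b
      using that by (simp add: pure_elt_def act_unit B.smult_one)
    show "act (inv\<^bsub>G\<^esub> i) (pure_elt A \<one>\<^bsub>A\<^esub> j i) \<odot>\<^bsub>B\<^esub> b = \<zero>\<^bsub>B\<^esub>"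
      if "i \<in> carrier G" "j \<in> carrier G" "i \<noteq> j" "b \<in> carrier B" for i j b
      using that left_module_zero_smult[OF B] by (simp add: pure_elt_def act_zero)
    show "t \<odot>\<^bsub>B\<^esub> (b \<oplus>\<^bsub>B\<^esub> b') = t \<odot>\<^bsub>B\<^esub> b \<oplus>\<^bsub>B\<^esub> t \<odot>\<^bsub>B\<^esub> b'"
      if "t \<in> carrier A" "b \<in> carrier B" "b' \<in> carrier B" for t b b'
      using that by (rule B.smult_r_distr)
  next
    fix p assume "add_coproduct (T act0) (carrier G) (\<lambda>_. B) (\<lambda>i. tens (pure_elt A \<one>\<^bsub>A\<^esub> i)) p"
    then show thesis using that[of p] by (simp add: Ind_eq)
  qed (use span in \<open>auto simp: pure_closed TA_closed act_closed\<close>)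
qed

end

context twisted_subgroup
begin

lemma transversal_exists:
  "\<exists>C. C \<subseteq> carrier G \<and> (\<forall>w\<in>carrier G. \<exists>c\<in>C. inv\<^bsub>G\<^esub> c \<otimes>\<^bsub>G\<^esub> w \<in> H) \<and>
    (\<forall>c\<in>C. \<forall>c'\<in>C. inv\<^bsub>G\<^esub> c \<otimes>\<^bsub>G\<^esub> c' \<in> H \<longrightarrow> c = c')"
proof -
  have trans: "inv\<^bsub>G\<^esub> a \<otimes>\<^bsub>G\<^esub> c \<in> H"
    if "inv\<^bsub>G\<^esub> a \<otimes>\<^bsub>G\<^esub> b \<in> H" "inv\<^bsub>G\<^esub> b \<otimes>\<^bsub>G\<^esub> c \<in> H" "a \<in> carrier G" "b \<in> carrier G" "c \<in> carrier G" for a b c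
  proof -
    have "inv\<^bsub>G\<^esub> a \<otimes>\<^bsub>G\<^esub> b \<otimes>\<^bsub>G\<^esub> (inv\<^bsub>G\<^esub> b \<otimes>\<^bsub>G\<^esub> c) \<in> H"
      by (rule subgroup.m_closed[OF H_subgroup that(1,2)])
    moreover have "inv\<^bsub>G\<^esub> a \<otimes>\<^bsub>G\<^esub> b \<otimes>\<^bsub>G\<^esub> (inv\<^bsub>G\<^esub> b \<otimes>\<^bsub>G\<^esub> c) = inv\<^bsub>G\<^esub> a \<otimes>\<^bsub>G\<^esub> (b \<otimes>\<^bsub>G\<^esub> inv\<^bsub>G\<^esub> b \<otimes>\<^bsub>G\<^esub> c)"
      using that by (simp only: G.m_assoc G.inv_closed G.m_closed)
    ultimately show ?thesis using that by (simp add: G.r_inv)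
  qed
  have sym: "inv\<^bsub>G\<^esub> b \<otimes>\<^bsub>G\<^esub> a \<in> H" if "inv\<^bsub>G\<^esub> a \<otimes>\<^bsub>G\<^esub> b \<in> H" "a \<in> carrier G" "b \<in> carrier G" for a b
    using subgroup.m_inv_closed[OF H_subgroup that(1)] that by (simp add: G.inv_mult_group)
  define rep where "rep w = (SOME v. v \<in> carrier G \<and> inv\<^bsub>G\<^esub> v \<otimes>\<^bsub>G\<^esub> w \<in> H)" for w
  have rep: "rep w \<in> carrier G" "inv\<^bsub>G\<^esub> (rep w) \<otimes>\<^bsub>G\<^esub> w \<in> H" if "w \<in> carrier G" for w
  proof -
    have "w \<in> carrier G \<and> inv\<^bsub>G\<^esub> w \<otimes>\<^bsub>G\<^esub> w \<in> H" using that H_one by (simp add: G.l_inv)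
    then have "rep w \<in> carrier G \<and> inv\<^bsub>G\<^esub> (rep w) \<otimes>\<^bsub>G\<^esub> w \<in> H" unfolding rep_def by (rule someI)
    then show "rep w \<in> carrier G" "inv\<^bsub>G\<^esub> (rep w) \<otimes>\<^bsub>G\<^esub> w \<in> H" by auto
  qed
  have rep_eq: "rep w = rep w'" if "inv\<^bsub>G\<^esub> w \<otimes>\<^bsub>G\<^esub> w' \<in> H" "w \<in> carrier G" "w' \<in> carrier G" for w w'
  proof -
    have "(v \<in> carrier G \<and> inv\<^bsub>G\<^esub> v \<otimes>\<^bsub>G\<^esub> w \<in> H) \<longleftrightarrow> (v \<in> carrier G \<and> inv\<^bsub>G\<^esub> v \<otimes>\<^bsub>G\<^esub> w' \<in> H)" for v
      using trans[of v w w'] trans[of v w' w] sym[of w w'] that by blast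
    then show ?thesis unfolding rep_def by simp
  qed
  have "c = c'" if c: "c \<in> rep ` carrier G" "c' \<in> rep ` carrier G" "inv\<^bsub>G\<^esub> c \<otimes>\<^bsub>G\<^esub> c' \<in> H" for c c'
  proof -
    obtain w w' where w: "c = rep w" "w \<in> carrier G" "c' = rep w'" "w' \<in> carrier G" using c by blast
    have "inv\<^bsub>G\<^esub> c \<otimes>\<^bsub>G\<^esub> w' \<in> H" using trans[of c c' w'] c(3) rep w by simp
    then have "inv\<^bsub>G\<^esub> w \<otimes>\<^bsub>G\<^esub> w' \<in> H" using trans[of w c w'] sym[of c w] rep w by simp
    then show ?thesis using rep_eq w by simp
  qed
  then show ?thesis using rep by (intro exI[of _ "rep ` carrier G"]) blast
qed

text \<open>
  \<open>A[G]\<close> is a free right \<open>A[H]\<close>-module with basis \<open>1 \<otimes> c\<close>, where \<open>c\<close> runs over a transversal of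
  \<open>G / H\<close>; the coordinates are \<open>coef c\<close>.
\<close>

lemma induced_coproduct:
  assumes B: "left_module H.TA B"
    and C: "C \<subseteq> carrier G" "\<And>w. w \<in> carrier G \<Longrightarrow> \<exists>c\<in>C. inv\<^bsub>G\<^esub> c \<otimes>\<^bsub>G\<^esub> w \<in> H"
      "\<And>c c'. c \<in> C \<Longrightarrow> c' \<in> C \<Longrightarrow> inv\<^bsub>G\<^esub> c \<otimes>\<^bsub>G\<^esub> c' \<in> H \<Longrightarrow> c = c'"
  obtains p where "add_coproduct (induced_module TA H.TA id B) C (\<lambda>_. B)
    (\<lambda>w. tensor_product.tens H.TA TA (\<lambda>f s. f \<otimes>\<^bsub>TA\<^esub> id s) B (pure_elt A \<one>\<^bsub>A\<^esub> w)) p"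
proof -
  interpret induction TA H.TA id B
    by (intro induction.intro induction_axioms.intro TA_ring H.TA_ring B) (simp add: TAH_sub)
  interpret B: left_module H.TA B by (rule B)
  have span: "f \<in> add_span TA {pure_elt A \<one>\<^bsub>A\<^esub> w \<otimes>\<^bsub>TA\<^esub> id t |w t. w \<in> C \<and> t \<in> carrier H.TA}"
    if f: "f \<in> carrier TA" for f
  proof (rule add_span_trans[OF _ TA_span[OF f]])
    fix x assume "x \<in> pures"
    then obtain a w where aw: "x = pure_elt A a w" "a \<in> carrier A" "w \<in> carrier G" by blast
    then obtain c where c: "c \<in> C" "inv\<^bsub>G\<^esub> c \<otimes>\<^bsub>G\<^esub> w \<in> H" using C(2) by blast
    have cG: "c \<in> carrier G" using c C(1) by blast
    let ?t = "pure_elt A (act (inv\<^bsub>G\<^esub> c) a) (inv\<^bsub>G\<^esub> c \<otimes>\<^bsub>G\<^esub> w)"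
    have "c \<otimes>\<^bsub>G\<^esub> (inv\<^bsub>G\<^esub> c \<otimes>\<^bsub>G\<^esub> w) = w" using cG aw by (metis G.inv_closed G.m_assoc G.r_inv G.l_one)
    then have "x = pure_elt A \<one>\<^bsub>A\<^esub> c \<otimes>\<^bsub>TA\<^esub> id ?t"
      using aw cG by (simp add: pure_mult act_closed act_comp[symmetric] act_id)
    moreover have "?t \<in> carrier H.TA" using H.pure_closed[of "act (inv\<^bsub>G\<^esub> c) a"] aw cG c act_closed by simp
    ultimately show "x \<in> add_span TA {pure_elt A \<one>\<^bsub>A\<^esub> w \<otimes>\<^bsub>TA\<^esub> id t |w t. w \<in> C \<and> t \<in> carrier H.TA}"
      using c by (intro add_span.base) blast
  qed
  have CG: "c \<in> carrier G" if "c \<in> C" for c using that C(1) by blast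
  have coef_closed: "coef i a \<in> carrier H.TA" if "i \<in> C" "a \<in> carrier TA" for i a
    using add_hom_closed[OF coef_hom[OF CG]] that by blast
  show ?thesis
  proof (rule coproduct_of_free[where I = C and r = "pure_elt A \<one>\<^bsub>A\<^esub>" and act = act0 and c = coef])
    show "coef i (a \<oplus>\<^bsub>TA\<^esub> a') \<odot>\<^bsub>B\<^esub> b = coef i a \<odot>\<^bsub>B\<^esub> b \<oplus>\<^bsub>B\<^esub> coef i a' \<odot>\<^bsub>B\<^esub> b"
      if "i \<in> C" "a \<in> carrier TA" "a' \<in> carrier TA" "b \<in> carrier B" for i a a' b
      using that by (simp add: add_hom_add[OF coef_hom[OF CG]] coef_closed B.smult_l_distr)
    show "coef i (a \<otimes>\<^bsub>TA\<^esub> id t) \<odot>\<^bsub>B\<^esub> b = coef i a \<odot>\<^bsub>B\<^esub> (t \<odot>\<^bsub>B\<^esub> b)"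
      if "i \<in> C" "a \<in> carrier TA" "t \<in> carrier H.TA" "b \<in> carrier B" for i a t b
      using that by (simp add: coef_mult CG coef_closed B.smult_assoc)
    show "coef i (pure_elt A \<one>\<^bsub>A\<^esub> i) \<odot>\<^bsub>B\<^esub> b = b" if "i \<in> C" "b \<in> carrier B" for i b
      using that B.smult_one[of b] by (simp add: coef_pure CG G.l_inv H_one act_unit H.TA_one)
    show "coef i (pure_elt A \<one>\<^bsub>A\<^esub> j) \<odot>\<^bsub>B\<^esub> b = \<zero>\<^bsub>B\<^esub>"
      if "i \<in> C" "j \<in> C" "i \<noteq> j" "b \<in> carrier B" for i j b
      using that left_module_zero_smult[OF B] C(3)[of i j] by (auto simp: coef_pure CG)
    show "t \<odot>\<^bsub>B\<^esub> (b \<oplus>\<^bsub>B\<^esub> b') = t \<odot>\<^bsub>B\<^esub> b \<oplus>\<^bsub>B\<^esub> t \<odot>\<^bsub>B\<^esub> b'"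
      if "t \<in> carrier H.TA" "b \<in> carrier B" "b' \<in> carrier B" for t b b'
      using that by (rule B.smult_r_distr)
  next
    fix p assume "add_coproduct (T act0) C (\<lambda>_. B) (\<lambda>i. tens (pure_elt A \<one>\<^bsub>A\<^esub> i)) p"
    then show thesis using that[of p] by (simp add: Ind_eq)
  qed (use span CG in \<open>auto simp: pure_closed coef_closed\<close>)
qed

end

section \<open>The module M of the weights in one coset\<close>

locale weight_setup = quantum_torus_setup \<Delta> X Y n q s
  for \<Delta> :: "'h::real_vector set" and X :: "('h \<Rightarrow> real) set" and Y :: "'h set"
    and n :: nat and q s :: complex +
  fixes lam :: "('h \<Rightarrow> real) \<Rightarrow> complex"
  assumes lam_torus: "lam \<in> carrier (torus X)"
begin

abbreviation Tor where "Tor \<equiv> carrier (torus X)"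
abbreviation C where "C \<equiv> q_coset X Y n s lam"
abbreviation tm where "tm \<mu> y \<equiv> \<mu> \<otimes>\<^bsub>torus X\<^esub> q_elt X n s y"
abbreviation ta where "ta \<equiv> torus_act X"
abbreviation IG where "IG \<equiv> isotropy_group \<Delta> X Y n s lam"

lemma Tor_iff: "\<mu> \<in> Tor \<longleftrightarrow> \<mu> \<in> extensional X \<and> (\<forall>x\<in>X. \<mu> x \<noteq> 0) \<and> (\<forall>x\<in>X. \<forall>x'\<in>X. \<mu> (x + x') = \<mu> x * \<mu> x')"
  by (simp add: torus_def)

lemma tm_eq: "tm \<mu> y = (\<lambda>x\<in>X. \<mu> x * Pq x y)"
  by (auto simp: torus_def q_elt_def)

lemma tm_apply: "x \<in> X \<Longrightarrow> tm \<mu> y x = \<mu> x * Pq x y" by (simp add: tm_eq)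

lemma tm_Tor: "\<mu> \<in> Tor \<Longrightarrow> y \<in> Y \<Longrightarrow> tm \<mu> y \<in> Tor"
  unfolding tm_eq by (simp add: Tor_iff Pq_nonzero X_add Pq_add_left)

lemma tm_tm: "y \<in> Y \<Longrightarrow> y' \<in> Y \<Longrightarrow> tm (tm \<mu> y) y' = tm \<mu> (y + y')"
  unfolding tm_eq by (rule restrict_ext) (simp add: Pq_add_right)

lemma tm_zero: "\<mu> \<in> Tor \<Longrightarrow> tm \<mu> 0 = \<mu>"
  unfolding tm_eq by (rule extensionalityI[of _ X]) (simp_all add: Tor_iff Pq_zero_right)

lemma Tor_zero: "\<mu> \<in> Tor \<Longrightarrow> \<mu> 0 = 1"
proof -
  assume "\<mu> \<in> Tor"
  then have "\<mu> (0 + 0) = \<mu> 0 * \<mu> 0" "\<mu> 0 \<noteq> 0" using X_zero unfolding Tor_iff by blast+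
  then show ?thesis by simp
qed

lemma C_eq: "C = tm lam ` Y"
  unfolding q_coset_def r_coset_def by (auto simp: torus_def q_elt_def image_iff mult.commute)

lemma C_Tor: "\<mu> \<in> C \<Longrightarrow> \<mu> \<in> Tor"
  unfolding C_eq using tm_Tor[OF lam_torus] by blast

lemma lam_C: "lam \<in> C"
  unfolding C_eq using tm_zero[OF lam_torus] Y_zero by force

lemma C_tm: "\<mu> \<in> C \<Longrightarrow> y \<in> Y \<Longrightarrow> tm \<mu> y \<in> C"
  unfolding C_eq using tm_tm Y_add by blast

lemma C_trans: assumes "\<mu> \<in> C" "\<nu> \<in> C" shows "\<exists>y\<in>Y. \<nu> = tm \<mu> y"
proof -
  obtain y y' where y: "y \<in> Y" "\<mu> = tm lam y" "y' \<in> Y" "\<nu> = tm lam y'" using assms unfolding C_eq by blast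
  have "- y + y' \<in> Y" using y Y_add Y_neg by blast
  moreover have "tm \<mu> (- y + y') = \<nu>" unfolding y(2) using y \<open>- y + y' \<in> Y\<close> by (simp add: tm_tm)
  ultimately show ?thesis by metis
qed

lemma ta_apply: "x \<in> X \<Longrightarrow> ta w \<mu> x = \<mu> (dual_act (wi w) x)" by (simp add: torus_act_def)

lemma ta_Tor: "w \<in> W \<Longrightarrow> \<mu> \<in> Tor \<Longrightarrow> ta w \<mu> \<in> Tor"
  unfolding torus_act_def
  by (simp add: Tor_iff X_add dual_act_add dual_act_closed[OF wi_W])

lemma ta_tm: "w \<in> W \<Longrightarrow> ta w (tm \<mu> y) = tm (ta w \<mu>) (w y)"
  unfolding torus_act_def tm_eq
  by (rule restrict_ext) (simp add: dual_act_closed[OF wi_W] Pq_dual_act_wi)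

lemma ta_comp: "w \<in> W \<Longrightarrow> v \<in> W \<Longrightarrow> ta (w \<circ> v) \<mu> = ta w (ta v \<mu>)"
  unfolding torus_act_def
  by (rule restrict_ext)
     (simp add: dual_act_closed[OF wi_W] o_inv_distrib W_bij dual_act_comp wi_W)

lemma ta_id: "\<mu> \<in> Tor \<Longrightarrow> ta id \<mu> = \<mu>"
  unfolding torus_act_def by (rule extensionalityI[of _ X]) (simp_all add: Tor_iff dual_act_id)

lemma ta_wi: "w \<in> W \<Longrightarrow> \<mu> \<in> Tor \<Longrightarrow> ta (wi w) (ta w \<mu>) = \<mu>" "w \<in> W \<Longrightarrow> \<mu> \<in> Tor \<Longrightarrow> ta w (ta (wi w) \<mu>) = \<mu>"
  using ta_comp[of "wi w" w \<mu>] ta_comp[of w "wi w" \<mu>] ta_id[of \<mu>] wi_W[of w] W_bij[of w]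
  by (simp_all add: bij_is_inj bij_is_surj surj_iff[symmetric] o_def inv_f_f surj_f_inv_f id_def)

text \<open>
  The isotropy group as a subset of \<open>W\<close>; \<open>C\<close> is the orbit \<open>\<lambda> q\<^sup>Y\<close> and \<open>tm \<mu> y\<close> is \<open>\<mu> q\<^sup>y\<close>.
\<close>

definition Gs where "Gs = {w \<in> W. ta w ` C = C}"

lemma IG_eq: "IG = WG\<lparr>carrier := Gs\<rparr>"
  by (simp add: isotropy_group_def stabilizer_def Gs_def)

lemma Gs_W: "w \<in> Gs \<Longrightarrow> w \<in> W" by (simp add: Gs_def)
lemma Gs_C: "w \<in> Gs \<Longrightarrow> \<mu> \<in> C \<Longrightarrow> ta w \<mu> \<in> C" unfolding Gs_def by blast

text \<open>
  The coset \<open>C\<close> is \<open>\<mu> q\<^sup>Y\<close> for each of its points \<open>\<mu>\<close>, and \<open>w\<close> preserves \<open>Y\<close>; so \<open>w\<close> preserves \<open>C\<close>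
  already if it sends one point of \<open>C\<close> into \<open>C\<close>.
\<close>

lemma Gs_criterion:
  assumes w: "w \<in> W" and \<mu>: "\<mu> \<in> C" "ta w \<mu> \<in> C" shows "w \<in> Gs"
proof -
  have orbit: "C = tm \<nu> ` Y" if "\<nu> \<in> C" for \<nu>
    using C_trans[OF that] C_tm[OF that] by blast
  have "ta w ` C = (\<lambda>y. tm (ta w \<mu>) (w y)) ` Y"
    unfolding orbit[OF \<mu>(1)] image_image by (simp only: ta_tm[OF w])
  also have "\<dots> = tm (ta w \<mu>) ` (w ` Y)" by (simp only: image_image)
  also have "\<dots> = C" unfolding Y_invariant[OF w] using orbit[OF \<mu>(2)] by simp
  finally show ?thesis using w by (simp add: Gs_def)
qed

lemma Gs_subgroup: "subgroup Gs WG"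
proof -
  interpret G: group WG by (rule W_group)
  show ?thesis
  proof (rule G.subgroupI)
    show "Gs \<subseteq> W" by (simp add: Gs_def)
    have "\<one>\<^bsub>WG\<^esub> \<in> Gs"
      by (rule Gs_criterion[OF G.one_closed lam_C]) (simp only: W_one ta_id[OF lam_torus] lam_C)
    then show "Gs \<noteq> {}" by blast
    fix w assume w: "w \<in> Gs"
    note wW = Gs_W[OF w]
    have "ta (inv\<^bsub>WG\<^esub> w) (ta w lam) = lam" unfolding W_inv[OF wW] by (rule ta_wi(1)[OF wW lam_torus])
    then show "inv\<^bsub>WG\<^esub> w \<in> Gs"
      by (intro Gs_criterion[OF G.inv_closed[OF wW] Gs_C[OF w lam_C]]) (simp only: lam_C)
    fix v assume v: "v \<in> Gs"
    have "ta (w \<otimes>\<^bsub>WG\<^esub> v) lam \<in> C"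
      unfolding W_mult[OF wW Gs_W[OF v]] ta_comp[OF wW Gs_W[OF v]] by (intro Gs_C w v lam_C)
    then show "w \<otimes>\<^bsub>WG\<^esub> v \<in> Gs"
      by (intro Gs_criterion[OF G.m_closed[OF wW Gs_W[OF v]] lam_C])
  qed
qed

abbreviation M where "M \<equiv> M_mod X Y n s lam"

lemma M_carrier: "carrier M = {f. Poly_Mapping.keys f \<subseteq> C}" "add M = (+)" "zero M = 0"
  by (auto simp: M_mod_def)

lemmas M_group = pm_group[OF M_carrier]
lemmas M_hom_eqI = pm_hom_eqI[OF M_carrier]

lemma M_smult_plin: "h \<odot>\<^bsub>M\<^esub> m = plin (\<lambda>k a. plin (\<lambda>\<mu> b. single (tm \<mu> (snd k)) (a * b * tm \<mu> (snd k) (fst k))) m) h"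
  by (simp add: M_mod_def plin_def case_prod_unfold Let_def)

lemma M_smult_single: "single (x, y) a \<odot>\<^bsub>M\<^esub> single \<mu> b = single (tm \<mu> y) (a * b * tm \<mu> y x)"
proof -
  have z: "plin (\<lambda>\<mu> b. single (tm \<mu> y) (0 * b * tm \<mu> y x)) (single \<mu> b) = 0"
    by (simp add: plin_def)
  show ?thesis unfolding M_smult_plin
    by (subst plin_single) (simp_all only: fst_conv snd_conv z, subst plin_single, simp_all)
qed

lemma M_smult_add_left: "(h + h') \<odot>\<^bsub>M\<^esub> m = h \<odot>\<^bsub>M\<^esub> m + h' \<odot>\<^bsub>M\<^esub> m"
  unfolding M_smult_plin by (rule plin_add) (simp only: distrib_right single_add plin_add_fun)

lemma M_smult_add_right: "h \<odot>\<^bsub>M\<^esub> (m + m') = h \<odot>\<^bsub>M\<^esub> m + h \<odot>\<^bsub>M\<^esub> m'"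
proof -
  define F where "F k a \<mu> b = single (tm \<mu> (snd k)) (a * b * tm \<mu> (snd k) (fst k))"
    for k :: "('h \<Rightarrow> real) \<times> 'h" and a :: complex and \<mu> b
  have F: "F k a l (b + c) = F k a l b + F k a l c" for k a l b c
    unfolding F_def by (simp only: distrib_left distrib_right single_add)
  have "plin (F k a) (m + m') = plin (F k a) m + plin (F k a) m'" for k a
    by (rule plin_add) (rule F)
  then have "plin (\<lambda>k a. plin (F k a) (m + m')) h = plin (\<lambda>k a. plin (F k a) m) h + plin (\<lambda>k a. plin (F k a) m') h"
    by (simp only: plin_add_fun)
  then show ?thesis unfolding M_smult_plin F_def .
qed

lemma M_smult_closed: "h \<in> carrier H \<Longrightarrow> m \<in> carrier M \<Longrightarrow> h \<odot>\<^bsub>M\<^esub> m \<in> carrier M"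
  unfolding M_smult_plin H_carrier M_carrier
  by (intro CollectI keys_plin_subset keys_single_subset) (auto dest!: subsetD intro: C_tm)

lemma M_hom_left: "m \<in> carrier M \<Longrightarrow> add_hom H M (\<lambda>h. h \<odot>\<^bsub>M\<^esub> m)"
  by (rule add_homI) (simp_all add: M_smult_closed M_smult_add_left H_carrier(2) M_carrier(2))

lemma M_hom_right: "h \<in> carrier H \<Longrightarrow> add_hom M M (\<lambda>m. h \<odot>\<^bsub>M\<^esub> m)"
  by (rule add_homI) (simp_all add: M_smult_closed M_smult_add_right M_carrier(2))

lemma M_single_closed: "\<mu> \<in> C \<Longrightarrow> single \<mu> b \<in> carrier M" by (simp add: M_carrier)

lemma M_assoc_single:
  assumes "x \<in> X" "y \<in> Y" "x' \<in> X" "y' \<in> Y" "\<mu> \<in> C"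
  shows "single (x, y) a \<otimes>\<^bsub>H\<^esub> single (x', y') b \<odot>\<^bsub>M\<^esub> single \<mu> c = single (x, y) a \<odot>\<^bsub>M\<^esub> (single (x', y') b \<odot>\<^bsub>M\<^esub> single \<mu> c)"
proof -
  have nu: "tm (tm \<mu> y') y = tm \<mu> (y + y')" using assms by (simp add: tm_tm add.commute)
  have T: "tm \<mu> (y + y') \<in> Tor" using assms C_Tor C_tm Y_add by blast
  have "tm \<mu> (y + y') x' = tm \<mu> y' x' * Pq x' y"
    using assms by (simp add: tm_apply Pq_add_right)
  moreover have "tm \<mu> (y + y') (x + x') = tm \<mu> (y + y') x * tm \<mu> (y + y') x'"
    using T assms by (simp add: Tor_iff)
  ultimately have "a * b * inverse (Pq x' y) * c * tm \<mu> (y + y') (x + x') = a * (b * c * tm \<mu> y' x') * tm \<mu> (y + y') x"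
    using Pq_nonzero[of x' y] by simp
  then show ?thesis by (simp only: H_mult_single M_smult_single nu)
qed

lemma M_module: "left_module H M"
proof (intro left_module.intro left_module_axioms.intro H_ring M_group)
  have 1: "single k a \<otimes>\<^bsub>H\<^esub> single l b \<odot>\<^bsub>M\<^esub> m = single k a \<odot>\<^bsub>M\<^esub> (single l b \<odot>\<^bsub>M\<^esub> m)"
    if "m \<in> carrier M" "k \<in> X \<times> Y" "l \<in> X \<times> Y" for k l a b m
    by (rule M_hom_eqI[OF M_hom_right add_hom_compose[OF M_hom_right M_hom_right] M_group _ that(1)])
       (use that in \<open>auto intro!: H_mult_closed H_single_closed M_assoc_single\<close>)
  have 2: "single k a \<otimes>\<^bsub>H\<^esub> g \<odot>\<^bsub>M\<^esub> m = single k a \<odot>\<^bsub>M\<^esub> (g \<odot>\<^bsub>M\<^esub> m)"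
    if "g \<in> carrier H" "k \<in> X \<times> Y" "m \<in> carrier M" for k a g m
    by (rule H_hom_eqI[OF add_hom_compose[OF H_hom_right M_hom_left] add_hom_compose[OF M_hom_left M_hom_right] M_group _ that(1)])
       (use that 1 in \<open>auto intro!: H_single_closed\<close>)
  show "f \<otimes>\<^bsub>H\<^esub> g \<odot>\<^bsub>M\<^esub> m = f \<odot>\<^bsub>M\<^esub> (g \<odot>\<^bsub>M\<^esub> m)"
    if "f \<in> carrier H" "g \<in> carrier H" "m \<in> carrier M" for f g m
    by (rule H_hom_eqI[OF add_hom_compose[OF H_hom_left M_hom_left] M_hom_left M_group _ that(1)])
       (use that 2 in \<open>auto intro!: M_smult_closed\<close>)
  have one: "\<one>\<^bsub>H\<^esub> \<odot>\<^bsub>M\<^esub> single \<mu> c = single \<mu> c" if "\<mu> \<in> C" for \<mu> c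
    using C_Tor[OF that] by (simp add: H_carrier(4) M_smult_single tm_zero Tor_zero)
  show "\<one>\<^bsub>H\<^esub> \<odot>\<^bsub>M\<^esub> m = m" if "m \<in> carrier M" for m
    by (rule M_hom_eqI[OF M_hom_right[OF H_one_closed] id_add_hom M_group _ that]) (rule one)
qed (simp_all add: M_smult_closed M_smult_add_left M_smult_add_right M_carrier(2) H_carrier(2))

text \<open>
  The action of the isotropy group on \<open>M\<close>, which is compatible with the twisted action of the
  quantum torus (\<open>gM_smult\<close>).
\<close>

definition gM where "gM w m = push (ta w) m"

lemma gM_single: "gM w (single \<mu> b) = single (ta w \<mu>) b" by (simp add: gM_def push_single)
lemma gM_closed: "w \<in> Gs \<Longrightarrow> m \<in> carrier M \<Longrightarrow> gM w m \<in> carrier M"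
  unfolding gM_def M_carrier by (intro CollectI keys_push[of m C]) (auto intro: Gs_C)
lemma gM_hom: "w \<in> Gs \<Longrightarrow> add_hom M M (gM w)"
  by (rule add_homI) (simp add: gM_closed, simp add: gM_def push_add M_carrier(2))

lemma gM_smult:
  assumes w: "w \<in> Gs" and h: "h \<in> carrier H" and m: "m \<in> carrier M"
  shows "gM w (h \<odot>\<^bsub>M\<^esub> m) = qtorus_act w h \<odot>\<^bsub>M\<^esub> gM w m"
proof -
  note wW = Gs_W[OF w]
  have 0: "gM w (single k a \<odot>\<^bsub>M\<^esub> single \<mu> b) = qtorus_act w (single k a) \<odot>\<^bsub>M\<^esub> gM w (single \<mu> b)"
    if k: "k \<in> X \<times> Y" and \<mu>: "\<mu> \<in> C" for k a \<mu> b
  proof -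
    obtain x y where k: "k = (x, y)" "x \<in> X" "y \<in> Y" using k by blast
    have "tm (ta w \<mu>) (w y) (dual_act w x) = ta w (tm \<mu> y) (dual_act w x)" by (simp only: ta_tm[OF wW])
    also have "\<dots> = tm \<mu> y x" using k by (simp only: ta_apply[OF dual_act_closed[OF wW]] dual_act_wi[OF wW])
    finally have e: "tm (ta w \<mu>) (w y) (dual_act w x) = tm \<mu> y x" .
    show ?thesis unfolding k(1) by (simp only: M_smult_single gM_single qact_single ta_tm[OF wW] e)
  qed
  have 1: "gM w (single k a \<odot>\<^bsub>M\<^esub> m) = qtorus_act w (single k a) \<odot>\<^bsub>M\<^esub> gM w m" if "k \<in> X \<times> Y" for k a
    by (rule M_hom_eqI[OF add_hom_compose[OF M_hom_right gM_hom[OF w]] add_hom_compose[OF gM_hom[OF w] M_hom_right] M_group _ m])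
       (use that 0 in \<open>auto intro!: H_single_closed qact_closed[OF wW]\<close>)
  show ?thesis
    by (rule H_hom_eqI[OF add_hom_compose[OF M_hom_left[OF m] gM_hom[OF w]]
          add_hom_compose[OF qact_hom[OF wW] M_hom_left[OF gM_closed[OF w m]]] M_group _ h]) (rule 1)
qed

lemma gM_comp: "w \<in> Gs \<Longrightarrow> v \<in> Gs \<Longrightarrow> m \<in> carrier M \<Longrightarrow> gM (w \<circ> v) m = gM w (gM v m)"
proof -
  assume w: "w \<in> Gs" and v: "v \<in> Gs" and m: "m \<in> carrier M"
  have wv: "w \<circ> v \<in> Gs" using subgroup.m_closed[OF Gs_subgroup w v] W_mult[OF Gs_W[OF w] Gs_W[OF v]] by simp
  show ?thesis
    by (rule M_hom_eqI[OF gM_hom[OF wv] add_hom_compose[OF gM_hom[OF v] gM_hom[OF w]] M_group _ m])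
       (simp only: gM_single ta_comp[OF Gs_W[OF w] Gs_W[OF v]])
qed

lemma gM_id: "m \<in> carrier M \<Longrightarrow> gM id m = m"
proof -
  assume m: "m \<in> carrier M"
  have one: "id \<in> Gs" using subgroup.one_closed[OF Gs_subgroup] by (simp only: W_one)
  show ?thesis
    by (rule M_hom_eqI[OF gM_hom[OF one] id_add_hom M_group _ m]) (simp add: gM_single ta_id[OF C_Tor])
qed

text \<open>
  The right action of scalars on \<open>M\<close> that enters the tensor product over the complex numbers.
\<close>

definition cm :: "('h character \<Rightarrow>\<^sub>0 complex) \<Rightarrow> complex \<Rightarrow> 'h character \<Rightarrow>\<^sub>0 complex"
  where "cm m c = Poly_Mapping.map (\<lambda>a. a * c) m"

lemma lookup_cm: "Poly_Mapping.lookup (cm m c) \<mu> = Poly_Mapping.lookup m \<mu> * c"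
  by (simp add: cm_def Poly_Mapping.map.rep_eq when_def)

lemma cm_single: "cm (single \<mu> b) c = single \<mu> (b * c)"
  by (rule poly_mapping_eqI) (simp add: lookup_cm lookup_single when_def)

lemma cm_closed: "m \<in> carrier M \<Longrightarrow> cm m c \<in> carrier M"
  unfolding M_carrier by (auto simp: in_keys_iff lookup_cm subset_iff)

lemma cm_hom: "add_hom M M (\<lambda>m. cm m c)"
  by (rule add_homI) (simp add: cm_closed, rule poly_mapping_eqI, simp add: M_carrier lookup_cm lookup_add distrib_right)

lemma smult_cm: "h \<in> carrier H \<Longrightarrow> m \<in> carrier M \<Longrightarrow> h \<odot>\<^bsub>M\<^esub> cm m c = cm (h \<odot>\<^bsub>M\<^esub> m) c"
proof -
  assume h: "h \<in> carrier H" and m: "m \<in> carrier M"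
  have 1: "single k a \<odot>\<^bsub>M\<^esub> cm m c = cm (single k a \<odot>\<^bsub>M\<^esub> m) c" if "k \<in> X \<times> Y" for k a
    by (rule M_hom_eqI[OF add_hom_compose[OF cm_hom M_hom_right] add_hom_compose[OF M_hom_right cm_hom] M_group _ m])
       (use that in \<open>auto simp: cm_single M_smult_single mult_ac intro!: H_single_closed\<close>)
  show ?thesis
    by (rule H_hom_eqI[OF M_hom_left[OF cm_closed[OF m]] add_hom_compose[OF M_hom_left[OF m] cm_hom] M_group _ h]) (rule 1)
qed

lemma gM_cm: "w \<in> Gs \<Longrightarrow> m \<in> carrier M \<Longrightarrow> gM w (cm m c) = cm (gM w m) c"
  by (rule M_hom_eqI[OF add_hom_compose[OF cm_hom gM_hom] add_hom_compose[OF gM_hom cm_hom] M_group])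
     (simp_all add: gM_single cm_single)

end

context weight_setup
begin

sublocale TS: twisted_subgroup H WG qtorus_act Gs
  by (intro twisted_subgroup.intro twisted_subgroup_axioms.intro twisted_WH Gs_subgroup)

lemma twisted_qtorus_eq:
  "twisted_qtorus X Y n s WG = TS.TA" "twisted_qtorus X Y n s IG = TS.H.TA"
  by (simp_all add: twisted_qtorus_def IG_eq)

lemma pure1_closed: "w \<in> W \<Longrightarrow> pure_elt H \<one>\<^bsub>H\<^esub> w \<in> carrier TS.TA"
  by (rule TS.pure_closed[OF H_one_closed])

sublocale FG: finite_group IG
  unfolding IG_eq
  by (intro finite_group.intro finite_group_axioms.intro group.subgroup_imp_group[OF W_group Gs_subgroup])
     (simp add: finite_subset[OF _ W_finite] Gs_def)

lemma IG_simps: "carrier IG = Gs" "v \<otimes>\<^bsub>IG\<^esub> w = v \<otimes>\<^bsub>WG\<^esub> w" "\<one>\<^bsub>IG\<^esub> = \<one>\<^bsub>WG\<^esub>"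
  by (simp_all add: IG_eq)

lemma Gs_finite: "finite Gs" using FG.finite_carrier by (simp add: IG_simps)

abbreviation Mtw where "Mtw \<equiv> M_tw_mod \<Delta> X Y n s lam"

lemma Mtw_simps: "carrier Mtw = carrier M" "a \<oplus>\<^bsub>Mtw\<^esub> b = a \<oplus>\<^bsub>M\<^esub> b" "\<zero>\<^bsub>Mtw\<^esub> = \<zero>\<^bsub>M\<^esub>"
  by (simp_all add: M_tw_mod_def M_carrier(2,3))

lemma Mtw_group: "abelian_group Mtw"
  by (rule pm_group[of Mtw C]) (simp_all add: M_tw_mod_def M_carrier(1))

lemma add_hom_Mtw: "add_hom Mtw B f \<longleftrightarrow> add_hom M B f" "add_hom B' Mtw g \<longleftrightarrow> add_hom B' M g"
  by (simp_all add: add_hom_def Mtw_simps)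

lemma Mtw_pure:
  assumes "w \<in> Gs" shows "pure_elt H h w \<odot>\<^bsub>Mtw\<^esub> m = h \<odot>\<^bsub>M\<^esub> gM w m"
proof -
  have "pure_elt H h w \<odot>\<^bsub>Mtw\<^esub> m = (\<Sum>v\<in>Gs. pure_elt H h w v \<odot>\<^bsub>M\<^esub> gM v m)"
    by (simp add: M_tw_mod_def IG_simps gM_def)
  also have "\<dots> = (\<Sum>v\<in>Gs. if v = w then h \<odot>\<^bsub>M\<^esub> gM w m else 0)"
    by (rule sum.cong) (auto simp: pure_elt_def H_carrier(3) M_smult_plin plin_def)
  also have "\<dots> = h \<odot>\<^bsub>M\<^esub> gM w m" using assms Gs_finite by simp
  finally show ?thesis .
qed

lemma M_span: "m \<in> carrier M \<Longrightarrow> m \<in> add_span M {single \<mu> b |\<mu> b. \<mu> \<in> C}"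
proof -
  assume "m \<in> carrier M"
  then have "Poly_Mapping.keys m \<subseteq> C" by (simp add: M_carrier)
  then show ?thesis
  proof (induction rule: pm_induct)
    case zero
    then show ?case using add_span.zero[of M] by (simp add: M_carrier(3))
  next
    case (add f g)
    then show ?case using add_span.add[of f M _ g] by (simp add: M_carrier(2))
  qed (auto intro!: add_span.base)
qed

lemma M_coproduct: "add_coproduct M C (\<lambda>_. complex_ring) (\<lambda>\<mu> b. single \<mu> b) (\<lambda>\<mu> m. Poly_Mapping.lookup m \<mu>)"
proof (rule add_coproduct.intro)
  show "carrier M \<subseteq> add_span M {single i u |i u. i \<in> C \<and> u \<in> carrier complex_ring}"
    using M_span by auto
qed (auto simp: M_group CR.abelian_group_axioms add_hom_def M_single_closed M_carrier(2,3) single_add lookup_add lookup_single)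

end

section \<open>The induced modules Z\<close>

locale weight_rep = weight_setup \<Delta> X Y n q s lam + U: gmodule "isotropy_group \<Delta> X Y n s lam" U
  for \<Delta> :: "'h::real_vector set" and X :: "('h \<Rightarrow> real) set" and Y :: "'h set"
    and n :: nat and q s :: complex and lam :: "('h \<Rightarrow> real) \<Rightarrow> complex"
    and U :: "(('h \<Rightarrow> 'h) \<Rightarrow> complex, 'u) module"
begin

text \<open>
  \<open>VM\<close> is the module \<open>M \<otimes> U\<close>, and \<open>vt m u\<close> is the tensor \<open>m \<otimes> u\<close>.  Here \<open>U\<close> is any module over the
  isotropy group, simple or not.
\<close>

sublocale VT: tensor_product complex_ring Mtw cm U.VU
  by (rule tensor_product.intro[OF Mtw_group U.VU_group])
     (simp_all add: Mtw_simps cm_closed U.VU_smult U.U.smult_closed FG.CA_pure_closed)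

definition vact where
  "vact = (\<lambda>f (m, u). \<Sum>w\<in>carrier IG. frag_of (pure_elt H (f w) w \<odot>\<^bsub>Mtw\<^esub> m, pure_elt complex_ring 1 w \<odot>\<^bsub>U\<^esub> u))"

definition VM where "VM = tensor_module complex_ring Mtw cm U.VU vact"

abbreviation vt where "vt \<equiv> VT.tens"

lemmas VM_group = VT.T_group[of vact, folded VM_def]
lemmas vt_closed = VT.tens_closed[of _ _ vact, folded VM_def, unfolded Mtw_simps U.VU_simps]
lemmas vt_hom_left = VT.tens_hom_left[of _ vact, folded VM_def, unfolded add_hom_Mtw U.VU_simps]
lemmas vt_hom_right = VT.tens_hom_right[of _ vact, folded VM_def, unfolded Mtw_simps]
lemmas vt_balanced = VT.tens_balanced[unfolded Mtw_simps U.VU_simps complex_ring_simps(1)]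
lemmas VM_hom_eqI = VT.T_hom_eqI[of vact, folded VM_def, unfolded Mtw_simps U.VU_simps]

lemma U_VU_hom: "add_hom U B f \<longleftrightarrow> add_hom U.VU B f" "add_hom B' U g \<longleftrightarrow> add_hom B' U.VU g"
  by (simp_all add: add_hom_def)

lemma ga_VU_hom: "w \<in> Gs \<Longrightarrow> add_hom U.VU U.VU (U.ga w)"
  using U.ga_hom[of w] by (simp add: U_VU_hom IG_simps)

lemma ga_closed: "w \<in> Gs \<Longrightarrow> u \<in> carrier U \<Longrightarrow> U.ga w u \<in> carrier U"
  using U.ga_closed[of w] by (simp add: IG_simps)

lemma vact_coset:
  assumes f: "f \<in> carrier TS.H.TA" and m: "m \<in> carrier M" and u: "u \<in> carrier U"
  shows "VT.K #>\<^bsub>VT.F\<^esub> vact f (m, u) = (\<Oplus>\<^bsub>VM\<^esub>w\<in>Gs. vt (f w \<odot>\<^bsub>M\<^esub> gM w m) (U.ga w u))"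
    "vact f (m, u) \<in> carrier VT.F"
proof -
  have eq: "vact f (m, u) = (\<Sum>w\<in>Gs. frag_of (f w \<odot>\<^bsub>M\<^esub> gM w m, U.ga w u))"
    unfolding vact_def by (simp add: IG_simps Mtw_pure U.ga_def)
  have fw: "f w \<in> carrier H" for w by (rule TS.H.TA_closed[OF f])
  have "VT.K #>\<^bsub>VT.F\<^esub> (\<Sum>w\<in>Gs. frag_of (f w \<odot>\<^bsub>M\<^esub> gM w m, U.ga w u)) = (\<Oplus>\<^bsub>VM\<^esub>w\<in>Gs. vt (f w \<odot>\<^bsub>M\<^esub> gM w m) (U.ga w u))
    \<and> (\<Sum>w\<in>Gs. frag_of (f w \<odot>\<^bsub>M\<^esub> gM w m, U.ga w u)) \<in> carrier VT.F"
    unfolding VM_def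
    by (rule VT.coset_sum[OF Gs_finite])
       (simp_all only: Mtw_simps U.VU_simps M_smult_closed fw gM_closed m ga_closed u)
  then show "VT.K #>\<^bsub>VT.F\<^esub> vact f (m, u) = (\<Oplus>\<^bsub>VM\<^esub>w\<in>Gs. vt (f w \<odot>\<^bsub>M\<^esub> gM w m) (U.ga w u))"
    "vact f (m, u) \<in> carrier VT.F" unfolding eq by blast+
qed

lemma
  assumes f: "f \<in> carrier TS.H.TA"
  shows VM_smult_hom: "add_hom VM VM (\<lambda>x. f \<odot>\<^bsub>VM\<^esub> x)"
    and VM_smult_vt: "\<And>m u. m \<in> carrier M \<Longrightarrow> u \<in> carrier U \<Longrightarrow>
      f \<odot>\<^bsub>VM\<^esub> vt m u = (\<Oplus>\<^bsub>VM\<^esub>w\<in>Gs. vt (f w \<odot>\<^bsub>M\<^esub> gM w m) (U.ga w u))"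
proof -
  have fw: "f w \<in> carrier H" for w by (rule TS.H.TA_closed[OF f])
  have cl: "vact f (m, u) \<in> carrier VT.F" if "m \<in> carrier Mtw" "u \<in> carrier U.VU" for m u
    using vact_coset(2)[OF f] that by (simp only: Mtw_simps U.VU_simps)
  have left: "add_hom Mtw VM (\<lambda>m. VT.K #>\<^bsub>VT.F\<^esub> vact f (m, u))" if u: "u \<in> carrier U.VU" for u
  proof -
    have u': "u \<in> carrier U" using u by simp
    have "add_hom M VM (\<lambda>m. \<Oplus>\<^bsub>VM\<^esub>w\<in>Gs. vt (f w \<odot>\<^bsub>M\<^esub> gM w m) (U.ga w u))"
      by (rule add_hom_finsum_fun[OF VM_group Gs_finite])
         (rule add_hom_compose[OF add_hom_compose[OF gM_hom M_hom_right[OF fw]] vt_hom_left[OF ga_closed[OF _ u']]])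
    then show ?thesis using vact_coset(1)[OF f _ u'] by (simp add: add_hom_def Mtw_simps M_group[THEN abelian_groupE(1)])
  qed
  have right: "add_hom U.VU VM (\<lambda>u. VT.K #>\<^bsub>VT.F\<^esub> vact f (m, u))" if m: "m \<in> carrier Mtw" for m
  proof -
    have m': "m \<in> carrier M" using m by (simp only: Mtw_simps)
    have "add_hom U.VU VM (\<lambda>u. \<Oplus>\<^bsub>VM\<^esub>w\<in>Gs. vt (f w \<odot>\<^bsub>M\<^esub> gM w m) (U.ga w u))"
      by (rule add_hom_finsum_fun[OF VM_group Gs_finite])
         (rule add_hom_compose[OF ga_VU_hom vt_hom_right[OF M_smult_closed[OF fw gM_closed[OF _ m']]]])
    then show ?thesis using vact_coset(1)[OF f m'] by (simp add: add_hom_def U.U_group[THEN abelian_groupE(1)])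
  qed
  have bal: "VT.K #>\<^bsub>VT.F\<^esub> vact f (cm m c, u) = VT.K #>\<^bsub>VT.F\<^esub> vact f (m, c \<odot>\<^bsub>U.VU\<^esub> u)"
    if m: "m \<in> carrier Mtw" and u: "u \<in> carrier U.VU" for m c u
  proof -
    interpret VM: abelian_group VM by (rule VM_group)
    have m': "m \<in> carrier M" and u': "u \<in> carrier U" using m u by (simp_all only: Mtw_simps U.VU_simps)
    have cu: "c \<odot>\<^bsub>U.VU\<^esub> u \<in> carrier U" using U.V.sc_closed[of u c] u' by simp
    have "vt (f w \<odot>\<^bsub>M\<^esub> gM w (cm m c)) (U.ga w u) = vt (f w \<odot>\<^bsub>M\<^esub> gM w m) (U.ga w (c \<odot>\<^bsub>U.VU\<^esub> u))" if w: "w \<in> Gs" for w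
    proof -
      have "vt (f w \<odot>\<^bsub>M\<^esub> gM w (cm m c)) (U.ga w u) = vt (cm (f w \<odot>\<^bsub>M\<^esub> gM w m) c) (U.ga w u)"
        by (simp only: gM_cm[OF w m'] smult_cm[OF fw gM_closed[OF w m']])
      also have "\<dots> = vt (f w \<odot>\<^bsub>M\<^esub> gM w m) (c \<odot>\<^bsub>U.VU\<^esub> U.ga w u)"
        by (rule vt_balanced[OF M_smult_closed[OF fw gM_closed[OF w m']] _ ga_closed[OF w u']]) simp
      also have "\<dots> = vt (f w \<odot>\<^bsub>M\<^esub> gM w m) (U.ga w (c \<odot>\<^bsub>U.VU\<^esub> u))"
        using U.ga_sc[of w u c] w u' by (simp only: IG_simps)
      finally show ?thesis .
    qed
    then show ?thesis
      unfolding vact_coset(1)[OF f cm_closed[OF m'] u'] vact_coset(1)[OF f m' cu]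
      by (intro VM.finsum_cong') (auto intro!: vt_closed M_smult_closed fw gM_closed ga_closed m' cu)
  qed
  note sc = VT.smult_coset[of vact f, folded VM_def, OF cl left right bal]
  show "add_hom VM VM (\<lambda>x. f \<odot>\<^bsub>VM\<^esub> x)" by (rule sc(1))
  show "f \<odot>\<^bsub>VM\<^esub> vt m u = (\<Oplus>\<^bsub>VM\<^esub>w\<in>Gs. vt (f w \<odot>\<^bsub>M\<^esub> gM w m) (U.ga w u))"
    if "m \<in> carrier M" "u \<in> carrier U" for m u
    using sc(2)[of m u] vact_coset(1)[OF f that] that by (simp only: Mtw_simps U.VU_simps)
qed

lemma VM_pure:
  assumes h: "h \<in> carrier H" and w: "w \<in> Gs" and m: "m \<in> carrier M" and u: "u \<in> carrier U"
  shows "pure_elt H h w \<odot>\<^bsub>VM\<^esub> vt m u = vt (h \<odot>\<^bsub>M\<^esub> gM w m) (U.ga w u)"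
proof -
  interpret VM: abelian_group VM by (rule VM_group)
  have pc: "pure_elt H h w \<in> carrier TS.H.TA" using TS.H.pure_closed[OF h] w by simp
  have z: "vt \<zero>\<^bsub>M\<^esub> (U.ga v u) = \<zero>\<^bsub>VM\<^esub>" if "v \<in> Gs" for v
    by (rule add_hom_zero[OF vt_hom_left[OF ga_closed[OF that u]] M_group VM_group])
  have "pure_elt H h w \<odot>\<^bsub>VM\<^esub> vt m u = (\<Oplus>\<^bsub>VM\<^esub>v\<in>Gs. vt (pure_elt H h w v \<odot>\<^bsub>M\<^esub> gM v m) (U.ga v u))"
    by (rule VM_smult_vt[OF pc m u])
  also have "\<dots> = (\<Oplus>\<^bsub>VM\<^esub>v\<in>Gs. if w = v then vt (h \<odot>\<^bsub>M\<^esub> gM w m) (U.ga w u) else \<zero>\<^bsub>VM\<^esub>)"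
  proof (rule VM.finsum_cong')
    fix v assume v: "v \<in> Gs"
    show "vt (pure_elt H h w v \<odot>\<^bsub>M\<^esub> gM v m) (U.ga v u) = (if w = v then vt (h \<odot>\<^bsub>M\<^esub> gM w m) (U.ga w u) else \<zero>\<^bsub>VM\<^esub>)"
      using z[OF v] left_module_zero_smult[OF M_module gM_closed[OF v m]] by (simp add: pure_elt_def)
  qed (use vt_closed[OF M_smult_closed[OF h gM_closed[OF w m]] ga_closed[OF w u]] in auto)
  also have "\<dots> = vt (h \<odot>\<^bsub>M\<^esub> gM w m) (U.ga w u)"
    by (rule VM.finsum_singleton[OF w Gs_finite])
       (use vt_closed[OF M_smult_closed[OF h gM_closed[OF w m]] ga_closed[OF w u]] in auto)
  finally show ?thesis .
qed

lemma VM_scalar_hom: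
  assumes x: "x \<in> carrier VM"
  shows "add_hom TS.H.TA VM (\<lambda>f. f \<odot>\<^bsub>VM\<^esub> x)"
proof (rule add_homI)
  interpret VM: abelian_group VM by (rule VM_group)
  fix f g assume f: "f \<in> carrier TS.H.TA" and g: "g \<in> carrier TS.H.TA"
  have fg: "f \<oplus>\<^bsub>TS.H.TA\<^esub> g \<in> carrier TS.H.TA" using f g by (rule TS.H.TA.a_closed)
  show "(f \<oplus>\<^bsub>TS.H.TA\<^esub> g) \<odot>\<^bsub>VM\<^esub> x = f \<odot>\<^bsub>VM\<^esub> x \<oplus>\<^bsub>VM\<^esub> g \<odot>\<^bsub>VM\<^esub> x"
  proof (rule VM_hom_eqI[OF VM_smult_hom[OF fg] _ VM_group _ x])
    show "add_hom VM VM (\<lambda>x. f \<odot>\<^bsub>VM\<^esub> x \<oplus>\<^bsub>VM\<^esub> g \<odot>\<^bsub>VM\<^esub> x)"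
      using add_hom_closed[OF VM_smult_hom[OF f]] add_hom_closed[OF VM_smult_hom[OF g]]
      by (intro add_homI) (simp_all add: add_hom_add[OF VM_smult_hom[OF f]] add_hom_add[OF VM_smult_hom[OF g]] VM.a_ac)
    fix m u assume m: "m \<in> carrier M" and u: "u \<in> carrier U"
    have fw: "f w \<in> carrier H" "g w \<in> carrier H" for w by (rule TS.H.TA_closed[OF f], rule TS.H.TA_closed[OF g])
    have c: "vt (h \<odot>\<^bsub>M\<^esub> gM w m) (U.ga w u) \<in> carrier VM" if "w \<in> Gs" "h \<in> carrier H" for w h
      by (rule vt_closed[OF M_smult_closed[OF that(2) gM_closed[OF that(1) m]] ga_closed[OF that(1) u]])
    have "vt ((f \<oplus>\<^bsub>TS.H.TA\<^esub> g) w \<odot>\<^bsub>M\<^esub> gM w m) (U.ga w u)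
      = vt (f w \<odot>\<^bsub>M\<^esub> gM w m) (U.ga w u) \<oplus>\<^bsub>VM\<^esub> vt (g w \<odot>\<^bsub>M\<^esub> gM w m) (U.ga w u)" if w: "w \<in> Gs" for w
      using add_hom_add[OF add_hom_compose[OF M_hom_left[OF gM_closed[OF w m]] vt_hom_left[OF ga_closed[OF w u]]] fw]
      by (simp only: TS.H.TA_add)
    then have "(\<Oplus>\<^bsub>VM\<^esub>w\<in>Gs. vt ((f \<oplus>\<^bsub>TS.H.TA\<^esub> g) w \<odot>\<^bsub>M\<^esub> gM w m) (U.ga w u))
      = (\<Oplus>\<^bsub>VM\<^esub>w\<in>Gs. vt (f w \<odot>\<^bsub>M\<^esub> gM w m) (U.ga w u)) \<oplus>\<^bsub>VM\<^esub> (\<Oplus>\<^bsub>VM\<^esub>w\<in>Gs. vt (g w \<odot>\<^bsub>M\<^esub> gM w m) (U.ga w u))"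
      by (intro trans[OF VM.finsum_cong' VM.finsum_addf]) (auto intro!: c fw)
    then show "(f \<oplus>\<^bsub>TS.H.TA\<^esub> g) \<odot>\<^bsub>VM\<^esub> vt m u = f \<odot>\<^bsub>VM\<^esub> vt m u \<oplus>\<^bsub>VM\<^esub> g \<odot>\<^bsub>VM\<^esub> vt m u"
      by (simp only: VM_smult_vt[OF fg m u] VM_smult_vt[OF f m u] VM_smult_vt[OF g m u])
  qed
qed (rule add_hom_closed[OF VM_smult_hom x])

text \<open>
  The tensors \<open>m \<otimes> u\<close> span, and on them \<open>h \<otimes> w\<close> acts by \<open>m \<otimes> u \<mapsto> h w m \<otimes> w u\<close>, so associativity is
  the compatibility of the actions of the quantum torus and of the isotropy group on \<open>M\<close>.
\<close>

lemma VM_module: "left_module TS.H.TA VM"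
proof (rule TS.H.left_moduleI[OF VM_group])
  have pc: "pure_elt H a w \<in> carrier TS.H.TA" if "a \<in> carrier H" "w \<in> Gs" for a w
    using TS.H.pure_closed[OF that(1)] that(2) by simp
  fix a b v w x assume a: "a \<in> carrier H" and b: "b \<in> carrier H" and v0: "v \<in> carrier TS.GH" and w0: "w \<in> carrier TS.GH"
    and x: "x \<in> carrier VM"
  have v: "v \<in> Gs" and w: "w \<in> Gs" using v0 w0 by simp_all
  note vW = Gs_W[OF v] and wW = Gs_W[OF w]
  have vw: "v \<otimes>\<^bsub>TS.GH\<^esub> w = v \<circ> w" using W_mult[OF vW wW] by simp
  have vwG: "v \<circ> w \<in> Gs" using subgroup.m_closed[OF Gs_subgroup v w] W_mult[OF vW wW] by simp
  have avb: "a \<otimes>\<^bsub>H\<^esub> qtorus_act v b \<in> carrier H" by (intro H_mult_closed a qact_closed vW b)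
  show "pure_elt H (a \<otimes>\<^bsub>H\<^esub> qtorus_act v b) (v \<otimes>\<^bsub>TS.GH\<^esub> w) \<odot>\<^bsub>VM\<^esub> x = pure_elt H a v \<odot>\<^bsub>VM\<^esub> (pure_elt H b w \<odot>\<^bsub>VM\<^esub> x)"
    unfolding vw
  proof (rule VM_hom_eqI[OF VM_smult_hom[OF pc[OF avb vwG]] add_hom_compose[OF VM_smult_hom[OF pc[OF b w]] VM_smult_hom[OF pc[OF a v]]] VM_group _ x])
    fix m u assume m: "m \<in> carrier M" and u: "u \<in> carrier U"
    note gm = gM_closed[OF w m]
    have "(a \<otimes>\<^bsub>H\<^esub> qtorus_act v b) \<odot>\<^bsub>M\<^esub> gM (v \<circ> w) m = a \<odot>\<^bsub>M\<^esub> gM v (b \<odot>\<^bsub>M\<^esub> gM w m)"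
      by (simp only: gM_comp[OF v w m] gM_smult[OF v b gm]
          left_module.smult_assoc[OF M_module a qact_closed[OF vW b] gM_closed[OF v gm]])
    moreover have "U.ga (v \<circ> w) u = U.ga v (U.ga w u)"
      using U.ga_mult[of v w u] v w u by (simp only: IG_simps W_mult[OF vW wW])
    ultimately show "pure_elt H (a \<otimes>\<^bsub>H\<^esub> qtorus_act v b) (v \<circ> w) \<odot>\<^bsub>VM\<^esub> vt m u = pure_elt H a v \<odot>\<^bsub>VM\<^esub> (pure_elt H b w \<odot>\<^bsub>VM\<^esub> vt m u)"
      by (simp only: VM_pure[OF avb vwG m u] VM_pure[OF b w m u]
          VM_pure[OF a v M_smult_closed[OF b gm] ga_closed[OF w u]])
  qed
next
  fix x assume x: "x \<in> carrier VM"
  have one: "\<one>\<^bsub>TS.GH\<^esub> \<in> Gs" using TS.H_one by simp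
  have oneid: "\<one>\<^bsub>TS.GH\<^esub> = id" using W_one by simp
  show "pure_elt H \<one>\<^bsub>H\<^esub> \<one>\<^bsub>TS.GH\<^esub> \<odot>\<^bsub>VM\<^esub> x = x"
  proof (rule VM_hom_eqI[OF VM_smult_hom id_add_hom VM_group _ x])
    show "pure_elt H \<one>\<^bsub>H\<^esub> \<one>\<^bsub>TS.GH\<^esub> \<in> carrier TS.H.TA" using TS.H.pure_closed[OF H_one_closed] one by simp
    fix m u assume m: "m \<in> carrier M" and u: "u \<in> carrier U"
    have "U.ga id u = u" using U.ga_one[OF u] by (simp only: IG_simps W_one)
    then show "pure_elt H \<one>\<^bsub>H\<^esub> \<one>\<^bsub>TS.GH\<^esub> \<odot>\<^bsub>VM\<^esub> vt m u = vt m u"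
      using VM_pure[OF H_one_closed one m u] oneid
      by (simp only: gM_id[OF m] left_module.smult_one[OF M_module m])
  qed
qed (rule VM_smult_hom, assumption, rule VM_scalar_hom)

text \<open>
  \<open>v\<^sub>\<mu> \<otimes> u\<close>, with which \<open>M \<otimes> U\<close> becomes a direct sum of copies of \<open>U\<close> indexed by the coset.
\<close>

definition vv where "vv \<mu> u = vt (single \<mu> 1) u"

lemma vt_single: "\<mu> \<in> C \<Longrightarrow> u \<in> carrier U \<Longrightarrow> vt (single \<mu> b) u = vv \<mu> (b \<odot>\<^bsub>U.VU\<^esub> u)"
  using vt_balanced[OF M_single_closed, of \<mu> b u 1] by (simp add: cm_single vv_def)

lemma vv_closed: "\<mu> \<in> C \<Longrightarrow> u \<in> carrier U \<Longrightarrow> vv \<mu> u \<in> carrier VM"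
  unfolding vv_def by (rule vt_closed[OF M_single_closed])

lemma VM_coproduct: "\<exists>p. add_coproduct VM C (\<lambda>_. U.VU) vv p"
proof -
  have span: "m \<in> add_span Mtw {cm (single \<mu> 1) t |\<mu> t. \<mu> \<in> C \<and> t \<in> carrier complex_ring}" if "m \<in> carrier Mtw" for m
  proof -
    have "m \<in> add_span M {single \<mu> b |\<mu> b. \<mu> \<in> C}" using that M_span by (simp only: Mtw_simps)
    then show ?thesis
    proof induction
      case zero
      then show ?case using add_span.zero[of Mtw] by (simp add: Mtw_simps)
    next
      case (base x)
      then show ?case by (auto intro!: add_span.base simp: cm_single)
    next
      case (add x y)
      then show ?case using add_span.add[of x Mtw _ y] by (simp add: Mtw_simps)
    qed
  qed
  obtain p where "add_coproduct (VT.T vact) C (\<lambda>_. U.VU) (\<lambda>\<mu>. vt (single \<mu> 1)) p"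
  proof (rule VT.coproduct_of_free[where I = C and r = "\<lambda>\<mu>. single \<mu> 1" and act = vact
        and c = "\<lambda>\<mu> m. Poly_Mapping.lookup m \<mu>"])
    show "t \<odot>\<^bsub>U.VU\<^esub> (b \<oplus>\<^bsub>U.VU\<^esub> b') = t \<odot>\<^bsub>U.VU\<^esub> b \<oplus>\<^bsub>U.VU\<^esub> t \<odot>\<^bsub>U.VU\<^esub> b'"
      if "b \<in> carrier U.VU" "b' \<in> carrier U.VU" for t b b' using U.V.sc_distr[OF that] .
    show "Poly_Mapping.lookup (a \<oplus>\<^bsub>Mtw\<^esub> a') i \<odot>\<^bsub>U.VU\<^esub> b = Poly_Mapping.lookup a i \<odot>\<^bsub>U.VU\<^esub> b \<oplus>\<^bsub>U.VU\<^esub> Poly_Mapping.lookup a' i \<odot>\<^bsub>U.VU\<^esub> b"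
      if "b \<in> carrier U.VU" for i a a' b
      using U.V.sc_distl[OF that] by (simp only: Mtw_simps M_carrier(2) lookup_add)
    show "Poly_Mapping.lookup (cm a t) i \<odot>\<^bsub>U.VU\<^esub> b = Poly_Mapping.lookup a i \<odot>\<^bsub>U.VU\<^esub> (t \<odot>\<^bsub>U.VU\<^esub> b)"
      if "b \<in> carrier U.VU" for i a t b
      using U.V.sc_assoc[OF that] by (simp only: lookup_cm)
    show "Poly_Mapping.lookup (single i 1) i \<odot>\<^bsub>U.VU\<^esub> b = b" if "b \<in> carrier U.VU" for i b
      using U.V.sc_one[OF that] by simp
    show "Poly_Mapping.lookup (single j 1) i \<odot>\<^bsub>U.VU\<^esub> b = \<zero>\<^bsub>U.VU\<^esub>" if "b \<in> carrier U.VU" "i \<noteq> j" for i j b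
      using U.V.sc_0[OF that(1)] that(2) by (simp add: lookup_single)
  qed (use span in \<open>auto simp: Mtw_simps M_single_closed\<close>)
  then show ?thesis by (auto simp: VM_def vv_def[abs_def])
qed

lemma VM_pure_vv:
  assumes "x \<in> X" "y \<in> Y" "w \<in> Gs" "\<mu> \<in> C" "u \<in> carrier U"
  shows "pure_elt H (single (x, y) a) w \<odot>\<^bsub>VM\<^esub> vv \<mu> u
    = vv (tm (ta w \<mu>) y) ((a * tm (ta w \<mu>) y x) \<odot>\<^bsub>U.VU\<^esub> U.ga w u)"
proof -
  have "pure_elt H (single (x, y) a) w \<odot>\<^bsub>VM\<^esub> vv \<mu> u = vt (single (tm (ta w \<mu>) y) (a * 1 * tm (ta w \<mu>) y x)) (U.ga w u)"
    unfolding vv_def by (simp only: VM_pure[OF H_single_closed[OF assms(1,2)] assms(3) M_single_closed[OF assms(4)] assms(5)]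
        gM_single M_smult_single)
  then show ?thesis
    using vt_single[OF C_tm[OF Gs_C[OF assms(3,4)] assms(2)] ga_closed[OF assms(3,5)]] by simp
qed

sublocale ZI: induction TS.TA TS.H.TA id VM
  by (intro induction.intro induction_axioms.intro TS.TA_ring TS.H.TA_ring VM_module) (simp add: TS.TAH_sub)

abbreviation Z where "Z \<equiv> ZI.Ind"

text \<open>
  \<open>w \<otimes> (v\<^sub>\<mu> \<otimes> u)\<close>, the elements of the copy \<open>(w, \<mu>)\<close> of \<open>U\<close> in \<open>Z\<close>.
\<close>

definition zz where "zz w \<mu> u = ZI.tens (pure_elt H \<one>\<^bsub>H\<^esub> w) (vv \<mu> u)"

lemma zz_closed: "w \<in> W \<Longrightarrow> \<mu> \<in> C \<Longrightarrow> u \<in> carrier U \<Longrightarrow> zz w \<mu> u \<in> carrier Z"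
  unfolding zz_def ZI.Ind_eq by (rule ZI.tens_closed[OF pure1_closed vv_closed])

lemma vv_hom: "\<mu> \<in> C \<Longrightarrow> add_hom U.VU VM (vv \<mu>)"
  unfolding vv_def[abs_def] by (rule vt_hom_right[OF M_single_closed])

lemma zz_hom: "w \<in> W \<Longrightarrow> \<mu> \<in> C \<Longrightarrow> add_hom U.VU Z (zz w \<mu>)"
  unfolding zz_def[abs_def] ZI.Ind_eq
  by (rule add_hom_compose[OF vv_hom ZI.tens_hom_right[OF pure1_closed]])

lemma pure_factor:
  assumes "w \<in> W" "g \<in> Gs" "h \<in> carrier H"
  shows "pure_elt H \<one>\<^bsub>H\<^esub> w \<otimes>\<^bsub>TS.TA\<^esub> pure_elt H h g = pure_elt H (qtorus_act w h) (w \<circ> g)"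
proof -
  show ?thesis
    using TS.pure_mult[OF H_one_closed assms(3,1) Gs_W[OF assms(2)]] W_mult[OF assms(1) Gs_W[OF assms(2)]]
      TS.A.l_one[OF qact_closed[OF assms(1,3)]] by simp
qed

text \<open>
  Elements of the isotropy group pass through the tensor sign.  This is where the action of the
  isotropy group on \<open>U\<close> becomes visible in \<open>Z\<close>.
\<close>

lemma zz_move:
  assumes w: "w \<in> W" and g: "g \<in> Gs" and \<mu>: "\<mu> \<in> C" and u: "u \<in> carrier U"
  shows "zz (w \<circ> g) \<mu> u = zz w (ta g \<mu>) (U.ga g u)"
proof -
  have pg: "pure_elt H \<one>\<^bsub>H\<^esub> g \<in> carrier TS.H.TA" using TS.H.pure_closed[OF H_one_closed] g by simp
  have g1: "pure_elt H \<one>\<^bsub>H\<^esub> g \<odot>\<^bsub>VM\<^esub> vv \<mu> u = vv (ta g \<mu>) (U.ga g u)"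
  proof -
    have T: "ta g \<mu> \<in> Tor" by (rule C_Tor[OF Gs_C[OF g \<mu>]])
    show ?thesis using VM_pure_vv[OF X_zero Y_zero g \<mu> u, of 1] U.V.sc_one[of "U.ga g u"] ga_closed[OF g u]
      by (simp add: H_carrier(4) tm_zero[OF T] Tor_zero[OF T])
  qed
  have "pure_elt H \<one>\<^bsub>H\<^esub> (w \<circ> g) = pure_elt H \<one>\<^bsub>H\<^esub> w \<otimes>\<^bsub>TS.TA\<^esub> id (pure_elt H \<one>\<^bsub>H\<^esub> g)"
    using pure_factor[OF w g H_one_closed] TS.act_unit[OF w] by simp
  then have "zz (w \<circ> g) \<mu> u = ZI.tens (pure_elt H \<one>\<^bsub>H\<^esub> w) (pure_elt H \<one>\<^bsub>H\<^esub> g \<odot>\<^bsub>VM\<^esub> vv \<mu> u)"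
    unfolding zz_def using ZI.tens_balanced[OF pure1_closed[OF w] pg vv_closed[OF \<mu> u]] by simp
  then show ?thesis unfolding g1 zz_def .
qed

text \<open>
  \<open>e\<^sup>x e\<^sup>y v w = t h\<close> with \<open>t = v w\<close> and \<open>h\<close> the monomial transformed by the inverse of \<open>t\<close>; it passes
  through the tensor sign and acts on \<open>v\<^sub>\<mu>\<close>.
\<close>

lemma zz_act:
  assumes x: "x \<in> X" and y: "y \<in> Y" and v: "v \<in> W" and w: "w \<in> W" and \<mu>: "\<mu> \<in> C" and u: "u \<in> carrier U"
    and t: "t = v \<circ> w"
  shows "pure_elt H (single (x, y) a) v \<odot>\<^bsub>Z\<^esub> zz w \<mu> u
    = zz t (tm \<mu> (wi t y)) ((a * tm \<mu> (wi t y) (dual_act (wi t) x)) \<odot>\<^bsub>U.VU\<^esub> u)"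
proof -
  have tW: "t \<in> W" using group.is_monoid[OF W_group] W_mult[OF v w] v w unfolding t by (metis monoid.m_closed)
  have idG: "id \<in> Gs" using subgroup.one_closed[OF Gs_subgroup] by (simp only: W_one)
  define h where "h = single (dual_act (wi t) x, wi t y) a"
  have xt: "dual_act (wi t) x \<in> X" "wi t y \<in> Y"
    by (rule dual_act_closed[OF wi_W[OF tW] x], rule W_Y[OF wi_W[OF tW] y])
  have hH: "h \<in> carrier H" unfolding h_def by (rule H_single_closed[OF xt])
  have th: "qtorus_act t h = single (x, y) a"
    unfolding h_def qact_single by (simp only: dual_act_wi[OF tW] W_inv_apply[OF tW])
  have sH: "single (x, y) a \<in> carrier H" by (rule H_single_closed[OF x y])
  have ph: "pure_elt H h id \<in> carrier TS.H.TA" using TS.H.pure_closed[OF hH] idG by simp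
  have "pure_elt H (single (x, y) a) v \<odot>\<^bsub>Z\<^esub> zz w \<mu> u = ZI.tens (pure_elt H (single (x, y) a) v \<otimes>\<^bsub>TS.TA\<^esub> pure_elt H \<one>\<^bsub>H\<^esub> w) (vv \<mu> u)"
    unfolding zz_def by (rule ZI.Ind_smult_tens[OF TS.pure_closed[OF sH v] pure1_closed[OF w] vv_closed[OF \<mu> u]])
  also have "pure_elt H (single (x, y) a) v \<otimes>\<^bsub>TS.TA\<^esub> pure_elt H \<one>\<^bsub>H\<^esub> w = pure_elt H (single (x, y) a) t"
    using TS.pure_mult[OF sH H_one_closed v w] TS.act_unit[OF v] TS.A.r_one[OF sH] W_mult[OF v w] t by simp
  also have "\<dots> = pure_elt H \<one>\<^bsub>H\<^esub> t \<otimes>\<^bsub>TS.TA\<^esub> id (pure_elt H h id)"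
    using pure_factor[OF tW idG hH] th by simp
  also have "ZI.tens (pure_elt H \<one>\<^bsub>H\<^esub> t \<otimes>\<^bsub>TS.TA\<^esub> id (pure_elt H h id)) (vv \<mu> u)
    = ZI.tens (pure_elt H \<one>\<^bsub>H\<^esub> t) (pure_elt H h id \<odot>\<^bsub>VM\<^esub> vv \<mu> u)"
    by (rule ZI.tens_balanced[OF pure1_closed[OF tW] ph vv_closed[OF \<mu> u]])
  also have "pure_elt H h id \<odot>\<^bsub>VM\<^esub> vv \<mu> u = vv (tm \<mu> (wi t y)) ((a * tm \<mu> (wi t y) (dual_act (wi t) x)) \<odot>\<^bsub>U.VU\<^esub> u)"
  proof -
    have "U.ga id u = u" using U.ga_one[OF u] by (simp only: IG_simps W_one)
    then show ?thesis
      unfolding h_def using VM_pure_vv[OF xt idG \<mu> u, of a] ta_id[OF C_Tor[OF \<mu>]] by simp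
  qed
  finally show ?thesis unfolding zz_def .
qed

end

section \<open>Weight spaces\<close>

context weight_setup
begin

text \<open>
  Representatives of the left cosets \<open>c G\<close> of the isotropy group; the set of weights \<open>c(C)\<close> depends only on
  the coset.
\<close>

definition Rep where "Rep = (SOME C. C \<subseteq> W \<and> (\<forall>w\<in>W. \<exists>c\<in>C. inv\<^bsub>WG\<^esub> c \<otimes>\<^bsub>WG\<^esub> w \<in> Gs) \<and>
    (\<forall>c\<in>C. \<forall>c'\<in>C. inv\<^bsub>WG\<^esub> c \<otimes>\<^bsub>WG\<^esub> c' \<in> Gs \<longrightarrow> c = c'))"

lemma Rep_raw: "Rep \<subseteq> W \<and> (\<forall>w\<in>W. \<exists>c\<in>Rep. inv\<^bsub>WG\<^esub> c \<otimes>\<^bsub>WG\<^esub> w \<in> Gs) \<and>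
    (\<forall>c\<in>Rep. \<forall>c'\<in>Rep. inv\<^bsub>WG\<^esub> c \<otimes>\<^bsub>WG\<^esub> c' \<in> Gs \<longrightarrow> c = c')"
  unfolding Rep_def by (rule someI_ex) (rule TS.transversal_exists)

lemma Rep_W: "c \<in> Rep \<Longrightarrow> c \<in> W" using Rep_raw by blast

lemma inv_mult_W: "v \<in> W \<Longrightarrow> w \<in> W \<Longrightarrow> inv\<^bsub>WG\<^esub> v \<otimes>\<^bsub>WG\<^esub> w = wi v \<circ> w"
  by (simp only: W_inv W_mult[OF wi_W])

lemma Rep_cover: assumes "w \<in> W" shows "\<exists>c\<in>Rep. \<exists>g\<in>Gs. w = c \<circ> g"
proof -
  obtain c where c: "c \<in> Rep" "inv\<^bsub>WG\<^esub> c \<otimes>\<^bsub>WG\<^esub> w \<in> Gs" using Rep_raw assms by blast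
  note cW = Rep_W[OF c(1)]
  have "w = c \<circ> (wi c \<circ> w)" by (rule ext) (simp add: W_inv_apply[OF cW])
  moreover have "wi c \<circ> w \<in> Gs" using c(2) by (simp only: inv_mult_W[OF cW assms])
  ultimately show ?thesis using c(1) by blast
qed

lemma Rep_unique: assumes "c \<in> Rep" "c' \<in> Rep" "wi c \<circ> c' \<in> Gs" shows "c = c'"
  using Rep_raw assms inv_mult_W[OF Rep_W[OF assms(1)] Rep_W[OF assms(2)]] by metis

lemma Rep_factor_unique:
  assumes "c \<in> Rep" "c' \<in> Rep" "g \<in> Gs" "g' \<in> Gs" "c \<circ> g = c' \<circ> g'"
  shows "c = c' \<and> g = g'"
proof -
  note W = Rep_W[OF assms(1)] Rep_W[OF assms(2)] Gs_W[OF assms(3)] Gs_W[OF assms(4)]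
  have g: "wi g' \<in> Gs" using subgroup.m_inv_closed[OF Gs_subgroup assms(4)] by (simp only: W_inv[OF W(4)])
  have "wi c \<circ> c' = g \<circ> wi g'"
  proof (rule ext)
    fix v
    have "c (g (wi g' v)) = c' (g' (wi g' v))" using fun_cong[OF assms(5), of "wi g' v"] by simp
    then have "c (g (wi g' v)) = c' v" by (simp only: W_inv_apply[OF W(4)])
    then have "wi c (c (g (wi g' v))) = wi c (c' v)" by simp
    then show "(wi c \<circ> c') v = (g \<circ> wi g') v" by (simp add: W_inv_apply[OF W(1)])
  qed
  then have "wi c \<circ> c' \<in> Gs" using subgroup.m_closed[OF Gs_subgroup assms(3) g] W_mult[OF W(3) Gs_W[OF g]] by simp
  then have c: "c = c'" by (rule Rep_unique[OF assms(1,2)])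
  have "g v = g' v" for v
  proof -
    have "wi c (c (g v)) = wi c (c (g' v))" using fun_cong[OF assms(5), of v] c by simp
    then show ?thesis by (simp only: W_inv_apply[OF W(1)])
  qed
  then show ?thesis using c by auto
qed

text \<open>
  From \<open>c(\<mu>) = c'(\<mu>')\<close> it follows that \<open>c\<^sup>-\<^sup>1 c'\<close> maps the point \<open>\<mu>'\<close> of \<open>C\<close> to the point \<open>\<mu>\<close>, so
  it belongs to the isotropy group by \<open>Gs_criterion\<close>.
\<close>

lemma weights_distinct:
  assumes "c \<in> Rep" "c' \<in> Rep" "\<mu> \<in> C" "\<mu>' \<in> C" "\<And>x. x \<in> X \<Longrightarrow> ta c \<mu> x = ta c' \<mu>' x"
  shows "c = c' \<and> \<mu> = \<mu>'"
proof -
  note W = Rep_W[OF assms(1)] Rep_W[OF assms(2)]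
  note T = C_Tor[OF assms(3)] C_Tor[OF assms(4)]
  have eq: "ta c \<mu> = ta c' \<mu>'"
    by (rule extensionalityI[of _ X]) (use ta_Tor[OF W(1) T(1)] ta_Tor[OF W(2) T(2)] assms(5) in \<open>simp_all add: Tor_iff\<close>)
  have "ta (wi c \<circ> c') \<mu>' = \<mu>"
    using ta_comp[OF wi_W[OF W(1)] W(2), of \<mu>'] ta_wi(1)[OF W(1) T(1)] eq by simp
  moreover have "wi c \<circ> c' \<in> W"
    using inv_mult_W[OF W] monoid.m_closed[OF group.is_monoid[OF W_group] group.inv_closed[OF W_group W(1)] W(2)] by simp
  ultimately have "wi c \<circ> c' \<in> Gs" using Gs_criterion[of "wi c \<circ> c'" \<mu>'] assms by simp
  then have c: "c = c'" by (rule Rep_unique[OF assms(1,2)])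
  have "ta c \<mu> = ta c \<mu>'" using eq by (simp only: c)
  then have "\<mu> = \<mu>'" using ta_wi(1)[OF W(1) T(1)] ta_wi(1)[OF W(1) T(2)] by metis
  then show ?thesis using c by blast
qed

lemma W_id: "id \<in> W" using monoid.one_closed[OF group.is_monoid[OF W_group]] by (simp only: W_one)

lemma W_comp: "v \<in> W \<Longrightarrow> w \<in> W \<Longrightarrow> v \<circ> w \<in> W"
  using monoid.m_closed[OF group.is_monoid[OF W_group]] by (simp only: W_mult[symmetric])

text \<open>
  The elements of the twisted group algebra that are needed to analyse \<open>Z\<close>: \<open>e\<^sup>x\<close>, which acts on each weight
  space by a scalar; scalars; and \<open>e\<^bsup>v(y)\<^esup> v w\<^sup>-\<^sup>1\<close> with \<open>\<nu> = \<mu> q\<^sup>y\<close>, which carries the copy \<open>(w, \<mu>)\<close>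
  identically onto the copy \<open>(v, \<nu>)\<close>.
\<close>

definition weight_elt where "weight_elt x = pure_elt H (single (x, 0) 1) id"
definition scalar_elt where "scalar_elt a = pure_elt H (single (0, 0) a) id"
definition transport_elt where "transport_elt w \<mu> v \<nu> = pure_elt H (single (0, v (SOME y. y \<in> Y \<and> \<nu> = tm \<mu> y)) 1) (v \<circ> wi w)"

lemma weight_elt_closed: "x \<in> X \<Longrightarrow> weight_elt x \<in> carrier TS.TA"
  unfolding weight_elt_def by (intro TS.pure_closed H_single_closed Y_zero W_id)

lemma scalar_elt_closed: "scalar_elt a \<in> carrier TS.TA"
  unfolding scalar_elt_def by (intro TS.pure_closed H_single_closed X_zero Y_zero W_id)

lemma translation_spec:
  assumes "\<mu> \<in> C" "\<nu> \<in> C"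
  shows "(SOME y. y \<in> Y \<and> \<nu> = tm \<mu> y) \<in> Y" "tm \<mu> (SOME y. y \<in> Y \<and> \<nu> = tm \<mu> y) = \<nu>"
proof -
  have "\<exists>y. y \<in> Y \<and> \<nu> = tm \<mu> y" using C_trans[OF assms] by blast
  from someI_ex[OF this] show "(SOME y. y \<in> Y \<and> \<nu> = tm \<mu> y) \<in> Y" "tm \<mu> (SOME y. y \<in> Y \<and> \<nu> = tm \<mu> y) = \<nu>" by simp_all
qed

lemma transport_elt_closed: "w \<in> W \<Longrightarrow> v \<in> W \<Longrightarrow> \<mu> \<in> C \<Longrightarrow> \<nu> \<in> C \<Longrightarrow> transport_elt w \<mu> v \<nu> \<in> carrier TS.TA"
  unfolding transport_elt_def by (rule TS.pure_closed[OF H_single_closed[OF X_zero W_Y[OF _ translation_spec(1)]] W_comp[OF _ wi_W]])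

end

context weight_rep
begin

lemma zz_weight_elt:
  assumes x: "x \<in> X" and w: "w \<in> W" and \<mu>: "\<mu> \<in> C" and u: "u \<in> carrier U"
  shows "weight_elt x \<odot>\<^bsub>Z\<^esub> zz w \<mu> u = zz w \<mu> (ta w \<mu> x \<odot>\<^bsub>U.VU\<^esub> u)"
  using zz_act[OF x Y_zero W_id w \<mu> u refl, of 1] linear_0[OF W_linear[OF wi_W[OF w]]]
  by (simp add: weight_elt_def tm_zero[OF C_Tor[OF \<mu>]] ta_apply[OF x])

lemma zz_scalar_elt:
  assumes w: "w \<in> W" and \<mu>: "\<mu> \<in> C" and u: "u \<in> carrier U"
  shows "scalar_elt a \<odot>\<^bsub>Z\<^esub> zz w \<mu> u = zz w \<mu> (a \<odot>\<^bsub>U.VU\<^esub> u)"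
  using zz_act[OF X_zero Y_zero W_id w \<mu> u refl, of a] linear_0[OF W_linear[OF wi_W[OF w]]]
  by (simp add: scalar_elt_def tm_zero[OF C_Tor[OF \<mu>]] dual_act_zero Tor_zero[OF C_Tor[OF \<mu>]])

lemma zz_transport_elt:
  assumes w: "w \<in> W" and v: "v \<in> W" and \<mu>: "\<mu> \<in> C" and \<nu>: "\<nu> \<in> C" and u: "u \<in> carrier U"
  shows "transport_elt w \<mu> v \<nu> \<odot>\<^bsub>Z\<^esub> zz w \<mu> u = zz v \<nu> u"
proof -
  define y where "y = (SOME y. y \<in> Y \<and> \<nu> = tm \<mu> y)"
  have y: "y \<in> Y" "tm \<mu> y = \<nu>" using translation_spec[OF \<mu> \<nu>] by (simp_all only: y_def)
  have t: "v = (v \<circ> wi w) \<circ> w" by (rule ext) (simp add: W_inv_apply[OF w])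
  show ?thesis
    using zz_act[OF X_zero W_Y[OF v y(1)] W_comp[OF v wi_W[OF w]] w \<mu> u t, of 1] U.V.sc_one[of u] u
    by (simp add: transport_elt_def y_def[symmetric] W_inv_apply[OF v] y(2) dual_act_zero Tor_zero[OF C_Tor[OF \<nu>]])
qed

lemma Z_coproduct_ex:
  "\<exists>p. add_coproduct Z (Rep \<times> C) (\<lambda>_. U.VU) (\<lambda>(c, \<mu>) u. zz c \<mu> u) p"
proof -
  obtain p where p: "add_coproduct Z Rep (\<lambda>_. VM) (\<lambda>w. ZI.tens (pure_elt H \<one>\<^bsub>H\<^esub> w)) p"
    by (rule TS.induced_coproduct[OF VM_module, of Rep]) (use Rep_raw in blast)+
  obtain p' where p': "add_coproduct VM C (\<lambda>_. U.VU) vv p'" using VM_coproduct by blast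
  from add_coproduct_compose[OF p p'] show ?thesis unfolding zz_def by blast
qed

text \<open>
  The coordinates of \<open>Z\<close> with respect to its copies of \<open>U\<close>; \<open>add_coproduct\<close> determines them uniquely.
\<close>

definition pz where "pz = (SOME p. add_coproduct Z (Rep \<times> C) (\<lambda>_. U.VU) (\<lambda>(c, \<mu>) u. zz c \<mu> u) p)"

sublocale ZC: add_coproduct Z "Rep \<times> C" "\<lambda>_. U.VU" "\<lambda>(c, \<mu>) u. zz c \<mu> u" pz
  unfolding pz_def by (rule someI_ex[OF Z_coproduct_ex])

lemma Z_module: "left_module TS.TA Z" by (rule ZI.Ind_module)

lemma pz_weight_elt:
  assumes x: "x \<in> X" and i: "c \<in> Rep" "\<mu> \<in> C" and \<zeta>: "\<zeta> \<in> carrier Z"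
  shows "pz (c, \<mu>) (weight_elt x \<odot>\<^bsub>Z\<^esub> \<zeta>) = ta c \<mu> x \<odot>\<^bsub>U.VU\<^esub> pz (c, \<mu>) \<zeta>"
proof -
  have iI: "(c, \<mu>) \<in> Rep \<times> C" using i by simp
  show ?thesis
  proof (rule add_hom_eq_on_span[OF add_hom_compose[OF left_module_smult_hom[OF Z_module weight_elt_closed[OF x]] ZC.p_hom[OF iI]]
        add_hom_compose[OF ZC.p_hom[OF iI] U.V.sc_hom] ZC.Z_group U.VU_group ZC.gens_closed])
    show "\<zeta> \<in> add_span Z {(case i of (c, \<mu>) \<Rightarrow> \<lambda>u. zz c \<mu> u) u |i u. i \<in> Rep \<times> C \<and> u \<in> carrier U.VU}"
      using ZC.spanning \<zeta> by blast
    fix \<xi> assume "\<xi> \<in> {(case i of (c, \<mu>) \<Rightarrow> \<lambda>u. zz c \<mu> u) u |i u. i \<in> Rep \<times> C \<and> u \<in> carrier U.VU}"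
    then obtain c' \<mu>' u where j: "c' \<in> Rep" "\<mu>' \<in> C" "u \<in> carrier U" "\<xi> = zz c' \<mu>' u" by auto
    have jI: "(c', \<mu>') \<in> Rep \<times> C" using j by simp
    have au: "a \<odot>\<^bsub>U.VU\<^esub> u \<in> carrier U.VU" for a using U.V.sc_closed j by simp
    have e: "weight_elt x \<odot>\<^bsub>Z\<^esub> \<xi> = zz c' \<mu>' (ta c' \<mu>' x \<odot>\<^bsub>U.VU\<^esub> u)"
      unfolding j(4) by (rule zz_weight_elt[OF x Rep_W[OF j(1)] j(2,3)])
    show "pz (c, \<mu>) (weight_elt x \<odot>\<^bsub>Z\<^esub> \<xi>) = ta c \<mu> x \<odot>\<^bsub>U.VU\<^esub> pz (c, \<mu>) \<xi>"
    proof (cases "(c, \<mu>) = (c', \<mu>')")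
      case True
      then show ?thesis unfolding e using ZC.p_z[OF jI au] ZC.p_z[OF jI, of u] j by simp
    next
      case False
      then show ?thesis unfolding e using ZC.p_z_neq[OF iI jI _ au] ZC.p_z_neq[OF iI jI, of u] j U.V.sc_zero by simp
    qed
  qed
qed

lemma pz_scalar_elt:
  assumes i: "c \<in> Rep" "\<mu> \<in> C" and \<zeta>: "\<zeta> \<in> carrier Z"
  shows "pz (c, \<mu>) (scalar_elt a \<odot>\<^bsub>Z\<^esub> \<zeta>) = a \<odot>\<^bsub>U.VU\<^esub> pz (c, \<mu>) \<zeta>"
proof -
  have iI: "(c, \<mu>) \<in> Rep \<times> C" using i by simp
  show ?thesis
  proof (rule add_hom_eq_on_span[OF add_hom_compose[OF left_module_smult_hom[OF Z_module scalar_elt_closed] ZC.p_hom[OF iI]]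
        add_hom_compose[OF ZC.p_hom[OF iI] U.V.sc_hom] ZC.Z_group U.VU_group ZC.gens_closed])
    show "\<zeta> \<in> add_span Z {(case i of (c, \<mu>) \<Rightarrow> \<lambda>u. zz c \<mu> u) u |i u. i \<in> Rep \<times> C \<and> u \<in> carrier U.VU}"
      using ZC.spanning \<zeta> by blast
    fix \<xi> assume "\<xi> \<in> {(case i of (c, \<mu>) \<Rightarrow> \<lambda>u. zz c \<mu> u) u |i u. i \<in> Rep \<times> C \<and> u \<in> carrier U.VU}"
    then obtain c' \<mu>' u where j: "c' \<in> Rep" "\<mu>' \<in> C" "u \<in> carrier U" "\<xi> = zz c' \<mu>' u" by auto
    have jI: "(c', \<mu>') \<in> Rep \<times> C" using j by simp
    have au: "a \<odot>\<^bsub>U.VU\<^esub> u \<in> carrier U.VU" for a using U.V.sc_closed j by simp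
    have e: "scalar_elt a \<odot>\<^bsub>Z\<^esub> \<xi> = zz c' \<mu>' (a \<odot>\<^bsub>U.VU\<^esub> u)"
      unfolding j(4) by (rule zz_scalar_elt[OF Rep_W[OF j(1)] j(2,3)])
    show "pz (c, \<mu>) (scalar_elt a \<odot>\<^bsub>Z\<^esub> \<xi>) = a \<odot>\<^bsub>U.VU\<^esub> pz (c, \<mu>) \<xi>"
    proof (cases "(c, \<mu>) = (c', \<mu>')")
      case True
      then show ?thesis unfolding e using ZC.p_z[OF jI au] ZC.p_z[OF jI, of u] j by simp
    next
      case False
      then show ?thesis unfolding e using ZC.p_z_neq[OF iI jI _ au] ZC.p_z_neq[OF iI jI, of u] j U.V.sc_zero by simp
    qed
  qed
qed

text \<open>
  Induction on the number of nonzero weight components.  Another weight \<open>c'(\<mu>')\<close> occurring in \<open>\<zeta>\<close>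
  is separated from \<open>c(\<mu>)\<close> by some \<open>e\<^sup>x\<close>; a multiple of \<open>(e\<^sup>x - c'(\<mu>')(x)) \<zeta>\<close> lies in \<open>N\<close>, has the same component at
  \<open>(c, \<mu>)\<close> and none at \<open>(c', \<mu>')\<close>.
\<close>

lemma weight_component:
  assumes N: "submodule N TS.TA Z" and i: "c \<in> Rep" "\<mu> \<in> C"
  shows "\<zeta> \<in> N \<Longrightarrow> zz c \<mu> (pz (c, \<mu>) \<zeta>) \<in> N"
proof (induction "card {j \<in> Rep \<times> C. pz j \<zeta> \<noteq> \<zero>\<^bsub>U.VU\<^esub>}" arbitrary: \<zeta> rule: less_induct)
  case less
  interpret Zm: left_module TS.TA Z by (rule Z_module)
  note Nc = submodule_closed[OF N]
  have \<zeta>: "\<zeta> \<in> carrier Z" using Nc(1) less.prems by blast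
  have iI: "(c, \<mu>) \<in> Rep \<times> C" using i by simp
  have pc: "pz j \<zeta> \<in> carrier U.VU" if "j \<in> Rep \<times> C" for j using ZC.p_closed[OF that \<zeta>] .
  show ?case
  proof (cases "\<exists>j\<in>Rep \<times> C. j \<noteq> (c, \<mu>) \<and> pz j \<zeta> \<noteq> \<zero>\<^bsub>U.VU\<^esub>")
    case False
    have "zz c \<mu> (pz (c, \<mu>) \<zeta>) = \<zeta>"
    proof (rule ZC.coordinates_inject)
      show "zz c \<mu> (pz (c, \<mu>) \<zeta>) \<in> carrier Z" using ZC.z_closed[OF iI pc[OF iI]] by simp
      show "pz j (zz c \<mu> (pz (c, \<mu>) \<zeta>)) = pz j \<zeta>" if j: "j \<in> Rep \<times> C" for j
      proof (cases "j = (c, \<mu>)")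
        case True
        then show ?thesis using ZC.p_z[OF iI pc[OF iI]] by simp
      next
        case neq: False
        then have "pz j \<zeta> = \<zero>\<^bsub>U.VU\<^esub>" using False j by blast
        then show ?thesis using ZC.p_z_neq[OF j iI neq pc[OF iI]] by simp
      qed
    qed (rule \<zeta>)
    then show ?thesis using less.prems by simp
  next
    case True
    then obtain c' \<mu>' where j: "c' \<in> Rep" "\<mu>' \<in> C" "(c', \<mu>') \<noteq> (c, \<mu>)" "pz (c', \<mu>') \<zeta> \<noteq> \<zero>\<^bsub>U.VU\<^esub>" by auto
    obtain x where x: "x \<in> X" "ta c \<mu> x \<noteq> ta c' \<mu>' x"
      using weights_distinct[OF i(1) j(1) i(2) j(2)] j(3) by blast
    define k where "k = 1 / (ta c \<mu> x - ta c' \<mu>' x)"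
    define \<zeta>' where "\<zeta>' = scalar_elt k \<odot>\<^bsub>Z\<^esub> (weight_elt x \<odot>\<^bsub>Z\<^esub> \<zeta>) \<oplus>\<^bsub>Z\<^esub> scalar_elt (- k * ta c' \<mu>' x) \<odot>\<^bsub>Z\<^esub> \<zeta>"
    have \<zeta>'N: "\<zeta>' \<in> N" unfolding \<zeta>'_def by (intro Nc(3,4) less.prems weight_elt_closed x scalar_elt_closed)
    have ez: "weight_elt x \<odot>\<^bsub>Z\<^esub> \<zeta> \<in> carrier Z" by (rule Zm.smult_closed[OF weight_elt_closed[OF x(1)] \<zeta>])
    have p': "pz (d, \<nu>) \<zeta>' = (k * (ta d \<nu> x - ta c' \<mu>' x)) \<odot>\<^bsub>U.VU\<^esub> pz (d, \<nu>) \<zeta>" if d: "d \<in> Rep" "\<nu> \<in> C" for d \<nu>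
    proof -
      have dI: "(d, \<nu>) \<in> Rep \<times> C" using d by simp
      have "pz (d, \<nu>) \<zeta>' = k \<odot>\<^bsub>U.VU\<^esub> (ta d \<nu> x \<odot>\<^bsub>U.VU\<^esub> pz (d, \<nu>) \<zeta>) \<oplus>\<^bsub>U.VU\<^esub> (- k * ta c' \<mu>' x) \<odot>\<^bsub>U.VU\<^esub> pz (d, \<nu>) \<zeta>"
        unfolding \<zeta>'_def
        by (simp only: add_hom_add[OF ZC.p_hom[OF dI] Zm.smult_closed[OF scalar_elt_closed ez] Zm.smult_closed[OF scalar_elt_closed \<zeta>]]
            pz_scalar_elt[OF d ez] pz_scalar_elt[OF d \<zeta>] pz_weight_elt[OF x(1) d \<zeta>])
      also have "\<dots> = (k * ta d \<nu> x + (- k * ta c' \<mu>' x)) \<odot>\<^bsub>U.VU\<^esub> pz (d, \<nu>) \<zeta>"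
        by (simp only: U.V.sc_distl[OF pc[OF dI]] U.V.sc_assoc[OF pc[OF dI]])
      finally show ?thesis by (simp add: algebra_simps)
    qed
    have pi: "pz (c, \<mu>) \<zeta>' = pz (c, \<mu>) \<zeta>"
      using p'[OF i] x(2) U.V.sc_one[OF pc[OF iI]] by (simp add: k_def)
    have sub: "{j \<in> Rep \<times> C. pz j \<zeta>' \<noteq> \<zero>\<^bsub>U.VU\<^esub>} \<subseteq> {j \<in> Rep \<times> C. pz j \<zeta> \<noteq> \<zero>\<^bsub>U.VU\<^esub>} - {(c', \<mu>')}"
    proof
      fix l assume l: "l \<in> {j \<in> Rep \<times> C. pz j \<zeta>' \<noteq> \<zero>\<^bsub>U.VU\<^esub>}"
      obtain d \<nu> where d: "l = (d, \<nu>)" "d \<in> Rep" "\<nu> \<in> C" using l by auto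
      have "pz l \<zeta> \<noteq> \<zero>\<^bsub>U.VU\<^esub>" using l p'[OF d(2,3)] d(1) U.V.sc_zero by auto
      moreover have "l \<noteq> (c', \<mu>')" using l p'[OF j(1,2)] U.V.sc_0[OF pc, of "(c', \<mu>')"] j by auto
      ultimately show "l \<in> {j \<in> Rep \<times> C. pz j \<zeta> \<noteq> \<zero>\<^bsub>U.VU\<^esub>} - {(c', \<mu>')}" using l by blast
    qed
    have "card {j \<in> Rep \<times> C. pz j \<zeta>' \<noteq> \<zero>\<^bsub>U.VU\<^esub>} < card {j \<in> Rep \<times> C. pz j \<zeta> \<noteq> \<zero>\<^bsub>U.VU\<^esub>}"
      by (rule psubset_card_mono[OF ZC.finite_support[OF \<zeta>]]) (use sub j in blast)
    from less.hyps[OF this \<zeta>'N] show ?thesis unfolding pi .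
  qed
qed

text \<open>
  All vectors \<open>u\<close> for which the copy of \<open>u\<close> at weight \<open>\<lambda>\<close> lies in the submodule \<open>N\<close> form a submodule
  of \<open>U\<close>: to apply \<open>g\<close>, carry the copy \<open>(1, \<lambda>)\<close> to \<open>(g, \<lambda>)\<close>, which by \<open>zz_move\<close> is the copy
  \<open>(1, g(\<lambda>))\<close> with \<open>g\<close> applied, and carry it back to \<open>(1, \<lambda>)\<close>.  If \<open>N\<close> is nonzero, it contains a nonzero weight
  component, so this submodule is nonzero, hence \<open>U\<close>.
\<close>

lemma Z_simple:
  assumes simple: "simple_module (group_algebra IG) U"
  shows "simple_module TS.TA Z"
  unfolding simple_module_def
proof (intro conjI allI impI)
  show "left_module TS.TA Z" by (rule Z_module)
  obtain c where c: "c \<in> Rep" using Rep_cover[OF W_id] by blast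
  have cI: "(c, lam) \<in> Rep \<times> C" using c lam_C by simp
  obtain u0 where u0: "u0 \<in> carrier U" "u0 \<noteq> \<zero>\<^bsub>U\<^esub>" using simple_moduleD(3)[OF simple] by blast
  have "pz (c, lam) (zz c lam u0) \<noteq> pz (c, lam) \<zero>\<^bsub>Z\<^esub>"
    using ZC.p_z[OF cI, of u0] ZC.p_zero[OF cI cI] u0 by simp
  then show "carrier Z \<noteq> {\<zero>\<^bsub>Z\<^esub>}" using ZC.z_closed[OF cI, of u0] u0 by auto
next
  fix N assume N: "submodule N TS.TA Z"
  note Nc = submodule_closed[OF N]
  show "N = {\<zero>\<^bsub>Z\<^esub>} \<or> N = carrier Z"
  proof (cases "N = {\<zero>\<^bsub>Z\<^esub>}")
    case False
    then obtain \<zeta> where \<zeta>: "\<zeta> \<in> N" "\<zeta> \<noteq> \<zero>\<^bsub>Z\<^esub>" using Nc(2) by blast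
    have \<zeta>Z: "\<zeta> \<in> carrier Z" using \<zeta> Nc(1) by blast
    obtain c \<mu> where i: "c \<in> Rep" "\<mu> \<in> C" "pz (c, \<mu>) \<zeta> \<noteq> \<zero>\<^bsub>U\<^esub>"
    proof -
      have "\<exists>j\<in>Rep \<times> C. pz j \<zeta> \<noteq> pz j \<zero>\<^bsub>Z\<^esub>"
        using ZC.coordinates_inject[OF \<zeta>Z ZC.Z.zero_closed] \<zeta>(2) by blast
      then show thesis using that ZC.p_zero by auto
    qed
    have iI: "(c, \<mu>) \<in> Rep \<times> C" using i by simp
    have move: "zz v \<nu> u \<in> N" if "zz w \<mu> u \<in> N" "w \<in> W" "v \<in> W" "\<mu> \<in> C" "\<nu> \<in> C" "u \<in> carrier U" for w v \<mu> \<nu> u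
      using Nc(4)[OF transport_elt_closed[OF that(2-5)] that(1)] zz_transport_elt[OF that(2-6)] by simp
    define U' where "U' = {u \<in> carrier U. zz id lam u \<in> N}"
    have act: "b \<odot>\<^bsub>U.VU\<^esub> U.ga g u \<in> U'" if g: "g \<in> Gs" and u: "u \<in> U'" for b g u
    proof -
      have uU: "u \<in> carrier U" using u by (simp add: U'_def)
      have gu: "U.ga g u \<in> carrier U" by (rule ga_closed[OF g uU])
      have "zz (id \<circ> g) lam u \<in> N"
        using move[of id lam u "id \<circ> g" lam] u uU W_id Gs_W[OF g] lam_C by (simp add: U'_def)
      then have "zz id (ta g lam) (U.ga g u) \<in> N" by (simp only: zz_move[OF W_id g lam_C uU])
      then have "zz id lam (U.ga g u) \<in> N" by (rule move[OF _ W_id W_id Gs_C[OF g lam_C] lam_C gu])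
      then have "scalar_elt b \<odot>\<^bsub>Z\<^esub> zz id lam (U.ga g u) \<in> N" by (rule Nc(4)[OF scalar_elt_closed])
      then have "zz id lam (b \<odot>\<^bsub>U.VU\<^esub> U.ga g u) \<in> N" by (simp only: zz_scalar_elt[OF W_id lam_C gu])
      then show ?thesis using U.V.sc_closed[of "U.ga g u" b] gu by (simp add: U'_def)
    qed
    note zh = zz_hom[OF W_id lam_C]
    have U'0: "\<zero>\<^bsub>U\<^esub> \<in> U'"
      using add_hom_zero[OF zh U.VU_group ZC.Z_group] Nc(2) U.U.M.zero_closed by (simp add: U'_def)
    have U'add: "u \<oplus>\<^bsub>U\<^esub> v \<in> U'" if "u \<in> U'" "v \<in> U'" for u v
      using that add_hom_add[OF zh, of u v] Nc(3) U.U.M.a_closed by (simp add: U'_def)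
    have "submodule U' (group_algebra IG) U"
    proof (rule left_module_submoduleI[OF U.U_module])
      fix a u assume a: "a \<in> carrier (group_algebra IG)" and u: "u \<in> U'"
      have uU: "u \<in> carrier U" using u by (simp add: U'_def)
      have "a \<in> add_span (group_algebra IG) FG.CG.pures" using FG.CG.TA_span a by (simp add: FG.CA_def)
      then show "a \<odot>\<^bsub>U\<^esub> u \<in> U'"
      proof induction
        case zero
        then show ?case using left_module_zero_smult[OF U.U_module uU] U'0 by simp
      next
        case (base a)
        then show ?case using U.pure_smult[OF _ uU] act[OF _ u] by (auto simp: IG_simps)
      next
        case (add a b)
        have "FG.CG.pures \<subseteq> carrier (group_algebra IG)" using FG.CG.pures_closed by (simp add: FG.CA_def)
        then have "a \<in> carrier (group_algebra IG)" "b \<in> carrier (group_algebra IG)"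
          using add.hyps add_span_subset[OF FG.CA_group] by blast+
        then show ?case using add.IH U'add U.U.smult_l_distr[OF _ _ uU] by simp
      qed
    qed (use U'0 U'add in \<open>auto simp: U'_def\<close>)
    moreover have "pz (c, \<mu>) \<zeta> \<in> U'"
    proof -
      have u: "pz (c, \<mu>) \<zeta> \<in> carrier U" using ZC.p_closed[OF iI \<zeta>Z] by simp
      then show ?thesis
        using move[OF weight_component[OF N i(1,2) \<zeta>(1)] Rep_W[OF i(1)] W_id i(2) lam_C] by (simp add: U'_def)
    qed
    ultimately have full: "U' = carrier U" using simple_moduleD(2)[OF simple] i(3) by blast
    have "carrier Z \<subseteq> N"
    proof
      fix \<xi> assume "\<xi> \<in> carrier Z"
      then show "\<xi> \<in> N"
      proof (induction rule: ZC.induct_span)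
        case (base j u)
        then obtain d \<nu> where d: "j = (d, \<nu>)" "d \<in> Rep" "\<nu> \<in> C" "u \<in> carrier U" by auto
        then have "u \<in> U'" using full by simp
        then show ?case using move[OF _ W_id Rep_W[OF d(2)] lam_C d(3,4)] d(1) by (simp add: U'_def)
      qed (use Nc(2,3) in auto)
    qed
    then show ?thesis using Nc(1) by blast
  qed simp
qed

end

text \<open>
  The isomorphism commutes with all \<open>e\<^sup>x\<close>, so it maps the weight space of \<open>c(\<lambda>)\<close> to that of the same
  weight, that is, by a map \<open>\<phi> : U1 \<rightarrow> U2\<close>.  Commuting with the elements that return to this weight
  after a shift by \<open>g\<close> makes \<open>\<phi>\<close> a homomorphism of \<open>G\<close>-modules.
\<close>

lemma (in weight_setup) Z_isomorphic_imp:
  fixes U1 :: "(('h \<Rightarrow> 'h) \<Rightarrow> complex, 'u) module" and U2 :: "(('h \<Rightarrow> 'h) \<Rightarrow> complex, 'u2) module"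
  assumes s1: "simple_module (group_algebra IG) U1" and s2: "simple_module (group_algebra IG) U2"
    and f: "bij_betw f (carrier (induced_module TS.TA TS.H.TA id (weight_rep.VM \<Delta> X Y n s lam U1)))
       (carrier (induced_module TS.TA TS.H.TA id (weight_rep.VM \<Delta> X Y n s lam U2)))"
      "mod_hom TS.TA (induced_module TS.TA TS.H.TA id (weight_rep.VM \<Delta> X Y n s lam U1))
        (induced_module TS.TA TS.H.TA id (weight_rep.VM \<Delta> X Y n s lam U2)) f"
  shows "module_isomorphic (group_algebra IG) U1 U2"
proof -
  interpret A: weight_rep \<Delta> X Y n q s lam U1
    by (intro weight_rep.intro weight_setup_axioms gmodule.intro FG.finite_group_axioms simple_moduleD(1)[OF s1])
  interpret B: weight_rep \<Delta> X Y n q s lam U2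
    by (intro weight_rep.intro weight_setup_axioms gmodule.intro FG.finite_group_axioms simple_moduleD(1)[OF s2])
  obtain c where c: "c \<in> Rep" using Rep_cover[OF W_id] by blast
  note cW = Rep_W[OF c]
  have cI: "(c, lam) \<in> Rep \<times> C" using c lam_C by simp
  note fh = mod_homD(1)[OF f(2)] and fs = mod_homD(2)[OF f(2)]
  define \<phi> where "\<phi> u = B.pz (c, lam) (f (A.zz c lam u))" for u
  have zc: "A.zz c lam u \<in> carrier A.Z" if "u \<in> carrier U1" for u by (rule A.zz_closed[OF cW lam_C that])
  have fzc: "f (A.zz c lam u) \<in> carrier B.Z" if "u \<in> carrier U1" for u by (rule add_hom_closed[OF fh zc[OF that]])
  have \<phi>c: "\<phi> u \<in> carrier U2" if "u \<in> carrier U1" for u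
    using B.ZC.p_closed[OF cI fzc[OF that]] by (simp add: \<phi>_def)
  have \<phi>h: "add_hom A.U.VU B.U.VU \<phi>"
    unfolding \<phi>_def[abs_def] by (rule add_hom_compose[OF add_hom_compose[OF A.zz_hom[OF cW lam_C] fh] B.ZC.p_hom[OF cI]])
  have fz: "f (A.zz c lam u) = B.zz c lam (\<phi> u)" if u: "u \<in> carrier U1" for u
  proof (rule B.ZC.coordinates_inject[OF fzc[OF u] B.zz_closed[OF cW lam_C \<phi>c[OF u]]])
    fix j assume j: "j \<in> Rep \<times> C"
    have \<phi>u: "\<phi> u \<in> carrier B.U.VU" using \<phi>c[OF u] by simp
    show "B.pz j (f (A.zz c lam u)) = B.pz j (B.zz c lam (\<phi> u))"
    proof (cases "j = (c, lam)")
      case True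
      then show ?thesis using B.ZC.p_z[OF cI \<phi>u] by (simp add: \<phi>_def)
    next
      case False
      obtain d \<nu> where d: "j = (d, \<nu>)" "d \<in> Rep" "\<nu> \<in> C" using j by auto
      obtain x where x: "x \<in> X" "ta d \<nu> x \<noteq> ta c lam x"
        using weights_distinct[OF d(2) c d(3) lam_C] False d(1) by blast
      have uV: "u \<in> carrier A.U.VU" using u by simp
      have "A.zz c lam (ta c lam x \<odot>\<^bsub>A.U.VU\<^esub> u) = scalar_elt (ta c lam x) \<odot>\<^bsub>A.Z\<^esub> A.zz c lam u"
        by (simp only: A.zz_scalar_elt[OF cW lam_C u])
      then have "weight_elt x \<odot>\<^bsub>A.Z\<^esub> A.zz c lam u = scalar_elt (ta c lam x) \<odot>\<^bsub>A.Z\<^esub> A.zz c lam u"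
        by (simp only: A.zz_weight_elt[OF x(1) cW lam_C u])
      then have "weight_elt x \<odot>\<^bsub>B.Z\<^esub> f (A.zz c lam u) = scalar_elt (ta c lam x) \<odot>\<^bsub>B.Z\<^esub> f (A.zz c lam u)"
        by (simp only: fs[OF weight_elt_closed[OF x(1)] zc[OF u], symmetric] fs[OF scalar_elt_closed zc[OF u], symmetric])
      then have e: "ta d \<nu> x \<odot>\<^bsub>B.U.VU\<^esub> B.pz j (f (A.zz c lam u)) = ta c lam x \<odot>\<^bsub>B.U.VU\<^esub> B.pz j (f (A.zz c lam u))"
        using B.pz_weight_elt[OF x(1) d(2,3) fzc[OF u]] B.pz_scalar_elt[OF d(2,3) fzc[OF u], of "ta c lam x"] d(1) by simp
      have pc: "B.pz j (f (A.zz c lam u)) \<in> carrier B.U.VU" by (rule B.ZC.p_closed[OF j fzc[OF u]])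
      have "(ta d \<nu> x - ta c lam x) \<odot>\<^bsub>B.U.VU\<^esub> B.pz j (f (A.zz c lam u)) = \<zero>\<^bsub>B.U.VU\<^esub>"
        using B.U.V.sc_distl[OF pc, of "ta d \<nu> x" "- ta c lam x"] B.U.V.sc_distl[OF pc, of "ta c lam x" "- ta c lam x"]
          e B.U.V.sc_0[OF pc] by simp
      then have "B.pz j (f (A.zz c lam u)) = \<zero>\<^bsub>B.U.VU\<^esub>"
        using B.U.V.sc_eq_zero[OF pc] x(2) by simp
      moreover have "B.pz j (B.zz c lam (\<phi> u)) = \<zero>\<^bsub>B.U.VU\<^esub>"
        using B.ZC.p_z_neq[OF j cI False \<phi>u] by simp
      ultimately show ?thesis by simp
    qed
  qed
  have pB: "B.pz (c, lam) (B.zz c lam v) = v" if "v \<in> carrier U2" for v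
    using B.ZC.p_z[OF cI, of v] that by simp
  have sc: "\<phi> (b \<odot>\<^bsub>A.U.VU\<^esub> u) = b \<odot>\<^bsub>B.U.VU\<^esub> \<phi> u" if u: "u \<in> carrier U1" for b u
  proof -
    have bu: "b \<odot>\<^bsub>B.U.VU\<^esub> \<phi> u \<in> carrier U2" using B.U.V.sc_closed[of "\<phi> u" b] \<phi>c[OF u] by simp
    have "f (A.zz c lam (b \<odot>\<^bsub>A.U.VU\<^esub> u)) = scalar_elt b \<odot>\<^bsub>B.Z\<^esub> f (A.zz c lam u)"
      by (simp only: A.zz_scalar_elt[OF cW lam_C u, symmetric] fs[OF scalar_elt_closed zc[OF u]])
    also have "\<dots> = B.zz c lam (b \<odot>\<^bsub>B.U.VU\<^esub> \<phi> u)" by (simp only: fz[OF u] B.zz_scalar_elt[OF cW lam_C \<phi>c[OF u]])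
    finally show ?thesis using pB[OF bu] by (simp add: \<phi>_def)
  qed
  have ga: "\<phi> (A.U.ga g u) = B.U.ga g (\<phi> u)" if g: "g \<in> Gs" and u: "u \<in> carrier U1" for g u
  proof -
    note gl = Gs_C[OF g lam_C] and cg = W_comp[OF cW Gs_W[OF g]]
    \<comment> \<open>\<open>r2 r1\<close> carries the copy \<open>(c, \<lambda>)\<close> to \<open>(c g, \<lambda>) = (c, g(\<lambda>))\<close> and back, and acts by \<open>g\<close>\<close>
    define r1 where "r1 = transport_elt c lam (c \<circ> g) lam"
    define r2 where "r2 = transport_elt c (ta g lam) c lam"
    have r: "r1 \<in> carrier TS.TA" "r2 \<in> carrier TS.TA"
      unfolding r1_def r2_def by (intro transport_elt_closed cW cg lam_C gl)+
    have a: "r2 \<odot>\<^bsub>A.Z\<^esub> (r1 \<odot>\<^bsub>A.Z\<^esub> A.zz c lam u) = A.zz c lam (A.U.ga g u)"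
      unfolding r1_def r2_def
      by (simp only: A.zz_transport_elt[OF cW cg lam_C lam_C u] A.zz_move[OF cW g lam_C u]
          A.zz_transport_elt[OF cW cW gl lam_C A.ga_closed[OF g u]])
    have b: "r2 \<odot>\<^bsub>B.Z\<^esub> (r1 \<odot>\<^bsub>B.Z\<^esub> B.zz c lam (\<phi> u)) = B.zz c lam (B.U.ga g (\<phi> u))"
      unfolding r1_def r2_def
      by (simp only: B.zz_transport_elt[OF cW cg lam_C lam_C \<phi>c[OF u]] B.zz_move[OF cW g lam_C \<phi>c[OF u]]
          B.zz_transport_elt[OF cW cW gl lam_C B.ga_closed[OF g \<phi>c[OF u]]])
    have "f (A.zz c lam (A.U.ga g u)) = B.zz c lam (B.U.ga g (\<phi> u))"
      unfolding a[symmetric] b[symmetric]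
      by (simp only: fs[OF r(2) left_module.smult_closed[OF A.Z_module r(1) zc[OF u]]] fs[OF r(1) zc[OF u]] fz[OF u])
    then show ?thesis using pB[OF B.ga_closed[OF g \<phi>c[OF u]]] by (simp add: \<phi>_def)
  qed
  have hom: "mod_hom (group_algebra IG) U1 U2 \<phi>"
    unfolding mod_hom_def
  proof (intro conjI ballI)
    show hU: "add_hom U1 U2 \<phi>" using \<phi>h by (simp add: add_hom_def)
    fix a u assume a: "a \<in> carrier (group_algebra IG)" and u: "u \<in> carrier U1"
    show "\<phi> (a \<odot>\<^bsub>U1\<^esub> u) = a \<odot>\<^bsub>U2\<^esub> \<phi> u"
    proof (rule FG.CA_hom_eqI[OF add_hom_compose[OF left_module_scalar_hom[OF A.U.U_module u] hU]
          left_module_scalar_hom[OF B.U.U_module \<phi>c[OF u]] B.U.U_group _ a])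
      fix b :: complex and g assume "g \<in> carrier IG"
      then have g: "g \<in> carrier IG" "g \<in> Gs" by (simp_all add: IG_simps)
      show "\<phi> (pure_elt complex_ring b g \<odot>\<^bsub>U1\<^esub> u) = pure_elt complex_ring b g \<odot>\<^bsub>U2\<^esub> \<phi> u"
        by (simp only: A.U.pure_smult[OF g(1) u] B.U.pure_smult[OF g(1) \<phi>c[OF u]] sc[OF A.ga_closed[OF g(2) u]] ga[OF g(2) u])
    qed
  qed
  obtain u where u: "u \<in> carrier U1" "u \<noteq> \<zero>\<^bsub>U1\<^esub>" using simple_moduleD(3)[OF s1] by blast
  have "\<phi> u \<noteq> \<zero>\<^bsub>U2\<^esub>"
  proof
    assume "\<phi> u = \<zero>\<^bsub>U2\<^esub>"
    then have "f (A.zz c lam u) = \<zero>\<^bsub>B.Z\<^esub>"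
      using fz[OF u(1)] add_hom_zero[OF B.zz_hom[OF cW lam_C] B.U.VU_group B.ZC.Z_group] by simp
    also have "\<dots> = f \<zero>\<^bsub>A.Z\<^esub>" by (rule add_hom_zero[OF fh A.ZC.Z_group B.ZC.Z_group, symmetric])
    finally have "A.zz c lam u = \<zero>\<^bsub>A.Z\<^esub>"
      using f(1) zc[OF u(1)] A.ZC.Z.zero_closed unfolding bij_betw_def by (meson inj_onD)
    then have "A.pz (c, lam) (A.zz c lam u) = \<zero>\<^bsub>U1\<^esub>" using A.ZC.p_zero[OF cI cI] by simp
    then show False using A.ZC.p_z[OF cI, of u] u by simp
  qed
  then show ?thesis using schur_isomorphic[OF s1 s2 hom u(1)] by blast
qed

section \<open>The decomposition of the induced module\<close>

lemma direct_sum_simps: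
  "f \<in> carrier (direct_sum I M) \<longleftrightarrow> f \<in> (\<Pi>\<^sub>E i\<in>I. carrier (M i)) \<and> finite {i \<in> I. f i \<noteq> \<zero>\<^bsub>M i\<^esub>}"
  "\<zero>\<^bsub>direct_sum I M\<^esub> = (\<lambda>i\<in>I. \<zero>\<^bsub>M i\<^esub>)"
  "f \<oplus>\<^bsub>direct_sum I M\<^esub> g = (\<lambda>i\<in>I. f i \<oplus>\<^bsub>M i\<^esub> g i)"
  "a \<odot>\<^bsub>direct_sum I M\<^esub> f = (\<lambda>i\<in>I. a \<odot>\<^bsub>M i\<^esub> f i)"
  by (simp_all add: direct_sum_def)

lemma direct_sum_cong:
  assumes "\<And>i. i \<in> I \<Longrightarrow> F i = F' i"
  shows "direct_sum I F = direct_sum I F'"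
proof -
  have "{f \<in> \<Pi>\<^sub>E i\<in>I. carrier (F i). finite {i \<in> I. f i \<noteq> \<zero>\<^bsub>F i\<^esub>}} = {f \<in> \<Pi>\<^sub>E i\<in>I. carrier (F' i). finite {i \<in> I. f i \<noteq> \<zero>\<^bsub>F' i\<^esub>}}"
    (is "{f \<in> ?A. ?P f} = {f \<in> ?B. ?Q f}")
  proof -
    have "?A = ?B" by (rule PiE_cong) (simp add: assms)
    moreover have "{i \<in> I. f i \<noteq> \<zero>\<^bsub>F i\<^esub>} = {i \<in> I. f i \<noteq> \<zero>\<^bsub>F' i\<^esub>}" for f by (rule Collect_cong) (use assms in auto)
    ultimately show ?thesis by simp
  qed
  then show ?thesis
    unfolding direct_sum_def using assms by (simp add: fun_eq_iff restrict_def)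
qed

lemma direct_sum_module:
  assumes "finite I" "ring R" "\<And>i. i \<in> I \<Longrightarrow> left_module R (M i)"
  shows "left_module R (direct_sum I M)"
proof -
  have g: "abelian_group (M i)" if "i \<in> I" for i by (rule left_module_groups(1)[OF assms(3)[OF that]])
  note gE = abelian_groupE[OF g]
  have fin: "finite {i \<in> I. P i}" for P using assms(1) by simp
  have car: "f \<in> carrier (direct_sum I M) \<longleftrightarrow> f \<in> (\<Pi>\<^sub>E i\<in>I. carrier (M i))" for f
    using fin by (simp add: direct_sum_simps)
  have mem: "f i \<in> carrier (M i)" if "f \<in> carrier (direct_sum I M)" "i \<in> I" for f i
    using that unfolding car by (rule PiE_mem)
  have ext: "f = (\<lambda>i\<in>I. f i)" if "f \<in> carrier (direct_sum I M)" for f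
    using that unfolding car PiE_def by (simp add: extensional_restrict)
  have closed: "(\<lambda>i\<in>I. f i) \<in> carrier (direct_sum I M)" if "\<And>i. i \<in> I \<Longrightarrow> f i \<in> carrier (M i)" for f
    unfolding car using that by (simp add: restrict_PiE_iff)
  have "abelian_group (direct_sum I M)"
  proof (rule abelian_groupI)
    fix f assume f: "f \<in> carrier (direct_sum I M)"
    note inv = abelian_group.a_inv_closed[OF g mem[OF f]]
    have "(\<lambda>i\<in>I. \<ominus>\<^bsub>M i\<^esub> f i) \<in> carrier (direct_sum I M)"
      by (rule closed[OF inv])
    moreover have "(\<lambda>i\<in>I. \<ominus>\<^bsub>M i\<^esub> f i) \<oplus>\<^bsub>direct_sum I M\<^esub> f = \<zero>\<^bsub>direct_sum I M\<^esub>"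
      unfolding direct_sum_simps by (rule restrict_ext) (simp add: abelian_group.l_neg[OF g mem[OF f]])
    ultimately show "\<exists>y\<in>carrier (direct_sum I M). y \<oplus>\<^bsub>direct_sum I M\<^esub> f = \<zero>\<^bsub>direct_sum I M\<^esub>" by blast
  next
    fix f g h assume fgh: "f \<in> carrier (direct_sum I M)" "g \<in> carrier (direct_sum I M)" "h \<in> carrier (direct_sum I M)"
    show "f \<oplus>\<^bsub>direct_sum I M\<^esub> g \<oplus>\<^bsub>direct_sum I M\<^esub> h = f \<oplus>\<^bsub>direct_sum I M\<^esub> (g \<oplus>\<^bsub>direct_sum I M\<^esub> h)"
      unfolding direct_sum_simps by (rule restrict_ext) (simp add: gE(3) fgh[THEN mem])
  next
    fix f g assume fg: "f \<in> carrier (direct_sum I M)" "g \<in> carrier (direct_sum I M)"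
    show "f \<oplus>\<^bsub>direct_sum I M\<^esub> g = g \<oplus>\<^bsub>direct_sum I M\<^esub> f"
      unfolding direct_sum_simps by (rule restrict_ext) (rule gE(4)[OF _ fg[THEN mem]])
    show "f \<oplus>\<^bsub>direct_sum I M\<^esub> g \<in> carrier (direct_sum I M)"
      unfolding direct_sum_simps(3) by (rule closed) (rule gE(1)[OF _ fg[THEN mem]])
  next
    show "\<zero>\<^bsub>direct_sum I M\<^esub> \<in> carrier (direct_sum I M)" unfolding direct_sum_simps(2) by (rule closed) (rule gE(2))
    fix f assume f: "f \<in> carrier (direct_sum I M)"
    show "\<zero>\<^bsub>direct_sum I M\<^esub> \<oplus>\<^bsub>direct_sum I M\<^esub> f = f"
      unfolding direct_sum_simps
      by (subst (2) ext[OF f], rule restrict_ext) (simp add: gE(5) mem[OF f])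
  qed
  then show ?thesis
  proof (intro left_module.intro left_module_axioms.intro assms(2))
    fix a f assume a: "a \<in> carrier R" and f: "f \<in> carrier (direct_sum I M)"
    show "a \<odot>\<^bsub>direct_sum I M\<^esub> f \<in> carrier (direct_sum I M)"
      unfolding direct_sum_simps(4) by (rule closed) (rule left_module.smult_closed[OF assms(3) a mem[OF f]])
    fix b assume b: "b \<in> carrier R"
    show "(a \<oplus>\<^bsub>R\<^esub> b) \<odot>\<^bsub>direct_sum I M\<^esub> f = a \<odot>\<^bsub>direct_sum I M\<^esub> f \<oplus>\<^bsub>direct_sum I M\<^esub> b \<odot>\<^bsub>direct_sum I M\<^esub> f"
      unfolding direct_sum_simps
      by (rule restrict_ext) (simp add: left_module.smult_l_distr[OF assms(3) a b mem[OF f]])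
    show "(a \<otimes>\<^bsub>R\<^esub> b) \<odot>\<^bsub>direct_sum I M\<^esub> f = a \<odot>\<^bsub>direct_sum I M\<^esub> (b \<odot>\<^bsub>direct_sum I M\<^esub> f)"
      unfolding direct_sum_simps
      by (rule restrict_ext) (simp add: left_module.smult_assoc[OF assms(3) a b mem[OF f]])
  next
    fix a f g assume a: "a \<in> carrier R" and fg: "f \<in> carrier (direct_sum I M)" "g \<in> carrier (direct_sum I M)"
    show "a \<odot>\<^bsub>direct_sum I M\<^esub> (f \<oplus>\<^bsub>direct_sum I M\<^esub> g) = a \<odot>\<^bsub>direct_sum I M\<^esub> f \<oplus>\<^bsub>direct_sum I M\<^esub> a \<odot>\<^bsub>direct_sum I M\<^esub> g"
      unfolding direct_sum_simps
      by (rule restrict_ext) (simp add: left_module.smult_r_distr[OF assms(3) a mem[OF fg(1)] mem[OF fg(2)]])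
  next
    fix f assume f: "f \<in> carrier (direct_sum I M)"
    show "\<one>\<^bsub>R\<^esub> \<odot>\<^bsub>direct_sum I M\<^esub> f = f"
      unfolding direct_sum_simps
      by (subst (2) ext[OF f], rule restrict_ext) (simp add: left_module.smult_one[OF assms(3)] mem[OF f])
  qed
qed

context weight_setup
begin

sublocale LI: induction TS.TA H "\<lambda>h. pure_elt H h \<one>\<^bsub>WG\<^esub>" M
  by (intro induction.intro induction_axioms.intro TS.TA_ring H_ring M_module)
     (rule TS.pure_closed[OF _ TS.G.one_closed])

abbreviation L where "L \<equiv> LI.Ind"

lemma induced_M_eq: "induced_M \<Delta> X Y n s lam = L"
  by (simp add: induced_M_def twisted_qtorus_eq)

text \<open>
  \<open>w \<otimes> b v\<^sub>\<mu>\<close>, the elements of the line \<open>(w, \<mu>)\<close> of \<open>L\<close>.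
\<close>

definition ll where "ll w \<mu> b = LI.tens (pure_elt H \<one>\<^bsub>H\<^esub> w) (single \<mu> b)"

lemma ll_closed: "w \<in> W \<Longrightarrow> \<mu> \<in> C \<Longrightarrow> ll w \<mu> b \<in> carrier L"
  unfolding ll_def LI.Ind_eq by (rule LI.tens_closed[OF pure1_closed M_single_closed])

lemma L_coproduct_ex:
  "\<exists>p. add_coproduct L (W \<times> C) (\<lambda>_. complex_ring) (\<lambda>(w, \<mu>) b. ll w \<mu> b) p"
proof -
  obtain p where p: "add_coproduct L W (\<lambda>_. M) (\<lambda>w. LI.tens (pure_elt H \<one>\<^bsub>H\<^esub> w)) p"
    using TS.induced_coproduct_base[OF M_module] by blast
  from add_coproduct_compose[OF p M_coproduct] show ?thesis unfolding ll_def by blast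
qed

definition pl where "pl = (SOME p. add_coproduct L (W \<times> C) (\<lambda>_. complex_ring) (\<lambda>(w, \<mu>) b. ll w \<mu> b) p)"

sublocale LC: add_coproduct L "W \<times> C" "\<lambda>_. complex_ring" "\<lambda>(w, \<mu>) b. ll w \<mu> b" pl
  unfolding pl_def by (rule someI_ex[OF L_coproduct_ex])

lemma L_module: "left_module TS.TA L" by (rule LI.Ind_module)

end

context weight_rep
begin

text \<open>
  \<open>f \<otimes> m \<mapsto> f \<otimes> (m \<otimes> u)\<close> is balanced over the quantum torus because the latter acts on \<open>M \<otimes> U\<close>
  through \<open>M\<close> alone.
\<close>

lemma theta_exists:
  assumes u: "u \<in> carrier U"
  shows "\<exists>\<theta>. mod_hom TS.TA L Z \<theta> \<and> (\<forall>w\<in>W. \<forall>\<mu>\<in>C. \<forall>b. \<theta> (ll w \<mu> b) = zz w \<mu> (b \<odot>\<^bsub>U.VU\<^esub> u))"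
proof -
  have bal: "ZI.tens (f \<otimes>\<^bsub>TS.TA\<^esub> pure_elt H h \<one>\<^bsub>WG\<^esub>) (vt m u) = ZI.tens f (vt (h \<odot>\<^bsub>M\<^esub> m) u)"
    if f: "f \<in> carrier TS.TA" and h: "h \<in> carrier H" and m: "m \<in> carrier M" for f h m
  proof -
    have one: "\<one>\<^bsub>WG\<^esub> \<in> Gs" by (rule TS.H_one)
    have ph: "pure_elt H h \<one>\<^bsub>WG\<^esub> \<in> carrier TS.H.TA" using TS.H.pure_closed[OF h] one by simp
    have "U.ga \<one>\<^bsub>WG\<^esub> u = u" using U.ga_one[OF u] by (simp only: IG_simps)
    then have "pure_elt H h \<one>\<^bsub>WG\<^esub> \<odot>\<^bsub>VM\<^esub> vt m u = vt (h \<odot>\<^bsub>M\<^esub> m) u"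
      using VM_pure[OF h one m u] gM_id[OF m] by (simp add: W_one)
    then show ?thesis using ZI.tens_balanced[OF f ph vt_closed[OF m u]] by simp
  qed
  obtain \<theta> where \<theta>: "add_hom L Z \<theta>" "\<And>f m. f \<in> carrier TS.TA \<Longrightarrow> m \<in> carrier M \<Longrightarrow> \<theta> (LI.tens f m) = ZI.tens f (vt m u)"
  proof (rule LI.universal[of Z "\<lambda>f m. ZI.tens f (vt m u)" LI.act0])
    show "abelian_group Z" by (rule ZC.Z_group)
    show "ZI.tens f (vt m u) \<in> carrier Z" if "f \<in> carrier TS.TA" "m \<in> carrier M" for f m
      unfolding ZI.Ind_eq by (rule ZI.tens_closed[OF that(1) vt_closed[OF that(2) u]])
    show "ZI.tens (f \<oplus>\<^bsub>TS.TA\<^esub> f') (vt m u) = ZI.tens f (vt m u) \<oplus>\<^bsub>Z\<^esub> ZI.tens f' (vt m u)"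
      if "f \<in> carrier TS.TA" "f' \<in> carrier TS.TA" "m \<in> carrier M" for f f' m
      unfolding ZI.Ind_eq by (rule ZI.tens_add_left[OF that(1,2) vt_closed[OF that(3) u]])
    show "ZI.tens f (vt (m \<oplus>\<^bsub>M\<^esub> m') u) = ZI.tens f (vt m u) \<oplus>\<^bsub>Z\<^esub> ZI.tens f (vt m' u)"
      if "f \<in> carrier TS.TA" "m \<in> carrier M" "m' \<in> carrier M" for f m m'
      unfolding ZI.Ind_eq add_hom_add[OF vt_hom_left[OF u] that(2,3)]
      by (rule ZI.tens_add_right[OF that(1) vt_closed[OF that(2) u] vt_closed[OF that(3) u]])
  qed (use bal in \<open>auto simp: LI.Ind_eq\<close>)
  have "mod_hom TS.TA L Z \<theta>"
    unfolding mod_hom_def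
  proof (intro conjI ballI)
    fix r x assume r: "r \<in> carrier TS.TA" and x: "x \<in> carrier L"
    show "\<theta> (r \<odot>\<^bsub>L\<^esub> x) = r \<odot>\<^bsub>Z\<^esub> \<theta> x"
    proof (rule LI.T_hom_eqI[of LI.act0, folded LI.Ind_eq, OF add_hom_compose[OF LI.Ind_smult_hom[OF r] \<theta>(1)]
          add_hom_compose[OF \<theta>(1) ZI.Ind_smult_hom[OF r]] ZC.Z_group _ x])
      fix f m assume f: "f \<in> carrier TS.TA" and m: "m \<in> carrier M"
      have rf: "r \<otimes>\<^bsub>TS.TA\<^esub> f \<in> carrier TS.TA" by (rule TS.TA_mult_closed[OF r f])
      show "\<theta> (r \<odot>\<^bsub>L\<^esub> LI.tens f m) = r \<odot>\<^bsub>Z\<^esub> \<theta> (LI.tens f m)"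
        by (simp only: LI.Ind_smult_tens[OF r f m] \<theta>(2)[OF rf m] \<theta>(2)[OF f m] ZI.Ind_smult_tens[OF r f vt_closed[OF m u]])
    qed
  qed (rule \<theta>(1))
  moreover have "\<theta> (ll w \<mu> b) = zz w \<mu> (b \<odot>\<^bsub>U.VU\<^esub> u)" if "w \<in> W" "\<mu> \<in> C" for w \<mu> b
    unfolding ll_def zz_def by (simp only: \<theta>(2)[OF pure1_closed[OF that(1)] M_single_closed[OF that(2)]] vt_single[OF that(2) u])
  ultimately show ?thesis by blast
qed

text \<open>
  By \<open>zz_move\<close> the lines \<open>(c g, g\<^sup>-\<^sup>1(\<nu>))\<close> are the ones that the homomorphisms of \<open>theta_exists\<close> send to the
  copy \<open>(c, \<nu>)\<close>.  The coordinates of \<open>x\<close> on them are read as an element of the group algebra.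
\<close>

definition slice where "slice c \<nu> x = (\<lambda>g. if g \<in> Gs then pl (c \<circ> g, ta (wi g) \<nu>) x else 0)"

lemma slice_index: "c \<in> Rep \<Longrightarrow> \<nu> \<in> C \<Longrightarrow> g \<in> Gs \<Longrightarrow> (c \<circ> g, ta (wi g) \<nu>) \<in> W \<times> C"
proof -
  assume c: "c \<in> Rep" and \<nu>: "\<nu> \<in> C" and g: "g \<in> Gs"
  have "wi g \<in> Gs" using subgroup.m_inv_closed[OF Gs_subgroup g] by (simp only: W_inv[OF Gs_W[OF g]])
  then show ?thesis using W_comp[OF Rep_W[OF c] Gs_W[OF g]] Gs_C[OF _ \<nu>] by simp
qed

lemma slice_closed: "slice c \<nu> x \<in> carrier (group_algebra IG)"
  by (simp add: FG.CA_carrier slice_def IG_simps)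

text \<open>
  Both sides are additive in \<open>x\<close>, and on the line \<open>(c g, g\<^sup>-\<^sup>1(\<nu>))\<close> both are \<open>b \<mapsto> b g u\<close> by
  \<open>zz_move\<close>.
\<close>

lemma slice_theta:
  assumes \<theta>: "mod_hom TS.TA L Z \<theta>" "\<And>w \<mu> b. w \<in> W \<Longrightarrow> \<mu> \<in> C \<Longrightarrow> \<theta> (ll w \<mu> b) = zz w \<mu> (b \<odot>\<^bsub>U.VU\<^esub> u)"
    and u: "u \<in> carrier U" and c: "c \<in> Rep" and \<nu>: "\<nu> \<in> C" and x: "x \<in> carrier L"
  shows "slice c \<nu> x \<odot>\<^bsub>U\<^esub> u = pz (c, \<nu>) (\<theta> x)"
proof -
  have cI: "(c, \<nu>) \<in> Rep \<times> C" using c \<nu> by simp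
  have sh: "add_hom L (group_algebra IG) (slice c \<nu>)"
  proof (rule add_homI)
    fix y z assume yz: "y \<in> carrier L" "z \<in> carrier L"
    show "slice c \<nu> (y \<oplus>\<^bsub>L\<^esub> z) = slice c \<nu> y \<oplus>\<^bsub>group_algebra IG\<^esub> slice c \<nu> z"
      using add_hom_add[OF LC.p_hom[OF slice_index[OF c \<nu>]] yz] by (auto simp: FG.CA_add slice_def)
  qed (rule slice_closed)
  have ph: "add_hom Z U (pz (c, \<nu>))" using ZC.p_hom[OF cI] by (simp only: U_VU_hom)
  show ?thesis
  proof (rule add_hom_eq_on_span[OF add_hom_compose[OF sh left_module_scalar_hom[OF U.U_module u]]
        add_hom_compose[OF mod_homD(1)[OF \<theta>(1)] ph] LC.Z_group U.U_group LC.gens_closed])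
    show "x \<in> add_span L {(case i of (w, \<mu>) \<Rightarrow> \<lambda>b. ll w \<mu> b) b |i b. i \<in> W \<times> C \<and> b \<in> carrier complex_ring}"
      using LC.spanning x by blast
    fix y assume "y \<in> {(case i of (w, \<mu>) \<Rightarrow> \<lambda>b. ll w \<mu> b) b |i b. i \<in> W \<times> C \<and> b \<in> carrier complex_ring}"
    then obtain w \<mu> b where w: "w \<in> W" "\<mu> \<in> C" "y = ll w \<mu> b" by auto
    obtain c' g' where c': "c' \<in> Rep" "g' \<in> Gs" "w = c' \<circ> g'" using Rep_cover[OF w(1)] by blast
    have bu: "b \<odot>\<^bsub>U.VU\<^esub> u \<in> carrier U" using U.V.sc_closed[of u b] u by simp
    have gbu: "U.ga g' (b \<odot>\<^bsub>U.VU\<^esub> u) \<in> carrier U.VU" using ga_closed[OF c'(2) bu] by simp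
    have jI: "(c', ta g' \<mu>) \<in> Rep \<times> C" using c' Gs_C[OF c'(2) w(2)] by simp
    have th: "\<theta> y = zz c' (ta g' \<mu>) (U.ga g' (b \<odot>\<^bsub>U.VU\<^esub> u))"
      unfolding w(3) \<theta>(2)[OF w(1,2)] unfolding c'(3) by (rule zz_move[OF Rep_W[OF c'(1)] c'(2) w(2) bu])
    have wI: "(w, \<mu>) \<in> W \<times> C" using w by simp
    have py: "pl i y = (if i = (w, \<mu>) then b else 0)" if "i \<in> W \<times> C" for i
      using LC.p_z[OF wI, of b] LC.p_z_neq[OF that wI, of b] w(3) by auto
    have iff: "(c \<circ> g, ta (wi g) \<nu>) = (w, \<mu>) \<longleftrightarrow> g = g' \<and> (c, \<nu>) = (c', ta g' \<mu>)" if g: "g \<in> Gs" for g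
    proof
      assume e: "(c \<circ> g, ta (wi g) \<nu>) = (w, \<mu>)"
      then have "c = c' \<and> g = g'" using Rep_factor_unique[OF c c'(1) g c'(2)] c'(3) by simp
      moreover have "ta g \<mu> = \<nu>" using e ta_wi(2)[OF Gs_W[OF g] C_Tor[OF \<nu>]] by auto
      ultimately show "g = g' \<and> (c, \<nu>) = (c', ta g' \<mu>)" by auto
    next
      assume "g = g' \<and> (c, \<nu>) = (c', ta g' \<mu>)"
      then show "(c \<circ> g, ta (wi g) \<nu>) = (w, \<mu>)" using c'(3) ta_wi(1)[OF Gs_W[OF g] C_Tor[OF w(2)]] by auto
    qed
    have sl: "slice c \<nu> y g = (if g = g' \<and> (c, \<nu>) = (c', ta g' \<mu>) then b else 0)" for g
    proof (cases "g \<in> Gs")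
      case True
      then show ?thesis using py[OF slice_index[OF c \<nu> True]] by (simp only: slice_def if_True iff[OF True])
    next
      case False
      then show ?thesis using c'(2) by (auto simp: slice_def)
    qed
    show "slice c \<nu> y \<odot>\<^bsub>U\<^esub> u = pz (c, \<nu>) (\<theta> y)"
    proof (cases "(c, \<nu>) = (c', ta g' \<mu>)")
      case True
      have "slice c \<nu> y = pure_elt complex_ring b g'"
        by (rule ext) (use sl True in \<open>simp add: pure_elt_def\<close>)
      then have "slice c \<nu> y \<odot>\<^bsub>U\<^esub> u = b \<odot>\<^bsub>U.VU\<^esub> U.ga g' u" using U.pure_smult[of g' u b] c'(2) u by (simp add: IG_simps)
      also have "\<dots> = U.ga g' (b \<odot>\<^bsub>U.VU\<^esub> u)" using U.ga_sc[of g' u b] c'(2) u by (simp add: IG_simps)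
      also have "\<dots> = pz (c, \<nu>) (\<theta> y)" unfolding th True using ZC.p_z[OF jI gbu] by simp
      finally show ?thesis .
    next
      case False
      have "slice c \<nu> y = \<zero>\<^bsub>group_algebra IG\<^esub>"
        by (rule ext) (use sl False in \<open>auto simp: FG.CA_zero\<close>)
      then have "slice c \<nu> y \<odot>\<^bsub>U\<^esub> u = \<zero>\<^bsub>U\<^esub>" using left_module_zero_smult[OF U.U_module u] by simp
      then show ?thesis unfolding th using ZC.p_z_neq[OF cI jI False gbu] by simp
    qed
  qed
qed

lemma theta_slice_vector:
  assumes \<theta>: "mod_hom TS.TA L Z \<theta>" "\<And>w \<mu> b. w \<in> W \<Longrightarrow> \<mu> \<in> C \<Longrightarrow> \<theta> (ll w \<mu> b) = zz w \<mu> (b \<odot>\<^bsub>U.VU\<^esub> u)"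
    and u: "u \<in> carrier U" and c: "c \<in> Rep" and \<nu>: "\<nu> \<in> C" and a: "a \<in> carrier (group_algebra IG)"
  shows "\<theta> (\<Oplus>\<^bsub>L\<^esub>g\<in>Gs. ll (c \<circ> g) (ta (wi g) \<nu>) (a g)) = zz c \<nu> (a \<odot>\<^bsub>U\<^esub> u)"
proof -
  have lc: "ll (c \<circ> g) (ta (wi g) \<nu>) (a g) \<in> carrier L" if "g \<in> Gs" for g
    using slice_index[OF c \<nu> that] by (intro ll_closed) auto
  have agu: "a g \<odot>\<^bsub>U.VU\<^esub> U.ga g u \<in> carrier U" if "g \<in> Gs" for g
    using U.V.sc_closed[of "U.ga g u" "a g"] ga_closed[OF that u] by simp
  have "\<theta> (\<Oplus>\<^bsub>L\<^esub>g\<in>Gs. ll (c \<circ> g) (ta (wi g) \<nu>) (a g)) = (\<Oplus>\<^bsub>Z\<^esub>g\<in>Gs. \<theta> (ll (c \<circ> g) (ta (wi g) \<nu>) (a g)))"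
    by (rule add_hom_finsum[OF mod_homD(1)[OF \<theta>(1)] LC.Z_group ZC.Z_group Gs_finite]) (use lc in auto)
  also have "\<dots> = (\<Oplus>\<^bsub>Z\<^esub>g\<in>Gs. zz c \<nu> (a g \<odot>\<^bsub>U.VU\<^esub> U.ga g u))"
  proof (rule ZC.Z.finsum_cong')
    fix g assume g: "g \<in> Gs"
    have i: "c \<circ> g \<in> W" "ta (wi g) \<nu> \<in> C" using slice_index[OF c \<nu> g] by auto
    have au: "a g \<odot>\<^bsub>U.VU\<^esub> u \<in> carrier U" using U.V.sc_closed[of u "a g"] u by simp
    have "\<theta> (ll (c \<circ> g) (ta (wi g) \<nu>) (a g)) = zz c (ta g (ta (wi g) \<nu>)) (U.ga g (a g \<odot>\<^bsub>U.VU\<^esub> u))"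
      unfolding \<theta>(2)[OF i] by (rule zz_move[OF Rep_W[OF c] g i(2) au])
    also have "\<dots> = zz c \<nu> (a g \<odot>\<^bsub>U.VU\<^esub> U.ga g u)"
      using ta_wi(2)[OF Gs_W[OF g] C_Tor[OF \<nu>]] U.ga_sc[of g u "a g"] g u by (simp only: IG_simps)
    finally show "\<theta> (ll (c \<circ> g) (ta (wi g) \<nu>) (a g)) = zz c \<nu> (a g \<odot>\<^bsub>U.VU\<^esub> U.ga g u)" .
  qed (use zz_closed[OF Rep_W[OF c] \<nu> agu] in auto)
  also have "\<dots> = zz c \<nu> (\<Oplus>\<^bsub>U.VU\<^esub>g\<in>Gs. a g \<odot>\<^bsub>U.VU\<^esub> U.ga g u)"
    by (rule add_hom_finsum[OF zz_hom[OF Rep_W[OF c] \<nu>] U.VU_group ZC.Z_group Gs_finite, symmetric]) (use agu in auto)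
  also have "(\<Oplus>\<^bsub>U.VU\<^esub>g\<in>Gs. a g \<odot>\<^bsub>U.VU\<^esub> U.ga g u) = a \<odot>\<^bsub>U\<^esub> u"
    using U.smult_expand[OF a u] by (simp add: U.V.lc_def IG_simps)
  finally show ?thesis .
qed

end

context weight_setup
begin

lemma weight_repI:
  "left_module (group_algebra IG) U \<Longrightarrow> weight_rep \<Delta> X Y n q s lam U"
  by (intro weight_rep.intro weight_setup_axioms gmodule.intro FG.finite_group_axioms)

abbreviation Zc where "Zc \<chi> \<equiv> induced_module TS.TA TS.H.TA id (weight_rep.VM \<Delta> X Y n s lam (class_rep \<chi>))"

lemma class_rep_weight_rep: "\<chi> \<in> FG.Irr \<Longrightarrow> weight_rep \<Delta> X Y n q s lam (class_rep \<chi>)"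
  by (rule weight_repI) (rule simple_moduleD(1)[OF FG.class_rep_simple])

lemma Z_mod_eq: "\<chi> \<in> FG.Irr \<Longrightarrow> Z_mod \<Delta> X Y n s lam \<chi> = Zc \<chi>"
proof -
  assume "\<chi> \<in> FG.Irr"
  then interpret weight_rep \<Delta> X Y n q s lam "class_rep \<chi>" by (rule class_rep_weight_rep)
  have "V_mod \<Delta> X Y n s lam \<chi> = VM"
    unfolding V_mod_def Let_def VM_def vact_def cm_def[abs_def] by simp
  then show ?thesis by (simp add: Z_mod_def twisted_qtorus_eq)
qed

text \<open>
  The map with components \<open>\<theta> \<chi> i\<close>, the homomorphism defined by the basis vector \<open>e \<chi> i\<close> of \<open>\<chi>\<close>.  On
  each slice it is the map \<open>a \<mapsto> (a e\<^sub>\<chi>\<^sub>,\<^sub>i)\<close>, and the slices make up \<open>L\<close> as the copies \<open>(c, \<nu>)\<close> make up the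
  modules \<open>Z\<close>; so its injectivity and surjectivity are those in \<open>regular_representation\<close>.
\<close>

theorem decomposition:
  "module_isomorphic TS.TA L
     (direct_sum FG.Irr (\<lambda>\<chi>. direct_sum {..<class_dim IG \<chi>} (\<lambda>_. Zc \<chi>)))"
proof -
  let ?d = "class_dim IG"
  let ?D = "direct_sum FG.Irr (\<lambda>\<chi>. direct_sum {..<?d \<chi>} (\<lambda>_. Zc \<chi>))"
  obtain e where e: "\<And>\<chi> i. \<chi> \<in> FG.Irr \<Longrightarrow> i < ?d \<chi> \<Longrightarrow> e \<chi> i \<in> carrier (class_rep \<chi>)"
    and surj: "\<And>t. (\<And>\<chi> i. \<chi> \<in> FG.Irr \<Longrightarrow> i < ?d \<chi> \<Longrightarrow> t \<chi> i \<in> carrier (class_rep \<chi>)) \<Longrightarrow>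
       \<exists>a\<in>carrier (group_algebra IG). \<forall>\<chi>\<in>FG.Irr. \<forall>i<?d \<chi>. a \<odot>\<^bsub>class_rep \<chi>\<^esub> e \<chi> i = t \<chi> i"
    and inj: "\<And>a. a \<in> carrier (group_algebra IG) \<Longrightarrow> (\<And>\<chi> i. \<chi> \<in> FG.Irr \<Longrightarrow> i < ?d \<chi> \<Longrightarrow>
       a \<odot>\<^bsub>class_rep \<chi>\<^esub> e \<chi> i = \<zero>\<^bsub>class_rep \<chi>\<^esub>) \<Longrightarrow> a = \<zero>\<^bsub>group_algebra IG\<^esub>"
    using FG.regular_representation by blast
  define good where "good \<chi> u \<theta> \<longleftrightarrow> mod_hom TS.TA L (Zc \<chi>) \<theta> \<and>
    (\<forall>w\<in>W. \<forall>\<mu>\<in>C. \<forall>b. \<theta> (ll w \<mu> b) = weight_rep.zz \<Delta> X Y n s lam (class_rep \<chi>) w \<mu>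
      (b \<odot>\<^bsub>underlying_space IG (class_rep \<chi>)\<^esub> u))" for \<chi> u \<theta>
  define \<theta> where "\<theta> \<chi> i = (SOME \<theta>. good \<chi> (e \<chi> i) \<theta>)" for \<chi> i
  have good: "good \<chi> (e \<chi> i) (\<theta> \<chi> i)" if i: "\<chi> \<in> FG.Irr" "i < ?d \<chi>" for \<chi> i
  proof -
    interpret P: weight_rep \<Delta> X Y n q s lam "class_rep \<chi>" by (rule class_rep_weight_rep[OF i(1)])
    have "\<exists>\<theta>. good \<chi> (e \<chi> i) \<theta>" unfolding good_def by (rule P.theta_exists[OF e[OF i]])
    then show ?thesis unfolding \<theta>_def by (rule someI_ex)
  qed
  have \<theta>m: "mod_hom TS.TA L (Zc \<chi>) (\<theta> \<chi> i)" if "\<chi> \<in> FG.Irr" "i < ?d \<chi>" for \<chi> i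
    using good[OF that] by (simp add: good_def)
  note \<theta>h = mod_homD(1)[OF \<theta>m]
  have Zm: "left_module TS.TA (Zc \<chi>)" if "\<chi> \<in> FG.Irr" for \<chi>
  proof -
    interpret P: weight_rep \<Delta> X Y n q s lam "class_rep \<chi>" by (rule class_rep_weight_rep[OF that])
    show ?thesis by (rule P.Z_module)
  qed
  have Zg: "abelian_group (Zc \<chi>)" if "\<chi> \<in> FG.Irr" for \<chi> by (rule left_module_groups(1)[OF Zm[OF that]])
  have Dm: "left_module TS.TA ?D"
    by (intro direct_sum_module FG.irr_finite TS.TA_ring finite_lessThan Zm)
  have Dc: "T \<in> carrier ?D \<longleftrightarrow> T \<in> (\<Pi>\<^sub>E \<chi>\<in>FG.Irr. \<Pi>\<^sub>E i\<in>{..<?d \<chi>}. carrier (Zc \<chi>))" for T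
  proof -
    have "carrier (direct_sum {..<?d \<chi>} (\<lambda>_. Zc \<chi>)) = (\<Pi>\<^sub>E i\<in>{..<?d \<chi>}. carrier (Zc \<chi>))" for \<chi>
      unfolding set_eq_iff direct_sum_simps by simp
    then show ?thesis using FG.irr_finite by (simp add: direct_sum_simps)
  qed
  define \<Theta> where "\<Theta> x = (\<lambda>\<chi>\<in>FG.Irr. \<lambda>i\<in>{..<?d \<chi>}. \<theta> \<chi> i x)" for x
  have \<Theta>c: "\<Theta> x \<in> carrier ?D" if x: "x \<in> carrier L" for x
    unfolding Dc \<Theta>_def using add_hom_closed[OF \<theta>h x] by auto
  have \<Theta>hom: "mod_hom TS.TA L ?D \<Theta>"
    unfolding mod_hom_def
  proof (intro conjI ballI add_homI)
    show "\<Theta> (x \<oplus>\<^bsub>L\<^esub> y) = \<Theta> x \<oplus>\<^bsub>?D\<^esub> \<Theta> y" if "x \<in> carrier L" "y \<in> carrier L" for x y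
      unfolding \<Theta>_def direct_sum_simps by (intro restrict_ext) (simp add: add_hom_add[OF \<theta>h that])
    show "\<Theta> (r \<odot>\<^bsub>L\<^esub> x) = r \<odot>\<^bsub>?D\<^esub> \<Theta> x" if "r \<in> carrier TS.TA" "x \<in> carrier L" for r x
      unfolding \<Theta>_def direct_sum_simps by (intro restrict_ext) (simp add: mod_homD(2)[OF \<theta>m that])
  qed (rule \<Theta>c)
  have kernel: "x = \<zero>\<^bsub>L\<^esub>" if x: "x \<in> carrier L" and z: "\<And>\<chi> i. \<chi> \<in> FG.Irr \<Longrightarrow> i < ?d \<chi> \<Longrightarrow> \<theta> \<chi> i x = \<zero>\<^bsub>Zc \<chi>\<^esub>" for x
  proof (rule LC.coordinates_inject[OF x LC.Z.zero_closed])
    fix j assume j: "j \<in> W \<times> C"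
    obtain w \<mu> where w: "j = (w, \<mu>)" "w \<in> W" "\<mu> \<in> C" using j by auto
    obtain c g where c: "c \<in> Rep" "g \<in> Gs" "w = c \<circ> g" using Rep_cover[OF w(2)] by blast
    \<comment> \<open>the line \<open>(w, \<mu>) = (c g, g\<^sup>-\<^sup>1(\<nu>))\<close> belongs to the slice \<open>(c, \<nu>)\<close>\<close>
    define \<nu> where "\<nu> = ta g \<mu>"
    have \<nu>: "\<nu> \<in> C" unfolding \<nu>_def by (rule Gs_C[OF c(2) w(3)])
    have "(\<lambda>g. if g \<in> Gs then pl (c \<circ> g, ta (wi g) \<nu>) x else 0) = \<zero>\<^bsub>group_algebra IG\<^esub>"
    proof (rule inj)
      show "(\<lambda>g. if g \<in> Gs then pl (c \<circ> g, ta (wi g) \<nu>) x else 0) \<in> carrier (group_algebra IG)"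
        by (simp add: FG.CA_carrier IG_simps)
      fix \<chi> i assume i: "\<chi> \<in> FG.Irr" "i < ?d \<chi>"
      interpret P: weight_rep \<Delta> X Y n q s lam "class_rep \<chi>" by (rule class_rep_weight_rep[OF i(1)])
      have g': "mod_hom TS.TA L P.Z (\<theta> \<chi> i)"
        "\<And>w \<mu> b. w \<in> W \<Longrightarrow> \<mu> \<in> C \<Longrightarrow> \<theta> \<chi> i (ll w \<mu> b) = P.zz w \<mu> (b \<odot>\<^bsub>P.U.VU\<^esub> e \<chi> i)"
        using good[OF i] by (simp_all add: good_def)
      have cI: "(c, \<nu>) \<in> Rep \<times> C" using c \<nu> by simp
      have "P.slice c \<nu> x \<odot>\<^bsub>class_rep \<chi>\<^esub> e \<chi> i = P.pz (c, \<nu>) (\<theta> \<chi> i x)"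
        by (rule P.slice_theta[OF g' e[OF i] c(1) \<nu> x])
      also have "\<dots> = \<zero>\<^bsub>class_rep \<chi>\<^esub>" unfolding z[OF i] using P.ZC.p_zero[OF cI cI] by simp
      finally show "(\<lambda>g. if g \<in> Gs then pl (c \<circ> g, ta (wi g) \<nu>) x else 0) \<odot>\<^bsub>class_rep \<chi>\<^esub> e \<chi> i = \<zero>\<^bsub>class_rep \<chi>\<^esub>"
        unfolding P.slice_def .
    qed
    from fun_cong[OF this, of g] have "pl (c \<circ> g, ta (wi g) \<nu>) x = 0" using c(2) by (simp add: FG.CA_zero)
    then have "pl j x = 0" unfolding \<nu>_def w(1) c(3) by (simp only: ta_wi(1)[OF Gs_W[OF c(2)] C_Tor[OF w(3)]])
    then show "pl j x = pl j \<zero>\<^bsub>L\<^esub>" using LC.p_zero[OF j j] by simp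
  qed
  have hit: "\<exists>x\<in>carrier L. \<forall>\<chi>\<in>FG.Irr. \<forall>i<?d \<chi>. \<theta> \<chi> i x = (if (\<chi>, i) = (\<chi>0, i0) then \<zeta> else \<zero>\<^bsub>Zc \<chi>\<^esub>)"
    if i0: "\<chi>0 \<in> FG.Irr" "i0 < ?d \<chi>0" and \<zeta>: "\<zeta> \<in> carrier (Zc \<chi>0)" for \<chi>0 i0 \<zeta>
  proof -
    interpret Q: weight_rep \<Delta> X Y n q s lam "class_rep \<chi>0" by (rule class_rep_weight_rep[OF i0(1)])
    show ?thesis using \<zeta>
    proof (induction rule: Q.ZC.induct_span)
      case zero
      have "\<theta> \<chi> i \<zero>\<^bsub>L\<^esub> = (if (\<chi>, i) = (\<chi>0, i0) then \<zero>\<^bsub>Zc \<chi>0\<^esub> else \<zero>\<^bsub>Zc \<chi>\<^esub>)" if i: "\<chi> \<in> FG.Irr" "i < ?d \<chi>" for \<chi> i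
      proof (cases "(\<chi>, i) = (\<chi>0, i0)")
        case True
        then show ?thesis using add_hom_zero[OF \<theta>h[OF i] LC.Z_group Zg[OF i(1)]] by simp
      next
        case False
        then show ?thesis using add_hom_zero[OF \<theta>h[OF i] LC.Z_group Zg[OF i(1)]] by (simp only: if_False)
      qed
      then show ?case by (intro bexI[of _ "\<zero>\<^bsub>L\<^esub>"] ballI allI impI) (assumption | rule LC.Z.zero_closed)+
    next
      case (base j u)
      obtain c \<nu> where c: "j = (c, \<nu>)" "c \<in> Rep" "\<nu> \<in> C" using base by auto
      have u: "u \<in> carrier (class_rep \<chi>0)" using base by simp
      have z0: "\<zero>\<^bsub>class_rep \<chi>\<^esub> \<in> carrier (class_rep \<chi>)" if "\<chi> \<in> FG.Irr" for \<chi>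
        using abelian_groupE(2)[OF left_module_groups(1)[OF simple_moduleD(1)[OF FG.class_rep_simple[OF that]]]] .
      have "\<exists>a\<in>carrier (group_algebra IG). \<forall>\<chi>\<in>FG.Irr. \<forall>i<?d \<chi>.
          a \<odot>\<^bsub>class_rep \<chi>\<^esub> e \<chi> i = (if (\<chi>, i) = (\<chi>0, i0) then u else \<zero>\<^bsub>class_rep \<chi>\<^esub>)"
        by (rule surj) (use u z0 in auto)
      then obtain a where a: "a \<in> carrier (group_algebra IG)" "\<forall>\<chi>\<in>FG.Irr. \<forall>i<?d \<chi>.
          a \<odot>\<^bsub>class_rep \<chi>\<^esub> e \<chi> i = (if (\<chi>, i) = (\<chi>0, i0) then u else \<zero>\<^bsub>class_rep \<chi>\<^esub>)" ..
      \<comment> \<open>the element of \<open>L\<close> supported on the slice \<open>(c, \<nu>)\<close>, with coefficients \<open>a\<close>\<close>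
      define x where "x = (\<Oplus>\<^bsub>L\<^esub>g\<in>Gs. ll (c \<circ> g) (ta (wi g) \<nu>) (a g))"
      have xL: "x \<in> carrier L" unfolding x_def
        by (rule LC.Z.finsum_closed) (use Q.slice_index[OF c(2,3)] ll_closed in auto)
      have "\<theta> \<chi> i x = (if (\<chi>, i) = (\<chi>0, i0) then Q.zz c \<nu> u else \<zero>\<^bsub>Zc \<chi>\<^esub>)" if i: "\<chi> \<in> FG.Irr" "i < ?d \<chi>" for \<chi> i
      proof -
        interpret P: weight_rep \<Delta> X Y n q s lam "class_rep \<chi>" by (rule class_rep_weight_rep[OF i(1)])
        have g': "mod_hom TS.TA L P.Z (\<theta> \<chi> i)"
          "\<And>w \<mu> b. w \<in> W \<Longrightarrow> \<mu> \<in> C \<Longrightarrow> \<theta> \<chi> i (ll w \<mu> b) = P.zz w \<mu> (b \<odot>\<^bsub>P.U.VU\<^esub> e \<chi> i)"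
          using good[OF i] by (simp_all add: good_def)
        have t: "\<theta> \<chi> i x = P.zz c \<nu> (a \<odot>\<^bsub>class_rep \<chi>\<^esub> e \<chi> i)"
          unfolding x_def by (rule P.theta_slice_vector[OF g' e[OF i] c(2,3) a(1)])
        show ?thesis
        proof (cases "(\<chi>, i) = (\<chi>0, i0)")
          case True
          then show ?thesis using t a(2) i by auto
        next
          case False
          then have "a \<odot>\<^bsub>class_rep \<chi>\<^esub> e \<chi> i = \<zero>\<^bsub>class_rep \<chi>\<^esub>" using a(2)[rule_format, OF i] by (simp only: if_False)
          then have "\<theta> \<chi> i x = \<zero>\<^bsub>Zc \<chi>\<^esub>"
            using t add_hom_zero[OF P.zz_hom[OF Rep_W[OF c(2)] c(3)] P.U.VU_group P.ZC.Z_group] by simp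
          then show ?thesis using False by (simp only: if_False)
        qed
      qed
      then show ?case unfolding c(1) prod.case using xL by (intro bexI[of _ x] ballI allI impI)
    next
      case (add \<zeta> \<zeta>')
      then obtain x y where x: "x \<in> carrier L" "\<forall>\<chi>\<in>FG.Irr. \<forall>i<?d \<chi>. \<theta> \<chi> i x = (if (\<chi>, i) = (\<chi>0, i0) then \<zeta> else \<zero>\<^bsub>Zc \<chi>\<^esub>)"
        and y: "y \<in> carrier L" "\<forall>\<chi>\<in>FG.Irr. \<forall>i<?d \<chi>. \<theta> \<chi> i y = (if (\<chi>, i) = (\<chi>0, i0) then \<zeta>' else \<zero>\<^bsub>Zc \<chi>\<^esub>)"
        by blast
      have "\<theta> \<chi> i (x \<oplus>\<^bsub>L\<^esub> y) = (if (\<chi>, i) = (\<chi>0, i0) then \<zeta> \<oplus>\<^bsub>Zc \<chi>0\<^esub> \<zeta>' else \<zero>\<^bsub>Zc \<chi>\<^esub>)" if i: "\<chi> \<in> FG.Irr" "i < ?d \<chi>" for \<chi> i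
        using x(2) y(2) i abelian_groupE(5)[OF Zg[OF i(1)] abelian_groupE(2)[OF Zg[OF i(1)]]]
        by (simp add: add_hom_add[OF \<theta>h[OF i] x(1) y(1)])
      then show ?case using LC.Z.a_closed[OF x(1) y(1)] by (intro bexI[of _ "x \<oplus>\<^bsub>L\<^esub> y"]) auto
    qed
  qed
  have onto: "\<exists>x\<in>carrier L. \<Theta> x = T" if T: "T \<in> carrier ?D" for T
  proof -
    define P where "P = Sigma FG.Irr (\<lambda>\<chi>. {..<?d \<chi>})"
    have Pf: "finite P" unfolding P_def using FG.irr_finite by simp
    have TZ: "T \<chi> i \<in> carrier (Zc \<chi>)" if "\<chi> \<in> FG.Irr" "i < ?d \<chi>" for \<chi> i
      using T that unfolding Dc by auto
    define \<xi> where "\<xi> p = (SOME x. x \<in> carrier L \<and> (\<forall>\<chi>\<in>FG.Irr. \<forall>i<?d \<chi>.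
      \<theta> \<chi> i x = (if (\<chi>, i) = p then T (fst p) (snd p) else \<zero>\<^bsub>Zc \<chi>\<^esub>)))" for p
    have \<xi>: "\<xi> p \<in> carrier L \<and> (\<forall>\<chi>\<in>FG.Irr. \<forall>i<?d \<chi>.
      \<theta> \<chi> i (\<xi> p) = (if (\<chi>, i) = p then T (fst p) (snd p) else \<zero>\<^bsub>Zc \<chi>\<^esub>))" if p: "p \<in> P" for p
      unfolding \<xi>_def
    proof (rule someI_ex)
      obtain \<chi>0 i0 where p0: "p = (\<chi>0, i0)" "\<chi>0 \<in> FG.Irr" "i0 < ?d \<chi>0" using p by (auto simp: P_def)
      show "\<exists>x. x \<in> carrier L \<and> (\<forall>\<chi>\<in>FG.Irr. \<forall>i<?d \<chi>. \<theta> \<chi> i x = (if (\<chi>, i) = p then T (fst p) (snd p) else \<zero>\<^bsub>Zc \<chi>\<^esub>))"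
        using hit[OF p0(2,3) TZ[OF p0(2,3)]] unfolding p0(1) fst_conv snd_conv Bex_def .
    qed
    define x where "x = (\<Oplus>\<^bsub>L\<^esub>p\<in>P. \<xi> p)"
    have \<xi>c: "\<xi> \<in> P \<rightarrow> carrier L" using \<xi> by blast
    have xL: "x \<in> carrier L" unfolding x_def by (rule LC.Z.finsum_closed[OF \<xi>c])
    have tx: "\<theta> \<chi> i x = T \<chi> i" if i: "\<chi> \<in> FG.Irr" "i < ?d \<chi>" for \<chi> i
    proof -
      interpret Zi: abelian_group "Zc \<chi>" by (rule Zg[OF i(1)])
      have iP: "(\<chi>, i) \<in> P" using i by (simp add: P_def)
      have "\<theta> \<chi> i x = (\<Oplus>\<^bsub>Zc \<chi>\<^esub>p\<in>P. \<theta> \<chi> i (\<xi> p))"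
        unfolding x_def by (rule add_hom_finsum[OF \<theta>h[OF i] LC.Z_group Zg[OF i(1)] Pf \<xi>c])
      also have "\<dots> = (\<Oplus>\<^bsub>Zc \<chi>\<^esub>p\<in>P. if (\<chi>, i) = p then T \<chi> i else \<zero>\<^bsub>Zc \<chi>\<^esub>)"
        by (rule Zi.finsum_cong') (use \<xi> i TZ in auto)
      also have "\<dots> = T \<chi> i" by (rule Zi.finsum_singleton[OF iP Pf]) (use TZ i in auto)
      finally show ?thesis .
    qed
    have "\<Theta> x = T"
    proof (rule extensionalityI[of _ FG.Irr])
      show "T \<in> extensional FG.Irr" using T unfolding Dc by (simp add: PiE_def)
      fix \<chi> assume \<chi>: "\<chi> \<in> FG.Irr"
      have "(\<lambda>i\<in>{..<?d \<chi>}. \<theta> \<chi> i x) = T \<chi>"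
      proof (rule extensionalityI[of _ "{..<?d \<chi>}"])
        show "T \<chi> \<in> extensional {..<?d \<chi>}" using T \<chi> unfolding Dc by (auto simp: PiE_def)
      qed (use tx \<chi> in auto)
      then show "\<Theta> x \<chi> = T \<chi>" using \<chi> by (simp add: \<Theta>_def)
    qed (simp add: \<Theta>_def)
    then show ?thesis using xL by blast
  qed
  have injT: "inj_on \<Theta> (carrier L)"
  proof (rule inj_onI)
    fix x y assume xy: "x \<in> carrier L" "y \<in> carrier L" "\<Theta> x = \<Theta> y"
    have d: "x \<oplus>\<^bsub>L\<^esub> \<ominus>\<^bsub>L\<^esub> y \<in> carrier L" using xy by simp
    have "\<theta> \<chi> i (x \<oplus>\<^bsub>L\<^esub> \<ominus>\<^bsub>L\<^esub> y) = \<zero>\<^bsub>Zc \<chi>\<^esub>" if i: "\<chi> \<in> FG.Irr" "i < ?d \<chi>" for \<chi> i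
    proof -
      have "\<theta> \<chi> i x = \<theta> \<chi> i y" using fun_cong[OF fun_cong[OF xy(3), of \<chi>], of i] i by (simp add: \<Theta>_def)
      moreover have "\<theta> \<chi> i (x \<oplus>\<^bsub>L\<^esub> \<ominus>\<^bsub>L\<^esub> y) = \<theta> \<chi> i x \<oplus>\<^bsub>Zc \<chi>\<^esub> \<ominus>\<^bsub>Zc \<chi>\<^esub> \<theta> \<chi> i y"
        using add_hom_add[OF \<theta>h[OF i] xy(1) LC.Z.a_inv_closed[OF xy(2)]] add_hom_neg[OF \<theta>h[OF i] LC.Z_group Zg[OF i(1)] xy(2)] by simp
      ultimately show ?thesis using abelian_group.r_neg[OF Zg[OF i(1)] add_hom_closed[OF \<theta>h[OF i] xy(2)]] by simp
    qed
    then have "x \<oplus>\<^bsub>L\<^esub> \<ominus>\<^bsub>L\<^esub> y = \<zero>\<^bsub>L\<^esub>" by (rule kernel[OF d])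
    then show "x = y" using xy LC.Z.minus_equality LC.Z.minus_minus LC.Z.a_inv_closed by metis
  qed
  have "bij_betw \<Theta> (carrier L) (carrier ?D)"
    unfolding bij_betw_def using injT onto \<Theta>c by blast
  then show ?thesis unfolding module_isomorphic_iff using L_module Dm \<Theta>hom by blast
qed

end

theorem theorem3p4:
  fixes \<Delta> :: "'h::real_vector set" and X :: "('h \<Rightarrow> real) set" and Y :: "'h set"
    and n :: nat and q s :: complex and lam :: "('h \<Rightarrow> real) \<Rightarrow> complex"
  assumes "quantum_torus_setup \<Delta> X Y n q s"
    and "lam \<in> carrier (torus X)"
  shows "module_isomorphic (twisted_qtorus X Y n s (weyl_group \<Delta>))
      (induced_M \<Delta> X Y n s lam)
      (direct_sum (irr_classes (isotropy_group \<Delta> X Y n s lam))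
        (\<lambda>\<chi>. direct_sum {..<class_dim (isotropy_group \<Delta> X Y n s lam) \<chi>}
          (\<lambda>_. Z_mod \<Delta> X Y n s lam \<chi>)))
    \<and> (\<forall>\<chi> \<in> irr_classes (isotropy_group \<Delta> X Y n s lam).
        simple_module (twisted_qtorus X Y n s (weyl_group \<Delta>)) (Z_mod \<Delta> X Y n s lam \<chi>))
    \<and> (\<forall>\<chi> \<in> irr_classes (isotropy_group \<Delta> X Y n s lam).
       \<forall>\<psi> \<in> irr_classes (isotropy_group \<Delta> X Y n s lam).
        \<chi> \<noteq> \<psi> \<longrightarrow> \<not> module_isomorphic (twisted_qtorus X Y n s (weyl_group \<Delta>))
          (Z_mod \<Delta> X Y n s lam \<chi>) (Z_mod \<Delta> X Y n s lam \<psi>))"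
proof -
  interpret weight_setup \<Delta> X Y n q s lam
    using assms by (simp add: weight_setup_def weight_setup_axioms_def)
  have ds: "direct_sum FG.Irr (\<lambda>\<chi>. direct_sum {..<class_dim IG \<chi>} (\<lambda>_. Z_mod \<Delta> X Y n s lam \<chi>))
    = direct_sum FG.Irr (\<lambda>\<chi>. direct_sum {..<class_dim IG \<chi>} (\<lambda>_. Zc \<chi>))"
    by (intro direct_sum_cong Z_mod_eq)
  show ?thesis
    unfolding twisted_qtorus_eq induced_M_eq ds
  proof (intro conjI ballI impI)
    show "module_isomorphic TS.TA L (direct_sum FG.Irr (\<lambda>\<chi>. direct_sum {..<class_dim IG \<chi>} (\<lambda>_. Zc \<chi>)))"
      by (rule decomposition)
    fix \<chi> assume \<chi>: "\<chi> \<in> FG.Irr"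
    interpret P: weight_rep \<Delta> X Y n q s lam "class_rep \<chi>" by (rule class_rep_weight_rep[OF \<chi>])
    show "simple_module TS.TA (Z_mod \<Delta> X Y n s lam \<chi>)"
      unfolding Z_mod_eq[OF \<chi>] by (rule P.Z_simple[OF FG.class_rep_simple[OF \<chi>]])
    fix \<psi> assume \<psi>: "\<psi> \<in> FG.Irr" "\<chi> \<noteq> \<psi>"
    show "\<not> module_isomorphic TS.TA (Z_mod \<Delta> X Y n s lam \<chi>) (Z_mod \<Delta> X Y n s lam \<psi>)"
    proof
      assume "module_isomorphic TS.TA (Z_mod \<Delta> X Y n s lam \<chi>) (Z_mod \<Delta> X Y n s lam \<psi>)"
      then obtain f where "bij_betw f (carrier (Zc \<chi>)) (carrier (Zc \<psi>))" "mod_hom TS.TA (Zc \<chi>) (Zc \<psi>) f"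
        unfolding module_isomorphic_iff Z_mod_eq[OF \<chi>] Z_mod_eq[OF \<psi>(1)] by blast
      then have "module_isomorphic FG.CA (class_rep \<chi>) (class_rep \<psi>)"
        by (rule Z_isomorphic_imp[OF FG.class_rep_simple[OF \<chi>] FG.class_rep_simple[OF \<psi>(1)]])
      then show False using FG.class_rep_noniso[OF \<chi> \<psi>(1)] \<psi>(2) by blast
    qed
  qed
qed

end
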